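(* Let $\lambda>0$ and $2<p<4$. There exists a constant $c_0>0$ such that for every $0<c<c_0$ the following holds: for every sequence $\{u_n\}\subset S(c)$ with $E(u_n)\to m(c)$, there exist a sequence $\{y_n\}\subset\mathbb{R}^2$ and $u\in S(c)$ such that, up to a subsequence, $u_n(\cdot+y_n)\to u$ strongly in $H^1(\mathbb{R}^2)$. In particular, for every $0<c<c_0$, $m(c)$ is attained, and there exist $u\in S(c)$ and $\alpha\in\mathbb{R}$ solving the stationary Chern–Simons–Schrödinger equation.
   Context: All functions are complex-valued; $H^1(\mathbb{R}^2)$ is the complex Sobolev space. Fix $\lambda>0$, $p>2$. For $u\in H^1(\mathbb{R}^2)$ define $G_j(x):=-\frac{1}{2\pi}\frac{x_j}{|x|^2}$ ($j=1,2$), the gauge fields $A_1(u):=-\frac12 G_2*|u|^2$, $A_2(u):=\frac12 G_1*|u|^2$, $A_0(u):=-G_1*\big(\mathrm{Im}(\bar u\,D_2u)\big)+G_2*\big(\mathrm{Im}(\bar u\,D_1u)\big)$, where $D_j:=\partial_j+iA_j(u)$. The energy is $E(u):=\frac12\int_{\mathbb{R}^2}(|D_1u|^2+|D_2u|^2)\,dx-\frac{\lambda}{p}\int_{\mathbb{R}^2}|u|^p\,dx$. For $c>0$, $S(c):=\{u\in H^1(\mathbb{R}^2):\int_{\mathbb{R}^2}|u|^2dx=c\}$ and $m(c):=\inf_{u\in S(c)}E(u)$. The stationary Chern–Simons–Schrödinger equation is $-(D_1D_1+D_2D_2)u+A_0(u)u+\alpha u=\lambda|u|^{p-2}u$ in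 $\mathbb{R}^2$ (in the weak sense), with $\alpha\in\mathbb{R}$ (the Lagrange multiplier); solutions in $S(c)$ correspond to critical points of $E$ restricted to $S(c)$. *)

theory Defs
  imports "HOL-Analysis.Analysis"
begin

type_synonym cfun = "real \<times> real \<Rightarrow> complex"

definition evec :: "nat \<Rightarrow> real \<times> real" where
  "evec j = (if j = 1 then (1, 0) else (0, 1))"

definition pd :: "nat \<Rightarrow> cfun \<Rightarrow> cfun" where
  "pd j f x = vector_derivative (\<lambda>t. f (x + t *\<^sub>R evec j)) (at 0)"

fun pds :: "nat list \<Rightarrow> cfun \<Rightarrow> cfun" where
  "pds [] f = f"
| "pds (j # js) f = pd j (pds js f)"

definition test_fun :: "cfun \<Rightarrow> bool" where
  "test_fun \<phi> \<longleftrightarrow>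
     (\<forall>js. set js \<subseteq> {1,2} \<longrightarrow> continuous_on UNIV (pds js \<phi>) \<and>
        (\<forall>j\<in>{1,2}. \<forall>x. ((\<lambda>t. pds js \<phi> (x + t *\<^sub>R evec j)) has_vector_derivative
                           pds (j # js) \<phi> x) (at 0))) \<and>
     compact (closure {x. \<phi> x \<noteq> 0})"

definition L2 :: "cfun \<Rightarrow> bool" where
  "L2 f \<longleftrightarrow> f \<in> borel_measurable lebesgue \<and> integrable lebesgue (\<lambda>x. (cmod (f x))\<^sup>2)"

definition is_wderiv :: "nat \<Rightarrow> cfun \<Rightarrow> cfun \<Rightarrow> bool" where
  "is_wderiv j u g \<longleftrightarrow>
     (\<forall>\<phi>. test_fun \<phi> \<longrightarrow>
        (LINT x|lebesgue. u x * pd j \<phi> x) = - (LINT x|lebesgue. g x * \<phi> x))"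

definition H1 :: "cfun set" where
  "H1 = {u. L2 u \<and> (\<forall>j\<in>{1,2}. \<exists>g. L2 g \<and> is_wderiv j u g)}"

text \<open>The (a.e. unique) weak derivative.\<close>
definition wd :: "nat \<Rightarrow> cfun \<Rightarrow> cfun" where
  "wd j u = (SOME g. L2 g \<and> is_wderiv j u g)"

definition H1_norm :: "cfun \<Rightarrow> real" where
  "H1_norm f = sqrt ((LINT x|lebesgue. (cmod (f x))\<^sup>2)
                    + (LINT x|lebesgue. (cmod (wd 1 f x))\<^sup>2)
                    + (LINT x|lebesgue. (cmod (wd 2 f x))\<^sup>2))"

definition G :: "nat \<Rightarrow> real \<times> real \<Rightarrow> real" where
  "G j x = - (1 / (2 * pi)) * (if j = 1 then fst x else snd x) / (norm x)\<^sup>2"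

definition conv :: "(real \<times> real \<Rightarrow> real) \<Rightarrow> (real \<times> real \<Rightarrow> real) \<Rightarrow> real \<times> real \<Rightarrow> real" where
  "conv K f x = (LINT y|lebesgue. K (x - y) * f y)"

definition A :: "nat \<Rightarrow> cfun \<Rightarrow> real \<times> real \<Rightarrow> real" where
  "A j u = (if j = 1 then (\<lambda>x. - (1/2) * conv (G 2) (\<lambda>y. (cmod (u y))\<^sup>2) x)
                    else (\<lambda>x. (1/2) * conv (G 1) (\<lambda>y. (cmod (u y))\<^sup>2) x))"

definition Dcov :: "nat \<Rightarrow> cfun \<Rightarrow> cfun" where
  "Dcov j u x = wd j u x + \<i> * complex_of_real (A j u x) * u x"

definition A0 :: "cfun \<Rightarrow> real \<times> real \<Rightarrow> real" where
  "A0 u x = - conv (G 1) (\<lambda>y. Im (cnj (u y) * Dcov 2 u y)) x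
            + conv (G 2) (\<lambda>y. Im (cnj (u y) * Dcov 1 u y)) x"

definition energy :: "real \<Rightarrow> real \<Rightarrow> cfun \<Rightarrow> real" where
  "energy lam p u = (1/2) * (LINT x|lebesgue. (cmod (Dcov 1 u x))\<^sup>2 + (cmod (Dcov 2 u x))\<^sup>2)
                   - (lam / p) * (LINT x|lebesgue. cmod (u x) powr p)"

definition Sc :: "real \<Rightarrow> cfun set" where
  "Sc c = {u \<in> H1. (LINT x|lebesgue. (cmod (u x))\<^sup>2) = c}"

definition mc :: "real \<Rightarrow> real \<Rightarrow> real \<Rightarrow> real" where
  "mc lam p c = (INF u\<in>Sc c. energy lam p u)"

text \<open>Weak form of  -(D_1D_1+D_2D_2)u + A_0(u)u + \<alpha> u = \<lambda>|u|^{p-2}u, tested against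
  complex test functions \<phi> (pairing with conj \<phi>; the magnetic Laplacian is integrated by parts:
  \<integral> (D_j D_j u) conj \<phi> = - \<integral> D_j u conj (D_j \<phi>), with D_j \<phi> = \<partial>_j \<phi> + i A_j(u) \<phi>).\<close>
definition weak_CSS :: "real \<Rightarrow> real \<Rightarrow> real \<Rightarrow> cfun \<Rightarrow> bool" where
  "weak_CSS lam p \<alpha> u \<longleftrightarrow>
    (\<forall>\<phi>. test_fun \<phi> \<longrightarrow>
      (LINT x|lebesgue. Dcov 1 u x * cnj (pd 1 \<phi> x + \<i> * complex_of_real (A 1 u x) * \<phi> x))
    + (LINT x|lebesgue. Dcov 2 u x * cnj (pd 2 \<phi> x + \<i> * complex_of_real (A 2 u x) * \<phi> x))
    + (LINT x|lebesgue. complex_of_real (A0 u x) * u x * cnj (\<phi> x))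
    + complex_of_real \<alpha> * (LINT x|lebesgue. u x * cnj (\<phi> x))
    = complex_of_real lam * (LINT x|lebesgue. complex_of_real (cmod (u x) powr (p - 2)) * u x * cnj (\<phi> x)))"

end

theory Submission
  imports Defs "HOL-Library.Diagonal_Subsequence"
begin

text \<open>
  For small mass the infimum is negative, by dilating a fixed bump, and the energy is coercive on the sphere, since the
  gauge field is bounded by a Hardy-type potential and \<open>p < 4\<close> is subcritical. Scaling \<open>v \<mapsto> \<surd>\<theta> v\<close> shows that the infimum
  is strictly subadditive: the nonlinear term grows like \<open>\<theta> powr (p/2)\<close>, while the magnetic part of the kinetic term
  contributes only a correction proportional to the mass. A minimizing sequence cannot vanish, because
  otherwise its \<open>L\<^sup>p\<close> norms would tend to 0 by Lions' lemma; after a translation it has a nonzero local limit \<open>u\<close>.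
  The energy splits asymptotically into that of \<open>u\<close> and that of the remainder, since the gauge field of a locally
  vanishing sequence tends to 0 locally uniformly. Strict subadditivity then forces \<open>u\<close> to carry the whole mass, and the
  convergence is strong. The Euler--Lagrange equation is the vanishing of the first variation on the sphere; the term
  with \<open>A0\<close> arises from the variation of the gauge field after exchanging the order of integration.
\<close>

subsection \<open>Square integrable functions on the plane\<close>

text \<open>The field \<open>A j u\<close> is nonlocal, so even distant pieces of a function feel
  each other's field. What tames it is a bound uniform in the point, \<open>hardy u z\<close> <= 20
  sqrt (\<open>nsq u\<close> * \<open>dirichlet g\<close>), together with |G_k(w)| <= 1/(6 |w|).
  Multiplying the field by \<open>u\<close> then costs at most 4 (\<open>nsq u\<close>)^2 *
  \<open>dirichlet g\<close> in squared norm, so for small mass the magnetic part is a perturbation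
  of the gradient. This produces two thresholds: 1/8 makes kinetic energy and Dirichlet integral
  comparable, and (p - 2)/260 makes the scaling argument work; the second lies below the first
  because p < 4. All Sobolev tools grow out of one identity for differences of \<open>u\<close>
  along coordinate lines. On squares of side L it yields an L^4 bound, a Hardy inequality and a
  Poincare inequality. Averaging the L^4 bound over all translates of the square makes it global,
  and optimising the length puts the L^4 and Hardy bounds into scale-invariant form.\<close>

definition l2 :: "cfun \<Rightarrow> bool" where
  "l2 f \<longleftrightarrow> f \<in> borel_measurable borel \<and> integrable lborel (\<lambda>x. (cmod (f x))\<^sup>2)"

definition nsq :: "cfun \<Rightarrow> real" where
  "nsq f = (LINT x|lborel. (cmod (f x))\<^sup>2)"

text \<open>The real inner product on complex-valued functions. Real linearity is enough for
  variations of the energy; the imaginary part of the weak equation is recovered at the end by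
  testing with \<open>\<i> * \<phi>\<close>.\<close>

definition ip :: "cfun \<Rightarrow> cfun \<Rightarrow> real" where
  "ip f g = (LINT x|lborel. Re (f x * cnj (g x)))"

definition cut :: "(real \<times> real) set \<Rightarrow> cfun \<Rightarrow> cfun" where
  "cut S f = (\<lambda>x. if x \<in> S then f x else 0)"

lemma l2_measurable[measurable_dest]: "l2 f \<Longrightarrow> f \<in> borel_measurable borel"
  by (simp add: l2_def)

lemma measurable_cnj[measurable (raw)]:
  "f \<in> borel_measurable M \<Longrightarrow> (\<lambda>x. cnj (f x)) \<in> borel_measurable M"
  by (rule measurable_compose[OF _ borel_measurable_continuous_onI]) (auto intro!: continuous_intros)

lemma l2_integrable: "l2 f \<Longrightarrow> integrable lborel (\<lambda>x. (cmod (f x))\<^sup>2)"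
  by (simp add: l2_def)

lemma l2I_bound:
  assumes "f \<in> borel_measurable borel" "integrable lborel F" "\<And>x. (cmod (f x))\<^sup>2 \<le> F x"
  shows "l2 f"
  unfolding l2_def
proof (intro conjI assms(1))
  show "integrable lborel (\<lambda>x. (cmod (f x))\<^sup>2)"
    by (rule Bochner_Integration.integrable_bound[OF assms(2)])
       (use assms in \<open>auto intro!: AE_I2 order_trans[OF assms(3)]\<close>)
qed

lemma nsq_nonneg[simp]: "0 \<le> nsq f"
  by (simp add: nsq_def)

lemma l2_zero[simp]: "l2 (\<lambda>x. 0)"
  by (simp add: l2_def)

lemma l2_cmod_mult:
  assumes "l2 f" "l2 g" shows "integrable lborel (\<lambda>x. cmod (f x) * cmod (g x))"
proof (rule Bochner_Integration.integrable_bound[where f="\<lambda>x. (cmod (f x))\<^sup>2 + (cmod (g x))\<^sup>2"])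
  have "cmod (f x) * cmod (g x) \<le> (cmod (f x))\<^sup>2 + (cmod (g x))\<^sup>2" for x
    using sum_squares_bound[of "cmod (f x)" "cmod (g x)"] mult_nonneg_nonneg[OF norm_ge_zero[of "f x"] norm_ge_zero[of "g x"]]
    by linarith
  then show "AE x in lborel. norm (cmod (f x) * cmod (g x)) \<le> norm ((cmod (f x))\<^sup>2 + (cmod (g x))\<^sup>2)"
    by (auto simp: abs_mult)
qed (use assms in \<open>auto simp: l2_def\<close>)

lemma l2_mult_integrable:
  fixes h :: "real \<times> real \<Rightarrow> 'b::{banach,second_countable_topology}"
  assumes "l2 f" "l2 g" "h \<in> borel_measurable borel" "\<And>x. norm (h x) \<le> cmod (f x) * cmod (g x)"
  shows "integrable lborel h"
  by (rule Bochner_Integration.integrable_bound[OF l2_cmod_mult[OF assms(1,2)]])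
     (use assms in \<open>auto simp: abs_mult\<close>)

lemma abs_Re_mult_cnj_le: "\<bar>Re (a * cnj b)\<bar> \<le> cmod a * cmod b"
  using abs_Re_le_cmod[of "a * cnj b"] by (simp add: norm_mult)

lemma l2_add: assumes "l2 f" "l2 g" shows "l2 (\<lambda>x. f x + g x)"
proof (rule l2I_bound[where F="\<lambda>x. 2 * (cmod (f x))\<^sup>2 + 2 * (cmod (g x))\<^sup>2"])
  show "(cmod (f x + g x))\<^sup>2 \<le> 2 * (cmod (f x))\<^sup>2 + 2 * (cmod (g x))\<^sup>2" for x
  proof -
    have "(cmod (f x + g x))\<^sup>2 \<le> (cmod (f x) + cmod (g x))\<^sup>2"
      by (intro power_mono norm_triangle_ineq) auto
    also have "\<dots> \<le> 2 * (cmod (f x))\<^sup>2 + 2 * (cmod (g x))\<^sup>2"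
      using sum_squares_bound[of "cmod (f x)" "cmod (g x)"] by (simp add: power2_sum)
    finally show ?thesis .
  qed
qed (use assms in \<open>auto simp: l2_def\<close>)

lemma l2_bmult:
  assumes "l2 f" "h \<in> borel_measurable borel" "\<And>x. cmod (h x) \<le> C"
  shows "l2 (\<lambda>x. h x * f x)"
proof (rule l2I_bound[where F="\<lambda>x. C\<^sup>2 * (cmod (f x))\<^sup>2"])
  show "(cmod (h x * f x))\<^sup>2 \<le> C\<^sup>2 * (cmod (f x))\<^sup>2" for x
    using assms(3)[of x] by (auto simp: norm_mult power_mult_distrib intro!: mult_right_mono power_mono)
qed (use assms in \<open>auto simp: l2_def\<close>)

lemma l2_cmult: "l2 f \<Longrightarrow> l2 (\<lambda>x. c * f x)"
  by (rule l2_bmult[where C="cmod c"]) auto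

lemma l2_uminus: "l2 f \<Longrightarrow> l2 (\<lambda>x. - f x)"
  using l2_cmult[of f "-1"] by simp

lemma l2_diff: "l2 f \<Longrightarrow> l2 g \<Longrightarrow> l2 (\<lambda>x. f x - g x)"
  using l2_add[of f "\<lambda>x. - g x"] l2_uminus[of g] by simp

lemma l2_cut: assumes "l2 f" "S \<in> sets borel" shows "l2 (cut S f)"
  unfolding cut_def
  by (rule l2I_bound[where F="\<lambda>x. (cmod (f x))\<^sup>2"]) (use assms in \<open>auto simp: l2_def\<close>)

lemma measurable_cut[measurable]:
  assumes [measurable]: "f \<in> borel_measurable borel" "S \<in> sets borel"
  shows "cut S f \<in> borel_measurable borel"
  unfolding cut_def by measurable

lemma l2_cmod: "l2 f \<Longrightarrow> l2 (\<lambda>x. of_real (cmod (f x)))"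
  by (auto simp: l2_def)

lemma nsq_cmod[simp]: "nsq (\<lambda>x. of_real (cmod (f x))) = nsq f"
  by (simp add: nsq_def)

lemma ip_integrable:
  assumes [measurable]: "l2 f" "l2 g" shows "integrable lborel (\<lambda>x. Re (f x * cnj (g x)))"
  by (rule l2_mult_integrable[OF assms]) (measurable, simp only: real_norm_def abs_Re_mult_cnj_le)

lemma l2_times_integrable: "l2 f \<Longrightarrow> l2 g \<Longrightarrow> integrable lborel (\<lambda>x. f x * g x)"
  by (rule l2_mult_integrable[of f g]) (auto simp: norm_mult)

lemma ip_self: "ip f f = nsq f"
  unfolding ip_def nsq_def by (simp add: cmod_power2 flip: power2_eq_square)

lemma ip_commute: "ip f g = ip g f"
  unfolding ip_def by (intro Bochner_Integration.integral_cong) auto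

lemma ip_add_left: "l2 f \<Longrightarrow> l2 g \<Longrightarrow> l2 h \<Longrightarrow> ip (\<lambda>x. f x + g x) h = ip f h + ip g h"
  unfolding ip_def
  by (subst Bochner_Integration.integral_add[symmetric]) (auto intro: ip_integrable simp: distrib_right simp del: times_complex.sel)

lemma ip_add_right: "l2 f \<Longrightarrow> l2 g \<Longrightarrow> l2 h \<Longrightarrow> ip h (\<lambda>x. f x + g x) = ip h f + ip h g"
  by (metis ip_add_left ip_commute)

lemma ip_scale_left: "ip (\<lambda>x. of_real c * f x) h = c * ip f h"
  unfolding ip_def by (subst integral_mult_right_zero[symmetric]) (simp add: algebra_simps)

lemma ip_scale_right: "ip h (\<lambda>x. of_real c * f x) = c * ip h f"
  by (metis ip_commute ip_scale_left)

lemma ip_diff_right: "l2 f \<Longrightarrow> l2 g \<Longrightarrow> l2 h \<Longrightarrow> ip h (\<lambda>x. f x - g x) = ip h f - ip h g"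
  using ip_add_right[of f "\<lambda>x. of_real (-1) * g x" h] ip_scale_right[of h "-1" g] l2_uminus[of g]
  by simp

lemma ip_cong_AE:
  assumes "AE x in lborel. f x = f' x" "AE x in lborel. g x = g' x"
    "f \<in> borel_measurable borel" "f' \<in> borel_measurable borel"
    "g \<in> borel_measurable borel" "g' \<in> borel_measurable borel"
  shows "ip f g = ip f' g'"
  unfolding ip_def by (rule integral_cong_AE) (use assms in auto)

lemma nsq_scale: "nsq (\<lambda>x. c * f x) = (cmod c)\<^sup>2 * nsq f"
  unfolding nsq_def by (simp add: norm_mult power_mult_distrib)

lemma nsq_uminus: "nsq (\<lambda>x. - f x) = nsq f"
  by (simp add: nsq_def)

lemma nsq_add:
  assumes "l2 f" "l2 g" shows "nsq (\<lambda>x. f x + g x) = nsq f + 2 * ip f g + nsq g"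
proof -
  have *: "l2 (\<lambda>x. f x + g x)" by (rule l2_add[OF assms])
  have "nsq (\<lambda>x. f x + g x) = ip (\<lambda>x. f x + g x) (\<lambda>x. f x + g x)" by (simp add: ip_self)
  also have "\<dots> = ip f f + ip f g + (ip g f + ip g g)"
    by (simp add: ip_add_left ip_add_right assms *)
  finally show ?thesis by (simp add: ip_self ip_commute[of g f])
qed

lemma nsq_diff:
  assumes "l2 f" "l2 g" shows "nsq (\<lambda>x. f x - g x) = nsq f - 2 * ip f g + nsq g"
  using nsq_add[OF assms(1) l2_uminus[OF assms(2)]] ip_scale_right[of f "-1" g]
  by (simp add: nsq_uminus)

text \<open>The discriminant argument behind Cauchy-Schwarz, where \<open>c\<close> is the squared
  norm of the second vector and may vanish.\<close>

lemma quadratic_nonneg_imp: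
  fixes a b c :: real
  assumes "\<And>t. 0 \<le> a + 2 * b * t + c * t\<^sup>2" shows "b\<^sup>2 \<le> a * c"
proof -
  have a: "0 \<le> a" using assms[of 0] by simp
  show ?thesis
  proof (cases "c = 0")
    case True
    have "b = 0"
    proof (rule ccontr)
      assume "b \<noteq> 0"
      \<comment> \<open>At this \<open>t\<close> the affine function a + 2bt takes the value
        -1.\<close>
      then show False using assms[of "-(a+1)/(2*b)"] True by (simp add: field_simps)
    qed
    then show ?thesis using True by simp
  next
    case False
    have c: "0 < c"
    proof (rule ccontr)
      assume "\<not> 0 < c"
      then have "c < 0" using False by simp
      \<comment> \<open>Such a \<open>t\<close> is at least 1 and makes -ct exceed a + 2|b|, so the
        negative quadratic term beats the rest.\<close>
      then have "a + 2 * b * t + c * t\<^sup>2 < 0" if "t = (a + 2*\<bar>b\<bar> + 1) / (-c) + 1" for t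
      proof -
        have t1: "t \<ge> 1" using that \<open>c < 0\<close> a by (simp add: divide_nonneg_neg)
        have ct: "- c * t > a + 2 * \<bar>b\<bar>" using that \<open>c<0\<close> a by (simp add: field_simps)
        have "a + 2*b*t + c * t\<^sup>2 \<le> a*t + 2*\<bar>b\<bar>*t + c*t*t"
          using t1 a by (simp add: power2_eq_square mult_le_cancel_left1 add_mono mult_mono)
        also have "\<dots> = t * (a + 2*\<bar>b\<bar> + c * t)" by (simp add: algebra_simps)
        also have "\<dots> < 0" using t1 ct by (intro mult_pos_neg) auto
        finally show ?thesis .
      qed
      then show False using assms not_le by blast
    qed
    \<comment> \<open>The minimum of the quadratic is attained at -b/c.\<close>
    have "0 \<le> a + 2 * b * (-b/c) + c * (-b/c)\<^sup>2" by (rule assms)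
    then show ?thesis using c by (simp add: field_simps power2_eq_square)
  qed
qed

lemma ip_cauchy_schwarz_sq:
  assumes "l2 f" "l2 g" shows "(ip f g)\<^sup>2 \<le> nsq f * nsq g"
proof (rule quadratic_nonneg_imp)
  fix t :: real
  have "0 \<le> nsq (\<lambda>x. f x + of_real t * g x)" by simp
  also have "\<dots> = nsq f + 2 * ip f g * t + nsq g * t\<^sup>2"
    by (subst nsq_add) (auto simp: assms l2_cmult ip_scale_right nsq_scale)
  finally show "0 \<le> nsq f + 2 * ip f g * t + nsq g * t\<^sup>2" .
qed

lemma ip_cauchy_schwarz:
  assumes "l2 f" "l2 g" shows "\<bar>ip f g\<bar> \<le> sqrt (nsq f) * sqrt (nsq g)"
  using real_sqrt_le_mono[OF ip_cauchy_schwarz_sq[OF assms]] by (simp add: real_sqrt_mult)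

lemma cauchy_schwarz_cmod:
  assumes "l2 f" "l2 g"
  shows "(LINT x|lborel. cmod (f x) * cmod (g x)) \<le> sqrt (nsq f) * sqrt (nsq g)"
  using ip_cauchy_schwarz[OF l2_cmod[OF assms(1)] l2_cmod[OF assms(2)]]
  by (simp add: ip_def)

lemma cauchy_schwarz_norm:
  assumes "l2 f" "l2 g"
  shows "cmod (LINT x|lborel. f x * g x) \<le> sqrt (nsq f) * sqrt (nsq g)"
proof -
  have "cmod (LINT x|lborel. f x * g x) \<le> (LINT x|lborel. cmod (f x * g x))"
    by (rule integral_norm_bound)
  then show ?thesis using cauchy_schwarz_cmod[OF assms] by (simp add: norm_mult)
qed

lemma nsq_add_le:
  assumes "l2 f" "l2 g" shows "nsq (\<lambda>x. f x + g x) \<le> 2 * nsq f + 2 * nsq g"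
  using nsq_add[OF assms] nsq_diff[OF assms] nsq_nonneg[of "\<lambda>x. f x - g x"] by linarith

lemma nsq_diff_le:
  assumes "l2 f" "l2 g" shows "nsq (\<lambda>x. f x - g x) \<le> 2 * nsq f + 2 * nsq g"
  using nsq_add[OF assms] nsq_diff[OF assms] nsq_nonneg[of "\<lambda>x. f x + g x"] by linarith

text \<open>Young's inequality for the cross term, with a factor close to 1 in front of
  \<open>f\<close>: the scaling argument cannot afford the factor 2 of
  \<open>nsq_add_le\<close>.\<close>

lemma nsq_add_le_eps:
  assumes "l2 f" "l2 g" "e > 0"
  shows "nsq (\<lambda>x. f x + g x) \<le> (1 + e) * nsq f + (1 + 1/e) * nsq g"
proof -
  have "0 \<le> nsq (\<lambda>x. of_real (sqrt e) * f x - of_real (1 / sqrt e) * g x)" by simp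
  also have "\<dots> = e * nsq f - 2 * ip f g + nsq g / e"
    using assms
    by (subst nsq_diff) (auto simp: l2_cmult nsq_scale ip_scale_left ip_scale_right power_divide simp flip: of_real_divide)
  finally show ?thesis using nsq_add[OF assms(1,2)] by (simp add: algebra_simps)
qed

lemma nsq_mono:
  assumes "l2 g" "f \<in> borel_measurable borel" "\<And>x. cmod (f x) \<le> cmod (g x)"
  shows "nsq f \<le> nsq g"
proof -
  have "l2 f" using assms(2) l2_integrable[OF assms(1)]
    by (rule l2I_bound) (use assms in \<open>auto intro: power_mono\<close>)
  then show ?thesis
  unfolding nsq_def using assms by (intro integral_mono) (auto simp: l2_def intro: power_mono)
qed

lemma nsq_bmult_le:
  assumes "l2 f" "h \<in> borel_measurable borel" "\<And>x. cmod (h x) \<le> C"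
  shows "nsq (\<lambda>x. h x * f x) \<le> C\<^sup>2 * nsq f"
proof -
  have "C \<ge> 0" using assms(3)[of 0] norm_ge_zero order_trans by blast
  have "nsq (\<lambda>x. h x * f x) \<le> nsq (\<lambda>x. of_real C * f x)"
    using assms \<open>C \<ge> 0\<close> by (intro nsq_mono l2_cmult) (auto simp: norm_mult intro: mult_right_mono)
  then show ?thesis by (simp add: nsq_scale)
qed

lemma nsq_cut_le: "l2 f \<Longrightarrow> S \<in> sets borel \<Longrightarrow> nsq (cut S f) \<le> nsq f"
  by (rule nsq_mono) (auto simp: cut_def)

lemma nsq_cut_mono:
  "l2 f \<Longrightarrow> S \<in> sets borel \<Longrightarrow> T \<in> sets borel \<Longrightarrow> S \<subseteq> T \<Longrightarrow> nsq (cut S f) \<le> nsq (cut T f)"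
  by (rule nsq_mono) (auto simp: cut_def l2_cut[unfolded cut_def])

lemma nsq_cut_split:
  assumes "l2 f" "S \<in> sets borel" shows "nsq f = nsq (cut S f) + nsq (cut (-S) f)"
proof -
  have "integrable lborel (\<lambda>x. (cmod (cut S f x))\<^sup>2)" "integrable lborel (\<lambda>x. (cmod (cut (-S) f x))\<^sup>2)"
    using l2_cut[of f S] l2_cut[of f "-S"] assms by (auto simp: l2_def)
  note * = this
  show ?thesis
    unfolding nsq_def Bochner_Integration.integral_add[OF *, symmetric]
    by (auto simp: cut_def intro!: Bochner_Integration.integral_cong)
qed

lemma nn_integral_cmod_sq: "l2 f \<Longrightarrow> (\<integral>\<^sup>+x. ennreal ((cmod (f x))\<^sup>2) \<partial>lborel) = ennreal (nsq f)"
  unfolding nsq_def by (rule nn_integral_eq_integral) (auto simp: l2_def)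

lemma nn_integral_cmod_sq_set:
  "l2 f \<Longrightarrow> S \<in> sets borel \<Longrightarrow>
    (\<integral>\<^sup>+x. ennreal ((cmod (f x))\<^sup>2) * indicator S x \<partial>lborel) = ennreal (nsq (cut S f))"
  by (subst nn_integral_cmod_sq[symmetric, OF l2_cut]) (auto simp: cut_def intro!: nn_integral_cong split: split_indicator)

text \<open>Fatou's lemma: the L2 norm is lower semicontinuous under almost everywhere convergence,
  and the limit is placed in L2 at the same time.\<close>

lemma l2_fatou:
  assumes f: "\<And>n. l2 (f n)" and le: "\<forall>\<^sub>F n in sequentially. nsq (f n) \<le> M"
    and g[measurable]: "g \<in> borel_measurable borel"
    and lim: "AE x in lborel. (\<lambda>n. f n x) \<longlonglongrightarrow> g x"
  shows "l2 g" "nsq g \<le> M"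
proof -
  note [measurable] = f
  have M: "M \<ge> 0"
    using eventually_happens'[OF sequentially_bot le] nsq_nonneg order_trans by blast
  have "(\<integral>\<^sup>+x. ennreal ((cmod (g x))\<^sup>2) \<partial>lborel) = (\<integral>\<^sup>+x. liminf (\<lambda>n. ennreal ((cmod (f n x))\<^sup>2)) \<partial>lborel)"
  proof (rule nn_integral_cong_AE, use lim in eventually_elim)
    fix x assume "(\<lambda>n. f n x) \<longlonglongrightarrow> g x"
    then have "(\<lambda>n. ennreal ((cmod (f n x))\<^sup>2)) \<longlonglongrightarrow> ennreal ((cmod (g x))\<^sup>2)"
      by (intro tendsto_intros)
    then show "ennreal ((cmod (g x))\<^sup>2) = liminf (\<lambda>n. ennreal ((cmod (f n x))\<^sup>2))"
      by (subst lim_imp_Liminf) simp_all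
  qed
  also have "\<dots> \<le> liminf (\<lambda>n. \<integral>\<^sup>+x. ennreal ((cmod (f n x))\<^sup>2) \<partial>lborel)"
    by (rule nn_integral_liminf) measurable
  also have "\<dots> \<le> limsup (\<lambda>n. \<integral>\<^sup>+x. ennreal ((cmod (f n x))\<^sup>2) \<partial>lborel)"
    by (simp add: Liminf_le_Limsup)
  also have "\<dots> \<le> ennreal M"
    by (rule Limsup_bounded) (use le in \<open>auto simp: nn_integral_cmod_sq f intro!: ennreal_leI elim!: eventually_mono\<close>)
  finally have *: "(\<integral>\<^sup>+x. ennreal ((cmod (g x))\<^sup>2) \<partial>lborel) \<le> ennreal M" .
  then show "l2 g"
    unfolding l2_def by (intro conjI g integrableI_bounded) (auto simp: le_less_trans)
  then show "nsq g \<le> M" using * M by (simp add: nn_integral_cmod_sq)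
qed

text \<open>Half-open, so that boxes of integer size are tiled exactly by the cells of
  \<open>grid\<close>.\<close>

definition qbox :: "real \<Rightarrow> (real \<times> real) set" where "qbox R = {-R..<R} \<times> {-R..<R}"

lemma qbox_sets[measurable, simp]: "qbox R \<in> sets borel"
  by (simp add: qbox_def borel_Times)

lemma qbox_mono: "R \<le> S \<Longrightarrow> qbox R \<subseteq> qbox S"
  by (auto simp: qbox_def)

lemma eventually_in_qbox: "\<forall>\<^sub>F n in sequentially. x \<in> qbox (real n)"
proof -
  obtain N where N: "\<bar>fst x\<bar> + \<bar>snd x\<bar> < real N" using reals_Archimedean2 by blast
  have "x \<in> qbox (real n)" if "n \<ge> N" for n
  proof -
    have "real N \<le> real n" using that by simp
    then show ?thesis using N unfolding qbox_def mem_Times_iff by auto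
  qed
  then show ?thesis by (auto simp: eventually_sequentially)
qed

text \<open>For a quantity split into a part that vanishes at each fixed cutoff \<open>k\<close> and
  a tail uniform in \<open>n\<close>: the tail fixes \<open>k\<close> first, then \<open>n\<close>
  is taken large.\<close>

lemma tendsto_0_split:
  fixes a :: "nat \<Rightarrow> real" and b :: "nat \<Rightarrow> nat \<Rightarrow> real"
  assumes "\<And>k. \<forall>\<^sub>F n in sequentially. \<bar>a n\<bar> \<le> b k n + d k" "\<And>k. b k \<longlonglongrightarrow> 0" "d \<longlonglongrightarrow> 0"
  shows "a \<longlonglongrightarrow> 0"
proof (rule tendstoI)
  fix e :: real assume e: "e > 0"
  have "\<forall>\<^sub>F k in sequentially. d k < e / 2" using assms(3) e by (intro order_tendstoD(2)[of _ 0]) auto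
  then obtain k where k: "d k < e / 2" using eventually_happens'[OF sequentially_bot] by blast
  have "\<forall>\<^sub>F n in sequentially. b k n < e / 2" using assms(2) e by (intro order_tendstoD(2)[of _ 0]) auto
  with assms(1)[of k] show "\<forall>\<^sub>F n in sequentially. dist (a n) 0 < e"
    by eventually_elim (use k in auto)
qed

lemma nsq_cut_exhaust:
  assumes f[measurable]: "l2 f" and S[measurable]: "\<And>n. S n \<in> sets borel" and ev: "\<And>x. \<forall>\<^sub>F n in sequentially. x \<in> S n"
  shows "(\<lambda>n. nsq (cut (- S n) f)) \<longlonglongrightarrow> 0"
proof -
  have "(\<lambda>n. LINT x|lborel. (cmod (cut (- S n) f x))\<^sup>2) \<longlonglongrightarrow> (LINT x|(lborel :: (real \<times> real) measure). (0::real))"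
  proof (rule integral_dominated_convergence[where w="\<lambda>x. (cmod (f x))\<^sup>2"])
    show "AE x in lborel. (\<lambda>n. (cmod (cut (- S n) f x))\<^sup>2) \<longlonglongrightarrow> 0"
    proof (rule AE_I2)
      fix x show "(\<lambda>n. (cmod (cut (- S n) f x))\<^sup>2) \<longlonglongrightarrow> 0"
        by (rule tendsto_eventually, rule eventually_mono[OF ev[of x]]) (simp add: cut_def)
    qed
    show "(\<lambda>x. (cmod (cut (- S n) f x))\<^sup>2) \<in> borel_measurable lborel" for n by measurable
  qed (use f in \<open>auto simp: l2_def cut_def\<close>)
  then show ?thesis by (simp add: nsq_def)
qed

lemma nsq_cut_tail: "l2 f \<Longrightarrow> (\<lambda>n. nsq (cut (- qbox (real n)) f)) \<longlonglongrightarrow> 0"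
  by (rule nsq_cut_exhaust) (simp_all add: eventually_in_qbox)

text \<open>Bounded and locally vanishing sequences are weakly null, even with absolute values
  inside the integral: outside a large box the fixed \<open>\<psi>\<close> has little mass, inside
  it \<open>f n\<close> has little.\<close>

lemma tendsto_pairing_loc:
  assumes psi: "l2 \<psi>" and f: "\<And>n. l2 (f n)" and M: "\<And>n. nsq (f n) \<le> M"
    and loc: "\<And>k. (\<lambda>n. nsq (cut (qbox (real k)) (f n))) \<longlonglongrightarrow> 0"
  shows "(\<lambda>n. LINT x|lborel. cmod (\<psi> x) * cmod (f n x)) \<longlonglongrightarrow> 0"
proof (rule tendsto_0_split)
  fix k
  have "\<bar>LINT x|lborel. cmod (\<psi> x) * cmod (f n x)\<bar>
      \<le> sqrt (nsq \<psi>) * sqrt (nsq (cut (qbox (real k)) (f n))) + sqrt (nsq (cut (- qbox (real k)) \<psi>)) * sqrt M" for n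
  proof -
    have c: "l2 (cut (qbox (real k)) (f n))" "l2 (cut (- qbox (real k)) \<psi>)" using psi f by (auto simp: l2_cut)
    have "(LINT x|lborel. cmod (\<psi> x) * cmod (f n x)) =
       (LINT x|lborel. cmod (\<psi> x) * cmod (cut (qbox (real k)) (f n) x)) + (LINT x|lborel. cmod (cut (- qbox (real k)) \<psi> x) * cmod (f n x))"
      by (subst Bochner_Integration.integral_add[symmetric, OF l2_cmod_mult[OF psi c(1)] l2_cmod_mult[OF c(2) f]])
         (auto simp: cut_def intro!: Bochner_Integration.integral_cong)
    also have "\<dots> \<le> sqrt (nsq \<psi>) * sqrt (nsq (cut (qbox (real k)) (f n))) + sqrt (nsq (cut (- qbox (real k)) \<psi>)) * sqrt (nsq (f n))"
      by (intro add_mono cauchy_schwarz_cmod c psi f)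
    also have "\<dots> \<le> sqrt (nsq \<psi>) * sqrt (nsq (cut (qbox (real k)) (f n))) + sqrt (nsq (cut (- qbox (real k)) \<psi>)) * sqrt M"
      by (intro add_left_mono mult_left_mono real_sqrt_le_mono M) auto
    finally show ?thesis by (subst abs_of_nonneg) auto
  qed
  then show "\<forall>\<^sub>F n in sequentially. \<bar>LINT x|lborel. cmod (\<psi> x) * cmod (f n x)\<bar>
      \<le> sqrt (nsq \<psi>) * sqrt (nsq (cut (qbox (real k)) (f n))) + sqrt (nsq (cut (- qbox (real k)) \<psi>)) * sqrt M"
    by simp
  show "(\<lambda>n. sqrt (nsq \<psi>) * sqrt (nsq (cut (qbox (real k)) (f n)))) \<longlonglongrightarrow> 0"
    using tendsto_mult_right_zero[OF tendsto_real_sqrt[OF loc[of k], simplified]] by blast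
next
  show "(\<lambda>k. sqrt (nsq (cut (- qbox (real k)) \<psi>)) * sqrt M) \<longlonglongrightarrow> 0"
    using tendsto_mult_left_zero[OF tendsto_real_sqrt[OF nsq_cut_tail[OF psi], simplified]] by blast
qed

lemma summable_convergent_diff:
  fixes f :: "nat \<Rightarrow> complex"
  assumes "summable (\<lambda>k. f (Suc k) - f k)" shows "convergent f"
proof -
  have "convergent (\<lambda>n. \<Sum>k<n. f (Suc k) - f k)" using assms by (simp add: summable_iff_convergent)
  then have "convergent (\<lambda>n. f n - f 0)" by (simp add: sum_lessThan_telescope)
  then have "convergent (\<lambda>n. (f n - f 0) + f 0)" by (intro convergent_add convergent_const)
  then show ?thesis by simp
qed

text \<open>Riesz-Fischer for local L2 convergence. One almost everywhere convergent subsequence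
  serves all boxes; its limit is then recognised as the local L2 limit of the full sequence.\<close>

lemma l2_loc_complete:
  assumes f: "\<And>n. l2 (f n)"
    and cau: "\<And>k e. e > 0 \<Longrightarrow> \<exists>N. \<forall>m\<ge>N. \<forall>n\<ge>N. nsq (cut (qbox (real k)) (\<lambda>x. f m x - f n x)) < e"
  obtains r g where "strict_mono (r :: nat \<Rightarrow> nat)" "g \<in> borel_measurable borel"
    "AE x in lborel. (\<lambda>n. f (r n) x) \<longlonglongrightarrow> g x" "\<And>k. l2 (cut (qbox (real k)) g)"
    "\<And>k. (\<lambda>n. nsq (cut (qbox (real k)) (\<lambda>x. f n x - g x))) \<longlonglongrightarrow> 0"
proof -
  note [measurable] = f
  have "\<forall>k. \<exists>N. \<forall>m\<ge>N. \<forall>n\<ge>N. nsq (cut (qbox (real k)) (\<lambda>x. f m x - f n x)) < (1/8)^k"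
    using cau by simp
  then obtain N where N: "\<And>k m n. m \<ge> N k \<Longrightarrow> n \<ge> N k \<Longrightarrow> nsq (cut (qbox (real k)) (\<lambda>x. f m x - f n x)) < (1/8)^k"
    by metis
  \<comment> \<open>At index \<open>k\<close> the subsequence is past the Cauchy thresholds of all
    boxes up to \<open>k\<close>; the summand \<open>k\<close> makes it strictly increasing.\<close>
  define r where "r k = (\<Sum>i\<le>k. N i) + k" for k
  have r: "strict_mono r" by (auto simp: strict_mono_Suc_iff r_def)
  have rN: "r k \<ge> N k" for k
    unfolding r_def by (rule trans_le_add1) (rule member_le_sum, auto)
  define D where "D k = (\<lambda>x. f (r (Suc k)) x - f (r k) x)" for k
  have D: "l2 (D k)" for k unfolding D_def by (intro l2_diff f)
  note [measurable] = D
  have Dle: "nsq (cut (qbox (real K)) (D (k + K))) \<le> (1/8)^(k+K)" for k K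
  proof -
    have "nsq (cut (qbox (real K)) (D (k + K))) \<le> nsq (cut (qbox (real (k + K))) (D (k + K)))"
      by (intro nsq_cut_mono D qbox_mono) auto
    also have "\<dots> < (1/8)^(k+K)"
      unfolding D_def by (rule N) (use rN[of "k+K"] rN[of "Suc (k+K)"] strict_mono_less_eq[OF r, of "k+K" "Suc (k+K)"] in auto)
    finally show ?thesis by simp
  qed
  \<comment> \<open>The weight 2^k turns finiteness of the sum into |D(k+K)(x)|^2 <= C 2^(-k), hence
    into absolutely summable increments. The shift by \<open>K\<close> is there because
    \<open>D k\<close> is controlled on the box of size \<open>K\<close> only from index
    \<open>K\<close> on.\<close>
  have conv1: "AE x in lborel. x \<in> qbox (real K) \<longrightarrow> convergent (\<lambda>n. f (r n) x)" for K
  proof -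
    have "(\<integral>\<^sup>+x. (\<Sum>k. ennreal (2^k) * ennreal ((cmod (cut (qbox (real K)) (D (k + K)) x))\<^sup>2)) \<partial>lborel)
        = (\<Sum>k. ennreal (2^k) * ennreal (nsq (cut (qbox (real K)) (D (k + K)))))"
    proof (subst nn_integral_suminf)
      have "(\<integral>\<^sup>+x. ennreal (2^k) * ennreal ((cmod (cut (qbox (real K)) (D (k + K)) x))\<^sup>2) \<partial>lborel)
        = ennreal (2^k) * ennreal (nsq (cut (qbox (real K)) (D (k + K))))" for k
        by (subst nn_integral_cmult) (measurable, simp add: nn_integral_cmod_sq l2_cut D)
      then show "(\<Sum>k. \<integral>\<^sup>+x. ennreal (2^k) * ennreal ((cmod (cut (qbox (real K)) (D (k + K)) x))\<^sup>2) \<partial>lborel)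
        = (\<Sum>k. ennreal (2^k) * ennreal (nsq (cut (qbox (real K)) (D (k + K)))))" by simp
    qed measurable
    also have "\<dots> \<le> (\<Sum>k. ennreal ((1/4)^k))"
    proof (rule suminf_le)
      fix k
      have "2^k * nsq (cut (qbox (real K)) (D (k + K))) \<le> 2^k * (1/8)^(k+K)"
        by (intro mult_left_mono Dle) auto
      also have "\<dots> \<le> 2^k * (1/8)^k" by (simp add: power_add power_le_one mult_left_le)
      also have "\<dots> = (1/4)^k" by (simp flip: power_mult_distrib)
      finally show "ennreal (2^k) * ennreal (nsq (cut (qbox (real K)) (D (k + K)))) \<le> ennreal ((1/4)^k)"
        by (simp add: ennreal_mult[symmetric])
    qed auto
    also have "\<dots> < \<infinity>"
      by (subst suminf_ennreal2) (auto intro!: summable_geometric)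
    finally have fin: "(\<integral>\<^sup>+x. (\<Sum>k. ennreal (2^k) * ennreal ((cmod (cut (qbox (real K)) (D (k + K)) x))\<^sup>2)) \<partial>lborel) \<noteq> \<infinity>"
      by simp
    have "AE x in lborel. (\<Sum>k. ennreal (2^k) * ennreal ((cmod (cut (qbox (real K)) (D (k + K)) x))\<^sup>2)) \<noteq> \<infinity>"
      by (rule nn_integral_PInf_AE[OF _ fin]) measurable
    then show ?thesis
    proof eventually_elim
      case (elim x)
      show ?case
      proof
        assume x: "x \<in> qbox (real K)"
        have eq: "cut (qbox (real K)) (D (k + K)) x = D (k + K) x" for k using x by (simp add: cut_def)
        obtain C where C: "(\<Sum>k. ennreal (2^k) * ennreal ((cmod (D (k + K) x))\<^sup>2)) = ennreal C" "C \<ge> 0"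
          using elim by (cases "(\<Sum>k. ennreal (2^k) * ennreal ((cmod (D (k + K) x))\<^sup>2))") (auto simp: eq)
        have "2^k * (cmod (D (k + K) x))\<^sup>2 \<le> C" for k
        proof -
          have "ennreal (2^k) * ennreal ((cmod (D (k + K) x))\<^sup>2) \<le> ennreal C"
            unfolding C(1)[symmetric] by (rule sum_le_suminf[of _ "{k}", simplified]) auto
          then show ?thesis using C(2) by (simp add: ennreal_mult[symmetric])
        qed
        then have "(cmod (D (k + K) x))\<^sup>2 * 2^k \<le> C" for k by (subst mult.commute)
        then have "(cmod (D (k + K) x))\<^sup>2 \<le> C / 2^k" for k by (subst pos_le_divide_eq) auto
        then have "(cmod (D (k + K) x))\<^sup>2 \<le> C * (1/2)^k" for k
          unfolding power_one_over by simp
        then have bd: "cmod (D (k + K) x) \<le> sqrt C * (sqrt (1/2))^k" for k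
          by (metis real_le_rsqrt real_sqrt_mult real_sqrt_power)
        have "summable (\<lambda>k. sqrt C * (sqrt (1/2))^k)"
          by (intro summable_mult summable_geometric) (auto simp: real_sqrt_lt_1_iff)
        then have "summable (\<lambda>k. D (k + K) x)"
          by (rule summable_comparison_test[rotated]) (use bd in auto)
        then have "summable (\<lambda>k. D k x)" by (subst (asm) summable_iff_shift)
        then show "convergent (\<lambda>n. f (r n) x)" unfolding D_def by (rule summable_convergent_diff)
      qed
    qed
  qed
  have conv2: "AE x in lborel. convergent (\<lambda>n. f (r n) x)"
  proof -
    have "AE x in lborel. \<forall>K. x \<in> qbox (real K) \<longrightarrow> convergent (\<lambda>n. f (r n) x)"
      by (subst AE_all_countable) (intro allI conv1)
    then show ?thesis
    proof eventually_elim
      case (elim x)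
      then show ?case using eventually_happens'[OF sequentially_bot eventually_in_qbox[of x]] by blast
    qed
  qed
  define g where "g x = lim (\<lambda>n. f (r n) x)" for x
  have g[measurable]: "g \<in> borel_measurable borel" unfolding g_def by measurable
  have lim: "AE x in lborel. (\<lambda>n. f (r n) x) \<longlonglongrightarrow> g x"
    using conv2 by eventually_elim (simp add: g_def convergent_LIMSEQ_iff)
  \<comment> \<open>The Cauchy estimate with its second index sent to infinity along
    \<open>r\<close>, by Fatou.\<close>
  have bound: "\<exists>N. \<forall>n\<ge>N. l2 (cut (qbox (real k)) (\<lambda>x. f n x - g x)) \<and> nsq (cut (qbox (real k)) (\<lambda>x. f n x - g x)) \<le> e"
    if "e > 0" for k e
  proof -
    obtain N where N: "\<And>m n. m \<ge> N \<Longrightarrow> n \<ge> N \<Longrightarrow> nsq (cut (qbox (real k)) (\<lambda>x. f m x - f n x)) < e"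
      using cau[OF \<open>e > 0\<close>] by metis
    have "l2 (cut (qbox (real k)) (\<lambda>x. f n x - g x)) \<and> nsq (cut (qbox (real k)) (\<lambda>x. f n x - g x)) \<le> e" if n: "n \<ge> N" for n
    proof -
      have 1: "l2 (cut (qbox (real k)) (\<lambda>x. f n x - f (r m) x))" for m by (intro l2_cut l2_diff f) simp
      have "r m \<ge> m" for m by (rule strict_mono_imp_increasing[OF r])
      then have 2: "\<forall>\<^sub>F m in sequentially. nsq (cut (qbox (real k)) (\<lambda>x. f n x - f (r m) x)) \<le> e"
        using N n by (auto simp: eventually_sequentially intro!: exI[of _ N] less_imp_le) (meson le_trans)
      have 3: "cut (qbox (real k)) (\<lambda>x. f n x - g x) \<in> borel_measurable borel"
        unfolding cut_def by measurable
      have 4: "AE x in lborel. (\<lambda>m. cut (qbox (real k)) (\<lambda>x. f n x - f (r m) x) x) \<longlonglongrightarrow> cut (qbox (real k)) (\<lambda>x. f n x - g x) x"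
        using lim by eventually_elim (auto simp: cut_def intro!: tendsto_intros)
      show ?thesis using l2_fatou[OF 1 2 3 4] by blast
    qed
    then show ?thesis by blast
  qed
  show thesis
  proof (rule that[OF r g lim])
    fix k
    obtain n where n: "l2 (cut (qbox (real k)) (\<lambda>x. f n x - g x))" using bound[of 1 k] by auto
    have "l2 (\<lambda>x. cut (qbox (real k)) (f n) x - cut (qbox (real k)) (\<lambda>x. f n x - g x) x)"
      by (intro l2_diff n l2_cut f) simp
    then show "l2 (cut (qbox (real k)) g)" by (simp add: cut_def if_distrib cong: if_cong)
    show "(\<lambda>n. nsq (cut (qbox (real k)) (\<lambda>x. f n x - g x))) \<longlonglongrightarrow> 0"
    proof (rule tendstoI)
      fix e :: real assume "e > 0"
      then obtain N where "\<forall>n\<ge>N. nsq (cut (qbox (real k)) (\<lambda>x. f n x - g x)) \<le> e/2" using bound[of "e/2" k] half_gt_zero by blast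
      then show "\<forall>\<^sub>F n in sequentially. dist (nsq (cut (qbox (real k)) (\<lambda>x. f n x - g x))) 0 < e"
        unfolding eventually_sequentially dist_real_def
        by (intro exI[of _ N]) (use \<open>e > 0\<close> in fastforce)
    qed
  qed
qed

declare split_paired_All [simp del] split_paired_Ex [simp del]

subsection \<open>Test functions\<close>

lemma nn_integral_shift:
  fixes f :: "'a::euclidean_space \<Rightarrow> ennreal"
  assumes [measurable]: "f \<in> borel_measurable borel"
  shows "(\<integral>\<^sup>+x. f (x + a) \<partial>lborel) = (\<integral>\<^sup>+x. f x \<partial>lborel)"
  by (subst (2) lborel_distr_plus[of a, symmetric]) (simp add: nn_integral_distr add.commute)

lemma integral_shift:
  fixes f :: "'a::euclidean_space \<Rightarrow> 'b::{banach,second_countable_topology}"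
  assumes [measurable]: "f \<in> borel_measurable borel"
  shows "(LINT x|lborel. f (x + a)) = (LINT x|lborel. f x)"
  by (subst (2) lborel_distr_plus[of a, symmetric]) (simp add: integral_distr add.commute)

lemma integrable_shift:
  fixes f :: "'a::euclidean_space \<Rightarrow> 'b::{banach,second_countable_topology}"
  assumes "integrable lborel f" shows "integrable lborel (\<lambda>x. f (x + a))"
proof -
  have [measurable]: "f \<in> borel_measurable borel" using borel_measurable_integrable[OF assms] by simp
  have "integrable (distr lborel borel ((+) a)) f" using assms by (simp add: lborel_distr_plus)
  then show ?thesis by (subst (asm) integrable_distr_eq) (auto simp: add.commute)
qed

lemma AE_shift:
  fixes P :: "'a::euclidean_space \<Rightarrow> bool"
  assumes "AE x in lborel. P x" shows "AE x in lborel. P (x + a)"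
proof -
  have "AE x in distr lborel borel ((+) a). P x" unfolding lborel_distr_plus by (rule assms)
  then have "AE x in lborel. P (a + x)" by (rule AE_distrD[rotated]) simp
  then show ?thesis by (simp add: add.commute)
qed

section \<open>Smooth functions of one variable\<close>

definition smooth :: "(real \<Rightarrow> real) \<Rightarrow> bool" where
  "smooth f \<longleftrightarrow> (\<exists>F. F 0 = f \<and> (\<forall>n x. ((F n :: real \<Rightarrow> real) has_real_derivative F (Suc n) x) (at x)))"

text \<open>The algebra generated by \<open>B\<close>. By the product rule all its members are
  smooth once each generator has a derivative inside the algebra, so smoothness needs to be checked
  on generators only.\<close>

inductive_set alg :: "(real \<Rightarrow> real) set \<Rightarrow> (real \<Rightarrow> real) set" for B where
  base: "f \<in> B \<Longrightarrow> f \<in> alg B"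
| const: "(\<lambda>x. c) \<in> alg B"
| add: "f \<in> alg B \<Longrightarrow> g \<in> alg B \<Longrightarrow> (\<lambda>x. f x + g x) \<in> alg B"
| mult: "f \<in> alg B \<Longrightarrow> g \<in> alg B \<Longrightarrow> (\<lambda>x. f x * g x) \<in> alg B"

lemma smooth_coinduct:
  assumes "f \<in> S" "\<And>f. f \<in> S \<Longrightarrow> \<exists>f'\<in>S. \<forall>x. (f has_real_derivative f' x) (at x)"
  shows "smooth f"
proof -
  obtain d where d: "\<And>f. f \<in> S \<Longrightarrow> d f \<in> S \<and> (\<forall>x. (f has_real_derivative d f x) (at x))"
    using assms(2) by metis
  have "(d ^^ n) f \<in> S" for n by (induct n) (use assms(1) d in auto)
  then show ?thesis
    unfolding smooth_def by (intro exI[of _ "\<lambda>n. (d ^^ n) f"]) (use d in auto)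
qed

lemma smooth_alg:
  assumes "\<And>b. b \<in> B \<Longrightarrow> \<exists>b'\<in>alg B. \<forall>x. (b has_real_derivative b' x) (at x)" and "f \<in> alg B"
  shows "smooth f"
proof (rule smooth_coinduct[OF assms(2)])
  fix f assume "f \<in> alg B"
  then show "\<exists>f'\<in>alg B. \<forall>x. (f has_real_derivative f' x) (at x)"
  proof induct
    case (base f) then show ?case by (rule assms(1))
  next
    case (const c)
    show ?case by (rule bexI[OF _ alg.const[of 0]]) (auto intro!: derivative_eq_intros)
  next
    case (add f g)
    then obtain f' g' where "f' \<in> alg B" "g' \<in> alg B"
      "\<And>x. (f has_real_derivative f' x) (at x)" "\<And>x. (g has_real_derivative g' x) (at x)" by blast
    then show ?case by (intro bexI[OF _ alg.add[of f' B g']]) (auto intro!: derivative_eq_intros)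
  next
    case (mult f g)
    then obtain f' g' where "f' \<in> alg B" "g' \<in> alg B"
      "\<And>x. (f has_real_derivative f' x) (at x)" "\<And>x. (g has_real_derivative g' x) (at x)" by blast
    then show ?case
      by (intro bexI[OF _ alg.add[OF alg.mult[of f' B g] alg.mult[of f B g']]])
         (auto intro!: derivative_eq_intros mult)
  qed
qed

lemma smooth_derivE:
  assumes "smooth f" obtains f' where "smooth f'" "\<And>x. (f has_real_derivative f' x) (at x)"
proof -
  obtain F where F: "F 0 = f" "\<And>n x. (F n has_real_derivative F (Suc n) x) (at x)"
    using assms by (auto simp: smooth_def)
  have "smooth (F 1)" unfolding smooth_def by (intro exI[of _ "\<lambda>n. F (Suc n)"]) (use F in auto)
  then show thesis using that[of "F 1"] F(2)[of 0] F(1) by auto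
qed

lemma smooth_antideriv:
  assumes "smooth f'" "\<And>x. (f has_real_derivative f' x) (at x)" shows "smooth f"
proof -
  obtain F where F: "F 0 = f'" "\<And>n x. (F n has_real_derivative F (Suc n) x) (at x)"
    using assms(1) by (auto simp: smooth_def)
  show ?thesis unfolding smooth_def
    by (intro exI[of _ "\<lambda>n. case n of 0 \<Rightarrow> f | Suc m \<Rightarrow> F m"]) (use F assms(2) in \<open>auto split: nat.split\<close>)
qed

lemma smooth_isCont: assumes "smooth f" shows "isCont f x"
proof -
  obtain f' where "\<And>x. (f has_real_derivative f' x) (at x)" using smooth_derivE[OF assms] by blast
  then show ?thesis using DERIV_isCont by blast
qed

lemma smooth_algI: assumes "f \<in> alg (Collect smooth)" shows "smooth f"
proof (rule smooth_alg[OF _ assms])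
  fix b :: "real \<Rightarrow> real" assume "b \<in> Collect smooth"
  then obtain b' where b': "smooth b'" "\<And>x. (b has_real_derivative b' x) (at x)"
    using smooth_derivE[of b] by blast
  have "b' \<in> alg (Collect smooth)" by (rule alg.base) (simp add: b')
  then show "\<exists>b'\<in>alg (Collect smooth). \<forall>x. (b has_real_derivative b' x) (at x)"
    using b'(2) by blast
qed

lemma smooth_mult: "smooth f \<Longrightarrow> smooth g \<Longrightarrow> smooth (\<lambda>x. f x * g x)"
  by (rule smooth_algI) (intro alg.mult alg.base CollectI)

lemma smooth_diff: assumes "smooth f" "smooth g" shows "smooth (\<lambda>x. f x - g x)"
proof -
  have "smooth (\<lambda>x. f x + (-1) * g x)"
    by (rule smooth_algI) (intro alg.add alg.mult alg.const alg.base CollectI assms)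
  then show ?thesis by simp
qed

lemma smooth_affine:
  assumes "smooth f" shows "smooth (\<lambda>x. f (a * x + b))"
proof -
  obtain F where F: "F 0 = f" "\<And>n x. (F n has_real_derivative F (Suc n) x) (at x)"
    using assms by (auto simp: smooth_def)
  have "((\<lambda>x. a ^ n * F n (a * x + b)) has_real_derivative a ^ Suc n * F (Suc n) (a * x + b)) (at x)" for n x
  proof -
    have "((\<lambda>x. a * x + b) has_real_derivative a) (at x)" by (auto intro!: derivative_eq_intros)
    from DERIV_cmult[OF DERIV_chain2[OF F(2) this], of "a ^ n" n]
    show ?thesis by (simp add: mult_ac)
  qed
  then show ?thesis unfolding smooth_def
    by (intro exI[of _ "\<lambda>n x. a ^ n * F n (a * x + b)"]) (use F(1) in auto)
qed

text \<open>The functions t^(-m) exp(-1/t), extended by 0 to t <= 0. The whole family in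
  \<open>m\<close> is introduced because differentiation stays within its linear
  combinations.\<close>

definition hexp :: "nat \<Rightarrow> real \<Rightarrow> real" where
  "hexp m t = (if t > 0 then (1/t) ^ m * exp (- (1/t)) else 0)"

lemma hexp_tendsto_0: "(hexp m \<longlongrightarrow> 0) (at 0)"
proof (rule filterlim_split_at)
  show "(hexp m \<longlongrightarrow> 0) (at_left 0)"
    by (rule tendsto_eventually) (auto simp: eventually_at_left_field hexp_def intro!: exI[of _ "-1"])
  have "((\<lambda>y::real. y ^ m / exp y) \<longlongrightarrow> 0) at_top" by (rule tendsto_power_div_exp_0)
  then have "((\<lambda>t::real. (inverse t) ^ m / exp (inverse t)) \<longlongrightarrow> 0) (at_right 0)"
    by (rule filterlim_compose[OF _ filterlim_inverse_at_top_right])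
  then show "(hexp m \<longlongrightarrow> 0) (at_right 0)"
    by (rule Lim_transform_eventually)
       (auto simp: eventually_at_right_field hexp_def exp_minus field_simps intro!: exI[of _ 1])
qed

lemma hexp_deriv:
  "(hexp m has_real_derivative (- real m) * hexp (m+1) x + hexp (m+2) x) (at x)"
proof -
  consider "x > 0" | "x < 0" | "x = 0" by linarith
  then show ?thesis
  proof cases
    case 1
    have P: "((\<lambda>t. (1/t) ^ m) has_real_derivative - real m * (1/x) ^ (m+1)) (at x)"
    proof (induct m)
      case (Suc m)
      have "((\<lambda>t. 1/t) has_real_derivative (- 1 / x^2)) (at x)"
        using 1 by (auto intro!: derivative_eq_intros simp: power2_eq_square)
      from DERIV_mult[OF this Suc]
      have "((\<lambda>t. 1/t * (1/t) ^ m) has_real_derivative - real (Suc m) * (1/x) ^ (Suc m + 1)) (at x)"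
        by (rule DERIV_cong) (use 1 in \<open>simp add: field_simps power2_eq_square\<close>)
      then show ?case by simp
    qed simp
    have E: "((\<lambda>t. exp (- (1/t))) has_real_derivative (1/x)^2 * exp (- (1/x))) (at x)"
      using 1 by (auto intro!: derivative_eq_intros simp: power2_eq_square)
    have "((\<lambda>t. (1/t) ^ m * exp (- (1/t))) has_real_derivative (- real m) * hexp (m+1) x + hexp (m+2) x) (at x)"
      by (rule DERIV_cong[OF DERIV_mult[OF P E]]) (use 1 in \<open>simp add: hexp_def power2_eq_square algebra_simps\<close>)
    then show ?thesis
      by (rule DERIV_cong_ev[THEN iffD1, rotated -1])
         (use 1 in \<open>auto simp: hexp_def eventually_nhds intro!: exI[of _ "{0<..}"]\<close>)
  next
    case 2
    have "((\<lambda>t. 0) has_real_derivative (- real m) * hexp (m+1) x + hexp (m+2) x) (at x)"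
      using 2 by (auto simp: hexp_def)
    then show ?thesis
      by (rule DERIV_cong_ev[THEN iffD1, rotated -1])
         (use 2 in \<open>auto simp: hexp_def eventually_nhds intro!: exI[of _ "{..<0}"]\<close>)
  next
    case 3
    \<comment> \<open>At the origin the difference quotient of \<open>hexp m\<close> is
      \<open>hexp (m+1)\<close>, which tends to 0 from both sides.\<close>
    have "((\<lambda>h. (hexp m (0 + h) - hexp m 0) / h) \<longlongrightarrow> 0) (at 0)"
      by (rule Lim_transform_eventually[OF hexp_tendsto_0[of "Suc m"]])
         (auto simp: eventually_at_filter hexp_def)
    then show ?thesis using 3 by (simp add: DERIV_def hexp_def)
  qed
qed

lemma smooth_hexp: "smooth (hexp 0)"
proof (rule smooth_alg[of "range hexp"])
  fix b :: "real \<Rightarrow> real" assume "b \<in> range hexp"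
  then obtain m where b: "b = hexp m" by auto
  have "(\<lambda>x. (- real m) * hexp (m+1) x + hexp (m+2) x) \<in> alg (range hexp)"
    by (intro alg.add alg.mult alg.const alg.base rangeI)
  then show "\<exists>b'\<in>alg (range hexp). \<forall>x. (b has_real_derivative b' x) (at x)"
    unfolding b by (rule bexI[rotated]) (intro allI hexp_deriv)
qed (auto intro: alg.base)

text \<open>The parameter \<open>k\<close> sharpens the edges without moving them: each
  \<open>bmp k a b\<close> vanishes off the open interval, and \<open>k\<close> to infinity gives
  its indicator.\<close>

definition bmp :: "nat \<Rightarrow> real \<Rightarrow> real \<Rightarrow> real \<Rightarrow> real" where
  "bmp k a b x = hexp 0 (real k * (x - a)) * hexp 0 (real k * (b - x))"

lemma smooth_bmp: "smooth (bmp k a b)"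
proof -
  have "smooth (\<lambda>x. hexp 0 (real k * x + (- real k * a)) * hexp 0 ((- real k) * x + real k * b))"
    by (intro smooth_mult smooth_affine smooth_hexp)
  then show ?thesis unfolding bmp_def[abs_def] by (simp add: algebra_simps)
qed

lemma hexp_range: "0 \<le> hexp 0 x" "hexp 0 x \<le> 1"
  by (auto simp: hexp_def)

lemma bmp_range: "0 \<le> bmp k a b x" "bmp k a b x \<le> 1"
  by (auto simp: bmp_def hexp_range mult_le_one)

lemma bmp_eq_0: "x \<notin> {a<..<b} \<Longrightarrow> bmp k a b x = 0"
  by (auto simp: bmp_def hexp_def zero_less_mult_iff)

lemma hexp_tendsto_1: "c > 0 \<Longrightarrow> (\<lambda>k. hexp 0 (real k * c)) \<longlonglongrightarrow> 1"
proof -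
  assume c: "c > 0"
  have "(\<lambda>k. exp (- (1 / (real (Suc k) * c)))) \<longlonglongrightarrow> exp (- 0)"
  proof (intro tendsto_intros)
    have "(\<lambda>k. (1 / c) * (1 / real (Suc k))) \<longlonglongrightarrow> (1/c) * 0"
      by (intro tendsto_intros LIMSEQ_Suc[OF lim_1_over_n])
    then show "(\<lambda>k. 1 / (real (Suc k) * c)) \<longlonglongrightarrow> 0" by (simp add: field_simps)
  qed
  then have "(\<lambda>k. hexp 0 (real (Suc k) * c)) \<longlonglongrightarrow> 1" using c by (simp add: hexp_def)
  then show ?thesis by (rule LIMSEQ_imp_Suc)
qed

lemma bmp_tendsto: "(\<lambda>k. bmp k a b x) \<longlonglongrightarrow> indicat_real {a<..<b} x"
proof (cases "x \<in> {a<..<b}")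
  case True
  then have "(\<lambda>k. bmp k a b x) \<longlonglongrightarrow> 1 * 1" unfolding bmp_def by (intro tendsto_mult hexp_tendsto_1) auto
  then show ?thesis using True by simp
qed (simp add: bmp_eq_0)

lemma continuous_bmp: "continuous_on UNIV (bmp k a b)"
  using smooth_isCont[OF smooth_bmp] by (simp add: continuous_at_imp_continuous_on)

lemma measurable_bmp[measurable]: "bmp k a b \<in> borel_measurable borel"
  by (intro borel_measurable_continuous_onI continuous_bmp)

section \<open>Tensor products as test functions on the plane\<close>

definition tens :: "(real \<Rightarrow> real) \<Rightarrow> (real \<Rightarrow> real) \<Rightarrow> cfun" where
  "tens F H x = complex_of_real (F (fst x) * H (snd x))"

lemma tens_deriv1:
  assumes "\<And>x. (F has_real_derivative F' x) (at x)"
  shows "((\<lambda>t. tens F H (x + t *\<^sub>R evec 1)) has_vector_derivative tens F' H x) (at 0)"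
proof -
  have "((\<lambda>t. fst x + t) has_real_derivative 1) (at 0)" by (auto intro!: derivative_eq_intros)
  from DERIV_cmult_right[OF DERIV_chain2[OF assms this], of "H (snd x)"]
  have "((\<lambda>t. F (fst x + t) * H (snd x)) has_real_derivative F' (fst x) * H (snd x)) (at 0)"
    by simp
  from has_vector_derivative_of_real[OF this, where 'a=complex]
  show ?thesis by (simp add: tens_def evec_def)
qed

lemma tens_deriv2:
  assumes "\<And>x. (H has_real_derivative H' x) (at x)"
  shows "((\<lambda>t. tens F H (x + t *\<^sub>R evec 2)) has_vector_derivative tens F H' x) (at 0)"
proof -
  have "((\<lambda>t. snd x + t) has_real_derivative 1) (at 0)" by (auto intro!: derivative_eq_intros)
  from DERIV_cmult[OF DERIV_chain2[OF assms this], of "F (fst x)"]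
  have "((\<lambda>t. F (fst x) * H (snd x + t)) has_real_derivative F (fst x) * H' (snd x)) (at 0)"
    by simp
  from has_vector_derivative_of_real[OF this, where 'a=complex]
  show ?thesis by (simp add: tens_def evec_def)
qed

lemma pd_tens:
  "(\<And>x. (F has_real_derivative F' x) (at x)) \<Longrightarrow> pd 1 (tens F H) = tens F' H"
  "(\<And>x. (H has_real_derivative H' x) (at x)) \<Longrightarrow> pd 2 (tens F H) = tens F H'"
  unfolding pd_def by (rule ext, rule vector_derivative_at, erule tens_deriv1 tens_deriv2)+

lemma tens_continuous:
  assumes "\<And>x. isCont F x" "\<And>x. isCont H x" shows "continuous_on UNIV (tens F H)"
proof -
  have c: "continuous_on UNIV F" "continuous_on UNIV H" using assms by (simp_all add: continuous_at_imp_continuous_on)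
  have "continuous_on UNIV (\<lambda>x::real\<times>real. F (fst x))" "continuous_on UNIV (\<lambda>x::real\<times>real. H (snd x))"
    by (rule continuous_on_compose2[OF c(1)] continuous_on_compose2[OF c(2)]; auto intro: continuous_intros)+
  then show ?thesis unfolding tens_def
    by (intro continuous_on_of_real continuous_on_mult)
qed

text \<open>An iterated partial derivative of F(x1) H(x2) depends only on how often each direction
  occurs, so one formula with \<open>count_list\<close> covers all lists of directions.\<close>

lemma test_tens:
  assumes F: "smooth F" and H: "smooth H"
    and F0: "\<And>x. x \<notin> {a..b} \<Longrightarrow> F x = 0" and H0: "\<And>x. x \<notin> {c..d} \<Longrightarrow> H x = 0"
  shows "test_fun (tens F H)"
proof -
  obtain FF where FF: "FF 0 = F" "\<And>n x. (FF n has_real_derivative FF (Suc n) x) (at x)"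
    using F by (auto simp: smooth_def)
  obtain HH where HH: "HH 0 = H" "\<And>n x. (HH n has_real_derivative HH (Suc n) x) (at x)"
    using H by (auto simp: smooth_def)
  have pds: "pds js (tens F H) = tens (FF (count_list js 1)) (HH (count_list js 2))" if "set js \<subseteq> {1,2}" for js
    using that
  proof (induct js)
    case Nil then show ?case by (simp add: FF HH)
  next
    case (Cons j js)
    then have "j = 1 \<or> j = 2" "pds js (tens F H) = tens (FF (count_list js 1)) (HH (count_list js 2))" by auto
    then show ?case
      by (elim disjE) (simp_all add: pd_tens(1)[OF FF(2), unfolded One_nat_def] pd_tens(2)[OF HH(2)])
  qed
  have cont: "isCont (FF n) x" "isCont (HH n) x" for n x
    using FF(2) HH(2) DERIV_isCont by blast+
  show ?thesis unfolding test_fun_def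
  proof (intro conjI allI impI ballI)
    fix js :: "nat list" assume js: "set js \<subseteq> {1,2}"
    show "continuous_on UNIV (pds js (tens F H))"
      unfolding pds[OF js] by (intro tens_continuous cont)
    fix j x assume "j \<in> {1,2::nat}"
    then have "j = 1 \<or> j = 2" "set (j # js) \<subseteq> {1,2}" using js by auto
    then show "((\<lambda>t. pds js (tens F H) (x + t *\<^sub>R evec j)) has_vector_derivative pds (j # js) (tens F H) x) (at 0)"
      unfolding pds[OF js] pds[OF \<open>set (j # js) \<subseteq> {1,2}\<close>]
    proof (elim disjE)
      assume "j = 1"
      then show "((\<lambda>t. tens (FF (count_list js 1)) (HH (count_list js 2)) (x + t *\<^sub>R evec j)) has_vector_derivative
        tens (FF (count_list (j # js) 1)) (HH (count_list (j # js) 2)) x) (at 0)"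
        using tens_deriv1[OF FF(2)[of "count_list js 1"], of "HH (count_list js 2)" x] by simp
    next
      assume "j = 2"
      then show "((\<lambda>t. tens (FF (count_list js 1)) (HH (count_list js 2)) (x + t *\<^sub>R evec j)) has_vector_derivative
        tens (FF (count_list (j # js) 1)) (HH (count_list (j # js) 2)) x) (at 0)"
        using tens_deriv2[OF HH(2)[of "count_list js 2"], of "FF (count_list js 1)" x] by simp
    qed
  next
    have "{x. tens F H x \<noteq> 0} \<subseteq> {a..b} \<times> {c..d}"
    proof
      fix x assume "x \<in> {x. tens F H x \<noteq> 0}"
      then have "F (fst x) \<noteq> 0" "H (snd x) \<noteq> 0" by (auto simp: tens_def)
      then have "fst x \<in> {a..b}" "snd x \<in> {c..d}" using F0 H0 by blast+
      then show "x \<in> {a..b} \<times> {c..d}" by (simp add: mem_Times_iff)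
    qed
    moreover have "compact ({a..b} \<times> {c..d})" by (intro compact_Times) auto
    ultimately show "compact (closure {x. tens F H x \<noteq> 0})"
      by (meson bounded_subset compact_closure compact_imp_bounded)
  qed
qed

definition bump2 :: "nat \<Rightarrow> real \<Rightarrow> real \<Rightarrow> real \<Rightarrow> real \<Rightarrow> cfun" where
  "bump2 k a b c d = tens (bmp k a b) (bmp k c d)"

lemma test_bump2: "test_fun (bump2 k a b c d)"
  unfolding bump2_def
proof (rule test_tens[OF smooth_bmp smooth_bmp])
  have *: "bmp k a b x = 0" if "x \<notin> {a..b}" for a b x
    by (rule bmp_eq_0) (use that in auto)
  show "x \<notin> {a..b} \<Longrightarrow> bmp k a b x = 0" "x \<notin> {c..d} \<Longrightarrow> bmp k c d x = 0" for x
    by (rule *, assumption)+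
qed

lemma measurable_bump2[measurable]: "bump2 k a b c d \<in> borel_measurable borel"
  unfolding bump2_def
  by (intro borel_measurable_continuous_onI tens_continuous smooth_isCont smooth_bmp)

lemma box_Pair_eq: "box (a, c) (b, d :: real) = {a<..<b :: real} \<times> {c<..<d}"
proof -
  have "box (a, c) (b, d) = box a b \<times> box c d" by (auto simp: Basis_prod_def ball_Un box_def)
  then show ?thesis by simp
qed

lemma bump2_le: "cmod (bump2 k a b c d x) \<le> indicat_real (box (a,c) (b,d)) x"
proof (cases "x \<in> box (a,c) (b,d)")
  case True
  have "\<bar>bmp k a b (fst x) * bmp k c d (snd x)\<bar> \<le> 1"
    using bmp_range[of k a b "fst x"] bmp_range[of k c d "snd x"] by (simp add: abs_mult mult_le_one)
  then show ?thesis using True by (simp add: bump2_def tens_def del: of_real_mult)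
next
  case False
  then have "fst x \<notin> {a<..<b} \<or> snd x \<notin> {c<..<d}" by (simp add: box_Pair_eq mem_Times_iff)
  then have "bmp k a b (fst x) = 0 \<or> bmp k c d (snd x) = 0" using bmp_eq_0 by blast
  then show ?thesis by (auto simp: bump2_def tens_def)
qed

lemma bump2_tendsto: "(\<lambda>k. bump2 k a b c d x) \<longlonglongrightarrow> of_real (indicat_real (box (a,c) (b,d)) x)"
proof -
  have "(\<lambda>k. complex_of_real (bmp k a b (fst x) * bmp k c d (snd x))) \<longlonglongrightarrow> of_real (indicat_real {a<..<b} (fst x) * indicat_real {c<..<d} (snd x))"
    by (intro tendsto_intros bmp_tendsto)
  also have "indicat_real {a<..<b} (fst x) * indicat_real {c<..<d} (snd x) = indicat_real (box (a,c) (b,d)) x"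
    by (simp add: box_Pair_eq indicator_def mem_Times_iff)
  finally show ?thesis by (simp add: bump2_def tens_def)
qed

lemma One_prod: "(One :: real \<times> real) = (1, 1)"
  by (simp add: Basis_prod_def sum.union_disjoint image_iff zero_prod_def)

text \<open>Sharpening the bumps turns the last hypothesis into vanishing integrals over all boxes;
  differentiating these over shrinking cubes gives f = 0 almost everywhere.\<close>

lemma fundamental_lemma:
  fixes f :: cfun
  assumes f[measurable]: "f \<in> borel_measurable borel"
    and int: "\<And>k. integrable lborel (cut (qbox (real k)) f)"
    and zero: "\<And>k a b c d. (LINT x|lborel. f x * bump2 k a b c d x) = 0"
  shows "AE x in lborel. f x = 0"
proof -
  have si: "set_integrable lborel S f" if S: "bounded S" "S \<in> sets borel" for S
  proof -
    obtain B where B: "\<And>x. x \<in> S \<Longrightarrow> norm x \<le> B" using S(1) by (auto simp: bounded_iff)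
    obtain k where k: "B < real k" using reals_Archimedean2 by blast
    have sub: "S \<subseteq> qbox (real k)"
    proof
      fix x assume "x \<in> S"
      then have "norm x < real k" using B[of x] k by auto
      then have "\<bar>fst x\<bar> < real k \<and> \<bar>snd x\<bar> < real k"
        using norm_fst_le[of "fst x" "snd x"] norm_snd_le[of "snd x" "fst x"] by auto
      then show "x \<in> qbox (real k)" by (auto simp: qbox_def mem_Times_iff)
    qed
    have "set_integrable lborel (qbox (real k)) f"
      using int[of k] unfolding set_integrable_def cut_def
      by (rule back_subst[of "integrable lborel"]) (auto simp: indicator_def)
    then show ?thesis by (rule set_integrable_subset) (use sub S in auto)
  qed
  have box0: "integral (cbox (a,c) (b,d)) f = 0" for a b c d
  proof -
    let ?S = "box (a,c) (b,d)"

    have "(\<lambda>k. LINT x|lborel. f x * bump2 k a b c d x) \<longlonglongrightarrow> (LINT x|lborel. indicat_real ?S x *\<^sub>R f x)"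
    proof (rule integral_dominated_convergence[where w="\<lambda>x. norm (indicat_real ?S x *\<^sub>R f x)"])
      show "integrable lborel (\<lambda>x. norm (indicat_real ?S x *\<^sub>R f x))"
        using si[of ?S] unfolding set_integrable_def by (intro integrable_norm) auto
      show "AE x in lborel. (\<lambda>k. f x * bump2 k a b c d x) \<longlonglongrightarrow> indicat_real ?S x *\<^sub>R f x"
      proof (rule AE_I2)
        fix x :: "real \<times> real"
        have "(\<lambda>k. f x * bump2 k a b c d x) \<longlonglongrightarrow> f x * of_real (indicat_real ?S x)"
          by (intro tendsto_intros bump2_tendsto)
        then show "(\<lambda>k. f x * bump2 k a b c d x) \<longlonglongrightarrow> indicat_real ?S x *\<^sub>R f x"
          by (simp only: scaleR_conv_of_real mult.commute)
      qed
      show "AE x in lborel. norm (f x * bump2 k a b c d x) \<le> norm (indicat_real ?S x *\<^sub>R f x)" for k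
      proof (rule AE_I2)
        fix x :: "real \<times> real"
        show "norm (f x * bump2 k a b c d x) \<le> norm (indicat_real ?S x *\<^sub>R f x)"
          using mult_left_mono[OF bump2_le[of k a b c d x] norm_ge_zero[of "f x"]]
          by (simp only: norm_mult norm_scaleR abs_indicator mult.commute)
      qed
    qed measurable
    then have "(LINT x|lborel. indicat_real ?S x *\<^sub>R f x) = 0"
      unfolding zero LIMSEQ_const_iff by simp
    moreover have "set_integrable lborel ?S f" by (intro si bounded_box) auto
    ultimately have "integral ?S f = 0"
      using set_borel_integral_eq_integral(2)[of ?S f] by (simp add: set_lebesgue_integral_def)
    then show ?thesis by (simp add: integral_open_interval)
  qed
  have "f integrable_on cbox a b" for a b
    by (rule set_borel_integral_eq_integral(1)) (intro si bounded_cbox, auto)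
  \<comment> \<open>Lebesgue differentiation: off a negligible set the averages over cubes with
    corner \<open>x\<close> converge to \<open>f x\<close>.\<close>
  then obtain N where N: "negligible N" "\<And>x e. x \<notin> N \<Longrightarrow> 0 < e \<Longrightarrow>
      \<exists>d>0. \<forall>h. 0 < h \<and> h < d \<longrightarrow> norm (integral (cbox x (x + h *\<^sub>R One)) f /\<^sub>R h ^ DIM(real \<times> real) - f x) < e"
    using integrable_ccontinuous_explicit[of f] by metis
  have "f x = 0" if x: "x \<notin> N" for x
  proof (rule ccontr)
    assume "f x \<noteq> 0"
    then obtain d where d: "d > 0" "\<forall>h. 0 < h \<and> h < d \<longrightarrow> norm (integral (cbox x (x + h *\<^sub>R One)) f /\<^sub>R h ^ DIM(real \<times> real) - f x) < norm (f x)"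
      using N(2)[OF x, of "norm (f x)"] by auto
    \<comment> \<open>The average over this cube is 0, so its distance to \<open>f x\<close> is
      exactly the norm of \<open>f x\<close>, not less.\<close>
    have "norm (integral (cbox x (x + (d/2) *\<^sub>R One)) f /\<^sub>R (d/2) ^ DIM(real \<times> real) - f x) < norm (f x)"
      by (rule d(2)[rule_format]) (use d(1) in simp)
    moreover have "integral (cbox x (x + (d/2) *\<^sub>R One)) f = 0"
      unfolding One_prod by (cases x) (simp add: box0)
    ultimately show False by simp
  qed
  then have "AE x in lebesgue. f x = 0"
    using N(1) by (intro AE_I'[of N]) (auto simp: negligible_iff_null_sets)
  then show ?thesis by (simp add: AE_completion_iff)
qed

section \<open>Supports, bounds and integrals of test functions\<close>

lemma test_deriv:
  assumes "test_fun \<phi>" "j \<in> {1,2}"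
  shows "((\<lambda>t. \<phi> (x + t *\<^sub>R evec j)) has_vector_derivative pd j \<phi> (x + s *\<^sub>R evec j)) (at s)"
proof -
  have "((\<lambda>t. \<phi> ((x + s *\<^sub>R evec j) + t *\<^sub>R evec j)) has_vector_derivative pd j \<phi> (x + s *\<^sub>R evec j)) (at 0)"
    using assms(1)[unfolded test_fun_def, THEN conjunct1, rule_format, of "[]", THEN conjunct2, rule_format, OF _ assms(2)]
    by simp
  moreover have "((\<lambda>t. t - s) has_vector_derivative 1) (at s)"
    by (auto intro!: derivative_eq_intros)
  ultimately have "(((\<lambda>t. \<phi> ((x + s *\<^sub>R evec j) + t *\<^sub>R evec j)) \<circ> (\<lambda>t. t - s)) has_vector_derivative 1 *\<^sub>R pd j \<phi> (x + s *\<^sub>R evec j)) (at s)"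
    by (intro vector_diff_chain_at) auto
  then show ?thesis by (simp add: o_def algebra_simps)
qed

lemma test_continuous: assumes "test_fun \<phi>" shows "continuous_on UNIV \<phi>"
  using assms[unfolded test_fun_def, THEN conjunct1, rule_format, of "[]"] by simp

lemma test_pd_continuous:
  assumes "test_fun \<phi>" "j \<in> {1,2}" shows "continuous_on UNIV (pd j \<phi>)"
proof -
  have "set [j] \<subseteq> {1,2}" using assms(2) by auto
  then have "continuous_on UNIV (pds [j] \<phi>)" using assms(1) unfolding test_fun_def by blast
  then show ?thesis by simp
qed

lemma test_support:
  assumes "test_fun \<phi>"
  shows "\<exists>k. \<forall>x. x \<notin> qbox (real k) \<longrightarrow> \<phi> x = 0 \<and> pd 1 \<phi> x = 0 \<and> pd 2 \<phi> x = 0"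
proof -
  let ?S = "closure {x. \<phi> x \<noteq> 0}"
  have "bounded ?S" using assms by (simp add: test_fun_def compact_imp_bounded)
  then obtain B where B: "\<And>x. x \<in> ?S \<Longrightarrow> norm x \<le> B" by (auto simp: bounded_iff)
  obtain k where k: "B < real k" using reals_Archimedean2 by blast
  have sub: "x \<in> qbox (real k)" if "x \<in> ?S" for x
  proof -
    have "norm x < real k" using B[OF that] k by auto
    then have "\<bar>fst x\<bar> < real k \<and> \<bar>snd x\<bar> < real k"
      using norm_fst_le[of "fst x" "snd x"] norm_snd_le[of "snd x" "fst x"] by auto
    then show ?thesis by (auto simp: qbox_def mem_Times_iff)
  qed
  \<comment> \<open>Off the closed support the function vanishes on a segment through the point in
    each direction, so its directional derivatives vanish there too.\<close>
  have pd0: "pd j \<phi> x = 0" if x: "x \<notin> ?S" and j: "j \<in> {1,2}" for j x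
  proof -
    have "((\<lambda>t. 0) has_vector_derivative 0) (at (0::real))" by simp
    then have "((\<lambda>t. \<phi> (x + t *\<^sub>R evec j)) has_vector_derivative 0) (at 0)"
    proof (rule has_vector_derivative_transform_within_open)
      show "open ((\<lambda>t. x + t *\<^sub>R evec j) -` (- ?S))"
        by (intro open_vimage open_Compl closed_closure) (auto intro!: continuous_intros)
      show "0 \<in> (\<lambda>t. x + t *\<^sub>R evec j) -` (- ?S)" using x by simp
      fix t assume "t \<in> (\<lambda>t. x + t *\<^sub>R evec j) -` (- ?S)"
      then show "0 = \<phi> (x + t *\<^sub>R evec j)" using closure_subset[of "{x. \<phi> x \<noteq> 0}"] by auto
    qed
    with test_deriv[OF assms j, of x 0] show "pd j \<phi> x = 0"
      using vector_derivative_unique_at by fastforce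
  qed
  have "\<phi> x = 0" if "x \<notin> ?S" for x using that closure_subset[of "{x. \<phi> x \<noteq> 0}"] by blast
  then show ?thesis using sub pd0 by (intro exI[of _ k]) blast
qed

lemma test_measurable: "test_fun \<phi> \<Longrightarrow> \<phi> \<in> borel_measurable borel"
  "test_fun \<phi> \<Longrightarrow> j \<in> {1,2} \<Longrightarrow> pd j \<phi> \<in> borel_measurable borel"
  by (rule borel_measurable_continuous_onI, erule test_continuous,
      rule borel_measurable_continuous_onI, erule (1) test_pd_continuous)

lemma emeasure_qbox: "emeasure lborel (qbox R) < \<infinity>"
proof -
  have "qbox R \<subseteq> cbox (-R,-R) (R,R)" by (auto simp: qbox_def cbox_Pair_eq)
  then show ?thesis by (intro emeasure_bounded_finite) (rule bounded_subset[OF bounded_cbox])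
qed

lemma bounded_cutoff_l2:
  assumes [measurable]: "f \<in> borel_measurable borel" and "\<And>x. cmod (f x) \<le> C" "\<And>x. x \<notin> qbox R \<Longrightarrow> f x = 0"
  shows "l2 f" "integrable lborel f"
proof -
  have i: "integrable lborel (\<lambda>x. C * indicat_real (qbox R) x)" "integrable lborel (\<lambda>x. C^2 * indicat_real (qbox R) x)"
    using emeasure_qbox[of R] by (auto simp: less_top[symmetric])
  have "(norm (f x))\<^sup>2 \<le> C^2 * indicat_real (qbox R) x" for x
    using power_mono[OF assms(2)[of x], of 2] assms(3)[of x] by (cases "x \<in> qbox R") auto
  then show "l2 f" by (rule l2I_bound[OF assms(1) i(2)])
  have "C \<ge> 0" using order_trans[OF norm_ge_zero assms(2)] .
  then have "norm (f x) \<le> norm (C * indicat_real (qbox R) x)" for x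
    using assms(2)[of x] assms(3)[of x] by (cases "x \<in> qbox R") auto
  then show "integrable lborel f"
    by (intro Bochner_Integration.integrable_bound[OF i(1)] AE_I2) auto
qed

lemma continuous_cutoff_bounded:
  fixes f :: cfun
  assumes "continuous_on UNIV f" "\<And>x. x \<notin> qbox R \<Longrightarrow> f x = 0"
  shows "\<exists>C\<ge>0. \<forall>x. cmod (f x) \<le> C"
proof -
  have "compact (f ` cbox (-R,-R) (R,R))"
    by (intro compact_continuous_image compact_cbox) (rule continuous_on_subset[OF assms(1)], simp)
  then have "bounded (f ` cbox (-R,-R) (R,R))" by (rule compact_imp_bounded)
  then obtain C where C: "\<And>x. x \<in> cbox (-R,-R) (R,R) \<Longrightarrow> cmod (f x) \<le> C"
    unfolding bounded_iff by (metis imageI)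
  have sub: "qbox R \<subseteq> cbox (-R,-R) (R,R)" by (auto simp: qbox_def cbox_Pair_eq)
  have "cmod (f x) \<le> max C 0" for x
    using C[of x] sub assms(2)[of x] by (cases "x \<in> qbox R") auto
  then show ?thesis by (intro exI[of _ "max C 0"]) simp
qed

lemma test_bounded:
  assumes "test_fun \<phi>"
  shows "\<exists>C\<ge>0. \<forall>x. cmod (\<phi> x) \<le> C \<and> cmod (pd 1 \<phi> x) \<le> C \<and> cmod (pd 2 \<phi> x) \<le> C"
proof -
  obtain k where k: "\<forall>x. x \<notin> qbox (real k) \<longrightarrow> \<phi> x = 0 \<and> pd 1 \<phi> x = 0 \<and> pd 2 \<phi> x = 0"
    using test_support[OF assms] ..
  obtain C0 where C0: "C0 \<ge> 0" "\<forall>x. cmod (\<phi> x) \<le> C0"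
    using continuous_cutoff_bounded[OF test_continuous[OF assms], of "real k"] k by auto
  obtain C1 where C1: "C1 \<ge> 0" "\<forall>x. cmod (pd 1 \<phi> x) \<le> C1"
    using continuous_cutoff_bounded[OF test_pd_continuous[OF assms, of 1], of "real k"] k by auto
  obtain C2 where C2: "C2 \<ge> 0" "\<forall>x. cmod (pd 2 \<phi> x) \<le> C2"
    using continuous_cutoff_bounded[OF test_pd_continuous[OF assms, of 2], of "real k"] k by auto
  have "cmod (\<phi> x) \<le> C0 + C1 + C2 \<and> cmod (pd 1 \<phi> x) \<le> C0 + C1 + C2 \<and> cmod (pd 2 \<phi> x) \<le> C0 + C1 + C2" for x
    using C0(1) C1(1) C2(1) C0(2)[rule_format, of x] C1(2)[rule_format, of x] C2(2)[rule_format, of x] by linarith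
  then show ?thesis using C0(1) C1(1) C2(1) by (intro exI[of _ "C0 + C1 + C2"]) simp
qed

lemma test_l2:
  assumes "test_fun \<phi>" shows "l2 \<phi>" "j \<in> {1,2} \<Longrightarrow> l2 (pd j \<phi>)"
proof -
  obtain C where C: "\<forall>x. cmod (\<phi> x) \<le> C \<and> cmod (pd 1 \<phi> x) \<le> C \<and> cmod (pd 2 \<phi> x) \<le> C"
    using test_bounded[OF assms] by blast
  obtain k where k: "\<forall>x. x \<notin> qbox (real k) \<longrightarrow> \<phi> x = 0 \<and> pd 1 \<phi> x = 0 \<and> pd 2 \<phi> x = 0"
    using test_support[OF assms] ..
  show "l2 \<phi>" by (rule bounded_cutoff_l2(1)[OF test_measurable(1)[OF assms], of C "real k"])
    (use C k in simp_all)
  assume j: "j \<in> {1,2}"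
  then have "j = 1 \<or> j = 2" by simp
  then have "\<forall>x. cmod (pd j \<phi> x) \<le> C" "\<forall>x. x \<notin> qbox (real k) \<longrightarrow> pd j \<phi> x = 0" using C k by blast+
  then show "l2 (pd j \<phi>)"
    by (intro bounded_cutoff_l2(1)[OF test_measurable(2)[OF assms j], of C "real k"]) simp_all
qed

text \<open>Difference quotients integrate to 0 by translation invariance and converge boundedly to
  \<open>f'\<close>. This is the source of integration by parts for test functions.\<close>

lemma integral_directional_deriv_0:
  fixes f f' :: cfun and e :: "real \<times> real"
  assumes deriv: "\<And>x s. ((\<lambda>t. f (x + t *\<^sub>R e)) has_vector_derivative f' (x + s *\<^sub>R e)) (at s)"
    and cont: "continuous_on UNIV f" "continuous_on UNIV f'"
    and supp: "\<And>x. x \<notin> qbox R \<Longrightarrow> f x = 0" "\<And>x. x \<notin> qbox R \<Longrightarrow> f' x = 0"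
    and e: "\<bar>fst e\<bar> \<le> 1" "\<bar>snd e\<bar> \<le> 1"
  shows "(LINT x|lborel. f' x) = 0"
proof -
  note [measurable] = borel_measurable_continuous_onI[OF cont(1)] borel_measurable_continuous_onI[OF cont(2)]
  obtain C where C: "C \<ge> 0" "\<And>x. cmod (f' x) \<le> C" using continuous_cutoff_bounded[OF cont(2) supp(2)] by blast
  obtain C' where C': "C' \<ge> 0" "\<And>x. cmod (f x) \<le> C'" using continuous_cutoff_bounded[OF cont(1) supp(1)] by blast
  have fint: "integrable lborel f" by (rule bounded_cutoff_l2(2)[OF _ C'(2) supp(1)]) measurable
  define h :: "nat \<Rightarrow> real" where "h n = 1 / real (Suc n)" for n
  have h: "0 < h n" "h n \<le> 1" for n by (auto simp: h_def)
  have h0: "h \<longlonglongrightarrow> 0" unfolding h_def[abs_def] by (rule LIMSEQ_Suc[OF lim_1_over_n])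
  define q where "q n x = (f (x + h n *\<^sub>R e) - f x) /\<^sub>R h n" for n x
  have zero: "(LINT x|lborel. q n x) = 0" for n
    unfolding q_def using integrable_shift[OF fint] fint by (simp add: integral_shift)
  have "(\<lambda>n. LINT x|lborel. q n x) \<longlonglongrightarrow> (LINT x|lborel. f' x)"
  \<comment> \<open>The dominating box is enlarged by 1: steps are at most 1 and the entries of
    \<open>e\<close> are bounded by 1, so the shifted support stays inside. The mean value
    inequality supplies the constant \<open>C\<close>.\<close>
  proof (rule integral_dominated_convergence[where w="\<lambda>x. C * indicat_real (qbox (R+1)) x"])
    show "AE x in lborel. (\<lambda>n. q n x) \<longlonglongrightarrow> f' x"
    proof (rule AE_I2)
      fix x
      have "((\<lambda>t. (f (x + t *\<^sub>R e) - f x) /\<^sub>R t) \<longlongrightarrow> f' x) (at 0)"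
      proof (rule LIM_zero_cancel, rule tendsto_norm_zero_cancel)
        have "((\<lambda>h. norm (f (x + h *\<^sub>R e) - f x - h *\<^sub>R f' x) / norm h) \<longlongrightarrow> 0) (at 0)"
          using deriv[of x 0] unfolding has_vector_derivative_def has_derivative_at by simp
        then show "((\<lambda>t. norm ((f (x + t *\<^sub>R e) - f x) /\<^sub>R t - f' x)) \<longlongrightarrow> 0) (at 0)"
        proof (rule Lim_transform_eventually)
          have "norm (f (x + h *\<^sub>R e) - f x - h *\<^sub>R f' x) / norm h = norm ((f (x + h *\<^sub>R e) - f x) /\<^sub>R h - f' x)" if "h \<noteq> 0" for h
          proof -
            have "(f (x + h *\<^sub>R e) - f x) /\<^sub>R h - f' x = (f (x + h *\<^sub>R e) - f x - h *\<^sub>R f' x) /\<^sub>R h"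
              using that by (simp add: scaleR_diff_right)
            then show ?thesis by (simp add: divide_inverse mult.commute)
          qed
          then show "\<forall>\<^sub>F h in at 0. norm (f (x + h *\<^sub>R e) - f x - h *\<^sub>R f' x) / norm h = norm ((f (x + h *\<^sub>R e) - f x) /\<^sub>R h - f' x)"
            by (auto simp: eventually_at_filter)
        qed
      qed
      then show "(\<lambda>n. q n x) \<longlonglongrightarrow> f' x" unfolding q_def
      proof (rule filterlim_compose)
        have "h n \<noteq> 0" for n using h(1)[of n] by simp
        then show "filterlim h (at 0) sequentially" using h0 by (simp add: filterlim_at)
      qed
    qed
    show "integrable lborel (\<lambda>x. C * indicat_real (qbox (R+1)) x)"
      using emeasure_qbox[of "R+1"] by (auto simp: less_top[symmetric])
    show "AE x in lborel. norm (q n x) \<le> C * indicat_real (qbox (R+1)) x" for n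
    proof (rule AE_I2)
      fix x
      show "norm (q n x) \<le> C * indicat_real (qbox (R+1)) x"
      proof (cases "x \<in> qbox (R+1)")
        case True
        have "norm (f (x + h n *\<^sub>R e) - f (x + 0 *\<^sub>R e)) \<le> C * norm (h n - 0)"
        proof (rule differentiable_bound[of UNIV])
          show "((\<lambda>t. f (x + t *\<^sub>R e)) has_derivative (\<lambda>h. h *\<^sub>R f' (x + s *\<^sub>R e))) (at s within UNIV)" for s
            using deriv[of x s] by (simp add: has_vector_derivative_def)
          show "onorm (\<lambda>h. h *\<^sub>R f' (x + s *\<^sub>R e)) \<le> C" for s
          proof (rule onorm_le)
            fix h :: real
            show "norm (h *\<^sub>R f' (x + s *\<^sub>R e)) \<le> C * norm h"
              using mult_left_mono[OF C(2)[of "x + s *\<^sub>R e"] abs_ge_zero[of h]] by (simp add: mult.commute)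
          qed
        qed auto
        then have "norm (f (x + h n *\<^sub>R e) - f x) / h n \<le> C" using h(1)[of n] by (simp add: field_simps)
        then show ?thesis using True h(1)[of n] by (simp add: q_def divide_inverse mult.commute)
      next
        case False
        have "x \<notin> qbox R" using False qbox_mono[of R "R+1"] by auto
        moreover have "x + h n *\<^sub>R e \<notin> qbox R"
        proof
          assume *: "x + h n *\<^sub>R e \<in> qbox R"
          have "\<bar>h n * fst e\<bar> \<le> 1" "\<bar>h n * snd e\<bar> \<le> 1" using e h[of n] by (auto simp: abs_mult mult_le_one)
          with * have "x \<in> qbox (R+1)" unfolding qbox_def mem_Times_iff by auto
          with False show False by simp
        qed
        ultimately show ?thesis using False by (simp add: q_def supp)
      qed
    qed
  qed (auto simp: q_def)
  then show ?thesis unfolding zero LIMSEQ_const_iff by simp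
qed

subsection \<open>Weak derivatives\<close>

lemma nn_integral_prod1:
  fixes f :: "real \<times> real \<Rightarrow> ennreal"
  assumes [measurable]: "f \<in> borel_measurable borel"
  shows "(\<integral>\<^sup>+x. f x \<partial>lborel) = (\<integral>\<^sup>+a. \<integral>\<^sup>+b. f (a, b) \<partial>lborel \<partial>lborel)"
proof -
  have "f \<in> borel_measurable (lborel \<Otimes>\<^sub>M lborel)" by (simp add: lborel_prod)
  from lborel.nn_integral_fst[OF this] show ?thesis by (simp add: lborel_prod)
qed

lemma nn_integral_prod2:
  fixes f :: "real \<times> real \<Rightarrow> ennreal"
  assumes [measurable]: "f \<in> borel_measurable borel"
  shows "(\<integral>\<^sup>+x. f x \<partial>lborel) = (\<integral>\<^sup>+b. \<integral>\<^sup>+a. f (a, b) \<partial>lborel \<partial>lborel)"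
proof -
  have "f \<in> borel_measurable (lborel \<Otimes>\<^sub>M lborel)" by (simp add: lborel_prod)
  from lborel_pair.nn_integral_snd[OF this] show ?thesis by (simp add: lborel_prod)
qed

definition wderiv :: "nat \<Rightarrow> cfun \<Rightarrow> cfun \<Rightarrow> bool" where
  "wderiv j u g \<longleftrightarrow> (\<forall>\<phi>. test_fun \<phi> \<longrightarrow> (LINT x|lborel. u x * pd j \<phi> x) = - (LINT x|lborel. g x * \<phi> x))"

text \<open>\<open>g\<close> is a chosen weak gradient \<open>(g 1, g 2)\<close> of the Borel function \<open>u\<close>; completed measures and the
  a.e. class of \<open>wd\<close> enter only when the energy of such a representative is identified with \<open>energy\<close>.\<close>

definition sob :: "cfun \<Rightarrow> (nat \<Rightarrow> cfun) \<Rightarrow> bool" where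
  "sob u g \<longleftrightarrow> l2 u \<and> (\<forall>j\<in>{1,2}. l2 (g j) \<and> wderiv j u (g j))"

lemma evec_abs: "\<bar>fst (evec j)\<bar> \<le> 1" "\<bar>snd (evec j)\<bar> \<le> 1"
  by (auto simp: evec_def)

text \<open>The derivative of the compactly supported product of the two test functions integrates
  to 0, and the product rule splits it into the two sides.\<close>

lemma test_wderiv:
  assumes phi: "test_fun \<phi>" and j: "j \<in> {1,2}" shows "wderiv j \<phi> (pd j \<phi>)"
  unfolding wderiv_def
proof (intro allI impI)
  fix \<psi> assume psi: "test_fun \<psi>"
  define f' where "f' x = \<phi> x * pd j \<psi> x + pd j \<phi> x * \<psi> x" for x
  obtain k where k: "\<forall>x. x \<notin> qbox (real k) \<longrightarrow> \<phi> x = 0 \<and> pd 1 \<phi> x = 0 \<and> pd 2 \<phi> x = 0"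
    using test_support[OF phi] ..
  have j': "j = 1 \<or> j = 2" using j by simp
  have "(LINT x|lborel. f' x) = 0"
  proof (rule integral_directional_deriv_0[where f="\<lambda>x. \<phi> x * \<psi> x" and e="evec j" and R="real k"])
    show "((\<lambda>t. \<phi> (x + t *\<^sub>R evec j) * \<psi> (x + t *\<^sub>R evec j)) has_vector_derivative f' (x + s *\<^sub>R evec j)) (at s)" for x s
      unfolding f'_def by (intro has_vector_derivative_mult test_deriv assms psi)
    show "continuous_on UNIV (\<lambda>x. \<phi> x * \<psi> x)" "continuous_on UNIV f'"
      unfolding f'_def[abs_def]
      by (intro continuous_on_add continuous_on_mult test_continuous test_pd_continuous assms psi)+
    show "\<phi> x * \<psi> x = 0" if "x \<notin> qbox (real k)" for x using k that by simp
    have "pd j \<phi> x = 0" if "x \<notin> qbox (real k)" for x using k that j' by auto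
    then show "f' x = 0" if "x \<notin> qbox (real k)" for x using k that by (simp add: f'_def)
  qed (rule evec_abs)+
  moreover have "(LINT x|lborel. f' x) = (LINT x|lborel. \<phi> x * pd j \<psi> x) + (LINT x|lborel. pd j \<phi> x * \<psi> x)"
    unfolding f'_def by (intro Bochner_Integration.integral_add l2_times_integrable test_l2 assms psi)
  ultimately show "(LINT x|lborel. \<phi> x * pd j \<psi> x) = - (LINT x|lborel. pd j \<phi> x * \<psi> x)"
    by (simp add: eq_neg_iff_add_eq_0)
qed

lemma l2_cut_integrable: assumes [measurable]: "l2 f" shows "integrable lborel (cut (qbox R) f)"
proof -
  have l: "l2 (cut (qbox R) (\<lambda>x. 1))"
    by (rule bounded_cutoff_l2(1)[of _ 1 R]) (auto simp: cut_def)
  have "integrable lborel (\<lambda>x. f x * cut (qbox R) (\<lambda>x. 1) x)" by (rule l2_times_integrable[OF assms l])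
  then show ?thesis by (rule back_subst[of "integrable lborel"]) (auto simp: cut_def)
qed

lemma wderiv_unique:
  assumes g: "l2 g" "l2 g'" and w: "wderiv j u g" "wderiv j u g'"
  shows "AE x in lborel. g x = g' x"
proof -
  note [measurable] = g
  have "AE x in lborel. g x - g' x = 0"
  proof (rule fundamental_lemma)
    show "integrable lborel (cut (qbox (real k)) (\<lambda>x. g x - g' x))" for k
      by (intro l2_cut_integrable l2_diff g)
    fix k a b c d
    have "(LINT x|lborel. (g x - g' x) * bump2 k a b c d x) = (LINT x|lborel. g x * bump2 k a b c d x) - (LINT x|lborel. g' x * bump2 k a b c d x)"
      unfolding left_diff_distrib
      by (intro Bochner_Integration.integral_diff l2_times_integrable g test_l2 test_bump2)
    also have "\<dots> = 0" using w test_bump2 unfolding wderiv_def by (metis add.inverse_inverse cancel_comm_monoid_add_class.diff_cancel)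
    finally show "(LINT x|lborel. (g x - g' x) * bump2 k a b c d x) = 0" .
  qed measurable
  then show ?thesis by eventually_elim simp
qed

lemma wderiv_add:
  assumes "l2 u" "l2 v" "l2 g" "l2 h" "j \<in> {1,2}" "wderiv j u g" "wderiv j v h"
  shows "wderiv j (\<lambda>x. u x + v x) (\<lambda>x. g x + h x)"
  unfolding wderiv_def
proof (intro allI impI)
  fix \<phi> assume phi: "test_fun \<phi>"
  have "(LINT x|lborel. (u x + v x) * pd j \<phi> x) = (LINT x|lborel. u x * pd j \<phi> x) + (LINT x|lborel. v x * pd j \<phi> x)"
    unfolding distrib_right by (intro Bochner_Integration.integral_add l2_times_integrable assms test_l2 phi)
  moreover have "(LINT x|lborel. (g x + h x) * \<phi> x) = (LINT x|lborel. g x * \<phi> x) + (LINT x|lborel. h x * \<phi> x)"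
    unfolding distrib_right by (intro Bochner_Integration.integral_add l2_times_integrable assms test_l2 phi)
  ultimately show "(LINT x|lborel. (u x + v x) * pd j \<phi> x) = - (LINT x|lborel. (g x + h x) * \<phi> x)"
    using assms(6,7) phi unfolding wderiv_def by simp
qed

lemma wderiv_cmult:
  assumes "wderiv j u g" shows "wderiv j (\<lambda>x. c * u x) (\<lambda>x. c * g x)"
  using assms unfolding wderiv_def by (simp add: mult.assoc)

lemma pd_shift: "pd j (\<lambda>x. \<phi> (x + a)) = (\<lambda>x. pd j \<phi> (x + a))"
  unfolding pd_def by (simp add: fun_eq_iff algebra_simps)

lemma pds_shift: "pds js (\<lambda>x. \<phi> (x + a)) = (\<lambda>x. pds js \<phi> (x + a))"
  by (induct js) (simp_all add: pd_shift)

lemma test_shift: assumes "test_fun \<phi>" shows "test_fun (\<lambda>x. \<phi> (x + a))"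
  unfolding test_fun_def pds_shift
proof (intro conjI allI impI ballI)
  fix js :: "nat list" assume js: "set js \<subseteq> {1,2}"
  have c: "continuous_on UNIV (pds js \<phi>)" using assms js unfolding test_fun_def by blast
  show "continuous_on UNIV (\<lambda>x. pds js \<phi> (x + a))"
    by (rule continuous_on_compose2[OF c]) (auto intro: continuous_intros)
  fix j x assume j: "j \<in> {1,2::nat}"
  have "((\<lambda>t. pds js \<phi> ((x + a) + t *\<^sub>R evec j)) has_vector_derivative pds (j # js) \<phi> (x + a)) (at 0)"
    using assms js j unfolding test_fun_def by blast
  then show "((\<lambda>t. pds js \<phi> (x + t *\<^sub>R evec j + a)) has_vector_derivative pds (j # js) \<phi> (x + a)) (at 0)"
    by (simp add: algebra_simps)
next
  have "bounded (closure {x. \<phi> x \<noteq> 0})" using assms by (simp add: test_fun_def compact_imp_bounded)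
  then have "bounded {x. \<phi> x \<noteq> 0}" by (rule bounded_subset) (rule closure_subset)
  then have "bounded ((\<lambda>x. - a + x) ` {x. \<phi> x \<noteq> 0})" by (rule bounded_translation)
  moreover have "{x. \<phi> (x + a) \<noteq> 0} \<subseteq> (\<lambda>x. - a + x) ` {x. \<phi> x \<noteq> 0}"
  proof
    fix x assume "x \<in> {x. \<phi> (x + a) \<noteq> 0}"
    then have "x + a \<in> {x. \<phi> x \<noteq> 0}" by simp
    then show "x \<in> (\<lambda>x. - a + x) ` {x. \<phi> x \<noteq> 0}" by (intro image_eqI[of _ _ "x + a"]) auto
  qed
  ultimately have "bounded {x. \<phi> (x + a) \<noteq> 0}" by (rule bounded_subset)
  then show "compact (closure {x. \<phi> (x + a) \<noteq> 0})" by simp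
qed

lemma wderiv_shift:
  assumes [measurable]: "u \<in> borel_measurable borel" "g \<in> borel_measurable borel" and j: "j \<in> {1,2}" and w: "wderiv j u g"
  shows "wderiv j (\<lambda>x. u (x + a)) (\<lambda>x. g (x + a))"
  unfolding wderiv_def
proof (intro allI impI)
  fix \<phi> assume phi: "test_fun \<phi>"
  note m = test_measurable[OF phi]
  have [measurable]: "\<phi> \<in> borel_measurable borel" "pd j \<phi> \<in> borel_measurable borel" by (rule m, rule m(2)[OF j])
  define \<psi> where "\<psi> = (\<lambda>x. \<phi> (x + (- a)))"
  have psi: "test_fun \<psi>" unfolding \<psi>_def by (rule test_shift[OF phi])
  have pdpsi: "pd j \<psi> = (\<lambda>x. pd j \<phi> (x + (- a)))" unfolding \<psi>_def by (rule pd_shift)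
  have "(LINT x|lborel. u x * pd j \<psi> x) = - (LINT x|lborel. g x * \<psi> x)"
    using w psi unfolding wderiv_def by blast
  moreover have "(LINT x|lborel. u (x + a) * pd j \<phi> x) = (LINT x|lborel. u x * pd j \<psi> x)"
    unfolding pdpsi by (subst integral_shift[of "\<lambda>x. u x * pd j \<phi> (x + - a)" a, symmetric]) simp_all
  moreover have "(LINT x|lborel. g (x + a) * \<phi> x) = (LINT x|lborel. g x * \<psi> x)"
    unfolding \<psi>_def by (subst integral_shift[of "\<lambda>x. g x * \<phi> (x + - a)" a, symmetric]) simp_all
  ultimately show "(LINT x|lborel. u (x + a) * pd j \<phi> x) = - (LINT x|lborel. g (x + a) * \<phi> x)" by simp
qed

lemma l2_shift: assumes "l2 f" shows "l2 (\<lambda>x. f (x + a))"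
proof -
  have [measurable]: "f \<in> borel_measurable borel" by (rule l2_measurable[OF assms])
  show ?thesis using integrable_shift[OF l2_integrable[OF assms], of a] unfolding l2_def by simp
qed

lemma nsq_shift: assumes "l2 f" shows "nsq (\<lambda>x. f (x + a)) = nsq f"
proof -
  have [measurable]: "f \<in> borel_measurable borel" by (rule l2_measurable[OF assms])
  show ?thesis unfolding nsq_def by (rule integral_shift[of "\<lambda>x. (cmod (f x))\<^sup>2"]) measurable
qed

lemma sob_l2: assumes "sob u g" shows "l2 u" "l2 (g 1)" "l2 (g 2)" "j \<in> {1,2} \<Longrightarrow> l2 (g j)"
  using assms by (auto simp: sob_def)

lemma sob_wderiv: "sob u g \<Longrightarrow> j \<in> {1,2} \<Longrightarrow> wderiv j u (g j)"
  unfolding sob_def by blast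

lemma sob_add: "sob u g \<Longrightarrow> sob v h \<Longrightarrow> sob (\<lambda>x. u x + v x) (\<lambda>j x. g j x + h j x)"
  unfolding sob_def by (auto intro!: l2_add wderiv_add)

lemma sob_cmult: "sob u g \<Longrightarrow> sob (\<lambda>x. c * u x) (\<lambda>j x. c * g j x)"
  unfolding sob_def by (auto intro!: l2_cmult wderiv_cmult)

lemma sob_diff: assumes "sob u g" "sob v h" shows "sob (\<lambda>x. u x - v x) (\<lambda>j x. g j x - h j x)"
  using sob_add[OF assms(1) sob_cmult[OF assms(2), of "-1"]] by simp

lemma sob_shift: assumes "sob u g" shows "sob (\<lambda>x. u (x + a)) (\<lambda>j x. g j (x + a))"
  unfolding sob_def
  by (intro conjI ballI l2_shift wderiv_shift sob_l2[OF assms] l2_measurable[OF sob_l2(1)[OF assms]]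
      l2_measurable[OF sob_l2(4)[OF assms]] sob_wderiv[OF assms])

lemma test_sob: "test_fun \<phi> \<Longrightarrow> sob \<phi> (\<lambda>j. pd j \<phi>)"
  by (simp add: sob_def test_l2 test_wderiv)

section \<open>Differences of Sobolev functions along coordinate lines\<close>

lemma bmp_antideriv:
  assumes h: "h > 0"
  shows "\<exists>P. smooth P \<and> (\<forall>x. (P has_real_derivative bmp k a b x - bmp k a b (x - h)) (at x)) \<and>
    (\<forall>x. ((\<lambda>s. bmp k a b (x - s)) has_integral P x) {0..h}) \<and> (\<forall>x. x \<notin> {a..b+h} \<longrightarrow> P x = 0)"
proof -
  let ?F = "bmp k a b"
  have "\<exists>Q. \<forall>x::real. -\<infinity> < x \<longrightarrow> x < \<infinity> \<longrightarrow> (Q has_vector_derivative ?F x) (at x)"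
    by (rule einterval_antiderivative) (auto intro: smooth_isCont[OF smooth_bmp])
  then obtain Q where Q': "\<forall>x::real. -\<infinity> < x \<longrightarrow> x < \<infinity> \<longrightarrow> (Q has_vector_derivative ?F x) (at x)" ..
  have Q: "(Q has_real_derivative ?F x) (at x)" for x
    using Q' unfolding has_real_derivative_iff_has_vector_derivative by simp
  define P where "P x = Q x - Q (x - h)" for x
  have dP: "(P has_real_derivative ?F x - ?F (x - h)) (at x)" for x
  proof -
    have "((\<lambda>x. x - h) has_real_derivative 1) (at x)" by (auto intro!: derivative_eq_intros)
    from DERIV_diff[OF Q[of x] DERIV_chain2[OF Q this]] show ?thesis unfolding P_def[abs_def] by simp
  qed
  have "smooth (\<lambda>x. ?F x - ?F (1 * x + (- h)))" by (rule smooth_diff[OF smooth_bmp smooth_affine[OF smooth_bmp]])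
  then have "smooth (\<lambda>x. ?F x - ?F (x - h))" by simp
  then have sP: "smooth P" by (rule smooth_antideriv[OF _ dP])
  have int: "((\<lambda>s. ?F (x - s)) has_integral P x) {0..h}" for x
  proof -
    have "((\<lambda>s. - Q (x - s)) has_vector_derivative ?F (x - s)) (at s within {0..h})" for s
    proof -
      have "((\<lambda>s. x - s) has_real_derivative -1) (at s)" by (auto intro!: derivative_eq_intros)
      from DERIV_minus[OF DERIV_chain2[OF Q this]]
      have "((\<lambda>s. - Q (x - s)) has_real_derivative ?F (x - s)) (at s)" by simp
      then show ?thesis
        unfolding has_real_derivative_iff_has_vector_derivative by (rule has_vector_derivative_at_within)
    qed
    then have "((\<lambda>s. ?F (x - s)) has_integral (- Q (x - h) - - Q (x - 0))) {0..h}"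
      by (intro fundamental_theorem_of_calculus) (use h in auto)
    then show ?thesis by (simp add: P_def)
  qed
  have "P x = 0" if x: "x \<notin> {a..b+h}" for x
  proof -
    have "?F (x - s) = 0" if "s \<in> {0..h}" for s by (rule bmp_eq_0) (use x that in auto)
    then have "((\<lambda>s. ?F (x - s)) has_integral 0) {0..h}" by (intro has_integral_is_0)
    with int show ?thesis using has_integral_unique by blast
  qed
  then show ?thesis using sP dP int by (intro exI[of _ P]) simp
qed

lemma LINT_has_integral_Icc:
  fixes f :: "real \<Rightarrow> real"
  assumes "continuous_on {0..h} f" "(f has_integral I) {0..h}"
  shows "(LINT s|lborel. indicat_real {0..h} s * f s) = I"
proof -
  have "set_integrable lborel {0..h} f" by (rule borel_integrable_atLeastAtMost') (rule assms(1))
  from set_borel_integral_eq_integral(2)[OF this] integral_unique[OF assms(2)]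
  show ?thesis by (simp add: set_lebesgue_integral_def)
qed

text \<open>An antiderivative of a bump need not have compact support, but that of a bump minus its
  translate does: it is the integral of the bump over the shifts in [0,h]. Used as a test function
  in the definition of the weak derivative, it produces a difference of \<open>u\<close>.\<close>

lemma bump_antideriv:
  assumes h: "h > 0" and j: "j \<in> {1,2}"
  shows "\<exists>\<Phi>. test_fun \<Phi> \<and> pd j \<Phi> = (\<lambda>x. bump2 k a b c d x - bump2 k a b c d (x - h *\<^sub>R evec j)) \<and>
     (\<forall>x. \<Phi> x = (LINT s|lborel. of_real (indicat_real {0..h} s) * bump2 k a b c d (x - s *\<^sub>R evec j)))"
proof -
  have cont: "continuous_on {0..h} (\<lambda>s. bmp k a b (x - s))" for k a b x
    by (rule continuous_on_compose2[OF continuous_bmp]) (auto intro: continuous_intros)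
  have LI: "(LINT s|lborel. indicat_real {0..h} s * bmp k a b (x - s)) = I"
    if "((\<lambda>s. bmp k a b (x - s)) has_integral I) {0..h}" for k a b x I
    by (rule LINT_has_integral_Icc[OF cont that])
  have "j = 1 \<or> j = 2" using j by simp
  then show ?thesis
  proof
    assume j: "j = 1"
    obtain P where P: "smooth P" "\<And>x. (P has_real_derivative bmp k a b x - bmp k a b (x - h)) (at x)"
      "\<And>x. ((\<lambda>s. bmp k a b (x - s)) has_integral P x) {0..h}" "\<And>x. x \<notin> {a..b+h} \<Longrightarrow> P x = 0"
      using bmp_antideriv[OF h, of k a b] by auto
    have "bmp k c d x = 0" if "x \<notin> {c..d}" for x by (rule bmp_eq_0) (use that in auto)
    then have "test_fun (tens P (bmp k c d))" by (intro test_tens[OF P(1) smooth_bmp P(4)])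
    moreover have "pd j (tens P (bmp k c d)) = (\<lambda>x. bump2 k a b c d x - bump2 k a b c d (x - h *\<^sub>R evec j))"
      unfolding j by (subst pd_tens(1)[OF P(2)]) (auto simp: tens_def bump2_def evec_def algebra_simps)
    moreover have "tens P (bmp k c d) x = (LINT s|lborel. of_real (indicat_real {0..h} s) * bump2 k a b c d (x - s *\<^sub>R evec j))" for x
    proof -
      have "(LINT s|lborel. of_real (indicat_real {0..h} s) * bump2 k a b c d (x - s *\<^sub>R evec j))
        = (LINT s|lborel. complex_of_real ((indicat_real {0..h} s * bmp k a b (fst x - s)) * bmp k c d (snd x)))"
        by (simp add: bump2_def tens_def j evec_def mult.assoc)
      also have "\<dots> = tens P (bmp k c d) x"
        unfolding integral_complex_of_real integral_mult_left_zero LI[OF P(3)] by (simp add: tens_def)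
      finally show ?thesis by simp
    qed
    ultimately show ?thesis by blast
  next
    assume j: "j = 2"
    obtain P where P: "smooth P" "\<And>x. (P has_real_derivative bmp k c d x - bmp k c d (x - h)) (at x)"
      "\<And>x. ((\<lambda>s. bmp k c d (x - s)) has_integral P x) {0..h}" "\<And>x. x \<notin> {c..d+h} \<Longrightarrow> P x = 0"
      using bmp_antideriv[OF h, of k c d] by auto
    have "bmp k a b x = 0" if "x \<notin> {a..b}" for x by (rule bmp_eq_0) (use that in auto)
    then have "test_fun (tens (bmp k a b) P)" by (intro test_tens[OF smooth_bmp P(1) _ P(4)])
    moreover have "pd j (tens (bmp k a b) P) = (\<lambda>x. bump2 k a b c d x - bump2 k a b c d (x - h *\<^sub>R evec j))"
      unfolding j by (subst pd_tens(2)[OF P(2)]) (auto simp: tens_def bump2_def evec_def algebra_simps)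
    moreover have "tens (bmp k a b) P x = (LINT s|lborel. of_real (indicat_real {0..h} s) * bump2 k a b c d (x - s *\<^sub>R evec j))" for x
    proof -
      have "(LINT s|lborel. of_real (indicat_real {0..h} s) * bump2 k a b c d (x - s *\<^sub>R evec j))
        = (LINT s|lborel. complex_of_real ((indicat_real {0..h} s * bmp k c d (snd x - s)) * bmp k a b (fst x)))"
        by (simp add: bump2_def tens_def j evec_def mult_ac)
      also have "\<dots> = tens (bmp k a b) P x"
        unfolding integral_complex_of_real integral_mult_left_zero LI[OF P(3)] by (simp add: tens_def)
      finally show ?thesis by simp
    qed
    ultimately show ?thesis by blast
  qed
qed

text \<open>Licence for Fubini in the next lemma: Cauchy-Schwarz bounds each slice uniformly in the
  shift, since translation preserves the L2 norm.\<close>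

lemma translate_pairing_integrable:
  fixes e :: "real \<times> real"
  assumes f: "l2 f" and w: "l2 w"
  shows "integrable (lborel \<Otimes>\<^sub>M lborel) (\<lambda>(s::real, x). of_real (indicat_real {0..h} s) * (f (x + s *\<^sub>R e) * w x))"
proof (rule lborel_pair.Fubini_integrable)
  note [measurable] = l2_measurable[OF f] l2_measurable[OF w]
  let ?F = "\<lambda>(s::real, x). of_real (indicat_real {0..h} s) * (f (x + s *\<^sub>R e) * w x)"
  have [measurable]: "?F \<in> borel_measurable (borel \<Otimes>\<^sub>M borel)" by measurable
  show "?F \<in> borel_measurable (lborel \<Otimes>\<^sub>M lborel)" by measurable
  have le: "(LINT x|lborel. norm (?F (s, x))) \<le> indicat_real {0..h} s * (sqrt (nsq f) * sqrt (nsq w))" for s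
  proof -
    have "(LINT x|lborel. norm (?F (s, x))) = indicat_real {0..h} s * (LINT x|lborel. cmod (f (x + s *\<^sub>R e)) * cmod (w x))"
      by (simp add: norm_mult)
    also have "\<dots> \<le> indicat_real {0..h} s * (sqrt (nsq (\<lambda>x. f (x + s *\<^sub>R e))) * sqrt (nsq w))"
      by (intro mult_left_mono cauchy_schwarz_cmod l2_shift f w) auto
    finally show ?thesis by (simp add: nsq_shift f)
  qed
  show "integrable lborel (\<lambda>s. LINT x|lborel. norm (?F (s, x)))"
  proof (rule Bochner_Integration.integrable_bound)
    show "integrable lborel (\<lambda>s. indicat_real {0..h} s * (sqrt (nsq f) * sqrt (nsq w)))"
      by (intro integrable_mult_left integrable_real_indicator) (auto simp: emeasure_lborel_Icc_eq)
    show "(\<lambda>s. LINT x|lborel. norm (?F (s, x))) \<in> borel_measurable lborel" by measurable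
    have "0 \<le> (LINT x|lborel. norm (?F (s, x)))" for s by (rule Bochner_Integration.integral_nonneg) simp
    then show "AE s in lborel. norm (LINT x|lborel. norm (?F (s, x))) \<le> norm (indicat_real {0..h} s * (sqrt (nsq f) * sqrt (nsq w)))"
      using le by (intro AE_I2) (smt (verit) real_norm_def)
  qed
  show "AE s in lborel. integrable lborel (\<lambda>x. ?F (s, x))"
    by (auto intro!: AE_I2 integrable_mult_right l2_times_integrable l2_shift f w)
qed

text \<open>The fundamental theorem of calculus for weak derivatives. Paired with a bump, the
  difference of \<open>u\<close> becomes a pairing of \<open>u\<close> with the derivative of the
  function from \<open>bump_antideriv\<close>; Fubini then moves the integration over shifts from
  that function onto \<open>g j\<close>.\<close>

lemma sob_diff_identity:
  assumes S: "sob u g" and j: "j \<in> {1,2}" and h: "h > 0"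
  shows "AE x in lborel. u (x + h *\<^sub>R evec j) - u x = (LINT s|lborel. of_real (indicat_real {0..h} s) * g j (x + s *\<^sub>R evec j))"
proof -
  let ?e = "evec j"
  let ?i = "\<lambda>s. complex_of_real (indicat_real {0..h} s)"
  have u: "l2 u" and g: "l2 (g j)" by (rule sob_l2(1)[OF S], rule sob_l2(4)[OF S j])
  note [measurable] = l2_measurable[OF u] l2_measurable[OF g]
  define I where "I x = (LINT s|lborel. ?i s * g j (x + s *\<^sub>R ?e))" for x
  have I[measurable]: "I \<in> borel_measurable borel" unfolding I_def[abs_def] by measurable
  have Ip: "integrable lborel (\<lambda>x. I x * w x)" if w: "l2 w" for w
  proof -
    from lborel_pair.integrable_snd[OF translate_pairing_integrable[OF g w, of h ?e]]
    have "integrable lborel (\<lambda>x. LINT s|lborel. ?i s * (g j (x + s *\<^sub>R ?e) * w x))" by simp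
    then show ?thesis unfolding I_def mult.assoc[symmetric] integral_mult_left_zero .
  qed
  have "AE x in lborel. u (x + h *\<^sub>R ?e) - u x - I x = 0"
  proof (rule fundamental_lemma)
    show "(\<lambda>x. u (x + h *\<^sub>R ?e) - u x - I x) \<in> borel_measurable borel" by measurable
    show "integrable lborel (cut (qbox (real k)) (\<lambda>x. u (x + h *\<^sub>R ?e) - u x - I x))" for k
    proof -
      have "l2 (cut (qbox (real k)) (\<lambda>x. 1))"
        by (rule bounded_cutoff_l2(1)[of _ 1 "real k"]) (auto simp: cut_def)
      from Ip[OF this] have "integrable lborel (\<lambda>x. cut (qbox (real k)) (\<lambda>x. u (x + h *\<^sub>R ?e) - u x) x - I x * cut (qbox (real k)) (\<lambda>x. 1) x)"
        by (intro Bochner_Integration.integrable_diff l2_cut_integrable l2_diff l2_shift u)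
      then show ?thesis by (rule back_subst[of "integrable lborel"]) (auto simp: cut_def)
    qed
    fix k a b c d
    let ?\<phi> = "bump2 k a b c d"
    have phi: "test_fun ?\<phi>" by (rule test_bump2)
    have lphi: "l2 ?\<phi>" by (rule test_l2(1)[OF phi])
    obtain \<Phi> where Phi: "test_fun \<Phi>" "pd j \<Phi> = (\<lambda>x. ?\<phi> x - ?\<phi> (x - h *\<^sub>R ?e))"
      "\<forall>x. \<Phi> x = (LINT s|lborel. ?i s * ?\<phi> (x - s *\<^sub>R ?e))"
      using bump_antideriv[OF h j, of k a b c d] by auto
    have phis: "l2 (\<lambda>x. ?\<phi> (x - h *\<^sub>R ?e))" using l2_shift[OF lphi, of "- h *\<^sub>R ?e"] by simp
    have 1: "(LINT x|lborel. u (x + h *\<^sub>R ?e) * ?\<phi> x) = (LINT x|lborel. u x * ?\<phi> (x - h *\<^sub>R ?e))"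
      by (subst integral_shift[of "\<lambda>x. u x * ?\<phi> (x - h *\<^sub>R ?e)" "h *\<^sub>R ?e", symmetric]) simp_all
    have "(LINT x|lborel. u x * pd j \<Phi> x) = (LINT x|lborel. u x * ?\<phi> x) - (LINT x|lborel. u x * ?\<phi> (x - h *\<^sub>R ?e))"
      unfolding Phi(2) right_diff_distrib by (intro Bochner_Integration.integral_diff l2_times_integrable u lphi phis)
    also have "(LINT x|lborel. u x * pd j \<Phi> x) = - (LINT x|lborel. g j x * \<Phi> x)"
      using sob_wderiv[OF S j] Phi(1) unfolding wderiv_def by blast
    finally have 2: "(LINT x|lborel. u (x + h *\<^sub>R ?e) * ?\<phi> x) - (LINT x|lborel. u x * ?\<phi> x) = (LINT x|lborel. g j x * \<Phi> x)"
      unfolding 1 by (simp add: algebra_simps)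
    have "(LINT x|lborel. I x * ?\<phi> x) = (LINT x|lborel. LINT s|lborel. ?i s * (g j (x + s *\<^sub>R ?e) * ?\<phi> x))"
      unfolding I_def mult.assoc[symmetric] integral_mult_left_zero ..
    also have "\<dots> = (LINT s|lborel. LINT x|lborel. ?i s * (g j (x + s *\<^sub>R ?e) * ?\<phi> x))"
      by (rule lborel_pair.Fubini_integral[OF translate_pairing_integrable[OF g lphi, of h ?e]])
    also have "\<dots> = (LINT s|lborel. LINT x|lborel. ?i s * (?\<phi> (x + s *\<^sub>R (- ?e)) * g j x))"
    proof (rule Bochner_Integration.integral_cong[OF refl])
      fix s
      have "(LINT x|lborel. g j (x + s *\<^sub>R ?e) * ?\<phi> x) = (LINT x|lborel. ?\<phi> (x + s *\<^sub>R (- ?e)) * g j x)"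
        by (subst integral_shift[of "\<lambda>x. ?\<phi> (x + s *\<^sub>R (- ?e)) * g j x" "s *\<^sub>R ?e", symmetric]) (simp_all add: mult.commute)
      then show "(LINT x|lborel. ?i s * (g j (x + s *\<^sub>R ?e) * ?\<phi> x)) = (LINT x|lborel. ?i s * (?\<phi> (x + s *\<^sub>R (- ?e)) * g j x))"
        by simp
    qed
    also have "\<dots> = (LINT x|lborel. LINT s|lborel. ?i s * (?\<phi> (x + s *\<^sub>R (- ?e)) * g j x))"
      by (rule lborel_pair.Fubini_integral[OF translate_pairing_integrable[OF lphi g, of h "- ?e"], symmetric])
    also have "\<dots> = (LINT x|lborel. \<Phi> x * g j x)"
      unfolding mult.assoc[symmetric] integral_mult_left_zero using Phi(3) by simp
    finally have 3: "(LINT x|lborel. I x * ?\<phi> x) = (LINT x|lborel. g j x * \<Phi> x)" by (simp add: mult.commute)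
    have "(LINT x|lborel. (u (x + h *\<^sub>R ?e) - u x - I x) * ?\<phi> x)
       = (LINT x|lborel. u (x + h *\<^sub>R ?e) * ?\<phi> x) - (LINT x|lborel. u x * ?\<phi> x) - (LINT x|lborel. I x * ?\<phi> x)"
    proof -
      have i: "integrable lborel (\<lambda>x. u (x + h *\<^sub>R ?e) * ?\<phi> x)" "integrable lborel (\<lambda>x. u x * ?\<phi> x)"
        by (intro l2_times_integrable l2_shift u lphi)+
      show ?thesis
        unfolding left_diff_distrib Bochner_Integration.integral_diff[OF Bochner_Integration.integrable_diff[OF i] Ip[OF lphi]]
          Bochner_Integration.integral_diff[OF i] ..
    qed
    then show "(LINT x|lborel. (u (x + h *\<^sub>R ?e) - u x - I x) * bump2 k a b c d x) = 0" using 2 3 by simp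
  qed
  then show ?thesis unfolding I_def by eventually_elim simp
qed

lemma ennreal_two_mult_le: "2 * (a * b) \<le> a^2 + (b::ennreal)^2"
proof (cases a; cases b)
  fix x y assume "a = ennreal x" "0 \<le> x" "b = ennreal y" "0 \<le> y"
  moreover have "2 * (x * y) \<le> x^2 + y^2" using sum_squares_bound[of x y] by simp
  ultimately show ?thesis
    by (simp add: ennreal_mult[symmetric] ennreal_power ennreal_plus[symmetric] del: ennreal_plus flip: ennreal_numeral)
qed (auto simp: power2_eq_square ennreal_top_mult ennreal_mult_top)

text \<open>Integrates 2 f(s) f(t) <= f(s)^2 + f(t)^2 over pairs of points of \<open>S\<close>. The
  argument stays in \<open>ennreal\<close>, so infinite integrals are covered.\<close>

lemma nn_cauchy_schwarz_set:
  assumes [measurable]: "f \<in> borel_measurable M" "S \<in> sets M"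
  shows "(\<integral>\<^sup>+s. f s * indicator S s \<partial>M)^2 \<le> emeasure M S * (\<integral>\<^sup>+s. (f s)^2 * indicator S s \<partial>M)"
proof -
  let ?i = "indicator S :: 'a \<Rightarrow> ennreal"
  let ?J = "\<integral>\<^sup>+s. f s * ?i s \<partial>M" and ?K = "\<integral>\<^sup>+s. (f s)^2 * ?i s \<partial>M"
  have "2 * ?J^2 = (\<integral>\<^sup>+s. \<integral>\<^sup>+t. 2 * ((f s * ?i s) * (f t * ?i t)) \<partial>M \<partial>M)"
    by (simp add: nn_integral_cmult nn_integral_multc power2_eq_square)
  also have "\<dots> \<le> (\<integral>\<^sup>+s. \<integral>\<^sup>+t. (f s)^2 * ?i s * ?i t + (f t)^2 * ?i t * ?i s \<partial>M \<partial>M)"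
  proof (intro nn_integral_mono)
    fix s t
    show "2 * ((f s * ?i s) * (f t * ?i t)) \<le> (f s)^2 * ?i s * ?i t + (f t)^2 * ?i t * ?i s"
      using ennreal_two_mult_le[of "f s" "f t"] by (auto simp: indicator_def)
  qed
  also have "\<dots> = 2 * (emeasure M S * ?K)"
    by (simp add: nn_integral_add nn_integral_cmult nn_integral_multc mult.commute mult_2)
  finally show ?thesis by (simp add: ennreal_mult_le_mult_iff)
qed

lemma norm_LINT_le_nn:
  fixes f :: "'a \<Rightarrow> complex"
  shows "ennreal (norm (LINT x|M. f x)) \<le> (\<integral>\<^sup>+x. ennreal (norm (f x)) \<partial>M)"
  by (cases "integrable M f") (auto simp: integral_norm_bound_ennreal not_integrable_integral_eq)

lemma sob_diff_pos:
  assumes S: "sob u g" and j: "j \<in> {1,2}" and h: "h > 0"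
  shows "AE x in lborel. ennreal ((cmod (u (x + h *\<^sub>R evec j) - u x))^2) \<le>
     ennreal h * (\<integral>\<^sup>+s. ennreal ((cmod (g j (x + s *\<^sub>R evec j)))^2) * indicator {0..h} s \<partial>lborel)"
proof -
  have [measurable]: "g j \<in> borel_measurable borel" by (rule l2_measurable[OF sob_l2(4)[OF S j]])
  show ?thesis using sob_diff_identity[OF S j h]
  proof eventually_elim
    case (elim x)
    have "ennreal (cmod (u (x + h *\<^sub>R evec j) - u x)) \<le> (\<integral>\<^sup>+s. ennreal (norm (of_real (indicat_real {0..h} s) * g j (x + s *\<^sub>R evec j))) \<partial>lborel)"
      unfolding elim by (rule norm_LINT_le_nn)
    also have "\<dots> = (\<integral>\<^sup>+s. ennreal (cmod (g j (x + s *\<^sub>R evec j))) * indicator {0..h} s \<partial>lborel)"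
      by (intro nn_integral_cong) (auto simp: indicator_def)
    finally have "(ennreal (cmod (u (x + h *\<^sub>R evec j) - u x)))^2 \<le> (\<integral>\<^sup>+s. ennreal (cmod (g j (x + s *\<^sub>R evec j))) * indicator {0..h} s \<partial>lborel)^2"
      by (rule power_mono) simp
    also have "\<dots> \<le> emeasure lborel {0..h} * (\<integral>\<^sup>+s. (ennreal (cmod (g j (x + s *\<^sub>R evec j))))^2 * indicator {0..h} s \<partial>lborel)"
      by (rule nn_cauchy_schwarz_set) measurable
    finally show ?case using h by (simp add: ennreal_power)
  qed
qed

lemma sob_diff_bound:
  assumes S: "sob u g" and j: "j \<in> {1,2}"
  shows "AE x in lborel. ennreal ((cmod (u (x + h *\<^sub>R evec j) - u x))^2) \<le>
     ennreal \<bar>h\<bar> * (\<integral>\<^sup>+t. (if min 0 h \<le> t \<and> t \<le> max 0 h then ennreal ((cmod (g j (x + t *\<^sub>R evec j)))^2) else 0) \<partial>lborel)"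
proof -
  have [measurable]: "g j \<in> borel_measurable borel" by (rule l2_measurable[OF sob_l2(4)[OF S j]])
  consider "h > 0" | "h = 0" | "h < 0" by linarith
  then show ?thesis
  proof cases
    case 1
    show ?thesis using sob_diff_pos[OF S j 1]
      by eventually_elim (use 1 in \<open>auto elim!: order_trans intro!: mult_left_mono nn_integral_mono simp: indicator_def\<close>)
  next
    case 3
    then have "- h > 0" by simp
    \<comment> \<open>A negative step from \<open>x\<close> is a positive step that starts at x + h
      e_j and ends at \<open>x\<close>.\<close>
    from AE_shift[OF sob_diff_pos[OF S j this], of "h *\<^sub>R evec j"]
    show ?thesis
    proof eventually_elim
      case (elim x)
      have "(\<integral>\<^sup>+s. ennreal ((cmod (g j (x + h *\<^sub>R evec j + s *\<^sub>R evec j)))^2) * indicator {0..-h} s \<partial>lborel)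
         = (\<integral>\<^sup>+s. (\<lambda>t. if min 0 h \<le> t \<and> t \<le> max 0 h then ennreal ((cmod (g j (x + t *\<^sub>R evec j)))^2) else 0) (s + h) \<partial>lborel)"
        using 3 by (intro nn_integral_cong) (auto simp: indicator_def algebra_simps)
      also have "\<dots> = (\<integral>\<^sup>+t. (if min 0 h \<le> t \<and> t \<le> max 0 h then ennreal ((cmod (g j (x + t *\<^sub>R evec j)))^2) else 0) \<partial>lborel)"
        by (rule nn_integral_shift) measurable
      finally show ?case using elim 3 by (simp add: norm_minus_commute)
    qed
  qed simp
qed

text \<open>The exceptional null set of the previous bound depends on \<open>h\<close>. Fubini for
  null sets exchanges the quantifiers, so that \<open>x\<close> can be fixed and \<open>h\<close>
  integrated.\<close>

lemma sob_diff_bound_AE2: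
  assumes S: "sob u g" and j: "j \<in> {1,2}"
  shows "AE x in lborel. AE h in lborel. ennreal ((cmod (u (x + h *\<^sub>R evec j) - u x))^2) \<le>
     ennreal \<bar>h\<bar> * (\<integral>\<^sup>+t. (if min 0 h \<le> t \<and> t \<le> max 0 h then ennreal ((cmod (g j (x + t *\<^sub>R evec j)))^2) else 0) \<partial>lborel)"
proof -
  have [measurable]: "g j \<in> borel_measurable borel" "u \<in> borel_measurable borel"
    by (rule l2_measurable[OF sob_l2(4)[OF S j]], rule l2_measurable[OF sob_l2(1)[OF S]])
  show ?thesis
  proof (subst lborel_pair.AE_commute)
    show "AE h in lborel. AE x in lborel. ennreal ((cmod (u (x + h *\<^sub>R evec j) - u x))^2) \<le>
     ennreal \<bar>h\<bar> * (\<integral>\<^sup>+t. (if min 0 h \<le> t \<and> t \<le> max 0 h then ennreal ((cmod (g j (x + t *\<^sub>R evec j)))^2) else 0) \<partial>lborel)"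
      by (intro AE_I2 sob_diff_bound S j)
  qed measurable
qed

subsection \<open>Local Sobolev and Hardy inequalities\<close>

definition coord :: "nat \<Rightarrow> real \<times> real \<Rightarrow> real" where
  "coord j x = (if j = 1 then fst x else snd x)"

lemma sq_norm_le_two: "(cmod a)^2 \<le> 2 * (cmod b)^2 + 2 * (cmod (b - a))^2"
proof -
  have "(cmod a)^2 \<le> (cmod b + cmod (b - a))^2"
    using norm_triangle_ineq4[of b "b - a"] by (intro power_mono) auto
  then show ?thesis using sum_squares_bound[of "cmod b" "cmod (b - a)"] by (simp add: power2_sum)
qed

text \<open>One-dimensional Sobolev embedding on an interval of length \<open>L\<close>: the
  inequality |u(x)|^2 <= 2 |u(x+h)|^2 + 2 |u(x+h) - u(x)|^2 is integrated over all steps that stay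
  in the interval, and the difference is at most \<open>L\<close> times the integral of
  |g|^2.\<close>

lemma line_est:
  assumes S: "sob u g" and j: "j \<in> {1,2}" and L: "L > 0"
  shows "AE x in lborel. coord j x \<in> {lo..<lo+L} \<longrightarrow> ennreal L * ennreal ((cmod (u x))^2) \<le>
    (\<integral>\<^sup>+t. ennreal (2 * (cmod (u (x + t *\<^sub>R evec j)))^2 + 2 * L^2 * (cmod (g j (x + t *\<^sub>R evec j)))^2) * indicator {lo..<lo+L} (coord j x + t) \<partial>lborel)"
  using sob_diff_bound_AE2[OF S j]
proof eventually_elim
  case (elim x)
  have [measurable]: "g j \<in> borel_measurable borel" "u \<in> borel_measurable borel"
    by (rule l2_measurable[OF sob_l2(4)[OF S j]], rule l2_measurable[OF sob_l2(1)[OF S]])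
  let ?i = "\<lambda>t. indicator {lo..<lo+L} (coord j x + t) :: ennreal"
  define K where "K = (\<integral>\<^sup>+t. ennreal ((cmod (g j (x + t *\<^sub>R evec j)))^2) * ?i t \<partial>lborel)"
  show ?case
  proof
    assume x: "coord j x \<in> {lo..<lo+L}"
    have em: "(\<integral>\<^sup>+t. ?i t \<partial>lborel) = ennreal L"
    proof -
      have "(\<integral>\<^sup>+t. indicator {lo..<lo+L} (t + coord j x) \<partial>lborel) = (\<integral>\<^sup>+t. indicator {lo..<lo+L} t \<partial>lborel :: ennreal)"
        by (rule nn_integral_shift) measurable
      then show ?thesis using L by (simp add: add.commute)
    qed
    have AEh: "AE h in lborel. ennreal ((cmod (u x))^2) * ?i h \<le>
        (ennreal (2 * (cmod (u (x + h *\<^sub>R evec j)))^2) + 2 * ennreal L * K) * ?i h"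
      using elim
    proof eventually_elim
      case (elim h)
      show ?case
      proof (cases "coord j x + h \<in> {lo..<lo+L}")
        case True
        have "ennreal ((cmod (u x))^2) \<le> ennreal (2 * (cmod (u (x + h *\<^sub>R evec j)))^2) + 2 * ennreal ((cmod (u (x + h *\<^sub>R evec j) - u x))^2)"
        proof -
          have "ennreal (2 * (cmod (u (x + h *\<^sub>R evec j)))^2) + 2 * ennreal ((cmod (u (x + h *\<^sub>R evec j) - u x))^2)
             = ennreal (2 * (cmod (u (x + h *\<^sub>R evec j)))^2 + 2 * (cmod (u (x + h *\<^sub>R evec j) - u x))^2)"
            by (subst ennreal_plus) (auto simp: ennreal_mult)
          then show ?thesis using ennreal_leI[OF sq_norm_le_two[of "u x" "u (x + h *\<^sub>R evec j)"]] by simp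
        qed
        also have "ennreal ((cmod (u (x + h *\<^sub>R evec j) - u x))^2) \<le> ennreal L * K"
        proof (rule order_trans[OF elim])
          show "ennreal \<bar>h\<bar> * (\<integral>\<^sup>+t. (if min 0 h \<le> t \<and> t \<le> max 0 h then ennreal ((cmod (g j (x + t *\<^sub>R evec j)))^2) else 0) \<partial>lborel) \<le> ennreal L * K"
            unfolding K_def
          proof (intro mult_mono nn_integral_mono)
            show "ennreal \<bar>h\<bar> \<le> ennreal L" using x True by (intro ennreal_leI) auto
            fix t
            have "coord j x + t \<in> {lo..<lo+L}" if "min 0 h \<le> t \<and> t \<le> max 0 h" using that x True by auto
            then show "(if min 0 h \<le> t \<and> t \<le> max 0 h then ennreal ((cmod (g j (x + t *\<^sub>R evec j)))^2) else 0) \<le> ennreal ((cmod (g j (x + t *\<^sub>R evec j)))^2) * ?i t"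
              by (auto simp: indicator_def)
          qed auto
        qed
        finally show ?thesis using True by (simp add: mult.assoc add_left_mono mult_left_mono)
      qed simp
    qed
    have "ennreal L * ennreal ((cmod (u x))^2) = (\<integral>\<^sup>+h. ennreal ((cmod (u x))^2) * ?i h \<partial>lborel)"
      by (simp add: nn_integral_cmult em mult.commute)
    also have "\<dots> \<le> (\<integral>\<^sup>+h. (ennreal (2 * (cmod (u (x + h *\<^sub>R evec j)))^2) + 2 * ennreal L * K) * ?i h \<partial>lborel)"
      by (rule nn_integral_mono_AE[OF AEh])
    also have "\<dots> = (\<integral>\<^sup>+h. ennreal (2 * (cmod (u (x + h *\<^sub>R evec j)))^2) * ?i h \<partial>lborel) + 2 * ennreal L * K * ennreal L"
      by (simp add: distrib_right nn_integral_add nn_integral_cmult em)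
    also have "2 * ennreal L * K * ennreal L = ennreal (2 * L^2) * K"
      using L by (simp add: ennreal_mult power2_eq_square mult_ac)
    also have "\<dots> = (\<integral>\<^sup>+t. ennreal (2 * L^2) * (ennreal ((cmod (g j (x + t *\<^sub>R evec j)))^2) * ?i t) \<partial>lborel)"
      unfolding K_def by (rule nn_integral_cmult[symmetric]) measurable
    also have "(\<integral>\<^sup>+h. ennreal (2 * (cmod (u (x + h *\<^sub>R evec j)))^2) * ?i h \<partial>lborel) + \<dots> =
      (\<integral>\<^sup>+t. ennreal (2 * (cmod (u (x + t *\<^sub>R evec j)))^2) * ?i t + ennreal (2 * L^2) * (ennreal ((cmod (g j (x + t *\<^sub>R evec j)))^2) * ?i t) \<partial>lborel)"
      by (rule nn_integral_add[symmetric]) measurable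
    also have "\<dots> = (\<integral>\<^sup>+t. ennreal (2 * (cmod (u (x + t *\<^sub>R evec j)))^2 + 2 * L^2 * (cmod (g j (x + t *\<^sub>R evec j)))^2) * ?i t \<partial>lborel)"
      by (intro nn_integral_cong) (auto simp: indicator_def ennreal_mult)
    finally show "ennreal L * ennreal ((cmod (u x))^2) \<le> (\<integral>\<^sup>+t. ennreal (2 * (cmod (u (x + t *\<^sub>R evec j)))^2 + 2 * L^2 * (cmod (g j (x + t *\<^sub>R evec j)))^2) * ?i t \<partial>lborel)" .
  qed
qed

definition sqr :: "real \<times> real \<Rightarrow> real \<Rightarrow> (real \<times> real) set" where
  "sqr z L = {fst z..<fst z + L} \<times> {snd z..<snd z + L}"

lemma sqr_sets[measurable, simp]: "sqr z L \<in> sets borel"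
  by (simp add: sqr_def borel_Times)

lemma qbox_eq_sqr: "qbox R = sqr (-R,-R) (2*R)"
  by (simp add: qbox_def sqr_def)

lemma indicator_sqr:
  "(indicator (sqr z L) (a, b) :: ennreal) = indicator {fst z..<fst z + L} a * indicator {snd z..<snd z + L} b"
  by (auto simp: sqr_def indicator_def)

text \<open>The integrand of \<open>line_est\<close> divided by \<open>L\<close>, so that its
  integral over a segment of length \<open>L\<close> bounds |u|^2 almost everywhere on that
  segment.\<close>

definition dens :: "real \<Rightarrow> cfun \<Rightarrow> (nat \<Rightarrow> cfun) \<Rightarrow> nat \<Rightarrow> real \<times> real \<Rightarrow> real" where
  "dens L u g j x = 2 / L * (cmod (u x))^2 + 2 * L * (cmod (g j x))^2"

lemma ennreal_lincomb:
  "a \<ge> 0 \<Longrightarrow> b \<ge> 0 \<Longrightarrow> x \<ge> 0 \<Longrightarrow> y \<ge> 0 \<Longrightarrow> ennreal (a * x + b * y) = ennreal a * ennreal x + ennreal b * ennreal y"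
  by (simp add: ennreal_mult)

text \<open>\<open>lin1\<close> depends on the second coordinate only, and \<open>lin2\<close> below
  on the first only. This separation of variables drives both the L^4 and the Hardy
  estimate.\<close>

definition lin1 :: "real \<Rightarrow> cfun \<Rightarrow> (nat \<Rightarrow> cfun) \<Rightarrow> real \<Rightarrow> real \<Rightarrow> ennreal" where
  "lin1 L u g lo b = (\<integral>\<^sup>+s. ennreal (dens L u g 1 (s, b)) * indicator {lo..<lo+L} s \<partial>lborel)"

definition lin2 :: "real \<Rightarrow> cfun \<Rightarrow> (nat \<Rightarrow> cfun) \<Rightarrow> real \<Rightarrow> real \<Rightarrow> ennreal" where
  "lin2 L u g lo a = (\<integral>\<^sup>+s. ennreal (dens L u g 2 (a, s)) * indicator {lo..<lo+L} s \<partial>lborel)"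

definition h1_sqr :: "real \<Rightarrow> cfun \<Rightarrow> (nat \<Rightarrow> cfun) \<Rightarrow> real \<times> real \<Rightarrow> real" where
  "h1_sqr L u g z = 2 / L * nsq (cut (sqr z L) u) + 2 * L * (nsq (cut (sqr z L) (g 1)) + nsq (cut (sqr z L) (g 2)))"

lemma h1_sqr_nonneg: "L > 0 \<Longrightarrow> 0 \<le> h1_sqr L u g z"
  by (simp add: h1_sqr_def)

lemma measurable_dens: assumes "sob u g" "j \<in> {1,2}" shows "dens L u g j \<in> borel_measurable borel"
proof -
  have [measurable]: "g j \<in> borel_measurable borel" "u \<in> borel_measurable borel"
    by (rule l2_measurable[OF sob_l2(4)[OF assms]], rule l2_measurable[OF sob_l2(1)[OF assms(1)]])
  show ?thesis unfolding dens_def[abs_def] by measurable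
qed

lemma measurable_lin:
  assumes S: "sob u g"
  shows "lin1 L u g lo \<in> borel_measurable borel" "lin2 L u g lo \<in> borel_measurable borel"
proof -
  have [measurable]: "dens L u g 1 \<in> borel_measurable borel" "dens L u g 2 \<in> borel_measurable borel"
    by (rule measurable_dens[OF S], simp)+
  show "lin1 L u g lo \<in> borel_measurable borel" unfolding lin1_def[abs_def] by measurable
  show "lin2 L u g lo \<in> borel_measurable borel" unfolding lin2_def[abs_def] by measurable
qed

lemma line_est_dens:
  assumes S: "sob u g" and j: "j \<in> {1,2}" and L: "L > 0"
  shows "AE x in lborel. coord j x \<in> {lo..<lo+L} \<longrightarrow> ennreal ((cmod (u x))^2) \<le>
    (\<integral>\<^sup>+t. ennreal (dens L u g j (x + t *\<^sub>R evec j)) * indicator {lo..<lo+L} (coord j x + t) \<partial>lborel)"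
  using line_est[OF S j L, of lo]
proof eventually_elim
  case (elim x)
  have [measurable]: "g j \<in> borel_measurable borel" "u \<in> borel_measurable borel"
    by (rule l2_measurable[OF sob_l2(4)[OF S j]], rule l2_measurable[OF sob_l2(1)[OF S]])
  show ?case
  proof
    assume x: "coord j x \<in> {lo..<lo+L}"
    have "ennreal ((cmod (u x))^2) = ennreal (1/L) * (ennreal L * ennreal ((cmod (u x))^2))"
      using L by (simp add: ennreal_mult[symmetric])
    also have "\<dots> \<le> ennreal (1/L) * (\<integral>\<^sup>+t. ennreal (2 * (cmod (u (x + t *\<^sub>R evec j)))^2 + 2 * L^2 * (cmod (g j (x + t *\<^sub>R evec j)))^2) * indicator {lo..<lo+L} (coord j x + t) \<partial>lborel)"
      using elim x by (intro mult_left_mono) auto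
    also have "\<dots> = (\<integral>\<^sup>+t. ennreal (1/L) * (ennreal (2 * (cmod (u (x + t *\<^sub>R evec j)))^2 + 2 * L^2 * (cmod (g j (x + t *\<^sub>R evec j)))^2) * indicator {lo..<lo+L} (coord j x + t)) \<partial>lborel)"
      by (rule nn_integral_cmult[symmetric]) measurable
    also have "\<dots> = (\<integral>\<^sup>+t. ennreal (dens L u g j (x + t *\<^sub>R evec j)) * indicator {lo..<lo+L} (coord j x + t) \<partial>lborel)"
    proof (intro nn_integral_cong)
      fix t
      have "dens L u g j (x + t *\<^sub>R evec j) = 1/L * (2 * (cmod (u (x + t *\<^sub>R evec j)))^2 + 2 * L^2 * (cmod (g j (x + t *\<^sub>R evec j)))^2)"
        using L by (simp add: dens_def field_simps power2_eq_square)
      then show "ennreal (1/L) * (ennreal (2 * (cmod (u (x + t *\<^sub>R evec j)))^2 + 2 * L^2 * (cmod (g j (x + t *\<^sub>R evec j)))^2) * indicator {lo..<lo+L} (coord j x + t))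
        = ennreal (dens L u g j (x + t *\<^sub>R evec j)) * indicator {lo..<lo+L} (coord j x + t)"
        using L by (simp only: mult.assoc[symmetric] ennreal_mult[symmetric] zero_le_divide_1_iff less_imp_le
           add_nonneg_nonneg mult_nonneg_nonneg zero_le_power2 zero_le_numeral)
    qed
    finally show "ennreal ((cmod (u x))^2) \<le> (\<integral>\<^sup>+t. ennreal (dens L u g j (x + t *\<^sub>R evec j)) * indicator {lo..<lo+L} (coord j x + t) \<partial>lborel)" .
  qed
qed

lemma local_sup:
  assumes S: "sob u g" and L: "L > 0"
  shows "AE x in lborel. x \<in> sqr z L \<longrightarrow> ennreal ((cmod (u x))^2) \<le> lin1 L u g (fst z) (snd x)
     \<and> ennreal ((cmod (u x))^2) \<le> lin2 L u g (snd z) (fst x)"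
proof -
  have [measurable]: "dens L u g 1 \<in> borel_measurable borel" "dens L u g 2 \<in> borel_measurable borel"
    by (rule measurable_dens[OF S], simp)+
  have j: "1 \<in> {1,2::nat}" "2 \<in> {1,2::nat}" by auto
  show ?thesis using line_est_dens[OF S j(1) L, of "fst z"] line_est_dens[OF S j(2) L, of "snd z"]
  proof eventually_elim
    case (elim x)
    have 1: "(\<integral>\<^sup>+t. ennreal (dens L u g 1 (x + t *\<^sub>R evec 1)) * indicator {fst z..<fst z+L} (coord 1 x + t) \<partial>lborel) = lin1 L u g (fst z) (snd x)"
    proof -
      have "(\<integral>\<^sup>+t. (\<lambda>s. ennreal (dens L u g 1 (s, snd x)) * indicator {fst z..<fst z+L} s) (t + fst x) \<partial>lborel) = lin1 L u g (fst z) (snd x)"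
        unfolding lin1_def by (rule nn_integral_shift) measurable
      moreover have "x + t *\<^sub>R evec 1 = (t + fst x, snd x)" for t by (cases x) (simp add: evec_def)
      ultimately show ?thesis by (simp add: coord_def add.commute del: One_nat_def)
    qed
    have 2: "(\<integral>\<^sup>+t. ennreal (dens L u g 2 (x + t *\<^sub>R evec 2)) * indicator {snd z..<snd z+L} (coord 2 x + t) \<partial>lborel) = lin2 L u g (snd z) (fst x)"
    proof -
      have "(\<integral>\<^sup>+t. (\<lambda>s. ennreal (dens L u g 2 (fst x, s)) * indicator {snd z..<snd z+L} s) (t + snd x) \<partial>lborel) = lin2 L u g (snd z) (fst x)"
        unfolding lin2_def by (rule nn_integral_shift) measurable
      moreover have "x + t *\<^sub>R evec 2 = (fst x, t + snd x)" for t by (cases x) (simp add: evec_def)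
      ultimately show ?thesis by (simp add: coord_def add.commute)
    qed
    show ?case
    proof
      assume "x \<in> sqr z L"
      then have "coord 1 x \<in> {fst z..<fst z+L}" "coord 2 x \<in> {snd z..<snd z+L}" by (auto simp: sqr_def coord_def)
      then show "ennreal ((cmod (u x))^2) \<le> lin1 L u g (fst z) (snd x) \<and> ennreal ((cmod (u x))^2) \<le> lin2 L u g (snd z) (fst x)"
        using elim unfolding 1 2 by blast
    qed
  qed
qed

lemma dens_integral:
  assumes S: "sob u g" and j: "j \<in> {1,2}" and L: "L > 0"
  shows "(\<integral>\<^sup>+x. ennreal (dens L u g j x) * indicator (sqr z L) x \<partial>lborel) \<le> ennreal (h1_sqr L u g z)"
proof -
  note l = sob_l2(1)[OF S] sob_l2(4)[OF S j]
  note [measurable] = l2_measurable[OF l(1)] l2_measurable[OF l(2)]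
  have j': "j = 1 \<or> j = 2" using j by simp
  have "(\<integral>\<^sup>+x. ennreal (dens L u g j x) * indicator (sqr z L) x \<partial>lborel)
    = (\<integral>\<^sup>+x. ennreal (2/L) * (ennreal ((cmod (u x))^2) * indicator (sqr z L) x) + ennreal (2*L) * (ennreal ((cmod (g j x))^2) * indicator (sqr z L) x) \<partial>lborel)"
  proof (intro nn_integral_cong)
    fix x
    have "ennreal (dens L u g j x) = ennreal (2/L) * ennreal ((cmod (u x))^2) + ennreal (2*L) * ennreal ((cmod (g j x))^2)"
      unfolding dens_def by (rule ennreal_lincomb) (use L in auto)
    then show "ennreal (dens L u g j x) * indicator (sqr z L) x =
      ennreal (2/L) * (ennreal ((cmod (u x))^2) * indicator (sqr z L) x) + ennreal (2*L) * (ennreal ((cmod (g j x))^2) * indicator (sqr z L) x)"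
      by (simp add: distrib_right mult.assoc)
  qed
  also have "\<dots> = ennreal (2/L) * ennreal (nsq (cut (sqr z L) u)) + ennreal (2*L) * ennreal (nsq (cut (sqr z L) (g j)))"
    by (simp add: nn_integral_add nn_integral_cmult nn_integral_cmod_sq_set l)
  also have "\<dots> = ennreal (2/L * nsq (cut (sqr z L) u) + 2*L * nsq (cut (sqr z L) (g j)))"
    using L by (intro ennreal_lincomb[symmetric]) auto
  also have "\<dots> \<le> ennreal (h1_sqr L u g z)"
    unfolding h1_sqr_def using L j' by (intro ennreal_leI add_left_mono mult_left_mono) auto
  finally show ?thesis .
qed

lemma lin1_integral:
  assumes S: "sob u g" and L: "L > 0"
  shows "(\<integral>\<^sup>+b. lin1 L u g (fst z) b * indicator {snd z..<snd z + L} b \<partial>lborel) \<le> ennreal (h1_sqr L u g z)"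
proof -
  have j: "1 \<in> {1,2::nat}" by simp
  have [measurable]: "dens L u g 1 \<in> borel_measurable borel" by (rule measurable_dens[OF S j])
  have "(\<integral>\<^sup>+b. lin1 L u g (fst z) b * indicator {snd z..<snd z + L} b \<partial>lborel)
    = (\<integral>\<^sup>+b. \<integral>\<^sup>+s. ennreal (dens L u g 1 (s, b)) * indicator (sqr z L) (s, b) \<partial>lborel \<partial>lborel)"
    unfolding lin1_def indicator_sqr
    by (subst nn_integral_multc[symmetric]) (simp_all add: mult_ac del: One_nat_def)
  also have "\<dots> = (\<integral>\<^sup>+x. ennreal (dens L u g 1 x) * indicator (sqr z L) x \<partial>lborel)"
    by (rule nn_integral_prod2[symmetric]) measurable
  finally show ?thesis using dens_integral[OF S j L] by simp
qed

lemma lin2_integral: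
  assumes S: "sob u g" and L: "L > 0"
  shows "(\<integral>\<^sup>+a. lin2 L u g (snd z) a * indicator {fst z..<fst z + L} a \<partial>lborel) \<le> ennreal (h1_sqr L u g z)"
proof -
  have j: "2 \<in> {1,2::nat}" by simp
  have [measurable]: "dens L u g 2 \<in> borel_measurable borel" by (rule measurable_dens[OF S j])
  have "(\<integral>\<^sup>+a. lin2 L u g (snd z) a * indicator {fst z..<fst z + L} a \<partial>lborel)
    = (\<integral>\<^sup>+a. \<integral>\<^sup>+s. ennreal (dens L u g 2 (a, s)) * indicator (sqr z L) (a, s) \<partial>lborel \<partial>lborel)"
    unfolding lin2_def indicator_sqr
    by (subst nn_integral_multc[symmetric]) (simp_all add: mult_ac del: One_nat_def)
  also have "\<dots> = (\<integral>\<^sup>+x. ennreal (dens L u g 2 x) * indicator (sqr z L) x \<partial>lborel)"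
    by (rule nn_integral_prod1[symmetric]) measurable
  finally show ?thesis using dens_integral[OF S j L] by simp
qed

text \<open>The Gagliardo-Nirenberg argument: one factor |u|^2 is bounded by \<open>lin1\<close>,
  the other by \<open>lin2\<close>, and the integral of a product in separate variables
  factorises.\<close>

lemma local_L4:
  assumes S: "sob u g" and L: "L > 0"
  shows "(\<integral>\<^sup>+x. ennreal ((cmod (u x))^4) * indicator (sqr z L) x \<partial>lborel) \<le> ennreal ((h1_sqr L u g z)^2)"
proof -
  note [measurable] = measurable_lin[OF S]
  have fs[measurable]: "(fst :: real \<times> real \<Rightarrow> real) \<in> borel_measurable borel" "(snd :: real \<times> real \<Rightarrow> real) \<in> borel_measurable borel"
    by (intro borel_measurable_continuous_onI continuous_intros)+
  note [measurable] = measurable_compose[OF fs(2) measurable_lin(1)[OF S]] measurable_compose[OF fs(1) measurable_lin(2)[OF S]]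
  have "(\<integral>\<^sup>+x. ennreal ((cmod (u x))^4) * indicator (sqr z L) x \<partial>lborel)
    \<le> (\<integral>\<^sup>+x. (lin1 L u g (fst z) (snd x) * lin2 L u g (snd z) (fst x)) * indicator (sqr z L) x \<partial>lborel)"
  proof (rule nn_integral_mono_AE, use local_sup[OF S L, of z] in eventually_elim)
    fix x
    assume *: "x \<in> sqr z L \<longrightarrow> ennreal ((cmod (u x))\<^sup>2) \<le> lin1 L u g (fst z) (snd x) \<and> ennreal ((cmod (u x))\<^sup>2) \<le> lin2 L u g (snd z) (fst x)"
    show "ennreal ((cmod (u x))^4) * indicator (sqr z L) x \<le> (lin1 L u g (fst z) (snd x) * lin2 L u g (snd z) (fst x)) * indicator (sqr z L) x"
    proof (cases "x \<in> sqr z L")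
      case True
      have "ennreal ((cmod (u x))^4) = ennreal ((cmod (u x))\<^sup>2) * ennreal ((cmod (u x))\<^sup>2)"
        by (simp add: ennreal_mult[symmetric] power_add[symmetric])
      also have "\<dots> \<le> lin1 L u g (fst z) (snd x) * lin2 L u g (snd z) (fst x)"
        using * True by (intro mult_mono) auto
      finally show ?thesis using True by simp
    qed simp
  qed
  also have "\<dots> = (\<integral>\<^sup>+a. \<integral>\<^sup>+b. (lin2 L u g (snd z) a * indicator {fst z..<fst z + L} a) * (lin1 L u g (fst z) b * indicator {snd z..<snd z + L} b) \<partial>lborel \<partial>lborel)"
    by (subst nn_integral_prod1) (simp_all add: indicator_sqr mult_ac)
  also have "\<dots> = (\<integral>\<^sup>+a. lin2 L u g (snd z) a * indicator {fst z..<fst z + L} a \<partial>lborel) * (\<integral>\<^sup>+b. lin1 L u g (fst z) b * indicator {snd z..<snd z + L} b \<partial>lborel)"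
    by (simp add: nn_integral_cmult nn_integral_multc)
  also have "\<dots> \<le> ennreal (h1_sqr L u g z) * ennreal (h1_sqr L u g z)"
    by (intro mult_mono lin1_integral lin2_integral S L) auto
  finally show ?thesis using h1_sqr_nonneg[OF L, of u g z] by (simp add: ennreal_mult[symmetric] power2_eq_square)
qed

text \<open>A slab of half-width \<open>r\<close> has length 2r, which cancels the weight 1/r. At r
  = 0 the convention 1/0 = 0 keeps the bound true.\<close>

lemma slab_measure:
  "(\<integral>\<^sup>+a. indicator {a. \<bar>a - c\<bar> \<le> r} a \<partial>lborel) * ennreal (1 / r) \<le> 2" if "r \<ge> 0" for c r :: real
proof -
  have "{a. \<bar>a - c\<bar> \<le> r} = {c - r..c + r}" by auto
  then have "(\<integral>\<^sup>+a. indicator {a. \<bar>a - c\<bar> \<le> r} a \<partial>lborel) = ennreal (2 * r)" using that by simp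
  then have "(\<integral>\<^sup>+a. indicator {a. \<bar>a - c\<bar> \<le> r} a \<partial>lborel) * ennreal (1 / r) = ennreal (2 * r * (1 / r))"
    using that by (simp add: ennreal_mult[symmetric])
  also have "\<dots> \<le> ennreal 2" by (intro ennreal_leI) auto
  finally show ?thesis by simp
qed

text \<open>The square is split by which coordinate of y - c is larger in modulus. Where the second
  is, 1/|c - y| is at most the reciprocal of that coordinate and |u|^2 is at most
  \<open>lin1\<close>; integrating the first coordinate over its slab cancels the singularity. The
  factor 4 is two regions times the 2 of \<open>slab_measure\<close>.\<close>

lemma local_hardy:
  assumes S: "sob u g" and L: "L > 0" and c: "c = z + (L/2, L/2)"
  shows "(\<integral>\<^sup>+y. ennreal ((cmod (u y))^2 / norm (c - y)) * indicator (sqr z L) y \<partial>lborel) \<le> ennreal (4 * h1_sqr L u g z)"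
proof -
  note [measurable] = measurable_lin[OF S]
  have fs[measurable]: "(fst :: real \<times> real \<Rightarrow> real) \<in> borel_measurable borel" "(snd :: real \<times> real \<Rightarrow> real) \<in> borel_measurable borel"
    by (intro borel_measurable_continuous_onI continuous_intros)+
  note [measurable] = measurable_compose[OF fs(2) measurable_lin(1)[OF S]] measurable_compose[OF fs(1) measurable_lin(2)[OF S]]
  let ?i1 = "indicator {fst z..<fst z + L} :: real \<Rightarrow> ennreal" and ?i2 = "indicator {snd z..<snd z + L} :: real \<Rightarrow> ennreal"
  let ?T1 = "\<lambda>y. (lin1 L u g (fst z) (snd y) * ?i2 (snd y)) * (ennreal (1 / \<bar>snd y - snd c\<bar>) * indicator {a. \<bar>a - fst c\<bar> \<le> \<bar>snd y - snd c\<bar>} (fst y))"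
  let ?T2 = "\<lambda>y. (lin2 L u g (snd z) (fst y) * ?i1 (fst y)) * (ennreal (1 / \<bar>fst y - fst c\<bar>) * indicator {a. \<bar>a - snd c\<bar> \<le> \<bar>fst y - fst c\<bar>} (snd y))"
  have m1: "?T1 \<in> borel_measurable borel"
  proof -
    have "{y::real\<times>real. \<bar>fst y - fst c\<bar> \<le> \<bar>snd y - snd c\<bar>} \<in> sets borel"
      by (intro borel_closed closed_Collect_le continuous_intros)
    then have "(indicator {y::real\<times>real. \<bar>fst y - fst c\<bar> \<le> \<bar>snd y - snd c\<bar>} :: _ \<Rightarrow> ennreal) \<in> borel_measurable borel" by simp
    then have "(\<lambda>y::real\<times>real. indicator {a. \<bar>a - fst c\<bar> \<le> \<bar>snd y - snd c\<bar>} (fst y) :: ennreal) \<in> borel_measurable borel"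
      by (rule back_subst[of "\<lambda>f. f \<in> borel_measurable borel"]) (auto simp: indicator_def)
    then show ?thesis
      by (intro borel_measurable_times_ennreal measurable_compose[OF fs(2) measurable_lin(1)[OF S]] measurable_compose[OF fs(1) measurable_lin(2)[OF S]]
         measurable_compose[OF fs(2) borel_measurable_indicator] measurable_compose[OF fs(1) borel_measurable_indicator]) measurable
  qed
  have m2: "?T2 \<in> borel_measurable borel"
  proof -
    have "{y::real\<times>real. \<bar>snd y - snd c\<bar> \<le> \<bar>fst y - fst c\<bar>} \<in> sets borel"
      by (intro borel_closed closed_Collect_le continuous_intros)
    then have "(indicator {y::real\<times>real. \<bar>snd y - snd c\<bar> \<le> \<bar>fst y - fst c\<bar>} :: _ \<Rightarrow> ennreal) \<in> borel_measurable borel" by simp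
    then have "(\<lambda>y::real\<times>real. indicator {a. \<bar>a - snd c\<bar> \<le> \<bar>fst y - fst c\<bar>} (snd y) :: ennreal) \<in> borel_measurable borel"
      by (rule back_subst[of "\<lambda>f. f \<in> borel_measurable borel"]) (auto simp: indicator_def)
    then show ?thesis
      by (intro borel_measurable_times_ennreal measurable_compose[OF fs(2) measurable_lin(1)[OF S]] measurable_compose[OF fs(1) measurable_lin(2)[OF S]]
         measurable_compose[OF fs(2) borel_measurable_indicator] measurable_compose[OF fs(1) borel_measurable_indicator]) measurable
  qed
  have "(\<integral>\<^sup>+y. ennreal ((cmod (u y))^2 / norm (c - y)) * indicator (sqr z L) y \<partial>lborel) \<le> (\<integral>\<^sup>+y. ?T1 y + ?T2 y \<partial>lborel)"
  proof (rule nn_integral_mono_AE, use local_sup[OF S L, of z] in eventually_elim)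
    fix y
    assume *: "y \<in> sqr z L \<longrightarrow> ennreal ((cmod (u y))\<^sup>2) \<le> lin1 L u g (fst z) (snd y) \<and> ennreal ((cmod (u y))\<^sup>2) \<le> lin2 L u g (snd z) (fst y)"
    show "ennreal ((cmod (u y))^2 / norm (c - y)) * indicator (sqr z L) y \<le> ?T1 y + ?T2 y"
    \<comment> \<open>At y = c the quotient is 0 by the convention on division by zero.\<close>
    proof (cases "y \<in> sqr z L \<and> y \<noteq> c")
      case True
      then have y: "y \<in> sqr z L" "fst y \<in> {fst z..<fst z + L}" "snd y \<in> {snd z..<snd z + L}" by (auto simp: sqr_def)
      have ne: "\<bar>fst y - fst c\<bar> > 0 \<or> \<bar>snd y - snd c\<bar> > 0" using True by (auto simp: prod_eq_iff)
      have n1: "\<bar>snd y - snd c\<bar> \<le> norm (c - y)" "\<bar>fst y - fst c\<bar> \<le> norm (c - y)"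
        using norm_snd_le[of "snd (c - y)" "fst (c - y)"] norm_fst_le[of "fst (c - y)" "snd (c - y)"]
        unfolding prod.collapse by (auto simp: abs_minus_commute)
      show ?thesis
      proof (cases "\<bar>fst y - fst c\<bar> \<le> \<bar>snd y - snd c\<bar>")
        case le: True
        have "ennreal ((cmod (u y))^2 / norm (c - y)) \<le> ennreal ((cmod (u y))^2 * (1 / \<bar>snd y - snd c\<bar>))"
          unfolding divide_inverse using ne le n1 by (intro ennreal_leI mult_left_mono) (auto intro!: le_imp_inverse_le)
        also have "\<dots> \<le> lin1 L u g (fst z) (snd y) * ennreal (1 / \<bar>snd y - snd c\<bar>)"
          by (subst ennreal_mult) (use * y in \<open>auto intro!: mult_right_mono\<close>)
        also have "\<dots> \<le> ?T1 y + ?T2 y" using y le by (intro add_increasing2) auto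
        finally show ?thesis using y by simp
      next
        case le: False
        have "ennreal ((cmod (u y))^2 / norm (c - y)) \<le> ennreal ((cmod (u y))^2 * (1 / \<bar>fst y - fst c\<bar>))"
          unfolding divide_inverse using ne le n1 by (intro ennreal_leI mult_left_mono) (auto intro!: le_imp_inverse_le)
        also have "\<dots> \<le> lin2 L u g (snd z) (fst y) * ennreal (1 / \<bar>fst y - fst c\<bar>)"
          by (subst ennreal_mult) (use * y in \<open>auto intro!: mult_right_mono\<close>)
        also have "\<dots> \<le> ?T1 y + ?T2 y" using y le by (intro add_increasing) auto
        finally show ?thesis using y by simp
      qed
    qed auto
  qed
  also have "\<dots> = (\<integral>\<^sup>+y. ?T1 y \<partial>lborel) + (\<integral>\<^sup>+y. ?T2 y \<partial>lborel)"
    by (rule nn_integral_add) (use m1 m2 in simp_all)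
  also have "(\<integral>\<^sup>+y. ?T1 y \<partial>lborel) \<le> 2 * ennreal (h1_sqr L u g z)"
  proof -
    have "(\<integral>\<^sup>+y. ?T1 y \<partial>lborel) = (\<integral>\<^sup>+b. (lin1 L u g (fst z) b * ?i2 b) * ((\<integral>\<^sup>+a. indicator {a. \<bar>a - fst c\<bar> \<le> \<bar>b - snd c\<bar>} a \<partial>lborel) * ennreal (1 / \<bar>b - snd c\<bar>)) \<partial>lborel)"
      by (subst nn_integral_prod2[OF m1]) (simp add: nn_integral_cmult nn_integral_multc mult_ac)
    also have "\<dots> \<le> (\<integral>\<^sup>+b. (lin1 L u g (fst z) b * ?i2 b) * 2 \<partial>lborel)"
      by (intro nn_integral_mono mult_left_mono slab_measure) auto
    also have "\<dots> \<le> 2 * ennreal (h1_sqr L u g z)"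
      by (subst nn_integral_multc) (simp_all add: mult.commute[of _ 2] mult_left_mono lin1_integral S L)
    finally show ?thesis .
  qed
  also have "(\<integral>\<^sup>+y. ?T2 y \<partial>lborel) \<le> 2 * ennreal (h1_sqr L u g z)"
  proof -
    have "(\<integral>\<^sup>+y. ?T2 y \<partial>lborel) = (\<integral>\<^sup>+b. (lin2 L u g (snd z) b * ?i1 b) * ((\<integral>\<^sup>+a. indicator {a. \<bar>a - snd c\<bar> \<le> \<bar>b - fst c\<bar>} a \<partial>lborel) * ennreal (1 / \<bar>b - fst c\<bar>)) \<partial>lborel)"
      by (subst nn_integral_prod1[OF m2]) (simp add: nn_integral_cmult nn_integral_multc mult_ac)
    also have "\<dots> \<le> (\<integral>\<^sup>+b. (lin2 L u g (snd z) b * ?i1 b) * 2 \<partial>lborel)"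
      by (intro nn_integral_mono mult_left_mono slab_measure) auto
    also have "\<dots> \<le> 2 * ennreal (h1_sqr L u g z)"
      by (subst nn_integral_multc) (simp_all add: mult.commute[of _ 2] mult_left_mono lin2_integral S L)
    finally show ?thesis .
  qed
  also have "2 * ennreal (h1_sqr L u g z) + 2 * ennreal (h1_sqr L u g z) = ennreal (4 * h1_sqr L u g z)"
    using h1_sqr_nonneg[OF L, of u g z] by (simp add: ennreal_mult distrib_right[symmetric])
  finally show ?thesis by (simp add: add_mono)
qed

subsection \<open>Global inequalities by covering\<close>

lemma emeasure_sqr: "L > 0 \<Longrightarrow> emeasure lborel (sqr z L) = ennreal (L^2)"
  unfolding sqr_def
  by (simp add: lborel_prod[symmetric] lborel.emeasure_pair_measure_Times ennreal_mult[symmetric] power2_eq_square)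

lemma indicator_sqr_swap:
  "(indicator (sqr z L) x :: ennreal) = indicator {fst x - L<..fst x} (fst z) * indicator {snd x - L<..snd x} (snd z)"
  by (auto simp: sqr_def indicator_def mem_Times_iff)

text \<open>Each \<open>x\<close> lies in \<open>sqr z L\<close> for a set of base points
  \<open>z\<close> of area L^2. Averaging over all \<open>z\<close> by Tonelli takes the place of a
  decomposition into disjoint squares.\<close>

lemma covering:
  fixes f :: "real \<times> real \<Rightarrow> ennreal"
  assumes [measurable]: "f \<in> borel_measurable borel" and L: "L > 0"
  shows "(\<integral>\<^sup>+z. \<integral>\<^sup>+x. f x * indicator (sqr z L) x \<partial>lborel \<partial>lborel) = ennreal (L^2) * (\<integral>\<^sup>+x. f x \<partial>lborel)"
proof -
  have m: "(\<lambda>(x, z). f x * indicator (sqr z L) x) \<in> borel_measurable (lborel \<Otimes>\<^sub>M lborel)"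
  proof -
    let ?P = "{p :: (real\<times>real) \<times> (real\<times>real). fst (snd p) \<le> fst (fst p) \<and> fst (fst p) < fst (snd p) + L \<and> snd (snd p) \<le> snd (fst p) \<and> snd (fst p) < snd (snd p) + L}"
    have "?P = {p. fst (snd p) \<le> fst (fst p)} \<inter> {p. fst (fst p) < fst (snd p) + L} \<inter> {p. snd (snd p) \<le> snd (fst p)} \<inter> {p. snd (fst p) < snd (snd p) + L}"
      by auto
    also have "\<dots> \<in> sets borel"
      by (intro sets.Int borel_closed borel_open closed_Collect_le open_Collect_less continuous_intros)
    finally have [measurable]: "?P \<in> sets borel" .
    have "(\<lambda>p. f (fst p) * indicator ?P p) \<in> borel_measurable borel"
      by (intro borel_measurable_times_ennreal measurable_compose[OF _ assms(1)] borel_measurable_indicator borel_measurable_continuous_onI continuous_intros) measurable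
    moreover have "(\<lambda>(x, z). f x * indicator (sqr z L) x) = (\<lambda>p. f (fst p) * indicator ?P p)"
      by (auto simp: fun_eq_iff indicator_def sqr_def)
    ultimately show ?thesis unfolding lborel_prod by simp
  qed
  have fs: "(fst :: real \<times> real \<Rightarrow> real) \<in> borel_measurable borel" "(snd :: real \<times> real \<Rightarrow> real) \<in> borel_measurable borel"
    by (intro borel_measurable_continuous_onI continuous_intros)+
  have "(\<integral>\<^sup>+z. \<integral>\<^sup>+x. f x * indicator (sqr z L) x \<partial>lborel \<partial>lborel) = (\<integral>\<^sup>+x. \<integral>\<^sup>+z. f x * indicator (sqr z L) x \<partial>lborel \<partial>lborel)"
    using lborel_pair.Fubini[OF m] by simp
  also have "\<dots> = (\<integral>\<^sup>+x. f x * ennreal (L^2) \<partial>lborel)"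
  proof (intro nn_integral_cong)
    fix x
    have "(\<integral>\<^sup>+z. f x * indicator (sqr z L) x \<partial>lborel) = f x * (\<integral>\<^sup>+z. indicator (sqr z L) x \<partial>lborel)"
      unfolding indicator_sqr_swap
      by (subst nn_integral_cmult)
         (auto intro!: borel_measurable_times_ennreal measurable_compose[OF fs(1)] measurable_compose[OF fs(2)])
    also have "(\<integral>\<^sup>+z. (indicator (sqr z L) x :: ennreal) \<partial>lborel) = (\<integral>\<^sup>+z. indicator ({fst x - L<..fst x} \<times> {snd x - L<..snd x}) z \<partial>lborel)"
      by (intro nn_integral_cong) (auto simp: sqr_def indicator_def mem_Times_iff)
    also have "\<dots> = emeasure lborel ({fst x - L<..fst x} \<times> {snd x - L<..snd x})"
      by (rule nn_integral_indicator) (simp add: borel_Times)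
    also have "\<dots> = ennreal (L^2)"
      using L by (simp add: lborel_prod[symmetric] lborel.emeasure_pair_measure_Times ennreal_mult[symmetric] power2_eq_square)
    finally show "(\<integral>\<^sup>+z. f x * indicator (sqr z L) x \<partial>lborel) = f x * ennreal (L^2)" .
  qed
  also have "\<dots> = ennreal (L^2) * (\<integral>\<^sup>+x. f x \<partial>lborel)"
    by (simp add: nn_integral_multc mult.commute)
  finally show ?thesis .
qed

definition dirichlet :: "(nat \<Rightarrow> cfun) \<Rightarrow> real" where
  "dirichlet g = nsq (g 1) + nsq (g 2)"

lemma dirichlet_nonneg[simp]: "0 \<le> dirichlet g"
  by (simp add: dirichlet_def)

definition h1_scaled :: "real \<Rightarrow> cfun \<Rightarrow> (nat \<Rightarrow> cfun) \<Rightarrow> real" where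
  "h1_scaled L u g = 2 / L * nsq u + 2 * L * dirichlet g"

lemma h1_sqr_le_h1_scaled: assumes "sob u g" "L > 0" shows "h1_sqr L u g z \<le> h1_scaled L u g"
  unfolding h1_sqr_def h1_scaled_def dirichlet_def using assms(2) sob_l2[OF assms(1)]
  by (intro add_mono mult_left_mono nsq_cut_le) auto

lemma covering_h1_sqr:
  assumes S: "sob u g" and L: "L > 0"
  shows "(\<integral>\<^sup>+z. ennreal (h1_sqr L u g z) \<partial>lborel) = ennreal (L^2) * ennreal (h1_scaled L u g)"
    "(\<lambda>z. ennreal (h1_sqr L u g z)) \<in> borel_measurable lborel"
proof -
  note l = sob_l2(1-3)[OF S]
  note [measurable] = l[THEN l2_measurable]
  define f where "f x = ennreal (2/L * (cmod (u x))^2 + 2*L * ((cmod (g 1 x))^2 + (cmod (g 2 x))^2))" for x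
  have [measurable]: "f \<in> borel_measurable borel" unfolding f_def by measurable
  have f_eq: "f x = ennreal (2/L) * ennreal ((cmod (u x))^2) + ennreal (2*L) * (ennreal ((cmod (g 1 x))^2) + ennreal ((cmod (g 2 x))^2))" for x
    unfolding f_def ennreal_plus[OF zero_le_power2 zero_le_power2, symmetric] by (rule ennreal_lincomb) (use L in auto)
  have h1_sqr: "ennreal (h1_sqr L u g z) = (\<integral>\<^sup>+x. f x * indicator (sqr z L) x \<partial>lborel)" for z
  proof -
    have "(\<integral>\<^sup>+x. f x * indicator (sqr z L) x \<partial>lborel) = (\<integral>\<^sup>+x. ennreal (2/L) * (ennreal ((cmod (u x))^2) * indicator (sqr z L) x) +
       ennreal (2*L) * ((ennreal ((cmod (g 1 x))^2) * indicator (sqr z L) x) + (ennreal ((cmod (g 2 x))^2) * indicator (sqr z L) x)) \<partial>lborel)"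
      unfolding f_eq by (intro nn_integral_cong) (simp add: distrib_right distrib_left mult.assoc)
    also have "\<dots> = ennreal (2/L) * ennreal (nsq (cut (sqr z L) u)) + ennreal (2*L) * (ennreal (nsq (cut (sqr z L) (g 1))) + ennreal (nsq (cut (sqr z L) (g 2))))"
      by (simp add: nn_integral_add nn_integral_cmult nn_integral_cmod_sq_set l del: One_nat_def)
    also have "\<dots> = ennreal (h1_sqr L u g z)"
      unfolding h1_sqr_def ennreal_plus[OF nsq_nonneg nsq_nonneg, symmetric] by (rule ennreal_lincomb[symmetric]) (use L in auto)
    finally show ?thesis by simp
  qed
  have "(\<integral>\<^sup>+x. f x \<partial>lborel) = ennreal (2/L) * ennreal (nsq u) + ennreal (2*L) * (ennreal (nsq (g 1)) + ennreal (nsq (g 2)))"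
    unfolding f_eq by (simp add: nn_integral_add nn_integral_cmult nn_integral_cmod_sq l del: One_nat_def)
  also have "\<dots> = ennreal (h1_scaled L u g)"
    unfolding h1_scaled_def dirichlet_def ennreal_plus[OF nsq_nonneg nsq_nonneg, symmetric] by (rule ennreal_lincomb[symmetric]) (use L in auto)
  finally have "(\<integral>\<^sup>+x. f x \<partial>lborel) = ennreal (h1_scaled L u g)" .
  then show "(\<integral>\<^sup>+z. ennreal (h1_sqr L u g z) \<partial>lborel) = ennreal (L^2) * ennreal (h1_scaled L u g)"
    unfolding h1_sqr by (subst covering[OF _ L]) simp_all
  have "nsq (cut (sqr z L) w) = (LINT x|lborel. indicat_real {fst x - L<..fst x} (fst z) * indicat_real {snd x - L<..snd x} (snd z) * (cmod (w x))^2)" for w z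
    unfolding nsq_def by (intro Bochner_Integration.integral_cong) (auto simp: cut_def sqr_def indicator_def mem_Times_iff)
  have "(\<lambda>z. nsq (cut (sqr z L) w)) \<in> borel_measurable lborel" if w[measurable]: "w \<in> borel_measurable borel" for w
  proof -
    let ?P = "{p :: (real\<times>real) \<times> (real\<times>real). fst (fst p) \<le> fst (snd p) \<and> fst (snd p) < fst (fst p) + L \<and> snd (fst p) \<le> snd (snd p) \<and> snd (snd p) < snd (fst p) + L}"
    have "?P = {p. fst (fst p) \<le> fst (snd p)} \<inter> {p. fst (snd p) < fst (fst p) + L} \<inter> {p. snd (fst p) \<le> snd (snd p)} \<inter> {p. snd (snd p) < snd (fst p) + L}"
      by auto
    also have "\<dots> \<in> sets borel"
      by (intro sets.Int borel_closed borel_open closed_Collect_le open_Collect_less continuous_intros)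
    finally have P: "?P \<in> sets borel" .
    have "(\<lambda>p :: (real\<times>real) \<times> (real\<times>real). w (snd p)) \<in> borel_measurable borel"
      by (rule measurable_compose[OF borel_measurable_continuous_onI[OF continuous_on_snd[OF continuous_on_id]] w])
    note [measurable] = P this
    have "(\<lambda>p. indicat_real ?P p * (cmod (w (snd p)))^2) \<in> borel_measurable borel"
      by (intro borel_measurable_times borel_measurable_indicator P) measurable
    then have "(\<lambda>p. indicat_real ?P p * (cmod (w (snd p)))^2) \<in> borel_measurable (lborel \<Otimes>\<^sub>M lborel)"
      unfolding lborel_prod by simp
    then have "(\<lambda>z. LINT x|lborel. indicat_real ?P (z, x) * (cmod (w x))^2) \<in> borel_measurable lborel"
      by (intro lborel.borel_measurable_lebesgue_integral) (simp add: case_prod_beta)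
    moreover have "nsq (cut (sqr z L) w) = (LINT x|lborel. indicat_real ?P (z, x) * (cmod (w x))^2)" for z
      unfolding nsq_def by (intro Bochner_Integration.integral_cong) (auto simp: cut_def sqr_def indicator_def mem_Times_iff)
    ultimately show ?thesis by simp
  qed
  note m = this
  show "(\<lambda>z. ennreal (h1_sqr L u g z)) \<in> borel_measurable lborel"
    unfolding h1_sqr_def
    by (intro measurable_compose[OF _ measurable_ennreal] borel_measurable_add borel_measurable_times borel_measurable_const m) measurable
qed

text \<open>The local bound is quadratic in \<open>h1_sqr\<close>. One factor is replaced by its
  global bound, the other is averaged over all squares, and L^2 cancels.\<close>

lemma global_L4:
  assumes S: "sob u g" and L: "L > 0"
  shows "(\<integral>\<^sup>+x. ennreal ((cmod (u x))^4) \<partial>lborel) \<le> ennreal ((h1_scaled L u g)^2)"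
proof -
  note [measurable] = sob_l2(1)[OF S, THEN l2_measurable]
  have D0: "0 \<le> h1_scaled L u g" using L by (simp add: h1_scaled_def)
  have "ennreal (L^2) * (\<integral>\<^sup>+x. ennreal ((cmod (u x))^4) \<partial>lborel) = (\<integral>\<^sup>+z. \<integral>\<^sup>+x. ennreal ((cmod (u x))^4) * indicator (sqr z L) x \<partial>lborel \<partial>lborel)"
    by (rule covering[symmetric, OF _ L]) measurable
  also have "\<dots> \<le> (\<integral>\<^sup>+z. ennreal (h1_scaled L u g) * ennreal (h1_sqr L u g z) \<partial>lborel)"
  proof (intro nn_integral_mono)
    fix z
    have "(h1_sqr L u g z)^2 \<le> h1_scaled L u g * h1_sqr L u g z"
      unfolding power2_eq_square by (intro mult_right_mono h1_sqr_le_h1_scaled S L h1_sqr_nonneg)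
    then show "(\<integral>\<^sup>+x. ennreal ((cmod (u x))^4) * indicator (sqr z L) x \<partial>lborel) \<le> ennreal (h1_scaled L u g) * ennreal (h1_sqr L u g z)"
      using local_L4[OF S L, of z] D0 h1_sqr_nonneg[OF L] by (simp add: ennreal_mult[symmetric]) (meson ennreal_leI order_trans)
  qed
  also have "\<dots> = ennreal (L^2) * ennreal ((h1_scaled L u g)^2)"
    using D0 by (subst nn_integral_cmult[OF covering_h1_sqr(2)[OF S L]]) (simp add: covering_h1_sqr(1)[OF S L] ennreal_mult power2_eq_square mult_ac)
  finally show ?thesis using L by (simp add: ennreal_mult_le_mult_iff)
qed

text \<open>The optimal choice is L = sqrt(a/b). Both coefficients are first increased by
  \<open>e n\<close>, since either may be 0.\<close>

lemma opt_bound: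
  fixes X a b :: real
  assumes "\<And>L. L > 0 \<Longrightarrow> X \<le> a / L + b * L" "a \<ge> 0" "b \<ge> 0"
  shows "X \<le> 2 * sqrt (a * b)"
proof (rule LIMSEQ_le_const)
  define e where "e n = 1 / real (Suc n)" for n
  have e: "e n > 0" for n by (simp add: e_def)
  have "e \<longlonglongrightarrow> 0" unfolding e_def[abs_def] by (rule LIMSEQ_Suc[OF lim_1_over_n])
  then have "(\<lambda>n. 2 * sqrt ((a + e n) * (b + e n))) \<longlonglongrightarrow> 2 * sqrt ((a + 0) * (b + 0))"
    by (intro tendsto_intros)
  then show "(\<lambda>n. 2 * sqrt ((a + e n) * (b + e n))) \<longlonglongrightarrow> 2 * sqrt (a * b)" by simp
  have "X \<le> 2 * sqrt ((a + e n) * (b + e n))" for n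
  proof -
    define p q where "p = sqrt (a + e n)" and "q = sqrt (b + e n)"
    have pq: "p > 0" "q > 0" "p^2 = a + e n" "q^2 = b + e n" using e[of n] assms by (auto simp: p_def q_def)
    have "X \<le> a / (p / q) + b * (p / q)" using pq by (intro assms(1)) simp
    also have "\<dots> \<le> (a + e n) / (p / q) + (b + e n) * (p / q)"
      using pq e[of n] by (intro add_mono divide_right_mono mult_right_mono) auto
    also have "\<dots> = 2 * (p * q)" using pq(1,2) unfolding pq(3,4)[symmetric] by (simp add: power2_eq_square)
    finally show ?thesis by (simp add: p_def q_def real_sqrt_mult)
  qed
  then show "\<exists>N. \<forall>n\<ge>N. X \<le> 2 * sqrt ((a + e n) * (b + e n))" by blast
qed

text \<open>Ladyzhenskaya's inequality. Optimising L bounds the square root of the integral by 2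
  sqrt (4 * \<open>nsq u\<close> * \<open>dirichlet g\<close>), whence the factor 16.\<close>

lemma sob_L4:
  assumes S: "sob u g"
  shows "integrable lborel (\<lambda>x. (cmod (u x))^4)" "(LINT x|lborel. (cmod (u x))^4) \<le> 16 * nsq u * dirichlet g"
proof -
  note [measurable] = sob_l2(1)[OF S, THEN l2_measurable]
  show i: "integrable lborel (\<lambda>x. (cmod (u x))^4)"
    using global_L4[OF S, of 1] by (intro integrableI_bounded) (auto simp: le_less_trans)
  let ?X = "LINT x|lborel. (cmod (u x))^4"
  have X: "?X \<ge> 0" by simp
  have "sqrt ?X \<le> (2 * nsq u) / L + (2 * dirichlet g) * L" if L: "L > 0" for L
  proof -
    have "ennreal ?X \<le> ennreal ((h1_scaled L u g)^2)"
      using global_L4[OF S L] nn_integral_eq_integral[OF i] by simp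
    then have "?X \<le> (h1_scaled L u g)^2" by simp
    then have "sqrt ?X \<le> h1_scaled L u g" using L by (intro real_le_lsqrt) (auto simp: h1_scaled_def)
    then show ?thesis by (simp add: h1_scaled_def mult_ac)
  qed
  then have "sqrt ?X \<le> 2 * sqrt ((2 * nsq u) * (2 * dirichlet g))" by (rule opt_bound) auto
  then have "(sqrt ?X)^2 \<le> (2 * sqrt ((2 * nsq u) * (2 * dirichlet g)))^2" by (rule power_mono) simp
  then show "?X \<le> 16 * nsq u * dirichlet g" using X by (simp add: power_mult_distrib)
qed

lemma sq_l2:
  assumes S: "sob u g" shows "l2 (\<lambda>x. of_real ((cmod (u x))^2))"
proof -
  note [measurable] = sob_l2(1)[OF S, THEN l2_measurable]
  show ?thesis by (rule l2I_bound[OF _ sob_L4(1)[OF S]]) (measurable, simp add: norm_power power_mult[symmetric])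
qed

text \<open>The quantitative core of Lions' lemma. On a unit square Cauchy-Schwarz for |u| times
  |u|^2 gives sqrt d times \<open>h1_sqr\<close>; being linear in \<open>h1_sqr\<close>, this can be
  averaged over all squares and keeps the small factor.\<close>

lemma sob_L3:
  assumes S: "sob u g" and d: "\<And>z. nsq (cut (sqr z 1) u) \<le> d"
  shows "integrable lborel (\<lambda>x. (cmod (u x))^3)" "(LINT x|lborel. (cmod (u x))^3) \<le> sqrt d * h1_scaled 1 u g"
proof -
  note l = sob_l2(1)[OF S] sq_l2[OF S]
  note [measurable] = l[THEN l2_measurable]
  have d0: "d \<ge> 0" using d[of 0] nsq_nonneg order_trans by blast
  have cube: "(cmod (u x))^3 = cmod (u x) * cmod (of_real ((cmod (u x))^2))" for x
    by (simp add: norm_mult power3_eq_cube power2_eq_square)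
  show i: "integrable lborel (\<lambda>x. (cmod (u x))^3)"
    unfolding cube by (rule l2_cmod_mult[OF l])
  have loc: "(\<integral>\<^sup>+x. ennreal ((cmod (u x))^3) * indicator (sqr z 1) x \<partial>lborel) \<le> ennreal (sqrt d) * ennreal (h1_sqr 1 u g z)" for z
  proof -
    let ?v = "cut (sqr z 1) u" and ?w = "cut (sqr z 1) (\<lambda>x. of_real ((cmod (u x))^2))"
    have lc: "l2 ?v" "l2 ?w" by (intro l2_cut l sqr_sets)+
    have "ennreal (nsq ?w) = (\<integral>\<^sup>+x. ennreal ((cmod (of_real ((cmod (u x))^2)))^2) * indicator (sqr z 1) x \<partial>lborel)"
      by (rule nn_integral_cmod_sq_set[symmetric, OF l(2)]) simp
    also have "\<dots> = (\<integral>\<^sup>+x. ennreal ((cmod (u x))^4) * indicator (sqr z 1) x \<partial>lborel)"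
      by (simp add: norm_power power_mult[symmetric])
    also have "\<dots> \<le> ennreal ((h1_sqr 1 u g z)^2)" by (rule local_L4[OF S]) simp
    finally have w: "nsq ?w \<le> (h1_sqr 1 u g z)^2" by simp
    have "(\<integral>\<^sup>+x. ennreal ((cmod (u x))^3) * indicator (sqr z 1) x \<partial>lborel) = (\<integral>\<^sup>+x. ennreal (cmod (?v x) * cmod (?w x)) \<partial>lborel)"
      by (intro nn_integral_cong) (auto simp: cut_def indicator_def cube)
    also have "\<dots> = ennreal (LINT x|lborel. cmod (?v x) * cmod (?w x))"
      by (rule nn_integral_eq_integral[OF l2_cmod_mult[OF lc]]) simp
    also have "\<dots> \<le> ennreal (sqrt d * h1_sqr 1 u g z)"
    proof (rule ennreal_leI)
      have "(LINT x|lborel. cmod (?v x) * cmod (?w x)) \<le> sqrt (nsq ?v) * sqrt (nsq ?w)"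
        by (rule cauchy_schwarz_cmod[OF lc])
      also have "\<dots> \<le> sqrt d * h1_sqr 1 u g z"
        using d w h1_sqr_nonneg[of 1 u g z] d0 by (intro mult_mono real_sqrt_le_mono real_le_lsqrt) auto
      finally show "(LINT x|lborel. cmod (?v x) * cmod (?w x)) \<le> sqrt d * h1_sqr 1 u g z" .
    qed
    finally show ?thesis using d0 h1_sqr_nonneg[of 1 u g z] by (simp add: ennreal_mult)
  qed
  have "ennreal (1^2) * (\<integral>\<^sup>+x. ennreal ((cmod (u x))^3) \<partial>lborel) = (\<integral>\<^sup>+z. \<integral>\<^sup>+x. ennreal ((cmod (u x))^3) * indicator (sqr z 1) x \<partial>lborel \<partial>lborel)"
    by (rule covering[symmetric]) auto
  also have "\<dots> \<le> (\<integral>\<^sup>+z. ennreal (sqrt d) * ennreal (h1_sqr 1 u g z) \<partial>lborel)"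
    by (intro nn_integral_mono loc)
  also have "\<dots> = ennreal (sqrt d * h1_scaled 1 u g)"
    using d0 by (subst nn_integral_cmult[OF covering_h1_sqr(2)[OF S]]) (simp_all add: covering_h1_sqr(1)[OF S] ennreal_mult h1_scaled_def)
  finally have "ennreal (LINT x|lborel. (cmod (u x))^3) \<le> ennreal (sqrt d * h1_scaled 1 u g)"
    using nn_integral_eq_integral[OF i] by simp
  then show "(LINT x|lborel. (cmod (u x))^3) \<le> sqrt d * h1_scaled 1 u g"
    by (subst (asm) ennreal_le_iff) (use d0 in \<open>auto simp: h1_scaled_def\<close>)
qed

section \<open>The Hardy potential\<close>

definition hardy :: "cfun \<Rightarrow> real \<times> real \<Rightarrow> real" where
  "hardy u z = (LINT y|lborel. (cmod (u y))^2 / norm (z - y))"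

lemma norm_outside_sqr:
  assumes "y \<notin> sqr (z - (\<rho>, \<rho>)) (2 * \<rho>)" shows "\<rho> \<le> norm (z - y)"
proof (rule ccontr)
  assume "\<not> \<rho> \<le> norm (z - y)"
  then have "\<bar>fst (z - y)\<bar> < \<rho>" "\<bar>snd (z - y)\<bar> < \<rho>"
    using norm_snd_le[of "snd (z - y)" "fst (z - y)"] norm_fst_le[of "fst (z - y)" "snd (z - y)"]
    unfolding prod.collapse by auto
  then have "y \<in> sqr (z - (\<rho>, \<rho>)) (2 * \<rho>)" by (auto simp: sqr_def mem_Times_iff)
  with assms show False by simp
qed

text \<open>Three zones around \<open>z\<close>: the local Hardy inequality in the inner square, the
  kernel bound 1/\<rho>' up to the outer square, and 1/\<rho> beyond it. The radii are kept apart
  because \<open>hardy_locally_uniformly_0\<close> takes a small inner and a large outer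
  one.\<close>

lemma hardy_bounds:
  assumes S: "sob u g" and r: "0 < \<rho>'" "\<rho>' \<le> \<rho>"
  shows "integrable lborel (\<lambda>y. (cmod (u y))^2 / norm (z - y))"
    "hardy u z \<le> 4 * h1_sqr (2*\<rho>') u g (z - (\<rho>',\<rho>')) + 1/\<rho>' * nsq (cut (sqr (z - (\<rho>,\<rho>)) (2*\<rho>)) u) + 1/\<rho> * nsq u"
proof -
  note l = sob_l2(1)[OF S]
  note [measurable] = l[THEN l2_measurable]
  let ?Q' = "sqr (z - (\<rho>',\<rho>')) (2*\<rho>')" and ?Q = "sqr (z - (\<rho>,\<rho>)) (2*\<rho>)"
  have L: "2*\<rho>' > 0" using r by simp
  have m: "(\<lambda>y. (cmod (u y))^2 / norm (z - y)) \<in> borel_measurable borel" by measurable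
  have c: "z = z - (\<rho>',\<rho>') + (2*\<rho>'/2, 2*\<rho>'/2)" by (simp add: prod_eq_iff)
  have pw: "ennreal ((cmod (u y))^2 / norm (z - y)) \<le> ennreal ((cmod (u y))^2 / norm (z - y)) * indicator ?Q' y
     + (ennreal (1/\<rho>') * (ennreal ((cmod (u y))^2) * indicator ?Q y) + ennreal (1/\<rho>) * ennreal ((cmod (u y))^2))" for y
  proof -
    consider "y \<in> ?Q'" | "y \<notin> ?Q'" "y \<in> ?Q" | "y \<notin> ?Q" by blast
    then show ?thesis
    proof cases
      case 1 then show ?thesis by simp
    next
      case 2
      have "(cmod (u y))^2 / norm (z - y) \<le> 1/\<rho>' * (cmod (u y))^2"
        using norm_outside_sqr[OF 2(1)] r by (auto simp: divide_inverse mult.commute intro!: mult_right_mono le_imp_inverse_le)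
      then have "ennreal ((cmod (u y))^2 / norm (z - y)) \<le> ennreal (1/\<rho>') * ennreal ((cmod (u y))^2)"
        using r by (subst ennreal_mult[symmetric]) (auto intro!: ennreal_leI)
      also have "\<dots> = ennreal (1/\<rho>') * (ennreal ((cmod (u y))^2) * indicator ?Q y)" using 2 by simp
      finally show ?thesis by (intro add_increasing[OF zero_le] add_increasing2[OF zero_le])
    next
      case 3
      have "(cmod (u y))^2 / norm (z - y) \<le> 1/\<rho> * (cmod (u y))^2"
        using norm_outside_sqr[OF 3] r by (auto simp: divide_inverse mult.commute intro!: mult_right_mono le_imp_inverse_le)
      then have "ennreal ((cmod (u y))^2 / norm (z - y)) \<le> ennreal (1/\<rho>) * ennreal ((cmod (u y))^2)"
        using r by (subst ennreal_mult[symmetric]) (auto intro!: ennreal_leI)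
      then show ?thesis by (intro add_increasing[OF zero_le])
    qed
  qed
  let ?B = "4 * h1_sqr (2*\<rho>') u g (z - (\<rho>',\<rho>')) + 1/\<rho>' * nsq (cut ?Q u) + 1/\<rho> * nsq u"
  have "(\<integral>\<^sup>+y. ennreal ((cmod (u y))^2 / norm (z - y)) \<partial>lborel) \<le> (\<integral>\<^sup>+y. ennreal ((cmod (u y))^2 / norm (z - y)) * indicator ?Q' y
     + (ennreal (1/\<rho>') * (ennreal ((cmod (u y))^2) * indicator ?Q y) + ennreal (1/\<rho>) * ennreal ((cmod (u y))^2)) \<partial>lborel)"
    by (intro nn_integral_mono pw)
  also have "\<dots> = (\<integral>\<^sup>+y. ennreal ((cmod (u y))^2 / norm (z - y)) * indicator ?Q' y \<partial>lborel) + (ennreal (1/\<rho>') * ennreal (nsq (cut ?Q u)) + ennreal (1/\<rho>) * ennreal (nsq u))"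
    by (simp add: nn_integral_add nn_integral_cmult nn_integral_cmod_sq_set nn_integral_cmod_sq l)
  also have "\<dots> \<le> ennreal (4 * h1_sqr (2*\<rho>') u g (z - (\<rho>',\<rho>'))) + (ennreal (1/\<rho>') * ennreal (nsq (cut ?Q u)) + ennreal (1/\<rho>) * ennreal (nsq u))"
    by (intro add_right_mono local_hardy[OF S L c])
  also have "\<dots> = ennreal ?B"
    using h1_sqr_nonneg[OF L] r by (subst ennreal_lincomb[symmetric]) (auto simp: ennreal_plus[symmetric] add.assoc simp del: ennreal_plus)
  finally have le: "(\<integral>\<^sup>+y. ennreal ((cmod (u y))^2 / norm (z - y)) \<partial>lborel) \<le> ennreal ?B" .
  show i: "integrable lborel (\<lambda>y. (cmod (u y))^2 / norm (z - y))"
    using le m by (intro integrableI_bounded) (auto simp: le_less_trans)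
  have "ennreal (hardy u z) \<le> ennreal ?B"
    unfolding hardy_def using le nn_integral_eq_integral[OF i] by simp
  then show "hardy u z \<le> ?B"
    by (subst (asm) ennreal_le_iff) (use h1_sqr_nonneg[OF L, of u g] r in auto)
qed

lemma hardy_nonneg: "0 \<le> hardy u z"
  unfolding hardy_def by (rule Bochner_Integration.integral_nonneg) simp

text \<open>\<open>hardy_bounds\<close> with equal radii, optimised in the radius: the mass has
  coefficient 4 + 1 + 1 = 6, the Dirichlet integral 16, and 2 sqrt 96 is below 20.\<close>

lemma hardy_le: assumes S: "sob u g" shows "hardy u z \<le> 20 * sqrt (nsq u * dirichlet g)"
proof -
  have "hardy u z \<le> (6 * nsq u) / \<rho> + (16 * dirichlet g) * \<rho>" if r: "\<rho> > 0" for \<rho>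
  proof -
    have "hardy u z \<le> 4 * h1_sqr (2*\<rho>) u g (z - (\<rho>,\<rho>)) + 1/\<rho> * nsq (cut (sqr (z - (\<rho>,\<rho>)) (2*\<rho>)) u) + 1/\<rho> * nsq u"
      by (rule hardy_bounds(2)[OF S r order_refl])
    also have "\<dots> \<le> 4 * h1_scaled (2*\<rho>) u g + 1/\<rho> * nsq u + 1/\<rho> * nsq u"
      using r by (intro add_mono mult_left_mono h1_sqr_le_h1_scaled[OF S] nsq_cut_le sob_l2[OF S]) auto
    also have "\<dots> = (6 * nsq u) / \<rho> + (16 * dirichlet g) * \<rho>"
      using r by (simp add: h1_scaled_def field_simps)
    finally show ?thesis .
  qed
  then have "hardy u z \<le> 2 * sqrt ((6 * nsq u) * (16 * dirichlet g))" by (rule opt_bound) auto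
  also have "\<dots> = 2 * sqrt (96 * (nsq u * dirichlet g))" by (simp add: mult_ac)
  also have "\<dots> \<le> 2 * sqrt (100 * (nsq u * dirichlet g))" by (intro mult_left_mono real_sqrt_le_mono mult_right_mono) auto
  also have "\<dots> = 20 * sqrt (nsq u * dirichlet g)" by (simp add: real_sqrt_mult)
  finally show ?thesis .
qed

subsection \<open>Poincare inequality and local compactness\<close>

text \<open>The counterpart of \<open>line_est\<close> for the Poincare inequality: the difference
  itself is integrated, so that only the derivative remains on the right.\<close>

lemma line_diff:
  assumes S: "sob u g" and j: "j \<in> {1,2}" and L: "L > 0"
  shows "AE x in lborel. coord j x \<in> {lo..<lo+L} \<longrightarrow>
    (\<integral>\<^sup>+h. ennreal ((cmod (u (x + h *\<^sub>R evec j) - u x))^2) * indicator {lo..<lo+L} (coord j x + h) \<partial>lborel)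
     \<le> ennreal (L^2) * (\<integral>\<^sup>+t. ennreal ((cmod (g j (x + t *\<^sub>R evec j)))^2) * indicator {lo..<lo+L} (coord j x + t) \<partial>lborel)"
  using sob_diff_bound_AE2[OF S j]
proof eventually_elim
  case (elim x)
  have [measurable]: "g j \<in> borel_measurable borel" "u \<in> borel_measurable borel"
    by (rule l2_measurable[OF sob_l2(4)[OF S j]], rule l2_measurable[OF sob_l2(1)[OF S]])
  let ?i = "\<lambda>t. indicator {lo..<lo+L} (coord j x + t) :: ennreal"
  define K where "K = (\<integral>\<^sup>+t. ennreal ((cmod (g j (x + t *\<^sub>R evec j)))^2) * ?i t \<partial>lborel)"
  show ?case
  proof
    assume x: "coord j x \<in> {lo..<lo+L}"
    have em: "(\<integral>\<^sup>+t. ?i t \<partial>lborel) = ennreal L"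
    proof -
      have "(\<integral>\<^sup>+t. indicator {lo..<lo+L} (t + coord j x) \<partial>lborel) = (\<integral>\<^sup>+t. indicator {lo..<lo+L} t \<partial>lborel :: ennreal)"
        by (rule nn_integral_shift) measurable
      then show ?thesis using L by (simp add: add.commute)
    qed
    have "AE h in lborel. ennreal ((cmod (u (x + h *\<^sub>R evec j) - u x))^2) * ?i h \<le> (ennreal L * K) * ?i h"
      using elim
    proof eventually_elim
      case (elim h)
      show ?case
      proof (cases "coord j x + h \<in> {lo..<lo+L}")
        case True
        have "ennreal \<bar>h\<bar> * (\<integral>\<^sup>+t. (if min 0 h \<le> t \<and> t \<le> max 0 h then ennreal ((cmod (g j (x + t *\<^sub>R evec j)))^2) else 0) \<partial>lborel) \<le> ennreal L * K"
          unfolding K_def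
        proof (intro mult_mono nn_integral_mono)
          show "ennreal \<bar>h\<bar> \<le> ennreal L" using x True by (intro ennreal_leI) auto
          fix t
          have "coord j x + t \<in> {lo..<lo+L}" if "min 0 h \<le> t \<and> t \<le> max 0 h" using that x True by auto
          then show "(if min 0 h \<le> t \<and> t \<le> max 0 h then ennreal ((cmod (g j (x + t *\<^sub>R evec j)))^2) else 0) \<le> ennreal ((cmod (g j (x + t *\<^sub>R evec j)))^2) * ?i t"
            by (auto simp: indicator_def)
        qed auto
        with elim have "ennreal ((cmod (u (x + h *\<^sub>R evec j) - u x))^2) \<le> ennreal L * K" by (rule order_trans)
        then show ?thesis using True by simp
      qed simp
    qed
    then have "(\<integral>\<^sup>+h. ennreal ((cmod (u (x + h *\<^sub>R evec j) - u x))^2) * ?i h \<partial>lborel) \<le> (\<integral>\<^sup>+h. (ennreal L * K) * ?i h \<partial>lborel)"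
      by (rule nn_integral_mono_AE)
    also have "\<dots> = ennreal (L^2) * K"
      using L by (simp add: nn_integral_cmult em ennreal_mult power2_eq_square mult_ac)
    finally show "(\<integral>\<^sup>+h. ennreal ((cmod (u (x + h *\<^sub>R evec j) - u x))^2) * ?i h \<partial>lborel) \<le> ennreal (L^2) * (\<integral>\<^sup>+t. ennreal ((cmod (g j (x + t *\<^sub>R evec j)))^2) * ?i t \<partial>lborel)"
      by (simp add: K_def)
  qed
qed

lemma fs_measurable:
  "(fst :: real \<times> real \<Rightarrow> real) \<in> borel_measurable borel" "(snd :: real \<times> real \<Rightarrow> real) \<in> borel_measurable borel"
  by (intro borel_measurable_continuous_onI continuous_intros)+

lemma poincare_dir1:
  assumes S: "sob u g" and L: "L > 0"
  shows "(\<integral>\<^sup>+x. (\<integral>\<^sup>+s. ennreal ((cmod (u (s, snd x) - u x))^2) * indicator {fst z..<fst z+L} s \<partial>lborel) * indicator (sqr z L) x \<partial>lborel)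
    \<le> ennreal (L^3 * nsq (cut (sqr z L) (g 1)))"
proof -
  note l = sob_l2(1,2)[OF S]
  note [measurable] = l[THEN l2_measurable]
  have j: "1 \<in> {1,2::nat}" by simp
  define k where "k b = (\<integral>\<^sup>+s. ennreal ((cmod (g 1 (s, b)))^2) * indicator {fst z..<fst z+L} s \<partial>lborel)" for b
  have [measurable]: "k \<in> borel_measurable borel" unfolding k_def[abs_def] by measurable
  have "(\<integral>\<^sup>+x. (\<integral>\<^sup>+s. ennreal ((cmod (u (s, snd x) - u x))^2) * indicator {fst z..<fst z+L} s \<partial>lborel) * indicator (sqr z L) x \<partial>lborel)
     \<le> (\<integral>\<^sup>+x. (ennreal (L^2) * k (snd x)) * indicator (sqr z L) x \<partial>lborel)"
  proof (rule nn_integral_mono_AE, use line_diff[OF S j L, of "fst z"] in eventually_elim)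
    case (elim x)
    have e: "x + t *\<^sub>R evec 1 = (t + fst x, snd x)" for t by (cases x) (simp add: evec_def)
    have 1: "(\<integral>\<^sup>+t. ennreal ((cmod (g 1 (x + t *\<^sub>R evec 1)))^2) * indicator {fst z..<fst z+L} (coord 1 x + t) \<partial>lborel) = k (snd x)"
    proof -
      have "(\<integral>\<^sup>+t. (\<lambda>s. ennreal ((cmod (g 1 (s, snd x)))^2) * indicator {fst z..<fst z+L} s) (t + fst x) \<partial>lborel) = k (snd x)"
        unfolding k_def by (rule nn_integral_shift) measurable
      then show ?thesis unfolding e by (simp add: coord_def add.commute del: One_nat_def)
    qed
    have 2: "(\<integral>\<^sup>+h. ennreal ((cmod (u (x + h *\<^sub>R evec 1) - u x))^2) * indicator {fst z..<fst z+L} (coord 1 x + h) \<partial>lborel)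
        = (\<integral>\<^sup>+s. ennreal ((cmod (u (s, snd x) - u x))^2) * indicator {fst z..<fst z+L} s \<partial>lborel)"
    proof -
      have "(\<integral>\<^sup>+t. (\<lambda>s. ennreal ((cmod (u (s, snd x) - u x))^2) * indicator {fst z..<fst z+L} s) (t + fst x) \<partial>lborel)
          = (\<integral>\<^sup>+s. ennreal ((cmod (u (s, snd x) - u x))^2) * indicator {fst z..<fst z+L} s \<partial>lborel)"
        by (rule nn_integral_shift) measurable
      then show ?thesis unfolding e by (simp add: coord_def add.commute del: One_nat_def)
    qed
    show ?case
    proof (cases "x \<in> sqr z L")
      case True
      then have "coord 1 x \<in> {fst z..<fst z+L}" by (auto simp: sqr_def coord_def)
      with elim True show ?thesis unfolding 1 2 by simp
    qed simp
  qed
  also have "\<dots> = (\<integral>\<^sup>+b. \<integral>\<^sup>+a. (ennreal (L^2) * k b) * (indicator {fst z..<fst z+L} a * indicator {snd z..<snd z+L} b) \<partial>lborel \<partial>lborel)"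
    by (subst nn_integral_prod2)
       (auto simp: indicator_sqr intro!: borel_measurable_times_ennreal measurable_compose[OF fs_measurable(2) \<open>k \<in> _\<close>])
  also have "\<dots> = (\<integral>\<^sup>+b. ennreal (L^3) * (k b * indicator {snd z..<snd z+L} b) \<partial>lborel)"
  proof (rule nn_integral_cong)
    fix b
    have "(\<integral>\<^sup>+a. (ennreal (L^2) * k b) * (indicator {fst z..<fst z+L} a * indicator {snd z..<snd z+L} b) \<partial>lborel)
       = ennreal (L^2) * k b * indicator {snd z..<snd z+L} b * (\<integral>\<^sup>+a. indicator {fst z..<fst z+L} a \<partial>lborel)"
      by (subst nn_integral_cmult[symmetric]) (auto simp: mult_ac)
    also have "\<dots> = ennreal (L^2) * ennreal L * (k b * indicator {snd z..<snd z+L} b)"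
      using L by (simp add: mult_ac)
    finally show "(\<integral>\<^sup>+a. (ennreal (L^2) * k b) * (indicator {fst z..<fst z+L} a * indicator {snd z..<snd z+L} b) \<partial>lborel)
       = ennreal (L^3) * (k b * indicator {snd z..<snd z+L} b)"
      using L by (simp add: ennreal_mult[symmetric] power2_eq_square power3_eq_cube mult.assoc)
  qed
  also have "\<dots> = ennreal (L^3) * (\<integral>\<^sup>+b. k b * indicator {snd z..<snd z+L} b \<partial>lborel)"
    by (rule nn_integral_cmult) measurable
  also have "(\<integral>\<^sup>+b. k b * indicator {snd z..<snd z+L} b \<partial>lborel) = (\<integral>\<^sup>+x. ennreal ((cmod (g 1 x))^2) * indicator (sqr z L) x \<partial>lborel)"
    unfolding k_def by (subst nn_integral_prod2, measurable, subst nn_integral_multc[symmetric], measurable) (simp add: indicator_sqr mult.assoc)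
  also have "\<dots> = ennreal (nsq (cut (sqr z L) (g 1)))" by (rule nn_integral_cmod_sq_set[OF l(2)]) simp
  finally show ?thesis using L by (simp add: ennreal_mult)
qed

lemma poincare_dir2:
  assumes S: "sob u g" and L: "L > 0"
  shows "(\<integral>\<^sup>+x. (\<integral>\<^sup>+s. ennreal ((cmod (u (fst x, s) - u x))^2) * indicator {snd z..<snd z+L} s \<partial>lborel) * indicator (sqr z L) x \<partial>lborel)
    \<le> ennreal (L^3 * nsq (cut (sqr z L) (g 2)))"
proof -
  note l = sob_l2(1,3)[OF S]
  note [measurable] = l[THEN l2_measurable]
  have j: "2 \<in> {1,2::nat}" by simp
  define k where "k a = (\<integral>\<^sup>+s. ennreal ((cmod (g 2 (a, s)))^2) * indicator {snd z..<snd z+L} s \<partial>lborel)" for a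
  have [measurable]: "k \<in> borel_measurable borel" unfolding k_def[abs_def] by measurable
  have "(\<integral>\<^sup>+x. (\<integral>\<^sup>+s. ennreal ((cmod (u (fst x, s) - u x))^2) * indicator {snd z..<snd z+L} s \<partial>lborel) * indicator (sqr z L) x \<partial>lborel)
     \<le> (\<integral>\<^sup>+x. (ennreal (L^2) * k (fst x)) * indicator (sqr z L) x \<partial>lborel)"
  proof (rule nn_integral_mono_AE, use line_diff[OF S j L, of "snd z"] in eventually_elim)
    case (elim x)
    have e: "x + t *\<^sub>R evec 2 = (fst x, t + snd x)" for t by (cases x) (simp add: evec_def)
    have 1: "(\<integral>\<^sup>+t. ennreal ((cmod (g 2 (x + t *\<^sub>R evec 2)))^2) * indicator {snd z..<snd z+L} (coord 2 x + t) \<partial>lborel) = k (fst x)"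
    proof -
      have "(\<integral>\<^sup>+t. (\<lambda>s. ennreal ((cmod (g 2 (fst x, s)))^2) * indicator {snd z..<snd z+L} s) (t + snd x) \<partial>lborel) = k (fst x)"
        unfolding k_def by (rule nn_integral_shift) measurable
      then show ?thesis unfolding e by (simp add: coord_def add.commute)
    qed
    have 2: "(\<integral>\<^sup>+h. ennreal ((cmod (u (x + h *\<^sub>R evec 2) - u x))^2) * indicator {snd z..<snd z+L} (coord 2 x + h) \<partial>lborel)
        = (\<integral>\<^sup>+s. ennreal ((cmod (u (fst x, s) - u x))^2) * indicator {snd z..<snd z+L} s \<partial>lborel)"
    proof -
      have "(\<integral>\<^sup>+t. (\<lambda>s. ennreal ((cmod (u (fst x, s) - u x))^2) * indicator {snd z..<snd z+L} s) (t + snd x) \<partial>lborel)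
          = (\<integral>\<^sup>+s. ennreal ((cmod (u (fst x, s) - u x))^2) * indicator {snd z..<snd z+L} s \<partial>lborel)"
        by (rule nn_integral_shift) measurable
      then show ?thesis unfolding e by (simp add: coord_def add.commute)
    qed
    show ?case
    proof (cases "x \<in> sqr z L")
      case True
      then have "coord 2 x \<in> {snd z..<snd z+L}" by (auto simp: sqr_def coord_def)
      with elim True show ?thesis unfolding 1 2 by simp
    qed simp
  qed
  also have "\<dots> = (\<integral>\<^sup>+a. \<integral>\<^sup>+b. (ennreal (L^2) * k a) * (indicator {fst z..<fst z+L} a * indicator {snd z..<snd z+L} b) \<partial>lborel \<partial>lborel)"
    by (subst nn_integral_prod1)
       (auto simp: indicator_sqr intro!: borel_measurable_times_ennreal measurable_compose[OF fs_measurable(1) \<open>k \<in> _\<close>])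
  also have "\<dots> = (\<integral>\<^sup>+a. ennreal (L^3) * (k a * indicator {fst z..<fst z+L} a) \<partial>lborel)"
  proof (rule nn_integral_cong)
    fix a
    have "(\<integral>\<^sup>+b. (ennreal (L^2) * k a) * (indicator {fst z..<fst z+L} a * indicator {snd z..<snd z+L} b) \<partial>lborel)
       = ennreal (L^2) * k a * indicator {fst z..<fst z+L} a * (\<integral>\<^sup>+b. indicator {snd z..<snd z+L} b \<partial>lborel)"
      by (subst nn_integral_cmult[symmetric]) (auto simp: mult_ac)
    also have "\<dots> = ennreal (L^2) * ennreal L * (k a * indicator {fst z..<fst z+L} a)"
      using L by (simp add: mult_ac)
    finally show "(\<integral>\<^sup>+b. (ennreal (L^2) * k a) * (indicator {fst z..<fst z+L} a * indicator {snd z..<snd z+L} b) \<partial>lborel)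
       = ennreal (L^3) * (k a * indicator {fst z..<fst z+L} a)"
      using L by (simp add: ennreal_mult[symmetric] power2_eq_square power3_eq_cube mult.assoc)
  qed
  also have "\<dots> = ennreal (L^3) * (\<integral>\<^sup>+a. k a * indicator {fst z..<fst z+L} a \<partial>lborel)"
    by (rule nn_integral_cmult) measurable
  also have "(\<integral>\<^sup>+a. k a * indicator {fst z..<fst z+L} a \<partial>lborel) = (\<integral>\<^sup>+x. ennreal ((cmod (g 2 x))^2) * indicator (sqr z L) x \<partial>lborel)"
    unfolding k_def by (subst nn_integral_prod1, measurable, subst nn_integral_multc[symmetric], measurable) (simp add: indicator_sqr mult_ac)
  also have "\<dots> = ennreal (nsq (cut (sqr z L) (g 2)))" by (rule nn_integral_cmod_sq_set[OF l(2)]) simp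
  finally show ?thesis using L by (simp add: ennreal_mult)
qed

lemma nn_integral_line_box1:
  fixes f :: "real \<Rightarrow> ennreal"
  assumes [measurable]: "f \<in> borel_measurable borel" and L: "L > 0"
  shows "(\<integral>\<^sup>+y. f (fst y) * indicator (sqr z L) y \<partial>lborel) = ennreal L * (\<integral>\<^sup>+s. f s * indicator {fst z..<fst z+L} s \<partial>lborel)"
proof -
  have "(\<integral>\<^sup>+y. f (fst y) * indicator (sqr z L) y \<partial>lborel) = (\<integral>\<^sup>+a. \<integral>\<^sup>+b. (f a * indicator {fst z..<fst z+L} a) * indicator {snd z..<snd z+L} b \<partial>lborel \<partial>lborel)"
    by (subst nn_integral_prod1)
       (auto simp: indicator_sqr mult.assoc intro!: borel_measurable_times_ennreal measurable_compose[OF fs_measurable(1) assms(1)])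
  also have "\<dots> = (\<integral>\<^sup>+a. (f a * indicator {fst z..<fst z+L} a) * ennreal L \<partial>lborel)"
    using L by (intro nn_integral_cong) (subst nn_integral_cmult, auto)
  finally show ?thesis by (subst (asm) nn_integral_multc) (measurable, simp add: mult.commute)
qed

lemma nn_integral_line_box2:
  fixes f :: "real \<Rightarrow> ennreal"
  assumes [measurable]: "f \<in> borel_measurable borel" and L: "L > 0"
  shows "(\<integral>\<^sup>+y. f (snd y) * indicator (sqr z L) y \<partial>lborel) = ennreal L * (\<integral>\<^sup>+s. f s * indicator {snd z..<snd z+L} s \<partial>lborel)"
proof -
  have "(\<integral>\<^sup>+y. f (snd y) * indicator (sqr z L) y \<partial>lborel) = (\<integral>\<^sup>+b. \<integral>\<^sup>+a. (f b * indicator {snd z..<snd z+L} b) * indicator {fst z..<fst z+L} a \<partial>lborel \<partial>lborel)"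
    by (subst nn_integral_prod2)
       (auto simp: indicator_sqr mult_ac intro!: borel_measurable_times_ennreal measurable_compose[OF fs_measurable(2) assms(1)])
  also have "\<dots> = (\<integral>\<^sup>+b. (f b * indicator {snd z..<snd z+L} b) * ennreal L \<partial>lborel)"
    using L by (intro nn_integral_cong) (subst nn_integral_cmult, auto)
  finally show ?thesis by (subst (asm) nn_integral_multc) (measurable, simp add: mult.commute)
qed

lemma sq_norm_add_le_two: "(cmod (a + b))^2 \<le> 2 * (cmod a)^2 + 2 * (cmod b)^2"
proof -
  have "(cmod (a + b))^2 \<le> (cmod a + cmod b)^2"
    by (intro power_mono norm_triangle_ineq) auto
  then show ?thesis using sum_squares_bound[of "cmod a" "cmod b"] by (simp add: power2_sum)
qed

text \<open>The points x and y are joined through the corner (y1, x2), one horizontal and one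
  vertical step. The free coordinate contributes a factor \<open>L\<close> and squaring the sum a
  factor 2, on top of the L^3 of each directional estimate.\<close>

lemma poincare_pairs:
  assumes S: "sob u g" and L: "L > 0"
  shows "(\<integral>\<^sup>+x. (\<integral>\<^sup>+y. ennreal ((cmod (u x - u y))^2) * indicator (sqr z L) y \<partial>lborel) * indicator (sqr z L) x \<partial>lborel)
    \<le> ennreal (2 * L^4 * (nsq (cut (sqr z L) (g 1)) + nsq (cut (sqr z L) (g 2))))"
proof -
  note [measurable] = sob_l2(1)[OF S, THEN l2_measurable] fs_measurable
  let ?Q = "sqr z L"
  have m4: "(\<lambda>p :: (real\<times>real)\<times>(real\<times>real). u (fst (snd p), snd (fst p))) \<in> borel_measurable borel"
    by (rule measurable_compose[OF borel_measurable_continuous_onI l2_measurable[OF sob_l2(1)[OF S]]])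
       (intro continuous_intros)
  define V1 where "V1 x = (\<integral>\<^sup>+s. ennreal ((cmod (u (s, snd x) - u x))^2) * indicator {fst z..<fst z+L} s \<partial>lborel)" for x
  define V2 where "V2 x = (\<integral>\<^sup>+s. ennreal ((cmod (u (fst x, s) - u x))^2) * indicator {snd z..<snd z+L} s \<partial>lborel)" for x
  have V1: "(\<integral>\<^sup>+y. ennreal (2 * (cmod (u (fst y, snd x) - u x))^2) * indicator ?Q y \<partial>lborel) = ennreal (2 * L) * V1 x" for x
  proof -
    have "(\<integral>\<^sup>+y. ennreal (2 * (cmod (u (fst y, snd x) - u x))^2) * indicator ?Q y \<partial>lborel)
       = ennreal L * (\<integral>\<^sup>+s. ennreal (2 * (cmod (u (s, snd x) - u x))^2) * indicator {fst z..<fst z+L} s \<partial>lborel)"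
      by (rule nn_integral_line_box1[OF _ L]) measurable
    also have "(\<integral>\<^sup>+s. ennreal (2 * (cmod (u (s, snd x) - u x))^2) * indicator {fst z..<fst z+L} s \<partial>lborel) = 2 * V1 x"
      unfolding V1_def by (subst nn_integral_cmult[symmetric], measurable) (simp add: ennreal_mult mult.assoc)
    finally show ?thesis using L by (simp add: ennreal_mult mult_ac)
  qed
  have V2: "(\<integral>\<^sup>+x. ennreal (2 * (cmod (u (fst y, snd x) - u y))^2) * indicator ?Q x \<partial>lborel) = ennreal (2 * L) * V2 y" for y
  proof -
    have "(\<integral>\<^sup>+x. ennreal (2 * (cmod (u (fst y, snd x) - u y))^2) * indicator ?Q x \<partial>lborel)
       = ennreal L * (\<integral>\<^sup>+s. ennreal (2 * (cmod (u (fst y, s) - u y))^2) * indicator {snd z..<snd z+L} s \<partial>lborel)"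
      by (rule nn_integral_line_box2[OF _ L]) measurable
    also have "(\<integral>\<^sup>+s. ennreal (2 * (cmod (u (fst y, s) - u y))^2) * indicator {snd z..<snd z+L} s \<partial>lborel) = 2 * V2 y"
      unfolding V2_def by (subst nn_integral_cmult[symmetric], measurable) (simp add: ennreal_mult mult.assoc)
    finally show ?thesis using L by (simp add: ennreal_mult mult_ac)
  qed
  have mV: "(\<lambda>x. V1 x) \<in> borel_measurable borel" "(\<lambda>x. V2 x) \<in> borel_measurable borel"
    unfolding V1_def V2_def by measurable
  note [measurable] = mV
  define T1 where "T1 = (\<lambda>(x, y). ennreal (2 * (cmod (u (fst y, snd x) - u x))^2) * indicator ?Q y * indicator ?Q x)"
  define T2 where "T2 = (\<lambda>(x, y). ennreal (2 * (cmod (u (fst y, snd x) - u y))^2) * indicator ?Q x * indicator ?Q y)"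
  have ux: "(\<lambda>p :: (real\<times>real)\<times>(real\<times>real). u (fst p)) \<in> borel_measurable borel" "(\<lambda>p :: (real\<times>real)\<times>(real\<times>real). u (snd p)) \<in> borel_measurable borel"
    and ix: "(\<lambda>p :: (real\<times>real)\<times>(real\<times>real). indicator ?Q (fst p) :: ennreal) \<in> borel_measurable borel" "(\<lambda>p :: (real\<times>real)\<times>(real\<times>real). indicator ?Q (snd p) :: ennreal) \<in> borel_measurable borel"
    by (rule measurable_compose[OF borel_measurable_continuous_onI] ; (intro continuous_intros | measurable))+
  note [measurable] = m4 ux ix
  have mT: "T1 \<in> borel_measurable (lborel \<Otimes>\<^sub>M lborel)" "T2 \<in> borel_measurable (lborel \<Otimes>\<^sub>M lborel)"
    unfolding T1_def T2_def lborel_prod case_prod_beta by (simp_all, measurable)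
  have "(\<integral>\<^sup>+x. (\<integral>\<^sup>+y. ennreal ((cmod (u x - u y))^2) * indicator ?Q y \<partial>lborel) * indicator ?Q x \<partial>lborel)
     \<le> (\<integral>\<^sup>+x. \<integral>\<^sup>+y. T1 (x, y) + T2 (x, y) \<partial>lborel \<partial>lborel)"
  proof (intro nn_integral_mono)
    fix x
    have "(\<integral>\<^sup>+y. ennreal ((cmod (u x - u y))^2) * indicator ?Q y \<partial>lborel) * indicator ?Q x = (\<integral>\<^sup>+y. ennreal ((cmod (u x - u y))^2) * indicator ?Q y * indicator ?Q x \<partial>lborel)"
      by (rule nn_integral_multc[symmetric]) measurable
    also have "\<dots> \<le> (\<integral>\<^sup>+y. T1 (x, y) + T2 (x, y) \<partial>lborel)"
    proof (intro nn_integral_mono)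
      fix y
      have "ennreal ((cmod (u x - u y))^2) \<le> ennreal (2 * (cmod (u (fst y, snd x) - u x))^2) + ennreal (2 * (cmod (u (fst y, snd x) - u y))^2)"
        using sq_norm_add_le_two[of "u x - u (fst y, snd x)" "u (fst y, snd x) - u y"]
        by (simp add: ennreal_plus[symmetric] norm_minus_commute del: ennreal_plus)
      then show "ennreal ((cmod (u x - u y))^2) * indicator ?Q y * indicator ?Q x \<le> T1 (x, y) + T2 (x, y)"
        by (auto simp: T1_def T2_def indicator_def)
    qed
    finally show "(\<integral>\<^sup>+y. ennreal ((cmod (u x - u y))^2) * indicator ?Q y \<partial>lborel) * indicator ?Q x \<le> (\<integral>\<^sup>+y. T1 (x, y) + T2 (x, y) \<partial>lborel)" .
  qed
  also have "\<dots> = (\<integral>\<^sup>+x. \<integral>\<^sup>+y. T1 (x, y) \<partial>lborel \<partial>lborel) + (\<integral>\<^sup>+x. \<integral>\<^sup>+y. T2 (x, y) \<partial>lborel \<partial>lborel)"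
    using mT by (subst nn_integral_add[symmetric]; (subst nn_integral_add)?) (auto intro: lborel.borel_measurable_nn_integral_fst)
  also have "(\<integral>\<^sup>+x. \<integral>\<^sup>+y. T2 (x, y) \<partial>lborel \<partial>lborel) = (\<integral>\<^sup>+y. \<integral>\<^sup>+x. T2 (x, y) \<partial>lborel \<partial>lborel)"
    by (rule lborel_pair.Fubini[OF mT(2), symmetric])
  also have "\<dots> = (\<integral>\<^sup>+y. ennreal (2 * L) * (V2 y * indicator ?Q y) \<partial>lborel)"
    unfolding T2_def by (intro nn_integral_cong) (simp, subst nn_integral_multc, measurable, simp add: V2 mult.assoc)
  also have "\<dots> = ennreal (2 * L) * (\<integral>\<^sup>+y. V2 y * indicator ?Q y \<partial>lborel)"
    by (rule nn_integral_cmult) measurable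
  also have "(\<integral>\<^sup>+x. \<integral>\<^sup>+y. T1 (x, y) \<partial>lborel \<partial>lborel) = (\<integral>\<^sup>+x. ennreal (2 * L) * (V1 x * indicator ?Q x) \<partial>lborel)"
    unfolding T1_def by (intro nn_integral_cong) (simp, subst nn_integral_multc, measurable, simp add: V1 mult.assoc)
  also have "\<dots> = ennreal (2 * L) * (\<integral>\<^sup>+x. V1 x * indicator ?Q x \<partial>lborel)"
    by (rule nn_integral_cmult) measurable
  also have "\<dots> + ennreal (2 * L) * (\<integral>\<^sup>+y. V2 y * indicator ?Q y \<partial>lborel)
     \<le> ennreal (2 * L) * ennreal (L^3 * nsq (cut ?Q (g 1))) + ennreal (2 * L) * ennreal (L^3 * nsq (cut ?Q (g 2)))"
    unfolding V1_def V2_def by (intro add_mono mult_left_mono poincare_dir1 poincare_dir2 S L) auto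
  also have "\<dots> = ennreal (2 * L * (L^3 * nsq (cut ?Q (g 1))) + 2 * L * (L^3 * nsq (cut ?Q (g 2))))"
    using L by (intro ennreal_lincomb[symmetric]) auto
  also have "2 * L * (L^3 * nsq (cut ?Q (g 1))) + 2 * L * (L^3 * nsq (cut ?Q (g 2))) = 2 * L^4 * (nsq (cut ?Q (g 1)) + nsq (cut ?Q (g 2)))"
    by (simp add: algebra_simps power_numeral_reduce)
  finally show ?thesis by simp
qed

lemma sqr_subset_qbox: "\<exists>R. sqr z L \<subseteq> qbox R"
proof
  show "sqr z L \<subseteq> qbox (\<bar>fst z\<bar> + \<bar>snd z\<bar> + \<bar>L\<bar>)"
    by (auto simp: sqr_def qbox_def)
qed

lemma cut_sqr_integrable: assumes "l2 f" shows "integrable lborel (cut (sqr z L) f)"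
proof -
  obtain R where R: "sqr z L \<subseteq> qbox R" using sqr_subset_qbox by blast
  have "integrable lborel (cut (qbox R) (cut (sqr z L) f))"
    by (rule l2_cut_integrable[OF l2_cut[OF assms sqr_sets]])
  moreover have "cut (qbox R) (cut (sqr z L) f) = cut (sqr z L) f" using R by (auto simp: cut_def fun_eq_iff)
  ultimately show ?thesis by simp
qed

text \<open>L^2 times u(x) minus the mean is the integral of u(x) - u(y) over the square, so
  Cauchy-Schwarz and \<open>poincare_pairs\<close> control the oscillation. The mean is left as a
  separate term because the compactness proof makes it converge along a subsequence.\<close>

lemma poincare_square:
  assumes S: "sob u g" and L: "L > 0"
  shows "nsq (cut (sqr z L) u) \<le> 2 / L^2 * (cmod (LINT x|lborel. cut (sqr z L) u x))^2
    + 4 * L^2 * (nsq (cut (sqr z L) (g 1)) + nsq (cut (sqr z L) (g 2)))"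
proof -
  note l = sob_l2(1)[OF S]
  note [measurable] = l[THEN l2_measurable]
  let ?Q = "sqr z L" and ?N = "nsq (cut (sqr z L) (g 1)) + nsq (cut (sqr z L) (g 2))"
  have L2: "L^2 > 0" using L by simp
  have em: "emeasure lborel ?Q = ennreal (L^2)" by (rule emeasure_sqr[OF L])
  define I where "I = (LINT x|lborel. cut ?Q u x)"
  define V where "V x = (\<integral>\<^sup>+y. ennreal ((cmod (u x - u y))^2) * indicator ?Q y \<partial>lborel)" for x
  have mV[measurable]: "V \<in> borel_measurable borel" unfolding V_def[abs_def] by measurable
  have pw: "ennreal ((cmod (u x))^2) \<le> ennreal (2 / L^2) * V x + ennreal (2 / L^4 * (cmod I)^2)" for x
  proof -
    define m where "m = I /\<^sub>R L^2"
    have one: "integrable lborel (\<lambda>y. indicat_real ?Q y *\<^sub>R u x)" "(LINT y|lborel. indicat_real ?Q y *\<^sub>R u x) = L^2 *\<^sub>R u x"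
      using em by (auto simp: measure_def)
    have "(LINT y|lborel. indicat_real ?Q y *\<^sub>R u x - cut ?Q u y) = L^2 *\<^sub>R (u x - m)"
      using L2 by (subst Bochner_Integration.integral_diff[OF one(1) cut_sqr_integrable[OF l]]) (simp add: one(2) I_def[symmetric] m_def scaleR_diff_right)
    then have "ennreal (L^2 * cmod (u x - m)) = ennreal (cmod (LINT y|lborel. indicat_real ?Q y *\<^sub>R u x - cut ?Q u y))"
      by simp
    also have "\<dots> \<le> (\<integral>\<^sup>+y. ennreal (cmod (indicat_real ?Q y *\<^sub>R u x - cut ?Q u y)) \<partial>lborel)" by (rule norm_LINT_le_nn)
    also have "\<dots> = (\<integral>\<^sup>+y. ennreal (cmod (u x - u y)) * indicator ?Q y \<partial>lborel)"
      by (intro nn_integral_cong) (auto simp: cut_def indicator_def)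
    finally have "(ennreal (L^2 * cmod (u x - m)))^2 \<le> (\<integral>\<^sup>+y. ennreal (cmod (u x - u y)) * indicator ?Q y \<partial>lborel)^2"
      by (rule power_mono) simp
    also have "\<dots> \<le> emeasure lborel ?Q * (\<integral>\<^sup>+y. (ennreal (cmod (u x - u y)))^2 * indicator ?Q y \<partial>lborel)"
      by (rule nn_cauchy_schwarz_set) measurable
    also have "\<dots> = ennreal (L^2) * V x" unfolding em V_def by (simp add: ennreal_power)
    finally have 1: "ennreal (L^4 * (cmod (u x - m))^2) \<le> ennreal (L^2) * V x"
      using L by (simp add: ennreal_power power_mult_distrib power_mult[symmetric])
    have "ennreal (2 * (cmod (u x - m))^2) = ennreal (2 / L^4) * ennreal (L^4 * (cmod (u x - m))^2)"
      using L by (simp add: ennreal_mult[symmetric])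
    also have "\<dots> \<le> ennreal (2 / L^4) * (ennreal (L^2) * V x)" by (intro mult_left_mono 1) simp
    also have "\<dots> = ennreal (2 / L^2) * V x"
      using L by (simp add: mult.assoc[symmetric] ennreal_mult[symmetric] power_numeral_reduce)
    finally have 2: "ennreal (2 * (cmod (u x - m))^2) \<le> ennreal (2 / L^2) * V x" .
    have inv4: "(inverse (L^2))^2 = inverse (L^4)" by (simp add: power_inverse flip: power_mult)
    have "ennreal ((cmod (u x))^2) \<le> ennreal (2 * (cmod (u x - m))^2 + 2 * (cmod m)^2)"
      using sq_norm_add_le_two[of "u x - m" m] by (intro ennreal_leI) simp
    also have "\<dots> = ennreal (2 * (cmod (u x - m))^2) + ennreal (2 / L^4 * (cmod I)^2)"
      using L inv4 by (simp add: m_def power_mult_distrib power_divide divide_inverse power_mult[symmetric] mult_ac)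
    finally show ?thesis using 2 by (meson add_right_mono order_trans)
  qed
  have "ennreal (nsq (cut ?Q u)) = (\<integral>\<^sup>+x. ennreal ((cmod (u x))^2) * indicator ?Q x \<partial>lborel)"
    by (rule nn_integral_cmod_sq_set[symmetric, OF l]) simp
  also have "\<dots> \<le> (\<integral>\<^sup>+x. ennreal (2 / L^2) * (V x * indicator ?Q x) + ennreal (2 / L^4 * (cmod I)^2) * indicator ?Q x \<partial>lborel)"
  proof (intro nn_integral_mono)
    fix x show "ennreal ((cmod (u x))^2) * indicator ?Q x \<le> ennreal (2 / L^2) * (V x * indicator ?Q x) + ennreal (2 / L^4 * (cmod I)^2) * indicator ?Q x"
      using pw[of x] by (cases "x \<in> ?Q") auto
  qed
  also have "\<dots> = ennreal (2 / L^2) * (\<integral>\<^sup>+x. V x * indicator ?Q x \<partial>lborel) + ennreal (2 / L^4 * (cmod I)^2) * ennreal (L^2)"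
    by (simp add: nn_integral_add nn_integral_cmult em)
  also have "\<dots> \<le> ennreal (2 / L^2) * ennreal (2 * L^4 * ?N) + ennreal (2 / L^4 * (cmod I)^2) * ennreal (L^2)"
    unfolding V_def by (intro add_right_mono mult_left_mono poincare_pairs S L) simp
  also have "\<dots> = ennreal (2 / L^2 * (2 * L^4 * ?N) + (2 / L^4 * (cmod I)^2) * L^2)"
    by (rule ennreal_lincomb[symmetric]) auto
  also have "2 / L^2 * (2 * L^4 * ?N) + (2 / L^4 * (cmod I)^2) * L^2 = 2 / L^2 * (cmod I)^2 + 4 * L^2 * ?N"
    using L by (simp add: field_simps power_numeral_reduce)
  finally show ?thesis unfolding I_def by (subst (asm) ennreal_le_iff) auto
qed

section \<open>Rellich compactness through cell integrals\<close>

definition cell :: "nat \<Rightarrow> int \<Rightarrow> int \<Rightarrow> (real \<times> real) set" where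
  "cell k i j = sqr (of_int i / real (Suc k), of_int j / real (Suc k)) (1 / real (Suc k))"

lemma cell_sets[simp, measurable]: "cell k i j \<in> sets borel"
  by (simp add: cell_def)

text \<open>Half-open cells partition the plane and are indexed by floors; hence the exact sums in
  \<open>grid_sum\<close> and \<open>nsq_grid\<close>.\<close>

lemma mem_cell: "x \<in> cell k i j \<longleftrightarrow> i = \<lfloor>fst x * real (Suc k)\<rfloor> \<and> j = \<lfloor>snd x * real (Suc k)\<rfloor>"
proof -
  have *: "a \<in> {of_int i / real (Suc k)..<of_int i / real (Suc k) + 1 / real (Suc k)} \<longleftrightarrow> i = \<lfloor>a * real (Suc k)\<rfloor>" for a :: real and i
  proof -
    have "a \<in> {of_int i / real (Suc k)..<of_int i / real (Suc k) + 1 / real (Suc k)} \<longleftrightarrow> of_int i \<le> a * real (Suc k) \<and> a * real (Suc k) < of_int i + 1"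
      by (simp add: add_divide_distrib[symmetric] pos_divide_le_eq pos_less_divide_eq del: of_nat_Suc)
    then show ?thesis by (metis floor_eq_iff)
  qed
  show ?thesis using *[of "fst x" i] *[of "snd x" j] unfolding cell_def sqr_def mem_Times_iff by simp
qed

definition grid :: "nat \<Rightarrow> nat \<Rightarrow> (int \<times> int) set" where
  "grid m k = {- int (m * Suc k)..<int (m * Suc k)} \<times> {- int (m * Suc k)..<int (m * Suc k)}"

lemma grid_sum:
  fixes c :: real
  shows "(\<Sum>p\<in>grid m k. if x \<in> cell k (fst p) (snd p) then c else 0) = (if x \<in> qbox (real m) then c else 0)"
proof -
  have *: "\<lfloor>a * real (Suc k)\<rfloor> \<in> {- int (m * Suc k)..<int (m * Suc k)} \<longleftrightarrow> a \<in> {- real m..<real m}" for a :: real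
  proof -
    have "- int (m * Suc k) \<le> \<lfloor>a * real (Suc k)\<rfloor> \<longleftrightarrow> - real m * real (Suc k) \<le> a * real (Suc k)"
      by (subst le_floor_iff) (simp add: distrib_left)
    also have "\<dots> \<longleftrightarrow> - real m \<le> a" by (rule mult_le_cancel_right_pos) simp
    finally have 1: "- int (m * Suc k) \<le> \<lfloor>a * real (Suc k)\<rfloor> \<longleftrightarrow> - real m \<le> a" .
    have "\<lfloor>a * real (Suc k)\<rfloor> < int (m * Suc k) \<longleftrightarrow> a * real (Suc k) < real m * real (Suc k)"
      by (subst floor_less_iff) (simp add: distrib_left)
    also have "\<dots> \<longleftrightarrow> a < real m" by (rule mult_less_cancel_right_pos) simp
    finally show ?thesis using 1 by simp
  qed
  let ?p = "(\<lfloor>fst x * real (Suc k)\<rfloor>, \<lfloor>snd x * real (Suc k)\<rfloor>)"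
  have "(\<Sum>p\<in>grid m k. if x \<in> cell k (fst p) (snd p) then c else 0) = (\<Sum>p\<in>grid m k. if p = ?p then c else 0)"
    by (intro sum.cong refl) (auto simp: mem_cell)
  also have "\<dots> = (if ?p \<in> grid m k then c else 0)"
    by (subst sum.delta) (auto simp: grid_def)
  also have "?p \<in> grid m k \<longleftrightarrow> x \<in> qbox (real m)"
    unfolding grid_def qbox_def mem_Times_iff using * by simp
  finally show ?thesis .
qed

lemma nsq_grid:
  assumes "l2 f" shows "nsq (cut (qbox (real m)) f) = (\<Sum>p\<in>grid m k. nsq (cut (cell k (fst p) (snd p)) f))"
proof -
  have "nsq (cut (qbox (real m)) f) = (LINT x|lborel. (\<Sum>p\<in>grid m k. (cmod (cut (cell k (fst p) (snd p)) f x))^2))"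
    unfolding nsq_def
  proof (intro Bochner_Integration.integral_cong refl)
    fix x
    have "(\<Sum>p\<in>grid m k. (cmod (cut (cell k (fst p) (snd p)) f x))^2) = (\<Sum>p\<in>grid m k. if x \<in> cell k (fst p) (snd p) then (cmod (f x))^2 else 0)"
      by (intro sum.cong) (auto simp: cut_def)
    then show "(cmod (cut (qbox (real m)) f x))^2 = (\<Sum>p\<in>grid m k. (cmod (cut (cell k (fst p) (snd p)) f x))^2)"
      by (simp add: grid_sum cut_def)
  qed
  also have "\<dots> = (\<Sum>p\<in>grid m k. nsq (cut (cell k (fst p) (snd p)) f))"
    unfolding nsq_def by (rule Bochner_Integration.integral_sum) (rule l2_integrable, rule l2_cut[OF assms], simp)
  finally show ?thesis .
qed

text \<open>Finitely many linear functionals, the cell integrals, control the local L2 norm up to an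
  error that a fine mesh makes small uniformly on Dirichlet-bounded sets. This is the total
  boundedness behind Rellich's theorem.\<close>

lemma grid_bound:
  assumes S: "sob u g"
  shows "nsq (cut (qbox (real m)) u) \<le> 2 * (real (Suc k))^2 * (\<Sum>p\<in>grid m k. (cmod (LINT x|lborel. cut (cell k (fst p) (snd p)) u x))^2)
     + 4 / (real (Suc k))^2 * dirichlet g"
proof -
  let ?s = "1 / real (Suc k)"
  have s: "?s > 0" by simp
  note l = sob_l2[OF S]
  have "nsq (cut (qbox (real m)) u) = (\<Sum>p\<in>grid m k. nsq (cut (cell k (fst p) (snd p)) u))"
    by (rule nsq_grid[OF l(1)])
  also have "\<dots> \<le> (\<Sum>p\<in>grid m k. 2 / ?s^2 * (cmod (LINT x|lborel. cut (cell k (fst p) (snd p)) u x))^2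
    + 4 * ?s^2 * (nsq (cut (cell k (fst p) (snd p)) (g 1)) + nsq (cut (cell k (fst p) (snd p)) (g 2))))"
    unfolding cell_def by (intro sum_mono poincare_square S s)
  also have "\<dots> = 2 / ?s^2 * (\<Sum>p\<in>grid m k. (cmod (LINT x|lborel. cut (cell k (fst p) (snd p)) u x))^2)
    + 4 * ?s^2 * (nsq (cut (qbox (real m)) (g 1)) + nsq (cut (qbox (real m)) (g 2)))"
    unfolding nsq_grid[OF l(2), of m k] nsq_grid[OF l(3), of m k] by (simp add: sum.distrib sum_distrib_left distrib_left del: One_nat_def)
  also have "\<dots> \<le> 2 / ?s^2 * (\<Sum>p\<in>grid m k. (cmod (LINT x|lborel. cut (cell k (fst p) (snd p)) u x))^2) + 4 * ?s^2 * dirichlet g"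
    unfolding dirichlet_def by (intro add_left_mono mult_left_mono add_mono nsq_cut_le l qbox_sets) simp
  finally show ?thesis by (simp add: power_divide)
qed

lemma diagonal_convergent:
  fixes X :: "nat \<Rightarrow> nat \<Rightarrow> complex"
  assumes "\<And>i. bounded (range (\<lambda>n. X n i))"
  shows "\<exists>r. strict_mono r \<and> (\<forall>i. convergent (\<lambda>n. X (r n) i))"
proof -
  interpret subseqs "\<lambda>i s. convergent (\<lambda>n. X (s n) i)"
  proof
    fix i and s :: "nat \<Rightarrow> nat" assume "strict_mono s"
    have "bounded (range (\<lambda>n. X (s n) i))" by (rule bounded_subset[OF assms[of i]]) auto
    then obtain l r where "strict_mono r" "((\<lambda>n. X (s n) i) \<circ> r) \<longlonglongrightarrow> l"
      using bounded_imp_convergent_subsequence by blast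
    then show "\<exists>r'. strict_mono r' \<and> convergent (\<lambda>n. X ((s \<circ> r') n) i)"
      by (intro exI[of _ r]) (auto simp: o_def convergent_def)
  qed
  have "convergent (\<lambda>n. X ((diagseq \<circ> ((+) (Suc i))) n) i)" for i
  proof (rule diagseq_holds)
    fix r s :: "nat \<Rightarrow> nat" and n assume r: "strict_mono r" and "convergent (\<lambda>k. X (s k) n)"
    then have "convergent ((\<lambda>k. X (s k) n) \<circ> r)" by (intro convergent_subseq_convergent) auto
    then show "convergent (\<lambda>k. X ((s \<circ> r) k) n)" by (simp add: o_def)
  qed
  then have "convergent (\<lambda>n. X (diagseq (n + Suc i)) i)" for i
    unfolding o_def by (subst add.commute)
  then have "convergent (\<lambda>n. X (diagseq n) i)" for i
    by (rule iffD1[OF convergent_ignore_initial_segment[of "\<lambda>n. X (diagseq n) i" "Suc i"]])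
  then show ?thesis using subseq_diagseq by blast
qed

lemma LINT_cut_sqr_le:
  assumes "l2 f" "L > 0" shows "cmod (LINT x|lborel. cut (sqr z L) f x) \<le> L * sqrt (nsq f)"
proof -
  let ?Q = "sqr z L"
  have one: "l2 (cut ?Q (\<lambda>x. 1))" "nsq (cut ?Q (\<lambda>x. 1)) = L^2"
  proof -
    have i: "integrable lborel (indicat_real ?Q)" using emeasure_sqr[OF assms(2), of z] by simp
    have e: "(cmod (cut ?Q (\<lambda>x. 1) x))^2 = indicat_real ?Q x" for x by (auto simp: cut_def)
    show "l2 (cut ?Q (\<lambda>x. 1))" unfolding l2_def e using i by simp
    show "nsq (cut ?Q (\<lambda>x. 1)) = L^2" unfolding nsq_def e using emeasure_sqr[OF assms(2), of z] assms(2) by (simp add: measure_def)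
  qed
  have "(LINT x|lborel. cut ?Q f x) = (LINT x|lborel. f x * cut ?Q (\<lambda>x. 1) x)"
    by (intro Bochner_Integration.integral_cong) (auto simp: cut_def)
  then have "cmod (LINT x|lborel. cut ?Q f x) \<le> sqrt (nsq f) * sqrt (L^2)"
    using cauchy_schwarz_norm[OF assms(1) one(1)] by (simp add: one(2))
  then show ?thesis using assms(2) by (simp add: mult.commute)
qed

lemma dirichlet_diff_le:
  assumes "sob u g" "sob v h" shows "dirichlet (\<lambda>j x. g j x - h j x) \<le> 2 * dirichlet g + 2 * dirichlet h"
proof -
  have "nsq (\<lambda>x. g 1 x - h 1 x) \<le> 2 * nsq (g 1) + 2 * nsq (h 1)" "nsq (\<lambda>x. g 2 x - h 2 x) \<le> 2 * nsq (g 2) + 2 * nsq (h 2)"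
    by (intro nsq_diff_le sob_l2[OF assms(1)] sob_l2[OF assms(2)])+
  from add_mono[OF this] show ?thesis unfolding dirichlet_def by (simp only: distrib_left ac_simps)
qed

text \<open>The integrals over all cells of all meshes converge along one diagonal subsequence;
  \<open>grid_bound\<close>, applied to differences, then makes it Cauchy in L2 on every
  box.\<close>

lemma rellich:
  fixes un :: "nat \<Rightarrow> cfun" and M :: real
  assumes S: "\<And>n. sob (un n) (gn n)" and M: "\<And>n. nsq (un n) \<le> M" "\<And>n. dirichlet (gn n) \<le> M"
  shows "\<exists>(r :: nat \<Rightarrow> nat) u. strict_mono r \<and> l2 u \<and> nsq u \<le> M \<and> (AE x in lborel. (\<lambda>n. un (r n) x) \<longlonglongrightarrow> u x) \<and>
     (\<forall>k. (\<lambda>n. nsq (cut (qbox (real k)) (\<lambda>x. un (r n) x - u x))) \<longlonglongrightarrow> 0)"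
proof -
  note l = sob_l2(1)[OF S]
  define I where "I n k i j = (LINT x|lborel. cut (cell k i j) (un n) x)" for n k i j
  \<comment> \<open>Enumerates the triples of mesh, column and row, so that one diagonal argument
    treats all cells.\<close>
  define X where "X n q = (let t = (from_nat q :: nat \<times> int \<times> int) in I n (fst t) (fst (snd t)) (snd (snd t)))" for n q
  have bd: "cmod (I n k i j) \<le> sqrt M" for n k i j
  proof -
    have "cmod (I n k i j) \<le> 1 / real (Suc k) * sqrt (nsq (un n))"
      unfolding I_def cell_def by (rule LINT_cut_sqr_le[OF l]) simp
    also have "\<dots> \<le> 1 * sqrt M" using M(1)[of n] by (intro mult_mono real_sqrt_le_mono) auto
    finally show ?thesis by simp
  qed
  have "\<exists>r. strict_mono r \<and> (\<forall>q. convergent (\<lambda>n. X (r n) q))"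
    by (rule diagonal_convergent) (auto simp: bounded_iff X_def Let_def intro!: exI[of _ "sqrt M"] bd)
  then obtain r where r: "strict_mono r" and conv: "\<forall>q. convergent (\<lambda>n. X (r n) q)" by blast
  have convI: "convergent (\<lambda>n. I (r n) k i j)" for k i j
    using conv[rule_format, of "to_nat (k, i, j)"] by (simp add: X_def)
  have cau: "\<exists>N. \<forall>a\<ge>N. \<forall>b\<ge>N. nsq (cut (qbox (real m)) (\<lambda>x. un (r a) x - un (r b) x)) < e" if e: "e > 0" for m e
  proof -
    obtain k0 where k0: "32 * M / e < real k0" using reals_Archimedean2 by blast
    define k where "k = k0"
    \<comment> \<open>The 16 is 4 from \<open>grid_bound\<close> times the bound 2M + 2M on the
      Dirichlet integral of a difference.\<close>
    have k: "16 * M / (real (Suc k))^2 < e / 2"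
    proof -
      have "32 * M < e * real k0" using k0 e by (simp add: field_simps)
      also have "\<dots> \<le> e * (real (Suc k))^2" unfolding k_def using e by (intro mult_left_mono) (auto simp: power2_eq_square algebra_simps)
      finally show ?thesis by (simp add: field_simps)
    qed
    define d where "d a b = 2 * (real (Suc k))^2 * (\<Sum>p\<in>grid m k. (cmod (I (r a) k (fst p) (snd p) - I (r b) k (fst p) (snd p)))^2)" for a b
    have bound: "nsq (cut (qbox (real m)) (\<lambda>x. un (r a) x - un (r b) x)) \<le> d a b + 16 * M / (real (Suc k))^2" for a b
    proof -
      have eq: "(LINT x|lborel. cut (cell k i j) (\<lambda>x. un (r a) x - un (r b) x) x) = I (r a) k i j - I (r b) k i j" for i j
        unfolding I_def cell_def Bochner_Integration.integral_diff[OF cut_sqr_integrable[OF l] cut_sqr_integrable[OF l], symmetric]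
        by (intro Bochner_Integration.integral_cong) (auto simp: cut_def)
      have "nsq (cut (qbox (real m)) (\<lambda>x. un (r a) x - un (r b) x)) \<le> d a b + 4 / (real (Suc k))^2 * dirichlet (\<lambda>j x. gn (r a) j x - gn (r b) j x)"
        using grid_bound[OF sob_diff[OF S S], of m "r a" "r b" k] unfolding eq d_def .
      also have "4 / (real (Suc k))^2 * dirichlet (\<lambda>j x. gn (r a) j x - gn (r b) j x) \<le> 4 / (real (Suc k))^2 * (2 * M + 2 * M)"
        using dirichlet_diff_le[OF S S, of "r a" "r b"] M(2)[of "r a"] M(2)[of "r b"] by (intro mult_left_mono) auto
      finally show ?thesis by simp
    qed
    have "\<exists>N. \<forall>a\<ge>N. \<forall>b\<ge>N. d a b < e / 2"
    proof -
      define l' where "l' p = lim (\<lambda>n. I (r n) k (fst p) (snd p))" for p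
      have lim: "(\<lambda>n. I (r n) k (fst p) (snd p)) \<longlonglongrightarrow> l' p" for p
        unfolding l'_def using convI by (simp add: convergent_LIMSEQ_iff)
      define s where "s a = 4 * (real (Suc k))^2 * (\<Sum>p\<in>grid m k. (cmod (I (r a) k (fst p) (snd p) - l' p))^2)" for a
      have "(\<lambda>a. 4 * (real (Suc k))^2 * (\<Sum>p\<in>grid m k. (cmod (I (r a) k (fst p) (snd p) - l' p))^2)) \<longlonglongrightarrow> 4 * (real (Suc k))^2 * (\<Sum>p\<in>grid m k. (cmod (l' p - l' p))^2)"
        by (intro tendsto_intros lim)
      then have "s \<longlonglongrightarrow> 0" unfolding s_def by simp
      then have "\<forall>\<^sub>F a in sequentially. s a < e / 4" using e by (intro order_tendstoD(2)[of _ 0]) auto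
      then obtain N where N: "\<And>a. a \<ge> N \<Longrightarrow> s a < e / 4" by (auto simp: eventually_sequentially)
      have dle: "d a b \<le> s a + s b" for a b
      proof -
        have "(\<Sum>p\<in>grid m k. (cmod (I (r a) k (fst p) (snd p) - I (r b) k (fst p) (snd p)))^2)
          \<le> (\<Sum>p\<in>grid m k. 2 * (cmod (I (r a) k (fst p) (snd p) - l' p))^2 + 2 * (cmod (I (r b) k (fst p) (snd p) - l' p))^2)"
        proof (rule sum_mono)
          fix p
          show "(cmod (I (r a) k (fst p) (snd p) - I (r b) k (fst p) (snd p)))^2 \<le> 2 * (cmod (I (r a) k (fst p) (snd p) - l' p))^2 + 2 * (cmod (I (r b) k (fst p) (snd p) - l' p))^2"
            using sq_norm_add_le_two[of "I (r a) k (fst p) (snd p) - l' p" "l' p - I (r b) k (fst p) (snd p)"] by (simp add: norm_minus_commute)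
        qed
        then have "d a b \<le> 2 * (real (Suc k))^2 * (\<Sum>p\<in>grid m k. 2 * (cmod (I (r a) k (fst p) (snd p) - l' p))^2 + 2 * (cmod (I (r b) k (fst p) (snd p) - l' p))^2)"
          unfolding d_def by (intro mult_left_mono) auto
        also have "\<dots> = s a + s b" unfolding s_def sum.distrib sum_distrib_left[symmetric] by (simp add: algebra_simps)
        finally show ?thesis .
      qed
      have "d a b < e / 2" if "a \<ge> N" "b \<ge> N" for a b using N[OF that(1)] N[OF that(2)] dle[of a b] by linarith
      then show ?thesis by blast
    qed
    then obtain N where "\<forall>a\<ge>N. \<forall>b\<ge>N. d a b < e / 2" by blast
    note N = this
    have "nsq (cut (qbox (real m)) (\<lambda>x. un (r a) x - un (r b) x)) < e" if "a \<ge> N" "b \<ge> N" for a b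
      using bound[of a b] k N[rule_format, OF that] by linarith
    then show ?thesis by blast
  qed
  have "\<exists>(r' :: nat \<Rightarrow> nat) u. strict_mono r' \<and> u \<in> borel_measurable borel \<and> (AE x in lborel. (\<lambda>n. un (r (r' n)) x) \<longlonglongrightarrow> u x)
     \<and> (\<forall>k. (\<lambda>n. nsq (cut (qbox (real k)) (\<lambda>x. un (r n) x - u x))) \<longlonglongrightarrow> 0)"
    by (rule l2_loc_complete[of "\<lambda>n. un (r n)", OF l cau]) auto
  then obtain r' :: "nat \<Rightarrow> nat" and u where r': "strict_mono r'" and u: "u \<in> borel_measurable borel"
    and ae: "AE x in lborel. (\<lambda>n. un (r (r' n)) x) \<longlonglongrightarrow> u x"
    and lc': "\<forall>k. (\<lambda>n. nsq (cut (qbox (real k)) (\<lambda>x. un (r n) x - u x))) \<longlonglongrightarrow> 0"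
    by auto
  note lc = lc'[rule_format]
  have "l2 u" "nsq u \<le> M" using l2_fatou[OF l always_eventually u ae, of M] M(1) by auto
  moreover have "(\<lambda>n. nsq (cut (qbox (real k)) (\<lambda>x. un (r (r' n)) x - u x))) \<longlonglongrightarrow> 0" for k
    using LIMSEQ_subseq_LIMSEQ[OF lc r'] by (simp add: o_def)
  ultimately show ?thesis using ae strict_mono_o[OF r r']
    by (intro exI[of _ "r \<circ> r'"] exI[of _ u]) (simp add: o_def)
qed

subsection \<open>Weak limits of derivatives\<close>

text \<open>Dyadic convex combinations of members of a tail. Function and derivative are combined
  with the same weights, so a pair remains a function with its weak derivative; midpoints are all
  that the parallelogram identity uses.\<close>

inductive_set mids :: "(nat \<Rightarrow> cfun) \<Rightarrow> (nat \<Rightarrow> cfun) \<Rightarrow> nat \<Rightarrow> (cfun \<times> cfun) set" for f h N where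
  base: "k \<ge> N \<Longrightarrow> (f k, h k) \<in> mids f h N"
| mid: "(a, b) \<in> mids f h N \<Longrightarrow> (a', b') \<in> mids f h N \<Longrightarrow>
    (\<lambda>x. (1/2) * a x + (1/2) * a' x, \<lambda>x. (1/2) * b x + (1/2) * b' x) \<in> mids f h N"

lemma nsq_mid:
  assumes "l2 a" "l2 b"
  shows "nsq (\<lambda>x. (1/2) * a x + (1/2) * b x) = (nsq a + nsq b) / 2 - nsq (\<lambda>x. a x - b x) / 4"
proof -
  have "(\<lambda>x. (1/2) * a x + (1/2) * b x) = (\<lambda>x. of_real (1/2) * (a x + b x))"
    by (simp add: fun_eq_iff field_simps)
  then have "nsq (\<lambda>x. (1/2) * a x + (1/2) * b x) = nsq (\<lambda>x. of_real (1/2) * (a x + b x))"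
    by (simp only:)
  also have "\<dots> = nsq (\<lambda>x. a x + b x) / 4" unfolding nsq_scale by (simp add: power2_eq_square)
  finally show ?thesis using nsq_add[OF assms] nsq_diff[OF assms] by argo
qed

lemma nsq_mid_le:
  assumes "l2 a" "l2 b" "nsq a \<le> C" "nsq b \<le> C" shows "nsq (\<lambda>x. (1/2) * a x + (1/2) * b x) \<le> C"
  unfolding nsq_mid[OF assms(1,2)] using nsq_nonneg[of "\<lambda>x. a x - b x"] assms(3,4) by argo

lemma ip_mid: assumes "l2 p" "l2 a" "l2 b" shows "ip p (\<lambda>x. (1/2) * a x + (1/2) * b x) = (ip p a + ip p b) / 2"
proof -
  have "ip p (\<lambda>x. of_real (1/2) * a x + of_real (1/2) * b x) = ip p (\<lambda>x. of_real (1/2) * a x) + ip p (\<lambda>x. of_real (1/2) * b x)"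
    by (rule ip_add_right[OF l2_cmult[OF assms(2)] l2_cmult[OF assms(3)] assms(1)])
  then show ?thesis unfolding ip_scale_right by simp
qed

lemma mids_props:
  assumes ab: "(a, b) \<in> mids f h N" and l: "\<And>n. l2 (f n)" "\<And>n. l2 (h n)" and w: "\<And>n. wderiv j (f n) (h n)" and j: "j \<in> {1,2}"
  shows "l2 a \<and> l2 b \<and> wderiv j a b"
  using ab
proof induct
  case (base k) then show ?case using l w by blast
next
  case (mid a b a' b')
  then show ?case by (intro conjI l2_add l2_cmult wderiv_add wderiv_cmult j) auto
qed

text \<open>Each of these bounds describes a convex set, so it passes from the tail to all its
  midpoints.\<close>

lemma mids_bounds:
  assumes ab: "(a, b) \<in> mids f h N" and l: "\<And>n. l2 (f n)" "\<And>n. l2 (h n)"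
    and p: "l2 \<psi>" and u: "l2 u" and S[measurable]: "S \<in> sets borel"
    and h1: "\<And>k. k \<ge> N \<Longrightarrow> nsq (h k) \<le> C1" and h2: "\<And>k. k \<ge> N \<Longrightarrow> \<bar>ip \<psi> (h k) - c\<bar> \<le> C2"
    and h3: "\<And>k. k \<ge> N \<Longrightarrow> nsq (cut S (\<lambda>x. f k x - u x)) \<le> C3" and h4: "\<And>k. k \<ge> N \<Longrightarrow> nsq (f k) \<le> C1"
  shows "l2 a \<and> l2 b \<and> nsq b \<le> C1 \<and> nsq a \<le> C1 \<and> \<bar>ip \<psi> b - c\<bar> \<le> C2 \<and> nsq (cut S (\<lambda>x. a x - u x)) \<le> C3"
  using ab
proof induct
  case (base k) then show ?case using l h1 h2 h3 h4 by blast
next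
  case (mid a b a' b')
  have l': "l2 a" "l2 b" "l2 a'" "l2 b'" using mid by auto
  have "nsq (\<lambda>x. (1/2) * cut S (\<lambda>x. a x - u x) x + (1/2) * cut S (\<lambda>x. a' x - u x) x) \<le> C3"
    using mid by (intro nsq_mid_le l2_cut l2_diff l' u S) auto
  moreover have "(\<lambda>x. (1/2) * cut S (\<lambda>x. a x - u x) x + (1/2) * cut S (\<lambda>x. a' x - u x) x) = cut S (\<lambda>x. ((1/2) * a x + (1/2) * a' x) - u x)"
    by (auto simp: cut_def fun_eq_iff field_simps)
  ultimately have "nsq (cut S (\<lambda>x. ((1/2) * a x + (1/2) * a' x) - u x)) \<le> C3" by simp
  moreover have "\<bar>ip \<psi> (\<lambda>x. (1/2) * b x + (1/2) * b' x) - c\<bar> \<le> C2"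
    unfolding ip_mid[OF p l'(2,4)] using mid by (auto simp: abs_le_iff field_simps)
  ultimately show ?case using mid by (intro conjI l2_add l2_cmult nsq_mid_le) auto
qed

lemma mids_antimono:
  assumes "(a, b) \<in> mids f h N'" "N \<le> N'" shows "(a, b) \<in> mids f h N"
  using assms(1)
proof induct
  case (base k) then show ?case using assms(2) by (intro mids.base) simp
next
  case (mid a b a' b') show ?case by (rule mids.mid[OF mid(2,4)])
qed

lemma LINT_mult_tendsto_loc:
  assumes p: "l2 p" and f: "\<And>n. l2 (f n)" and u: "l2 u" and M: "\<And>n. nsq (f n) \<le> M"
    and loc: "\<forall>k. (\<lambda>n. nsq (cut (qbox (real k)) (\<lambda>x. f n x - u x))) \<longlonglongrightarrow> 0"
  shows "(\<lambda>n. LINT x|lborel. f n x * p x) \<longlonglongrightarrow> (LINT x|lborel. u x * p x)"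
    "(\<lambda>n. ip p (f n)) \<longlonglongrightarrow> ip p u"
    "(\<lambda>n. LINT x|lborel. cmod (p x) * cmod (f n x - u x)) \<longlonglongrightarrow> 0"
proof -
  have d: "l2 (\<lambda>x. f n x - u x)" for n by (intro l2_diff f u)
  have Md: "nsq (\<lambda>x. f n x - u x) \<le> 2 * M + 2 * nsq u" for n
    using nsq_diff_le[OF f u, of n] M[of n] by linarith
  show t: "(\<lambda>n. LINT x|lborel. cmod (p x) * cmod (f n x - u x)) \<longlonglongrightarrow> 0"
    by (rule tendsto_pairing_loc[OF p d Md loc[rule_format]])
  show "(\<lambda>n. LINT x|lborel. f n x * p x) \<longlonglongrightarrow> (LINT x|lborel. u x * p x)"
  proof (rule LIM_zero_cancel, rule Lim_null_comparison[OF _ t], rule always_eventually, rule allI)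
    fix n
    have "(LINT x|lborel. f n x * p x) - (LINT x|lborel. u x * p x) = (LINT x|lborel. (f n x - u x) * p x)"
      unfolding left_diff_distrib by (intro Bochner_Integration.integral_diff[symmetric] l2_times_integrable f u p)
    also have "norm \<dots> \<le> (LINT x|lborel. norm ((f n x - u x) * p x))" by (rule integral_norm_bound)
    finally show "norm ((LINT x|lborel. f n x * p x) - (LINT x|lborel. u x * p x)) \<le> (LINT x|lborel. cmod (p x) * cmod (f n x - u x))"
      by (simp add: norm_mult mult.commute)
  qed
  show "(\<lambda>n. ip p (f n)) \<longlonglongrightarrow> ip p u"
  proof (rule LIM_zero_cancel, rule Lim_null_comparison[OF _ t], rule always_eventually, rule allI)
    fix n
    have "ip p (f n) - ip p u = ip p (\<lambda>x. f n x - u x)" by (rule ip_diff_right[symmetric, OF f u p])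
    also have "norm \<dots> \<le> (LINT x|lborel. norm (Re (p x * cnj (f n x - u x))))" unfolding ip_def by (rule integral_norm_bound)
    also have "\<dots> \<le> (LINT x|lborel. cmod (p x) * cmod (f n x - u x))"
      by (rule integral_mono[OF integrable_norm[OF ip_integrable[OF p d]] l2_cmod_mult[OF p d]])
         (simp only: real_norm_def abs_Re_mult_cnj_le)
    finally show "norm (ip p (f n) - ip p u) \<le> (LINT x|lborel. cmod (p x) * cmod (f n x - u x))" .
  qed
qed

lemma wderiv_limit:
  assumes a: "\<And>n. l2 (a n)" "\<And>n. nsq (a n) \<le> M" and u: "l2 u"
    and al: "\<forall>k. (\<lambda>n. nsq (cut (qbox (real k)) (\<lambda>x. a n x - u x))) \<longlonglongrightarrow> 0"
    and b: "\<And>n. l2 (b n)" "\<And>n. nsq (b n) \<le> M'" and v: "l2 v"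
    and bl: "\<forall>k. (\<lambda>n. nsq (cut (qbox (real k)) (\<lambda>x. b n x - v x))) \<longlonglongrightarrow> 0"
    and w: "\<And>n. wderiv j (a n) (b n)" and j: "j \<in> {1,2}"
  shows "wderiv j u v"
  unfolding wderiv_def
proof (intro allI impI)
  fix \<phi> assume phi: "test_fun \<phi>"
  have "(\<lambda>n. LINT x|lborel. a n x * pd j \<phi> x) \<longlonglongrightarrow> (LINT x|lborel. u x * pd j \<phi> x)"
    by (rule LINT_mult_tendsto_loc(1)[OF test_l2(2)[OF phi j] a(1) u a(2) al])
  moreover have "(\<lambda>n. LINT x|lborel. b n x * \<phi> x) \<longlonglongrightarrow> (LINT x|lborel. v x * \<phi> x)"
    by (rule LINT_mult_tendsto_loc(1)[OF test_l2(1)[OF phi] b(1) v b(2) bl])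
  then have "(\<lambda>n. LINT x|lborel. a n x * pd j \<phi> x) \<longlonglongrightarrow> - (LINT x|lborel. v x * \<phi> x)"
    using w phi unfolding wderiv_def by (simp add: tendsto_minus)
  ultimately show "(LINT x|lborel. u x * pd j \<phi> x) = - (LINT x|lborel. v x * \<phi> x)"
    by (rule LIMSEQ_unique)
qed

text \<open>The points of nearly minimal norm in the convex hulls of the tails of \<open>h\<close> form a Cauchy sequence, by the
  parallelogram identity; this replaces weak sequential compactness of the unit ball.\<close>

lemma weak_limit_deriv:
  assumes f: "\<And>n. l2 (f n)" "\<And>n. nsq (f n) \<le> M" and h: "\<And>n. l2 (h n)" "\<And>n. nsq (h n) \<le> M"
    and w: "\<And>n. wderiv j (f n) (h n)" and j: "j \<in> {1,2}" and u: "l2 u" and p: "l2 \<psi>"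
    and loc: "\<forall>k. (\<lambda>n. nsq (cut (qbox (real k)) (\<lambda>x. f n x - u x))) \<longlonglongrightarrow> 0"
    and c: "(\<lambda>n. ip \<psi> (h n)) \<longlonglongrightarrow> c"
  shows "\<exists>v. l2 v \<and> wderiv j u v \<and> ip \<psi> v = c \<and> nsq v \<le> M"
proof -
  \<comment> \<open>The infimal squared norm in the hull of the tail. It increases with
    \<open>N\<close> and stays below \<open>M\<close>, hence converges.\<close>
  define D where "D N = (INF ab\<in>mids f h N. nsq (snd ab))" for N
  have ne: "mids f h N \<noteq> {}" for N using mids.base[of N N f h] by auto
  have bdd: "bdd_below ((\<lambda>ab. nsq (snd ab)) ` mids f h N)" for N by (intro bdd_belowI[of _ 0]) auto
  have D_le: "D N \<le> nsq b" if "(a, b) \<in> mids f h N" for a b N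
    unfolding D_def by (rule cINF_lower2[OF bdd that]) simp
  have D_le_M: "D N \<le> M" for N using D_le[OF mids.base[of N N f h]] h(2)[of N] by simp
  have D_mono: "D N \<le> D N'" if "N \<le> N'" for N N'
    unfolding D_def by (rule cINF_superset_mono[OF ne bdd]) (use mids_antimono[OF _ that] in auto)
  have "\<exists>ab. ab \<in> mids f h N \<and> nsq (snd ab) < D N + 1 / real (Suc N)" for N
  proof -
    have lt: "Inf ((\<lambda>ab. nsq (snd ab)) ` mids f h N) < D N + 1 / real (Suc N)"
      unfolding D_def by (rule less_add_same_cancel1[THEN iffD2]) simp
    have "(\<lambda>ab. nsq (snd ab)) ` mids f h N \<noteq> {}" unfolding image_is_empty by (rule ne)
    from cInf_lessD[OF this lt] obtain y where y: "y \<in> (\<lambda>ab. nsq (snd ab)) ` mids f h N" "y < D N + 1 / real (Suc N)"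
      by (rule bexE)
    from y(1) obtain t where "y = nsq (snd t)" "t \<in> mids f h N" by (rule imageE)
    with y(2) show ?thesis by (intro exI[of _ t] conjI) simp_all
  qed
  then obtain ab where ab: "\<And>N. ab N \<in> mids f h N" "\<And>N. nsq (snd (ab N)) < D N + 1 / real (Suc N)" by metis
  define a where "a N = fst (ab N)" for N
  define b where "b N = snd (ab N)" for N
  have abm: "(a N, b N) \<in> mids f h N" for N using ab(1)[of N] by (simp add: a_def b_def)
  have bD: "nsq (b N) < D N + 1 / real (Suc N)" for N using ab(2) by (simp add: b_def)
  have props: "l2 (a N) \<and> l2 (b N) \<and> wderiv j (a N) (b N)" for N
    by (rule mids_props[OF abm f(1) h(1) w j])
  have la: "l2 (a N)" and lb: "l2 (b N)" and wab: "wderiv j (a N) (b N)" for N using props by auto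
  have "\<exists>d. D \<longlonglongrightarrow> d \<and> (\<forall>N. D N \<le> d)"
  proof -
    obtain d where "D \<longlonglongrightarrow> d" "\<forall>N. D N \<le> d"
      by (rule incseq_convergent[of D M]) (use D_mono D_le_M in \<open>auto simp: incseq_def\<close>)
    then show ?thesis by blast
  qed
  then obtain d where d: "D \<longlonglongrightarrow> d" "\<forall>N. D N \<le> d" by blast
  have cau: "\<exists>N. \<forall>m\<ge>N. \<forall>n\<ge>N. nsq (cut (qbox (real k)) (\<lambda>x. b m x - b n x)) < e" if e: "e > 0" for k e
  proof -
    have "(\<lambda>N. 4 * (d - D N) + 4 * (1 / real (Suc N))) \<longlonglongrightarrow> 4 * (d - d) + 4 * 0"
      by (intro tendsto_intros d(1) LIMSEQ_Suc[OF lim_1_over_n])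
    then have "\<forall>\<^sub>F N in sequentially. 4 * (d - D N) + 4 * (1 / real (Suc N)) < e"
      using e by (intro order_tendstoD(2)[of _ 0]) auto
    then obtain N where N: "4 * (d - D N) + 4 * (1 / real (Suc N)) < e" by (auto simp: eventually_sequentially)
    have "nsq (cut (qbox (real k)) (\<lambda>x. b m x - b n x)) < e" if mn: "m \<ge> N" "n \<ge> N" for m n
    proof -
      \<comment> \<open>The midpoint still belongs to the hull of the tail from \<open>N\<close>.
        Since its squared norm is at least \<open>D N\<close>, the parallelogram identity forces the
        squared distance of \<open>b m\<close> and \<open>b n\<close> below 4 (d - D N) + 4/(N +
        1).\<close>
      have "(\<lambda>x. (1/2) * a m x + (1/2) * a n x, \<lambda>x. (1/2) * b m x + (1/2) * b n x) \<in> mids f h N"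
        by (intro mids.mid mids_antimono[OF abm] mn)
      then have "D N \<le> nsq (\<lambda>x. (1/2) * b m x + (1/2) * b n x)" by (rule D_le)
      also have "\<dots> = (nsq (b m) + nsq (b n)) / 2 - nsq (\<lambda>x. b m x - b n x) / 4" by (rule nsq_mid[OF lb lb])
      finally have 1: "nsq (\<lambda>x. b m x - b n x) \<le> 2 * nsq (b m) + 2 * nsq (b n) - 4 * D N" by argo
      have 2: "nsq (b q) \<le> d + 1 / real (Suc N)" if "q \<ge> N" for q
      proof -
        have "1 / real (Suc q) \<le> 1 / real (Suc N)" using that by (intro divide_left_mono) auto
        then show ?thesis using bD[of q] d(2)[rule_format, of q] by linarith
      qed
      have "nsq (cut (qbox (real k)) (\<lambda>x. b m x - b n x)) \<le> nsq (\<lambda>x. b m x - b n x)"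
        by (intro nsq_cut_le l2_diff lb qbox_sets)
      then show ?thesis using 1 2[OF mn(1)] 2[OF mn(2)] N by argo
    qed
    then show ?thesis by blast
  qed
  have "\<exists>(r :: nat \<Rightarrow> nat) v. strict_mono r \<and> v \<in> borel_measurable borel \<and> (AE x in lborel. (\<lambda>n. b (r n) x) \<longlonglongrightarrow> v x)
     \<and> (\<forall>k. (\<lambda>n. nsq (cut (qbox (real k)) (\<lambda>x. b n x - v x))) \<longlonglongrightarrow> 0)"
    by (rule l2_loc_complete[OF lb cau]) auto
  then obtain r :: "nat \<Rightarrow> nat" and v where r: "strict_mono r" and v: "v \<in> borel_measurable borel"
    and ae: "AE x in lborel. (\<lambda>n. b (r n) x) \<longlonglongrightarrow> v x"
    and bl: "\<forall>k. (\<lambda>n. nsq (cut (qbox (real k)) (\<lambda>x. b n x - v x))) \<longlonglongrightarrow> 0" by auto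
  have bnds: "nsq (b N) \<le> M \<and> nsq (a N) \<le> M" for N
    using mids_bounds[OF abm f(1) h(1) p u qbox_sets[of 0], of N M 0 "SUP k. \<bar>ip \<psi> (h k) - 0\<bar>" "SUP k. nsq (cut (qbox 0) (\<lambda>x. f k x - u x))"] f(2) h(2)
  proof -
    have q1: "\<bar>ip \<psi> (h k) - 0\<bar> \<le> sqrt (nsq \<psi>) * sqrt M" for k
    proof -
      have "\<bar>ip \<psi> (h k)\<bar> \<le> sqrt (nsq \<psi>) * sqrt (nsq (h k))" by (rule ip_cauchy_schwarz[OF p h(1)])
      also have "\<dots> \<le> sqrt (nsq \<psi>) * sqrt M" by (intro mult_left_mono real_sqrt_le_mono h(2)) simp
      finally show ?thesis by simp
    qed
    have q2: "nsq (cut (qbox 0) (\<lambda>x. f k x - u x)) \<le> 2 * M + 2 * nsq u" for k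
      using nsq_cut_le[OF l2_diff[OF f(1) u, of k] qbox_sets[of 0]] nsq_diff_le[OF f(1) u, of k] f(2)[of k] by linarith
    show ?thesis using mids_bounds[OF abm f(1) h(1) p u qbox_sets[of 0] h(2) q1 q2 f(2), of N] by blast
  qed
  have lv: "l2 v" "nsq v \<le> M" using l2_fatou[OF lb always_eventually v ae, of M] bnds by auto
  have al: "\<forall>k. (\<lambda>n. nsq (cut (qbox (real k)) (\<lambda>x. a n x - u x))) \<longlonglongrightarrow> 0"
  proof
    fix k
    show "(\<lambda>n. nsq (cut (qbox (real k)) (\<lambda>x. a n x - u x))) \<longlonglongrightarrow> 0"
    proof (rule tendstoI)
      fix e :: real assume e: "e > 0"
      have "\<forall>\<^sub>F n in sequentially. nsq (cut (qbox (real k)) (\<lambda>x. f n x - u x)) < e / 2"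
        using loc e by (intro order_tendstoD(2)[of _ 0]) auto
      then obtain N where N: "\<And>n. n \<ge> N \<Longrightarrow> nsq (cut (qbox (real k)) (\<lambda>x. f n x - u x)) < e / 2"
        by (auto simp: eventually_sequentially)
      have "nsq (cut (qbox (real k)) (\<lambda>x. a n x - u x)) \<le> e / 2" if n: "n \<ge> N" for n
      proof -
        have q1: "\<bar>ip \<psi> (h k) - 0\<bar> \<le> sqrt (nsq \<psi>) * sqrt M" for k
        proof -
          have "\<bar>ip \<psi> (h k)\<bar> \<le> sqrt (nsq \<psi>) * sqrt (nsq (h k))" by (rule ip_cauchy_schwarz[OF p h(1)])
          also have "\<dots> \<le> sqrt (nsq \<psi>) * sqrt M" by (intro mult_left_mono real_sqrt_le_mono h(2)) simp
          finally show ?thesis by simp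
        qed
        have q2: "nsq (cut (qbox (real k)) (\<lambda>x. f m x - u x)) \<le> e / 2" if "m \<ge> n" for m using N[of m] n that by simp
        show ?thesis using mids_bounds[OF abm f(1) h(1) p u qbox_sets[of "real k"] h(2) q1 q2 f(2), of n] by blast
      qed
      then show "\<forall>\<^sub>F n in sequentially. dist (nsq (cut (qbox (real k)) (\<lambda>x. a n x - u x))) 0 < e"
        unfolding eventually_sequentially dist_real_def
        by (intro exI[of _ N]) (use e in fastforce)
    qed
  qed
  have wv: "wderiv j u v"
    by (rule wderiv_limit[OF la _ u al lb _ lv(1) bl wab j]) (use bnds in auto)
  have "(\<lambda>n. ip \<psi> (b n)) \<longlonglongrightarrow> ip \<psi> v"
    by (rule LINT_mult_tendsto_loc(2)[OF p lb lv(1) _ bl]) (use bnds in auto)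
  moreover have "(\<lambda>n. ip \<psi> (b n)) \<longlonglongrightarrow> c"
  proof (rule tendstoI)
    fix e :: real assume e: "e > 0"
    have "\<forall>\<^sub>F n in sequentially. dist (ip \<psi> (h n)) c < e / 2" by (rule tendstoD[OF c]) (use e in simp)
    then obtain N where N: "\<And>n. n \<ge> N \<Longrightarrow> dist (ip \<psi> (h n)) c < e / 2" by (auto simp: eventually_sequentially)
    have "\<bar>ip \<psi> (b n) - c\<bar> \<le> e / 2" if n: "n \<ge> N" for n
    proof -
      have q1: "\<bar>ip \<psi> (h m) - c\<bar> \<le> e / 2" if "m \<ge> n" for m using N[of m] n that by (simp add: dist_real_def)
      have q2: "nsq (cut (qbox 0) (\<lambda>x. f k x - u x)) \<le> 2 * M + 2 * nsq u" for k
        using nsq_cut_le[OF l2_diff[OF f(1) u, of k] qbox_sets[of 0]] nsq_diff_le[OF f(1) u, of k] f(2)[of k] by linarith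
      show ?thesis using mids_bounds[OF abm f(1) h(1) p u qbox_sets[of 0] h(2) q1 q2 f(2), of n] by blast
    qed
    then show "\<forall>\<^sub>F n in sequentially. dist (ip \<psi> (b n)) c < e"
      unfolding eventually_sequentially dist_real_def
      by (intro exI[of _ N]) (use e in fastforce)
  qed
  ultimately have "ip \<psi> v = c" by (rule LIMSEQ_unique)
  then show ?thesis using lv wv by blast
qed

lemma nsq_g_le_dirichlet: "j \<in> {1,2} \<Longrightarrow> nsq (g j) \<le> dirichlet g"
  unfolding dirichlet_def by auto

text \<open>Along a subsequence kept away from the limit the pairings would accumulate at some
  \<open>c\<close>. By \<open>weak_limit_deriv\<close> this \<open>c\<close> is the pairing with a
  weak derivative of \<open>u\<close>, and weak derivatives are unique almost everywhere.\<close>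

lemma weak_convergence:
  fixes f :: "nat \<Rightarrow> cfun"
  assumes S: "\<And>n. sob (f n) (h n)" and M: "\<And>n. nsq (f n) \<le> M" "\<And>n. dirichlet (h n) \<le> M" and U: "sob u g"
    and loc: "\<forall>k. (\<lambda>n. nsq (cut (qbox (real k)) (\<lambda>x. f n x - u x))) \<longlonglongrightarrow> 0"
    and p: "l2 \<psi>" and j: "j \<in> {1,2}"
  shows "(\<lambda>n. ip \<psi> (h n j)) \<longlonglongrightarrow> ip \<psi> (g j)"
proof (rule ccontr)
  assume "\<not> (\<lambda>n. ip \<psi> (h n j)) \<longlonglongrightarrow> ip \<psi> (g j)"
  then obtain e where e: "e > 0" "\<not> (\<forall>\<^sub>F n in sequentially. dist (ip \<psi> (h n j)) (ip \<psi> (g j)) < e)"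
    unfolding tendsto_iff by blast
  then have "\<exists>\<^sub>F n in sequentially. \<not> dist (ip \<psi> (h n j)) (ip \<psi> (g j)) < e" by (simp add: frequently_def)
  then have "infinite {n. \<not> dist (ip \<psi> (h n j)) (ip \<psi> (g j)) < e}"
    by (simp add: frequently_cofinite[symmetric] cofinite_eq_sequentially)
  then obtain s :: "nat \<Rightarrow> nat" where s: "strict_mono s" "\<forall>n. s n \<in> {n. \<not> dist (ip \<psi> (h n j)) (ip \<psi> (g j)) < e}"
    using infinite_enumerate by blast
  have hM: "nsq (h n j) \<le> M" for n using nsq_g_le_dirichlet[OF j] M(2) order_trans by blast
  have lh: "l2 (h n j)" for n by (rule sob_l2(4)[OF S j])
  have bd: "\<bar>ip \<psi> (h n j)\<bar> \<le> sqrt (nsq \<psi>) * sqrt M" for n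
  proof -
    have "\<bar>ip \<psi> (h n j)\<bar> \<le> sqrt (nsq \<psi>) * sqrt (nsq (h n j))" by (rule ip_cauchy_schwarz[OF p lh])
    also have "\<dots> \<le> sqrt (nsq \<psi>) * sqrt M" by (intro mult_left_mono real_sqrt_le_mono hM) simp
    finally show ?thesis .
  qed
  have "bounded (range (\<lambda>n. ip \<psi> (h (s n) j)))"
    unfolding bounded_iff by (intro exI[of _ "sqrt (nsq \<psi>) * sqrt M"]) (use bd in auto)
  then obtain c s' where s': "strict_mono s'" "((\<lambda>n. ip \<psi> (h (s n) j)) \<circ> s') \<longlonglongrightarrow> c"
    using bounded_imp_convergent_subsequence by blast
  have ss: "strict_mono (s \<circ> s')" by (rule strict_mono_o[OF s(1) s'(1)])
  have "\<exists>v. l2 v \<and> wderiv j u v \<and> ip \<psi> v = c \<and> nsq v \<le> M"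
  proof (rule weak_limit_deriv)
    show "l2 (f ((s \<circ> s') n))" "nsq (f ((s \<circ> s') n)) \<le> M" "l2 (h ((s \<circ> s') n) j)" "nsq (h ((s \<circ> s') n) j) \<le> M"
      "wderiv j (f ((s \<circ> s') n)) (h ((s \<circ> s') n) j)" for n
      by (rule sob_l2(1)[OF S] M(1) lh hM sob_wderiv[OF S j])+
    show "\<forall>k. (\<lambda>n. nsq (cut (qbox (real k)) (\<lambda>x. f ((s \<circ> s') n) x - u x))) \<longlonglongrightarrow> 0"
      using LIMSEQ_subseq_LIMSEQ[OF loc[rule_format] ss] by (simp add: o_def)
    show "(\<lambda>n. ip \<psi> (h ((s \<circ> s') n) j)) \<longlonglongrightarrow> c" using s'(2) by (simp add: o_def)
  qed (rule j sob_l2(1)[OF U] p)+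
  then obtain v where v: "l2 v" "wderiv j u v" "ip \<psi> v = c" by blast
  have "AE x in lborel. v x = g j x"
    by (rule wderiv_unique[OF v(1) sob_l2(4)[OF U j] v(2) sob_wderiv[OF U j]])
  then have "ip \<psi> v = ip \<psi> (g j)"
    by (intro ip_cong_AE l2_measurable v p sob_l2(4)[OF U j]) auto
  then have "((\<lambda>n. ip \<psi> (h (s n) j)) \<circ> s') \<longlonglongrightarrow> ip \<psi> (g j)" using s'(2) v(3) by simp
  then have "\<forall>\<^sub>F n in sequentially. dist (((\<lambda>n. ip \<psi> (h (s n) j)) \<circ> s') n) (ip \<psi> (g j)) < e"
    using e(1) by (rule tendstoD)
  then obtain n where "dist (ip \<psi> (h (s (s' n)) j)) (ip \<psi> (g j)) < e"
    by (auto simp: eventually_sequentially)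
  with s(2) show False by auto
qed

theorem sobolev_compactness:
  fixes un :: "nat \<Rightarrow> cfun"
  assumes S: "\<And>n. sob (un n) (gn n)" and M: "\<And>n. nsq (un n) \<le> M" "\<And>n. dirichlet (gn n) \<le> M"
  shows "\<exists>(r :: nat \<Rightarrow> nat) u g. strict_mono r \<and> sob u g \<and> (AE x in lborel. (\<lambda>n. un (r n) x) \<longlonglongrightarrow> u x) \<and>
     (\<forall>k. (\<lambda>n. nsq (cut (qbox (real k)) (\<lambda>x. un (r n) x - u x))) \<longlonglongrightarrow> 0)"
proof -
  obtain r :: "nat \<Rightarrow> nat" and u where r: "strict_mono r" "l2 u" "AE x in lborel. (\<lambda>n. un (r n) x) \<longlonglongrightarrow> u x"
    "\<forall>k. (\<lambda>n. nsq (cut (qbox (real k)) (\<lambda>x. un (r n) x - u x))) \<longlonglongrightarrow> 0"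
    using rellich[of un gn M, OF S M] by blast
  have "\<exists>v. l2 v \<and> wderiv j u v" if j: "j \<in> {1,2}" for j
  proof -
    have hM: "nsq (gn n j) \<le> M" for n using nsq_g_le_dirichlet[OF j] M(2) order_trans by blast
    \<comment> \<open>Only the existence of a weak derivative is wanted, so the pairing is taken
      with the zero function.\<close>
    have "\<exists>v. l2 v \<and> wderiv j u v \<and> ip (\<lambda>x. 0) v = 0 \<and> nsq v \<le> M"
      by (rule weak_limit_deriv[where f="\<lambda>n. un (r n)" and h="\<lambda>n. gn (r n) j", OF sob_l2(1)[OF S] M(1) sob_l2(4)[OF S j] hM sob_wderiv[OF S j] j r(2) l2_zero r(4)])
         (simp add: ip_def)
    then show ?thesis by blast
  qed
  then obtain g1 g2 where g: "l2 g1" "wderiv 1 u g1" "l2 g2" "wderiv 2 u g2" by (metis insertI1 insertI2)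
  define g where "g j = (if j = (1::nat) then g1 else g2)" for j
  have "sob u g" unfolding sob_def g_def using g r(2) by auto
  then show ?thesis using r by blast
qed

subsection \<open>The gauge field and the energy\<close>

lemma measurable_G[measurable]: "G k \<in> borel_measurable borel"
proof -
  note [measurable] = fs_measurable
  show ?thesis unfolding G_def[abs_def] by (cases "k = 1") (simp_all, measurable)
qed

lemma G_bound: "\<bar>G k w\<bar> \<le> 1 / (6 * norm w)"
proof (cases "w = 0")
  case False
  have "\<bar>if k = 1 then fst w else snd w\<bar> \<le> norm w"
    using norm_snd_le[of "snd w" "fst w"] norm_fst_le[of "fst w" "snd w"] by auto
  then have "\<bar>G k w\<bar> \<le> (1 / (2 * pi)) * norm w / (norm w)\<^sup>2"
    unfolding G_def by (simp add: abs_mult divide_right_mono)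
  also have "\<dots> = 1 / (2 * pi * norm w)" using False by (simp add: power2_eq_square)
  also have "\<dots> \<le> 1 / (6 * norm w)"
    using False pi_gt3 by (intro divide_left_mono mult_right_mono mult_pos_pos) auto
  finally show ?thesis .
qed (simp add: G_def)

definition Gconv :: "nat \<Rightarrow> cfun \<Rightarrow> cfun \<Rightarrow> real \<times> real \<Rightarrow> real" where
  "Gconv k a b z = (LINT y|lborel. G k (z - y) * Re (a y * cnj (b y)))"

text \<open>Polarised gauge field: \<open>A j u = Ab j u u\<close>.\<close>

definition Ab :: "nat \<Rightarrow> cfun \<Rightarrow> cfun \<Rightarrow> real \<times> real \<Rightarrow> real" where
  "Ab j a b z = (if j = 1 then - Gconv 2 a b z / 2 else Gconv 1 a b z / 2)"

text \<open>Cauchy-Schwarz with the weight 1/|z - y| shared evenly between the two factors.\<close>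

lemma hardy_pair_integrable:
  assumes "sob a g" "sob b h"
  shows "integrable lborel (\<lambda>y. cmod (a y) * cmod (b y) / norm (z - y))"
    "(LINT y|lborel. cmod (a y) * cmod (b y) / norm (z - y)) \<le> sqrt (hardy a z) * sqrt (hardy b z)"
proof -
  note [measurable] = l2_measurable[OF sob_l2(1)[OF assms(1)]] l2_measurable[OF sob_l2(1)[OF assms(2)]]
  have w: "l2 (\<lambda>y. a y * of_real (1 / sqrt (norm (z - y))))" "nsq (\<lambda>y. a y * of_real (1 / sqrt (norm (z - y)))) = hardy a z"
    if S: "sob a g" for a g
  proof -
    have [measurable]: "a \<in> borel_measurable borel" by (rule l2_measurable[OF sob_l2(1)[OF S]])
    have e: "(cmod (a y * of_real (1 / sqrt (norm (z - y)))))^2 = (cmod (a y))^2 / norm (z - y)" for y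
      by (simp add: norm_mult power_mult_distrib norm_divide power_divide)
    show "l2 (\<lambda>y. a y * of_real (1 / sqrt (norm (z - y))))"
      unfolding l2_def e using hardy_bounds(1)[OF S, of 1 1 z] by simp
    show "nsq (\<lambda>y. a y * of_real (1 / sqrt (norm (z - y)))) = hardy a z"
      unfolding nsq_def e hardy_def ..
  qed
  have e: "cmod (a y * of_real (1 / sqrt (norm (z - y)))) * cmod (b y * of_real (1 / sqrt (norm (z - y)))) = cmod (a y) * cmod (b y) / norm (z - y)" for y
    by (simp add: norm_mult norm_divide real_sqrt_mult_self flip: power2_eq_square)
  show "integrable lborel (\<lambda>y. cmod (a y) * cmod (b y) / norm (z - y))"
    using l2_cmod_mult[OF w(1)[OF assms(1)] w(1)[OF assms(2)]] unfolding e .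
  show "(LINT y|lborel. cmod (a y) * cmod (b y) / norm (z - y)) \<le> sqrt (hardy a z) * sqrt (hardy b z)"
    using cauchy_schwarz_cmod[OF w(1)[OF assms(1)] w(1)[OF assms(2)]] unfolding e w(2)[OF assms(1)] w(2)[OF assms(2)] .
qed

lemma Gconv_integrable:
  assumes S: "sob a g" "sob b h" shows "integrable lborel (\<lambda>y. G k (z - y) * Re (a y * cnj (b y)))"
    and "\<bar>Gconv k a b z\<bar> \<le> sqrt (hardy a z) * sqrt (hardy b z) / 6"
proof -
  note [measurable] = l2_measurable[OF sob_l2(1)[OF S(1)]] l2_measurable[OF sob_l2(1)[OF S(2)]]
  note hi = hardy_pair_integrable[OF S, of z]
  have le: "\<bar>G k (z - y) * Re (a y * cnj (b y))\<bar> \<le> cmod (a y) * cmod (b y) / norm (z - y) * (1/6)" for y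
  proof -
    have "\<bar>G k (z - y) * Re (a y * cnj (b y))\<bar> \<le> 1 / (6 * norm (z - y)) * (cmod (a y) * cmod (b y))"
      unfolding abs_mult by (intro mult_mono G_bound abs_Re_mult_cnj_le) auto
    then show ?thesis by (simp add: mult.commute)
  qed
  have hi6: "integrable lborel (\<lambda>y. cmod (a y) * cmod (b y) / norm (z - y) * (1/6))"
    by (intro integrable_mult_left hi(1))
  show i: "integrable lborel (\<lambda>y. G k (z - y) * Re (a y * cnj (b y)))"
  proof (rule Bochner_Integration.integrable_bound[OF hi6])
    have "(\<lambda>y. Re (a y * cnj (b y))) \<in> borel_measurable borel" by measurable
    then show "(\<lambda>y. G k (z - y) * Re (a y * cnj (b y))) \<in> borel_measurable lborel" by measurable
    show "AE y in lborel. norm (G k (z - y) * Re (a y * cnj (b y))) \<le> norm (cmod (a y) * cmod (b y) / norm (z - y) * (1/6))"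
      by (intro AE_I2) (simp only: real_norm_def order_trans[OF le abs_ge_self])
  qed
  have "\<bar>Gconv k a b z\<bar> \<le> (LINT y|lborel. \<bar>G k (z - y) * Re (a y * cnj (b y))\<bar>)"
    unfolding Gconv_def using integral_norm_bound[of lborel "\<lambda>y. G k (z - y) * Re (a y * cnj (b y))"] by simp
  also have "\<dots> \<le> (LINT y|lborel. cmod (a y) * cmod (b y) / norm (z - y) * (1/6))"
    using i by (intro integral_mono le hi6 integrable_abs)
  also have "\<dots> = (LINT y|lborel. cmod (a y) * cmod (b y) / norm (z - y)) * (1/6)" by (rule integral_mult_left_zero)
  also have "\<dots> \<le> (sqrt (hardy a z) * sqrt (hardy b z)) * (1/6)" by (intro mult_right_mono hi(2)) simp
  finally show "\<bar>Gconv k a b z\<bar> \<le> sqrt (hardy a z) * sqrt (hardy b z) / 6" by simp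
qed

lemma Gconv_measurable:
  assumes [measurable]: "a \<in> borel_measurable borel" "b \<in> borel_measurable borel"
  shows "Gconv k a b \<in> borel_measurable borel"
proof -
  have 1: "(\<lambda>y. Re (a y * cnj (b y))) \<in> borel_measurable borel" by measurable
  have "(\<lambda>p :: (real\<times>real) \<times> (real\<times>real). G k (fst p - snd p) * Re (a (snd p) * cnj (b (snd p)))) \<in> borel_measurable borel"
  proof (rule borel_measurable_times)
    show "(\<lambda>p :: (real\<times>real) \<times> (real\<times>real). G k (fst p - snd p)) \<in> borel_measurable borel"
      by (rule measurable_compose[OF borel_measurable_continuous_onI measurable_G]) (intro continuous_intros)
    show "(\<lambda>p :: (real\<times>real) \<times> (real\<times>real). Re (a (snd p) * cnj (b (snd p)))) \<in> borel_measurable borel"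
      by (rule measurable_compose[OF borel_measurable_continuous_onI 1]) (intro continuous_intros)
  qed
  then have "(\<lambda>p. G k (fst p - snd p) * Re (a (snd p) * cnj (b (snd p)))) \<in> borel_measurable (lborel \<Otimes>\<^sub>M lborel)"
    unfolding lborel_prod by simp
  then have "(\<lambda>z. LINT y|lborel. G k (fst (z, y) - snd (z, y)) * Re (a (snd (z, y)) * cnj (b (snd (z, y))))) \<in> borel_measurable lborel"
    by (intro lborel.borel_measurable_lebesgue_integral) (simp add: case_prod_beta)
  then show ?thesis unfolding Gconv_def[abs_def] by simp
qed

lemma Ab_measurable[measurable]:
  assumes "a \<in> borel_measurable borel" "b \<in> borel_measurable borel" shows "Ab j a b \<in> borel_measurable borel"
proof -
  note [measurable] = Gconv_measurable[OF assms]
  show ?thesis unfolding Ab_def[abs_def] by (cases "j = 1") (simp_all, measurable)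
qed

lemma Ab_bound:
  assumes S: "sob a g" "sob b h" shows "\<bar>Ab j a b z\<bar> \<le> sqrt (hardy a z) * sqrt (hardy b z) / 12"
  using Gconv_integrable(2)[OF S, of 2 z] Gconv_integrable(2)[OF S, of 1 z] unfolding Ab_def by (auto simp: abs_divide)

lemma Ab_add_left:
  assumes S: "sob a g" "sob a' g'" "sob b h" shows "Ab j (\<lambda>x. a x + a' x) b z = Ab j a b z + Ab j a' b z"
proof -
  have "Gconv k (\<lambda>x. a x + a' x) b z = Gconv k a b z + Gconv k a' b z" for k
    unfolding Gconv_def
    by (subst Bochner_Integration.integral_add[symmetric, OF Gconv_integrable(1)[OF S(1,3)] Gconv_integrable(1)[OF S(2,3)]])
       (simp only: distrib_right distrib_left plus_complex.sel)
  then show ?thesis by (auto simp: Ab_def field_simps)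
qed

lemma Gconv_commute: "Gconv k a b z = Gconv k b a z"
  unfolding Gconv_def by (intro Bochner_Integration.integral_cong refl) (simp add: mult.commute)

lemma Ab_commute: "Ab j a b z = Ab j b a z"
  unfolding Ab_def by (simp add: Gconv_commute)

lemma Ab_add_right:
  assumes S: "sob a g" "sob a' g'" "sob b h" shows "Ab j b (\<lambda>x. a x + a' x) z = Ab j b a z + Ab j b a' z"
  using Ab_add_left[OF S] by (simp add: Ab_commute)

lemma Ab_scale_left: "Ab j (\<lambda>x. of_real c * a x) b z = c * Ab j a b z"
proof -
  have "Gconv k (\<lambda>x. of_real c * a x) b z = c * Gconv k a b z" for k
    unfolding Gconv_def by (subst integral_mult_right_zero[symmetric]) (simp add: mult_ac distrib_left right_diff_distrib)
  then show ?thesis by (simp add: Ab_def)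
qed

lemma Ab_scale_right: "Ab j b (\<lambda>x. of_real c * a x) z = c * Ab j b a z"
  using Ab_scale_left[of j c a b z] by (simp add: Ab_commute)

lemma conv_G_sq:
  assumes [measurable]: "u \<in> borel_measurable borel" shows "conv (G k) (\<lambda>y. (cmod (u y))\<^sup>2) z = Gconv k u u z"
proof -
  have "conv (G k) (\<lambda>y. (cmod (u y))\<^sup>2) z = (LINT y|lborel. G k (z - y) * (cmod (u y))\<^sup>2)"
    unfolding conv_def by (rule integral_completion) measurable
  moreover have "Re (u y * cnj (u y)) = (cmod (u y))^2" for y
    by (simp add: cmod_power2 flip: power2_eq_square)
  ultimately show ?thesis unfolding Gconv_def by simp
qed

lemma A_eq_Ab: assumes "u \<in> borel_measurable borel" shows "A j u z = Ab j u u z"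
  unfolding A_def Ab_def by (simp add: conv_G_sq[OF assms])

text \<open>Here \<open>dcov\<close>, \<open>kinetic\<close>, \<open>pmass\<close> and \<open>en\<close> stand for \<open>D\<^sub>j u\<close>, \<open>\<integral>|Du|\<^sup>2\<close>, \<open>\<integral>|u|\<^sup>p\<close> and \<open>E(u)\<close>, for a function \<open>u\<close> with
  chosen gradient \<open>g\<close>.\<close>

definition dcov :: "nat \<Rightarrow> cfun \<Rightarrow> (nat \<Rightarrow> cfun) \<Rightarrow> cfun" where
  "dcov j u g x = g j x + \<i> * of_real (Ab j u u x) * u x"

definition kinetic :: "cfun \<Rightarrow> (nat \<Rightarrow> cfun) \<Rightarrow> real" where
  "kinetic u g = nsq (dcov 1 u g) + nsq (dcov 2 u g)"

definition pmass :: "real \<Rightarrow> cfun \<Rightarrow> real" where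
  "pmass p u = (LINT x|lborel. cmod (u x) powr p)"

definition en :: "real \<Rightarrow> real \<Rightarrow> cfun \<Rightarrow> (nat \<Rightarrow> cfun) \<Rightarrow> real" where
  "en lam p u g = 1/2 * kinetic u g - lam / p * pmass p u"

lemma Ab_self_bound:
  assumes S: "sob u g" shows "\<bar>Ab j u u z\<bar> \<le> hardy u z / 12" "\<bar>Ab j u u z\<bar> \<le> 2 * sqrt (nsq u * dirichlet g)"
proof -
  show 1: "\<bar>Ab j u u z\<bar> \<le> hardy u z / 12"
    using Ab_bound[OF S S, of j z] hardy_nonneg[of u z] by simp
  have "0 \<le> sqrt (nsq u * dirichlet g)" by simp
  then show "\<bar>Ab j u u z\<bar> \<le> 2 * sqrt (nsq u * dirichlet g)" using 1 hardy_le[OF S, of z] by linarith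
qed

lemma l2_bounded_phase_mult:
  assumes f: "l2 f" and a[measurable]: "a \<in> borel_measurable borel" and b: "\<And>x. \<bar>a x\<bar> \<le> C"
  shows "l2 (\<lambda>x. \<i> * of_real (a x) * f x)" "nsq (\<lambda>x. \<i> * of_real (a x) * f x) \<le> C^2 * nsq f"
  using l2_bmult[OF f, of "\<lambda>x. \<i> * of_real (a x)" C] nsq_bmult_le[OF f, of "\<lambda>x. \<i> * of_real (a x)" C] b
  by (simp_all add: norm_mult)

text \<open>The squared supremum of the field is of order \<open>nsq u * dirichlet g\<close>, and
  multiplication by \<open>u\<close> adds a second factor \<open>nsq u\<close>. This quadratic
  smallness in the mass is what makes the magnetic term perturbative.\<close>

lemma Au_l2:
  assumes S: "sob u g"
  shows "l2 (\<lambda>x. \<i> * of_real (Ab j u u x) * u x)"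
    "nsq (\<lambda>x. \<i> * of_real (Ab j u u x) * u x) \<le> 4 * (nsq u)^2 * dirichlet g"
proof -
  note [measurable] = l2_measurable[OF sob_l2(1)[OF S]]
  have m: "Ab j u u \<in> borel_measurable borel" by measurable
  note b = l2_bounded_phase_mult[OF sob_l2(1)[OF S] m Ab_self_bound(2)[OF S]]
  show "l2 (\<lambda>x. \<i> * of_real (Ab j u u x) * u x)" by (rule b(1))
  have "nsq (\<lambda>x. \<i> * of_real (Ab j u u x) * u x) \<le> (2 * sqrt (nsq u * dirichlet g))^2 * nsq u" by (rule b(2))
  then show "nsq (\<lambda>x. \<i> * of_real (Ab j u u x) * u x) \<le> 4 * (nsq u)^2 * dirichlet g"
    by (simp add: power_mult_distrib power2_eq_square mult_ac)
qed

lemma dcov_l2: assumes "sob u g" "j \<in> {1,2}" shows "l2 (dcov j u g)"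
  unfolding dcov_def[abs_def] by (intro l2_add sob_l2(4)[OF assms] Au_l2[OF assms(1)])

lemma dcov12_l2: assumes "sob u g" shows "l2 (dcov 1 u g)" "l2 (dcov 2 u g)"
  by (rule dcov_l2[OF assms], simp)+

lemma kinetic_nonneg[simp]: "0 \<le> kinetic u g" by (simp add: kinetic_def)

lemma dirichlet_le_kinetic:
  assumes S: "sob u g" and c: "nsq u \<le> 1/8" shows "dirichlet g \<le> 4 * kinetic u g"
proof -
  have "nsq (g j) \<le> 2 * nsq (dcov j u g) + 8 * (nsq u)^2 * dirichlet g" if j: "j \<in> {1,2}" for j
  proof -
    have "nsq (\<lambda>x. dcov j u g x - \<i> * of_real (Ab j u u x) * u x) \<le> 2 * nsq (dcov j u g) + 2 * nsq (\<lambda>x. \<i> * of_real (Ab j u u x) * u x)"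
      by (rule nsq_diff_le[OF dcov_l2[OF S j] Au_l2(1)[OF S]])
    then show ?thesis using Au_l2(2)[OF S, of j] by (simp add: dcov_def)
  qed
  from this[of 1] this[of 2] have "dirichlet g \<le> 2 * kinetic u g + 16 * (nsq u)^2 * dirichlet g"
    unfolding kinetic_def dirichlet_def by simp
  \<comment> \<open>The mass threshold enters here: 16/64 = 1/4, so at most half of the Dirichlet
    integral comes from the gauge field and can be absorbed on the left.\<close>
  moreover have "16 * (nsq u)^2 * dirichlet g \<le> 1/2 * dirichlet g"
  proof (rule mult_right_mono)
    have "(nsq u)^2 \<le> (1/8)^2" by (intro power_mono c) simp
    then show "16 * (nsq u)^2 \<le> 1/2" by (simp add: power2_eq_square)
  qed simp
  ultimately show ?thesis by argo
qed

lemma kinetic_le_dirichlet: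
  assumes S: "sob u g" shows "kinetic u g \<le> (2 + 16 * (nsq u)^2) * dirichlet g"
proof -
  have "nsq (dcov j u g) \<le> 2 * nsq (g j) + 2 * (4 * (nsq u)^2 * dirichlet g)" if j: "j \<in> {1,2}" for j
    unfolding dcov_def[abs_def] using nsq_add_le[OF sob_l2(4)[OF S j] Au_l2(1)[OF S], of j] Au_l2(2)[OF S, of j] by linarith
  from this[of 1] this[of 2] show ?thesis unfolding kinetic_def dirichlet_def by (simp add: algebra_simps)
qed

section \<open>The nonlinear term and coercivity\<close>

lemma powr_le_24:
  assumes "2 < p" "p < 4" "(0::real) \<le> t" shows "t powr p \<le> t^2 + t^4"
proof (cases "t \<le> 1")
  case True
  show ?thesis
  proof (cases "t = 0")
    case False
    then have "t powr p \<le> t powr 2" using True assms by (intro powr_mono') auto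
    then show ?thesis using assms False by (simp add: add_increasing2)
  qed simp
next
  case False
  then have "t powr p \<le> t powr 4" using assms by (intro powr_mono) auto
  then show ?thesis using False by (simp add: add_increasing)
qed

lemma pmass_integrable:
  assumes S: "sob u g" and p: "2 < p" "p < 4" shows "integrable lborel (\<lambda>x. cmod (u x) powr p)"
proof -
  note [measurable] = l2_measurable[OF sob_l2(1)[OF S]]
  show ?thesis
    by (rule Bochner_Integration.integrable_bound[OF Bochner_Integration.integrable_add[OF l2_integrable[OF sob_l2(1)[OF S]] sob_L4(1)[OF S]]])
       (use powr_le_24[OF p] in \<open>auto intro!: AE_I2\<close>)
qed

lemma pmass_nonneg: "0 \<le> pmass p u" unfolding pmass_def by (rule Bochner_Integration.integral_nonneg) simp

text \<open>Split at the \<open>T\<close> with T^(p-4) = e: above \<open>T\<close> the fourth power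
  dominates with factor \<open>e\<close>, below it the square with factor T^(p-2).\<close>

lemma powr_interp1:
  assumes p: "2 < p" "p < (4::real)" and e: "e > 0"
  shows "\<exists>C\<ge>0. \<forall>t\<ge>0. t powr p \<le> e * t^4 + C * t^2"
proof -
  define T where "T = e powr (1 / (p - 4))"
  have T: "T > 0" "T powr (p - 4) = e" using e p by (auto simp: T_def powr_powr)
  have "t powr p \<le> e * t^4 + T powr (p - 2) * t^2" if t: "t \<ge> 0" for t
  proof (cases "t = 0")
    case False
    then have t0: "t > 0" using t by simp
    show ?thesis
    proof (cases "t \<le> T")
      case True
      have "t powr p = t powr (p - 2) * t^2" using t0 powr_add[of t "p - 2" 2] by simp
      also have "\<dots> \<le> T powr (p - 2) * t^2" using True t0 p by (intro mult_right_mono powr_mono2) auto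
      finally show ?thesis using e by (simp add: add_increasing)
    next
      case False
      have "t powr p = t powr (p - 4) * t^4" using t0 powr_add[of t "p - 4" 4] by simp
      also have "\<dots> \<le> T powr (p - 4) * t^4" using False T p by (intro mult_right_mono powr_mono2') auto
      finally show ?thesis using T by (simp add: add_increasing2)
    qed
  qed simp
  then show ?thesis by (intro exI[of _ "T powr (p - 2)"]) simp
qed

text \<open>Only the cubic term carries a large constant. It is the one that \<open>sob_L3\<close>
  makes small for vanishing sequences, while the quadratic and quartic integrals are merely
  bounded.\<close>

lemma powr_interp2:
  assumes p: "2 < p" "p < (4::real)" and e: "e > 0"
  shows "\<exists>C\<ge>0. \<forall>t\<ge>0. t powr p \<le> e * t^2 + C * t^3 + e * t^4"
proof -
  obtain C1 where C1: "C1 \<ge> 0" "\<forall>t\<ge>0. t powr p \<le> e * t^4 + C1 * t^2" using powr_interp1[OF p e] by blast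
  define s where "s = e powr (1 / (p - 2))"
  have s: "s > 0" "s powr (p - 2) = e" using e p by (auto simp: s_def powr_powr)
  have "t powr p \<le> e * t^2 + C1 / s * t^3 + e * t^4" if t: "t \<ge> 0" for t
  proof (cases "t = 0")
    case False
    then have t0: "t > 0" using t by simp
    show ?thesis
    proof (cases "t \<le> s")
      case True
      have "t powr p = t powr (p - 2) * t^2" using t0 powr_add[of t "p - 2" 2] by simp
      also have "\<dots> \<le> s powr (p - 2) * t^2" using True t0 p by (intro mult_right_mono powr_mono2) auto
      finally show ?thesis using s e C1 t0 by (simp add: add_increasing2)
    next
      case False
      have "C1 * t^2 \<le> C1 / s * t^3"
        using False C1 s t0 by (simp add: field_simps power_numeral_reduce mult_left_mono)
      moreover have "0 \<le> e * t^2" using e by simp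
      ultimately show ?thesis using C1(2)[rule_format, of t] t by linarith
    qed
  qed simp
  then show ?thesis using C1 s by (intro exI[of _ "C1 / s"]) simp
qed

lemma pmass_le1:
  assumes p: "2 < p" "p < 4" and e: "e > 0"
  shows "\<exists>C\<ge>0. \<forall>u g. sob u g \<longrightarrow> pmass p u \<le> 16 * e * nsq u * dirichlet g + C * nsq u"
proof -
  obtain C where C: "C \<ge> 0" "\<forall>t\<ge>0. t powr p \<le> e * t^4 + C * t^2" using powr_interp1[OF p e] by blast
  have "pmass p u \<le> 16 * e * nsq u * dirichlet g + C * nsq u" if S: "sob u g" for u g
  proof -
    have i: "integrable lborel (\<lambda>x. e * (cmod (u x))^4)" "integrable lborel (\<lambda>x. C * (cmod (u x))^2)"
      by (intro integrable_mult_right sob_L4(1)[OF S] l2_integrable[OF sob_l2(1)[OF S]])+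
    have "pmass p u \<le> (LINT x|lborel. e * (cmod (u x))^4 + C * (cmod (u x))^2)"
      unfolding pmass_def by (intro integral_mono pmass_integrable[OF S p] Bochner_Integration.integrable_add i) (use C in auto)
    also have "\<dots> = e * (LINT x|lborel. (cmod (u x))^4) + C * nsq u"
      by (simp add: Bochner_Integration.integral_add[OF i] nsq_def)
    also have "\<dots> \<le> e * (16 * nsq u * dirichlet g) + C * nsq u"
      using e by (intro add_right_mono mult_left_mono sob_L4(2)[OF S]) simp
    finally show ?thesis by (simp add: mult_ac)
  qed
  then show ?thesis using C(1) by blast
qed

lemma en_coercive:
  assumes lam: "lam > 0" and p: "2 < p" "p < 4"
  shows "\<exists>C\<ge>0. \<forall>u g. sob u g \<longrightarrow> nsq u \<le> 1/8 \<longrightarrow> dirichlet g \<le> 16 * en lam p u g + C"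
proof -
  \<comment> \<open>With this weight the nonlinear term costs at most 1/16 of the Dirichlet integral
    plus a constant, half of the 1/8 supplied by the kinetic term.\<close>
  have e: "p / (32 * lam) > 0" using lam p by simp
  obtain C where C: "C \<ge> 0" "\<forall>u g. sob u g \<longrightarrow> pmass p u \<le> 16 * (p / (32 * lam)) * nsq u * dirichlet g + C * nsq u"
    using pmass_le1[OF p e] by blast
  have "dirichlet g \<le> 16 * en lam p u g + 2 * (lam / p) * C" if S: "sob u g" and c: "nsq u \<le> 1/8" for u g
  proof -
    have "lam / p * pmass p u \<le> lam / p * (16 * (p / (32 * lam)) * nsq u * dirichlet g + C * nsq u)"
      using C(2) S lam p by (intro mult_left_mono) auto
    also have "\<dots> = 1/2 * (nsq u * dirichlet g) + lam / p * (C * nsq u)"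
      using lam p by (simp add: field_simps)
    also have "\<dots> \<le> 1/2 * (1/8 * dirichlet g) + lam / p * (C * (1/8))"
      using lam p C c by (intro add_mono mult_left_mono mult_right_mono) auto
    finally have "lam / p * pmass p u \<le> dirichlet g / 16 + (lam / p) * C / 8" by simp
    then show ?thesis using dirichlet_le_kinetic[OF S c] unfolding en_def by argo
  qed
  then show ?thesis using C(1) lam p by (intro exI[of _ "2 * (lam / p) * C"]) auto
qed

subsection \<open>Scaling of the energy\<close>

text \<open>The field is quadratic, so scaling by \<open>s\<close> multiplies it by s^2; relative to
  the common factor \<open>s\<close> only the magnetic term changes, by s^2 - 1.\<close>

lemma dcov_scale:
  "dcov j (\<lambda>x. of_real s * u x) (\<lambda>j x. of_real s * g j x) =
    (\<lambda>x. of_real s * (dcov j u g x + of_real (s^2 - 1) * (\<i> * of_real (Ab j u u x) * u x)))"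
  unfolding dcov_def[abs_def] Ab_scale_left Ab_scale_right by (simp add: fun_eq_iff algebra_simps power2_eq_square)

text \<open>The Young parameter is e = (\<theta> - 1) * \<open>nsq v\<close> itself. By
  \<open>Au_l2\<close> the magnetic correction is then at most 16 e times the Dirichlet integral,
  and \<open>dirichlet_le_kinetic\<close> turns this into 64 e times the kinetic energy; with the e
  of Young's inequality this makes 65.\<close>

lemma kinetic_scale:
  assumes S: "sob v g" and c: "nsq v \<le> 1/8" and th: "\<theta> > 1" "(\<theta> - 1) * nsq v \<le> 1" and v: "nsq v > 0"
  shows "kinetic (\<lambda>x. of_real (sqrt \<theta>) * v x) (\<lambda>j x. of_real (sqrt \<theta>) * g j x) \<le> \<theta> * (1 + 65 * ((\<theta> - 1) * nsq v)) * kinetic v g"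
proof -
  define e where "e = (\<theta> - 1) * nsq v"
  have e: "e > 0" "e \<le> 1" using th v by (auto simp: e_def)
  let ?a = "\<lambda>j x. \<i> * of_real (Ab j v v x) * v x"
  have part: "nsq (dcov j (\<lambda>x. of_real (sqrt \<theta>) * v x) (\<lambda>j x. of_real (sqrt \<theta>) * g j x)) \<le> \<theta> * ((1 + e) * nsq (dcov j v g) + 8 * e * dirichlet g)"
    if j: "j \<in> {1,2}" for j
  proof -
    have "nsq (dcov j (\<lambda>x. of_real (sqrt \<theta>) * v x) (\<lambda>j x. of_real (sqrt \<theta>) * g j x)) = \<theta> * nsq (\<lambda>x. dcov j v g x + of_real (\<theta> - 1) * ?a j x)"
      unfolding dcov_scale nsq_scale using th by simp
    also have "nsq (\<lambda>x. dcov j v g x + of_real (\<theta> - 1) * ?a j x) \<le> (1 + e) * nsq (dcov j v g) + (1 + 1/e) * nsq (\<lambda>x. of_real (\<theta> - 1) * ?a j x)"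
      by (rule nsq_add_le_eps[OF dcov_l2[OF S j] l2_cmult[OF Au_l2(1)[OF S]] e(1)])
    also have "(1 + 1/e) * nsq (\<lambda>x. of_real (\<theta> - 1) * ?a j x) \<le> 8 * e * dirichlet g"
    proof -
      have "nsq (\<lambda>x. of_real (\<theta> - 1) * ?a j x) = (\<theta> - 1)^2 * nsq (?a j)" unfolding nsq_scale norm_of_real by simp
      also have "\<dots> \<le> (\<theta> - 1)^2 * (4 * (nsq v)^2 * dirichlet g)" by (intro mult_left_mono Au_l2(2)[OF S]) simp
      also have "\<dots> = 4 * e^2 * dirichlet g" by (simp add: e_def power_mult_distrib)
      finally have "(1 + 1/e) * nsq (\<lambda>x. of_real (\<theta> - 1) * ?a j x) \<le> (1 + 1/e) * (4 * e^2 * dirichlet g)"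
        using e by (intro mult_left_mono) auto
      also have "\<dots> = 4 * e * (e + 1) * dirichlet g" using e by (simp add: field_simps power2_eq_square)
      also have "\<dots> \<le> 4 * e * 2 * dirichlet g" using e by (intro mult_right_mono mult_left_mono) auto
      finally show ?thesis by simp
    qed
    finally show ?thesis using th by simp
  qed
  have "kinetic (\<lambda>x. of_real (sqrt \<theta>) * v x) (\<lambda>j x. of_real (sqrt \<theta>) * g j x)
    \<le> \<theta> * ((1 + e) * nsq (dcov 1 v g) + 8 * e * dirichlet g) + \<theta> * ((1 + e) * nsq (dcov 2 v g) + 8 * e * dirichlet g)"
    unfolding kinetic_def by (intro add_mono part) auto
  also have "\<dots> = \<theta> * ((1 + e) * kinetic v g + 16 * e * dirichlet g)" by (simp add: kinetic_def algebra_simps)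
  also have "\<dots> \<le> \<theta> * ((1 + e) * kinetic v g + 16 * e * (4 * kinetic v g))"
    using th e by (intro mult_left_mono add_left_mono dirichlet_le_kinetic S c) auto
  also have "\<dots> = \<theta> * (1 + 65 * e) * kinetic v g" by (simp add: algebra_simps)
  finally show ?thesis by (simp add: e_def)
qed

lemma pmass_scale: assumes "\<theta> \<ge> 0" shows "pmass p (\<lambda>x. of_real (sqrt \<theta>) * v x) = \<theta> powr (p/2) * pmass p v"
proof -
  have "cmod (of_real (sqrt \<theta>) * v x) powr p = \<theta> powr (p/2) * cmod (v x) powr p" for x
    using assms by (simp add: norm_mult powr_mult powr_half_sqrt[symmetric] powr_powr)
  then show ?thesis unfolding pmass_def by simp
qed

text \<open>The power \<open>\<theta> powr (p/2)\<close> of the nonlinear term beats the growth of the magnetic term, which carries a factor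
  \<open>nsq v\<close>; this is where the mass has to be small, and where the constant \<open>(p - 2)/260\<close> comes from.\<close>

lemma en_scale:
  assumes S: "sob v g" and p: "2 < p" "p < 4" and lam: "lam > 0" and v: "nsq v > 0"
    and th: "\<theta> \<ge> 1" "\<theta> * nsq v \<le> (p - 2) / 260"
  shows "en lam p (\<lambda>x. of_real (sqrt \<theta>) * v x) (\<lambda>j x. of_real (sqrt \<theta>) * g j x) \<le> \<theta> * (1 + (p - 2) / 4 * (1 - 1/\<theta>)) * en lam p v g"
proof (cases "\<theta> = 1")
  case False
  then have th1: "\<theta> > 1" using th by simp
  define t where "t = 1 - 1/\<theta>"
  have t: "0 < t" using th1 by (simp add: t_def)
  have le: "nsq v \<le> \<theta> * nsq v" using th v by simp
  have "(p - 2) / 260 \<le> 1/8" using p by simp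
  then have c: "nsq v \<le> 1/8" using le th(2) by linarith
  have e: "(\<theta> - 1) * nsq v = t * (\<theta> * nsq v)" using th1 by (simp add: t_def field_simps)
  have e1: "(\<theta> - 1) * nsq v \<le> 1" using th(2) p v by (simp add: left_diff_distrib)
  \<comment> \<open>Since 65/260 = 1/4, the magnetic correction consumes at most half of the
    nonlinear gain (p - 2)/2 * t. The smallness is used for the target mass \<theta> *
    \<open>nsq v\<close>.\<close>
  have e2: "65 * ((\<theta> - 1) * nsq v) \<le> (p - 2) / 4 * t"
  proof -
    have "t * (\<theta> * nsq v) \<le> t * ((p - 2) / 260)" using t th(2) by (intro mult_left_mono) auto
    then show ?thesis unfolding e by (simp add: mult.commute)
  qed
  have K: "kinetic (\<lambda>x. of_real (sqrt \<theta>) * v x) (\<lambda>j x. of_real (sqrt \<theta>) * g j x) \<le> \<theta> * (1 + (p - 2) / 4 * t) * kinetic v g"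
  proof -
    have "kinetic (\<lambda>x. of_real (sqrt \<theta>) * v x) (\<lambda>j x. of_real (sqrt \<theta>) * g j x) \<le> \<theta> * (1 + 65 * ((\<theta> - 1) * nsq v)) * kinetic v g"
      by (rule kinetic_scale[OF S c th1 e1 v])
    also have "\<dots> \<le> \<theta> * (1 + (p - 2) / 4 * t) * kinetic v g"
      using th1 e2 by (intro mult_right_mono mult_left_mono) auto
    finally show ?thesis .
  qed
  \<comment> \<open>Writes \<theta>^(p/2) as \<theta> * exp ((p - 2)/2 * ln \<theta>) and uses ln
    \<theta> >= 1 - 1/\<theta> = t.\<close>
  have N: "\<theta> powr (p/2) \<ge> \<theta> * (1 + (p - 2) / 2 * t)"
  proof -
    have "ln (1/\<theta>) \<le> 1/\<theta> - 1" using th1 by (intro ln_le_minus_one) simp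
    then have "t \<le> ln \<theta>" using th1 by (simp add: ln_div t_def)
    then have "1 + (p - 2) / 2 * t \<le> 1 + (p - 2) / 2 * ln \<theta>" using p by (intro add_left_mono mult_left_mono) auto
    also have "\<dots> \<le> exp ((p - 2) / 2 * ln \<theta>)" by (rule exp_ge_add_one_self)
    also have "\<dots> = \<theta> powr ((p - 2) / 2)" using th1 by (simp add: powr_def)
    finally have "\<theta> * (1 + (p - 2) / 2 * t) \<le> \<theta> * \<theta> powr ((p - 2) / 2)" using th1 by (intro mult_left_mono) auto
    also have "\<dots> = \<theta> powr (p/2)" using th1 powr_add[of \<theta> 1 "(p - 2)/2"] by (simp add: field_simps)
    finally show ?thesis .
  qed
  \<comment> \<open>Half of the nonlinear gain is given up, so that kinetic and nonlinear terms
    share one factor, which can be taken out of the energy whatever its sign.\<close>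
  have "lam / p * (\<theta> * (1 + (p - 2) / 4 * t) * pmass p v) \<le> lam / p * (\<theta> powr (p/2) * pmass p v)"
  proof (intro mult_left_mono mult_right_mono pmass_nonneg)
    have "\<theta> * (1 + (p - 2) / 4 * t) \<le> \<theta> * (1 + (p - 2) / 2 * t)" using th1 t p by (intro mult_left_mono add_left_mono mult_right_mono) auto
    then show "\<theta> * (1 + (p - 2) / 4 * t) \<le> \<theta> powr (p/2)" using N by linarith
  qed (use lam p in auto)
  then have "en lam p (\<lambda>x. of_real (sqrt \<theta>) * v x) (\<lambda>j x. of_real (sqrt \<theta>) * g j x)
    \<le> 1/2 * (\<theta> * (1 + (p - 2) / 4 * t) * kinetic v g) - lam / p * (\<theta> * (1 + (p - 2) / 4 * t) * pmass p v)"
    unfolding en_def pmass_scale[OF order_trans[OF zero_le_one th(1)]] by (intro diff_mono mult_left_mono[OF K]) simp_all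
  also have "\<dots> = \<theta> * (1 + (p - 2) / 4 * t) * en lam p v g"
  proof -
    have "1/2 * (X * K) - L * (X * N) = X * (1/2 * K - L * N)" for X K L N :: real by (simp add: algebra_simps)
    then show ?thesis unfolding en_def .
  qed
  finally show ?thesis by (simp add: t_def)
qed simp

subsection \<open>Splitting of the energy along locally vanishing sequences\<close>

lemma tendsto_0_eps:
  fixes a :: "nat \<Rightarrow> real"
  assumes "\<And>e. e > 0 \<Longrightarrow> \<forall>\<^sub>F n in sequentially. \<bar>a n\<bar> \<le> e"
  shows "a \<longlonglongrightarrow> 0"
proof (rule tendstoI)
  fix e :: real assume "e > 0"
  then have "\<forall>\<^sub>F n in sequentially. \<bar>a n\<bar> \<le> e/2" using assms[of "e/2"] by simp
  then show "\<forall>\<^sub>F n in sequentially. dist (a n) 0 < e" by eventually_elim (use \<open>e > 0\<close> in auto)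
qed

lemma nsq_bmult_cut_le:
  assumes f: "l2 f" and a[measurable]: "a \<in> borel_measurable borel" and S[measurable]: "S \<in> sets borel"
    and C1: "\<And>x. x \<in> S \<Longrightarrow> \<bar>a x\<bar> \<le> C1" and C2: "\<And>x. \<bar>a x\<bar> \<le> C2"
  shows "nsq (\<lambda>x. \<i> * of_real (a x) * f x) \<le> C1^2 * nsq (cut S f) + C2^2 * nsq (cut (-S) f)"
proof -
  have l: "l2 (\<lambda>x. \<i> * of_real (a x) * f x)" by (rule l2_bounded_phase_mult[OF f a C2])
  have "nsq (\<lambda>x. \<i> * of_real (a x) * f x) = nsq (cut S (\<lambda>x. \<i> * of_real (a x) * f x)) + nsq (cut (-S) (\<lambda>x. \<i> * of_real (a x) * f x))"
    by (rule nsq_cut_split[OF l S])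
  also have "cut S (\<lambda>x. \<i> * of_real (a x) * f x) = (\<lambda>x. \<i> * of_real (if x \<in> S then a x else 0) * cut S f x)"
    by (auto simp: cut_def fun_eq_iff)
  also have "nsq \<dots> \<le> (max C1 0)^2 * nsq (cut S f)"
    by (rule l2_bounded_phase_mult(2)[OF l2_cut[OF f S]]) (measurable, use C1 in fastforce)
  also have "cut (-S) (\<lambda>x. \<i> * of_real (a x) * f x) = (\<lambda>x. \<i> * of_real (a x) * cut (-S) f x)"
    by (auto simp: cut_def fun_eq_iff)
  also have "nsq \<dots> \<le> C2^2 * nsq (cut (-S) f)"
    by (rule l2_bounded_phase_mult(2)[OF l2_cut[OF f] a C2]) simp
  also have "(max C1 0)^2 * nsq (cut S f) \<le> C1^2 * nsq (cut S f)"
    by (intro mult_right_mono) (auto simp: max_def)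
  finally show ?thesis by simp
qed

text \<open>The radius is fixed first, large enough for the far part, of size mass over radius, to
  be small. Then \<open>z\<close> is taken so far out that the square around it meets only the tails
  of \<open>u\<close> and of its gradient.\<close>

lemma hardy_vanishes_at_infinity:
  assumes S: "sob u g" and e: "e > 0"
  shows "\<exists>k :: nat. \<forall>z. z \<notin> qbox (real k) \<longrightarrow> hardy u z \<le> e"
proof -
  note l = sob_l2(1-3)[OF S]
  obtain m :: nat where m: "4 * nsq u / e < real m" using reals_Archimedean2 by blast
  define \<rho> where "\<rho> = real (Suc m)"
  have r: "\<rho> > 0" by (simp add: \<rho>_def)
  have r2: "2 * nsq u / \<rho> \<le> e / 2"
  proof -
    have "4 * nsq u < e * \<rho>" using m e by (simp add: \<rho>_def field_simps)
    then show ?thesis using r by (simp add: field_simps)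
  qed
  have "(\<lambda>n. 4 * (1 / \<rho> * nsq (cut (- qbox (real n)) u) + 4 * \<rho> * (nsq (cut (- qbox (real n)) (g 1)) + nsq (cut (- qbox (real n)) (g 2))))) \<longlonglongrightarrow> 4 * (1 / \<rho> * 0 + 4 * \<rho> * (0 + 0))"
    by (intro tendsto_intros nsq_cut_tail l)
  then have "\<forall>\<^sub>F n in sequentially. 4 * (1 / \<rho> * nsq (cut (- qbox (real n)) u) + 4 * \<rho> * (nsq (cut (- qbox (real n)) (g 1)) + nsq (cut (- qbox (real n)) (g 2)))) < e / 2"
    using e by (intro order_tendstoD(2)[of _ 0]) auto
  then obtain n where n: "4 * (1 / \<rho> * nsq (cut (- qbox (real n)) u) + 4 * \<rho> * (nsq (cut (- qbox (real n)) (g 1)) + nsq (cut (- qbox (real n)) (g 2)))) < e / 2"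
    by (auto simp: eventually_sequentially)
  have "hardy u z \<le> e" if z: "z \<notin> qbox (real (n + Suc m))" for z
  proof -
    let ?Q = "sqr (z - (\<rho>,\<rho>)) (2*\<rho>)"
    have sub: "?Q \<subseteq> - qbox (real n)"
    proof
      fix x assume x: "x \<in> ?Q"
      show "x \<in> - qbox (real n)"
      proof
        assume xb: "x \<in> qbox (real n)"
        have "z \<in> qbox (real (n + Suc m))"
          using x xb unfolding sqr_def qbox_def mem_Times_iff \<rho>_def by auto
        with z show False by simp
      qed
    qed
    have cm: "nsq (cut ?Q f) \<le> nsq (cut (- qbox (real n)) f)" if "l2 f" for f
      by (rule nsq_cut_mono[OF that _ _ sub]) auto
    have "hardy u z \<le> 4 * h1_sqr (2*\<rho>) u g (z - (\<rho>,\<rho>)) + 1/\<rho> * nsq (cut ?Q u) + 1/\<rho> * nsq u"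
      by (rule hardy_bounds(2)[OF S r order_refl])
    also have "h1_sqr (2*\<rho>) u g (z - (\<rho>,\<rho>)) \<le> 1 / \<rho> * nsq (cut (- qbox (real n)) u) + 4 * \<rho> * (nsq (cut (- qbox (real n)) (g 1)) + nsq (cut (- qbox (real n)) (g 2)))"
    proof -
      have "1 / \<rho> * nsq (cut ?Q u) \<le> 1 / \<rho> * nsq (cut (- qbox (real n)) u)" using r by (intro mult_left_mono cm l) simp
      moreover have "4 * \<rho> * (nsq (cut ?Q (g 1)) + nsq (cut ?Q (g 2))) \<le> 4 * \<rho> * (nsq (cut (- qbox (real n)) (g 1)) + nsq (cut (- qbox (real n)) (g 2)))"
        using r by (intro mult_left_mono add_mono cm l) simp
      moreover have "2 / (2 * \<rho>) = 1 / \<rho>" "2 * (2 * \<rho>) = 4 * \<rho>" by simp_all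
      ultimately show ?thesis unfolding h1_sqr_def by (simp only: add_mono)
    qed
    also have "1 / \<rho> * nsq (cut ?Q u) \<le> 1 / \<rho> * nsq u" using r by (intro mult_left_mono nsq_cut_le l sqr_sets) simp
    finally have "hardy u z \<le> 4 * (1 / \<rho> * nsq (cut (- qbox (real n)) u) + 4 * \<rho> * (nsq (cut (- qbox (real n)) (g 1)) + nsq (cut (- qbox (real n)) (g 2)))) + 2 * nsq u / \<rho>"
      by simp
    then show ?thesis using n r2 by linarith
  qed
  then show ?thesis by blast
qed

text \<open>Three choices in order: \<rho> large for the far zone; \<rho>' small for the gradient
  term 16 \<rho>' M, which does not vanish along the sequence; then \<open>n\<close> large for the
  local mass, which carries the factor 5/\<rho>'.\<close>

lemma hardy_locally_uniformly_0:
  fixes w :: "nat \<Rightarrow> cfun"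
  assumes S: "\<And>n. sob (w n) (h n)" and M: "\<And>n. nsq (w n) \<le> M" "\<And>n. dirichlet (h n) \<le> M"
    and loc: "\<forall>k. (\<lambda>n. nsq (cut (qbox (real k)) (w n))) \<longlonglongrightarrow> 0" and e: "e > 0"
  shows "\<forall>\<^sub>F n in sequentially. \<forall>z\<in>qbox (real k). hardy (w n) z \<le> e"
proof -
  have M0: "M \<ge> 0" using M(1)[of 0] nsq_nonneg[of "w 0"] by linarith
  obtain m :: nat where m: "4 * M / e < real m" using reals_Archimedean2 by blast
  define \<rho> where "\<rho> = real (Suc m)"
  have r: "\<rho> \<ge> 1" by (simp add: \<rho>_def)
  have "4 * M < e * real m" using m e by (simp add: field_simps)
  also have "\<dots> \<le> e * \<rho>" using e by (simp add: \<rho>_def)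
  finally have r2: "M / \<rho> \<le> e / 4" using r by (simp add: field_simps)
  define \<rho>' where "\<rho>' = min 1 (e / (64 * M + 64))"
  have r': "\<rho>' > 0" "\<rho>' \<le> \<rho>" "\<rho>' \<le> e / (64 * M + 64)" using e M0 r by (auto simp: \<rho>'_def)
  have r3: "16 * \<rho>' * M \<le> e / 4"
  proof -
    have "\<rho>' * (64 * M + 64) \<le> e" using r'(3) M0 by (simp add: pos_le_divide_eq)
    then show ?thesis using r'(1) by (simp add: algebra_simps)
  qed
  define N where "N = k + Suc m"
  have "(\<lambda>n. 5 / \<rho>' * nsq (cut (qbox (real N)) (w n))) \<longlonglongrightarrow> 5 / \<rho>' * 0"
    using loc by (intro tendsto_intros) auto
  then have "\<forall>\<^sub>F n in sequentially. 5 / \<rho>' * nsq (cut (qbox (real N)) (w n)) < e / 2"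
    using e by (intro order_tendstoD(2)[of _ 0]) auto
  then show ?thesis
  proof eventually_elim
    case (elim n)
    show ?case
    proof
      fix z assume z: "z \<in> qbox (real k)"
      let ?Q = "sqr (z - (\<rho>,\<rho>)) (2*\<rho>)" and ?Q' = "sqr (z - (\<rho>',\<rho>')) (2*\<rho>')"
      have sub: "?Q \<subseteq> qbox (real N)" "?Q' \<subseteq> qbox (real N)"
        using z r' unfolding sqr_def qbox_def N_def \<rho>_def by auto
      note l = sob_l2(1-3)[OF S, of n]
      have "hardy (w n) z \<le> 4 * h1_sqr (2*\<rho>') (w n) (h n) (z - (\<rho>',\<rho>')) + 1/\<rho>' * nsq (cut ?Q (w n)) + 1/\<rho> * nsq (w n)"
        by (rule hardy_bounds(2)[OF S r'(1,2)])
      also have "h1_sqr (2*\<rho>') (w n) (h n) (z - (\<rho>',\<rho>')) \<le> 1 / \<rho>' * nsq (cut (qbox (real N)) (w n)) + 4 * \<rho>' * M"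
      proof -
        have "nsq (cut ?Q' (h n 1)) + nsq (cut ?Q' (h n 2)) \<le> M"
          using add_mono[OF nsq_cut_le[OF l(2), of ?Q'] nsq_cut_le[OF l(3), of ?Q']] M(2)[of n] unfolding dirichlet_def by simp
        moreover have "nsq (cut ?Q' (w n)) \<le> nsq (cut (qbox (real N)) (w n))" by (rule nsq_cut_mono[OF l(1) _ _ sub(2)]) auto
        moreover have "2 / (2 * \<rho>') = 1 / \<rho>'" "2 * (2 * \<rho>') = 4 * \<rho>'" by simp_all
        ultimately show ?thesis unfolding h1_sqr_def using r' by (intro add_mono mult_left_mono) (simp_all add: divide_right_mono del: One_nat_def)
      qed
      also have "1/\<rho>' * nsq (cut ?Q (w n)) \<le> 1/\<rho>' * nsq (cut (qbox (real N)) (w n))"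
        using r' nsq_cut_mono[OF l(1) _ _ sub(1)] by (intro mult_left_mono) auto
      also have "1/\<rho> * nsq (w n) \<le> M / \<rho>" using M(1)[of n] r by (simp add: divide_right_mono)
      also have "4 * (1 / \<rho>' * nsq (cut (qbox (real N)) (w n)) + 4 * \<rho>' * M) + 1/\<rho>' * nsq (cut (qbox (real N)) (w n)) + M / \<rho>
        = 5 / \<rho>' * nsq (cut (qbox (real N)) (w n)) + 16 * \<rho>' * M + M / \<rho>" by (simp add: algebra_simps)
      finally have "hardy (w n) z \<le> 5 / \<rho>' * nsq (cut (qbox (real N)) (w n)) + 16 * \<rho>' * M + M / \<rho>" by simp
      then show "hardy (w n) z \<le> e" using elim r2 r3 by linarith
    qed
  qed
qed

lemma hardy_bounded:
  assumes "sob u g" "nsq u \<le> M" "dirichlet g \<le> M" shows "hardy u z \<le> 20 * M"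
proof -
  have M: "M \<ge> 0" using assms(2) nsq_nonneg[of u] by linarith
  have "sqrt (nsq u * dirichlet g) \<le> sqrt (M * M)" using assms(2,3) M by (intro real_sqrt_le_mono mult_mono) auto
  then show ?thesis using hardy_le[OF assms(1), of z] M by (simp add: real_sqrt_mult)
qed

text \<open>The function \<open>u\<close> is the local limit and \<open>w n\<close> the remainder.
  Functions vanish strongly on boxes, gradients only weakly; this is exactly what compactness
  provides.\<close>

locale splitting =
  fixes u :: cfun and g :: "nat \<Rightarrow> cfun" and w :: "nat \<Rightarrow> cfun" and h :: "nat \<Rightarrow> nat \<Rightarrow> cfun" and M :: real
  assumes U: "sob u g" and W: "\<And>n. sob (w n) (h n)"
    and MU: "nsq u \<le> M" "dirichlet g \<le> M" and MW: "\<And>n. nsq (w n) \<le> M" "\<And>n. dirichlet (h n) \<le> M"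
    and loc: "\<forall>k. (\<lambda>n. nsq (cut (qbox (real k)) (w n))) \<longlonglongrightarrow> 0"
    and weak: "\<And>j \<psi>. j \<in> {1,2} \<Longrightarrow> l2 \<psi> \<Longrightarrow> (\<lambda>n. ip \<psi> (h n j)) \<longlonglongrightarrow> 0"
begin

lemma M0: "M \<ge> 0" using MU(1) nsq_nonneg[of u] by linarith

lemma lu: "l2 u" and lw: "l2 (w n)"
  by (rule sob_l2(1)[OF U], rule sob_l2(1)[OF W])

lemma mu: "u \<in> borel_measurable borel" and mw: "w n \<in> borel_measurable borel"
  by (rule l2_measurable[OF lu], rule l2_measurable[OF lw])

lemma Aww_bound: "\<bar>Ab j (w n) (w n) z\<bar> \<le> 2 * M"
proof -
  have "sqrt (nsq (w n) * dirichlet (h n)) \<le> sqrt (M * M)" using MW[of n] M0 by (intro real_sqrt_le_mono mult_mono) auto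
  then show ?thesis using Ab_self_bound(2)[OF W[of n], of j z] M0 by (simp add: real_sqrt_mult)
qed

lemma Auu_bound: "\<bar>Ab j u u z\<bar> \<le> 2 * M"
proof -
  have "sqrt (nsq u * dirichlet g) \<le> sqrt (M * M)" using MU M0 by (intro real_sqrt_le_mono mult_mono) auto
  then show ?thesis using Ab_self_bound(2)[OF U, of j z] M0 by (simp add: real_sqrt_mult)
qed

text \<open>On a large box the field of \<open>w n\<close> is uniformly small; outside it the field
  is bounded and the fixed \<open>P\<close> has little mass.\<close>

lemma Aww_mult_tendsto:
  assumes P: "l2 P" shows "(\<lambda>n. nsq (\<lambda>x. \<i> * of_real (Ab j (w n) (w n) x) * P x)) \<longlonglongrightarrow> 0"
proof (rule tendsto_0_eps)
  fix e :: real assume e: "e > 0"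
  have "(\<lambda>k. (2 * M)^2 * nsq (cut (- qbox (real k)) P)) \<longlonglongrightarrow> (2 * M)^2 * 0" by (intro tendsto_intros nsq_cut_tail P)
  then have "\<forall>\<^sub>F k in sequentially. (2 * M)^2 * nsq (cut (- qbox (real k)) P) < e / 2"
    using e by (intro order_tendstoD(2)[of _ 0]) auto
  then obtain k where k: "(2 * M)^2 * nsq (cut (- qbox (real k)) P) < e / 2" by (auto simp: eventually_sequentially)
  define d where "d = sqrt (e / (2 * nsq P + 2))"
  have d: "d > 0" "d^2 * nsq P \<le> e / 2"
  proof -
    show "d > 0" using e by (simp add: d_def add_nonneg_pos)
    have "d^2 * nsq P = e * (nsq P / (2 * nsq P + 2))" using e by (simp add: d_def add_nonneg_pos)
    also have "\<dots> \<le> e * (1/2)" using e by (intro mult_left_mono) (auto simp: divide_le_eq add_nonneg_pos)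
    finally show "d^2 * nsq P \<le> e / 2" by simp
  qed
  have "\<forall>\<^sub>F n in sequentially. \<forall>z\<in>qbox (real k). hardy (w n) z \<le> d"
    by (rule hardy_locally_uniformly_0[OF W MW loc d(1)])
  then show "\<forall>\<^sub>F n in sequentially. \<bar>nsq (\<lambda>x. \<i> * of_real (Ab j (w n) (w n) x) * P x)\<bar> \<le> e"
  proof eventually_elim
    case (elim n)
    have "\<bar>Ab j (w n) (w n) z\<bar> \<le> d" if "z \<in> qbox (real k)" for z
      using Ab_self_bound(1)[OF W[of n], of j z] elim that hardy_nonneg[of "w n" z] by fastforce
    then have "nsq (\<lambda>x. \<i> * of_real (Ab j (w n) (w n) x) * P x) \<le> d^2 * nsq (cut (qbox (real k)) P) + (2*M)^2 * nsq (cut (- qbox (real k)) P)"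
      by (intro nsq_bmult_cut_le P Ab_measurable mw Aww_bound) auto
    also have "d^2 * nsq (cut (qbox (real k)) P) \<le> d^2 * nsq P" by (intro mult_left_mono nsq_cut_le P) auto
    finally show ?case using d(2) k by simp
  qed
qed

text \<open>The roles are exchanged: the field of the fixed \<open>u\<close> decays at infinity, and
  on the remaining box \<open>w n\<close> has little mass.\<close>

lemma Auu_w_tendsto: "(\<lambda>n. nsq (\<lambda>x. \<i> * of_real (Ab j u u x) * w n x)) \<longlonglongrightarrow> 0"
proof (rule tendsto_0_eps)
  fix e :: real assume e: "e > 0"
  define d where "d = sqrt (e / (2 * M + 2))"
  have d: "d > 0" "d^2 * M \<le> e / 2"
  proof -
    show "d > 0" using e M0 by (simp add: d_def add_nonneg_pos)
    have "d^2 * M = e * (M / (2 * M + 2))" using e M0 by (simp add: d_def add_nonneg_pos)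
    also have "\<dots> \<le> e * (1/2)" using e M0 by (intro mult_left_mono) (auto simp: divide_le_eq add_nonneg_pos)
    finally show "d^2 * M \<le> e / 2" by simp
  qed
  obtain k :: nat where k: "\<forall>z. z \<notin> qbox (real k) \<longrightarrow> hardy u z \<le> d" using hardy_vanishes_at_infinity[OF U d(1)] by blast
  have "(\<lambda>n. (2 * M)^2 * nsq (cut (qbox (real k)) (w n))) \<longlonglongrightarrow> (2 * M)^2 * 0" using loc by (intro tendsto_intros) auto
  then have "\<forall>\<^sub>F n in sequentially. (2 * M)^2 * nsq (cut (qbox (real k)) (w n)) < e / 2"
    using e by (intro order_tendstoD(2)[of _ 0]) auto
  then show "\<forall>\<^sub>F n in sequentially. \<bar>nsq (\<lambda>x. \<i> * of_real (Ab j u u x) * w n x)\<bar> \<le> e"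
  proof eventually_elim
    case (elim n)
    have "\<bar>Ab j u u z\<bar> \<le> d" if "z \<in> - qbox (real k)" for z
      using Ab_self_bound(1)[OF U, of j z] k[rule_format, of z] that hardy_nonneg[of u z] by auto
    then have "nsq (\<lambda>x. \<i> * of_real (Ab j u u x) * w n x) \<le> d^2 * nsq (cut (- qbox (real k)) (w n)) + (2*M)^2 * nsq (cut (- (- qbox (real k))) (w n))"
      by (intro nsq_bmult_cut_le lw Ab_measurable mu Auu_bound) auto
    also have "d^2 * nsq (cut (- qbox (real k)) (w n)) \<le> d^2 * M"
      using nsq_cut_le[OF lw[of n], of "- qbox (real k)"] MW(1)[of n] by (intro mult_left_mono) auto
    finally show ?case using d(2) elim by simp
  qed
qed

text \<open>At every point one of the two Hardy potentials is small and the other bounded, so their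
  geometric mean is small on the whole plane.\<close>

lemma Auw_uniform:
  assumes e: "e > 0" shows "\<forall>\<^sub>F n in sequentially. \<forall>z. \<bar>Ab j u (w n) z\<bar> \<le> e"
proof -
  define d where "d = e^2 / (20 * M + 1)"
  have d: "d > 0" "d * (20 * M) \<le> e^2"
  proof -
    show "d > 0" using e M0 by (simp add: d_def add_nonneg_pos)
    have "d * (20 * M) = e^2 * (20 * M / (20 * M + 1))" by (simp add: d_def)
    also have "\<dots> \<le> e^2 * 1" using M0 by (intro mult_left_mono) (auto simp: divide_le_eq add_nonneg_pos)
    finally show "d * (20 * M) \<le> e^2" by simp
  qed
  obtain k :: nat where k: "\<forall>z. z \<notin> qbox (real k) \<longrightarrow> hardy u z \<le> d" using hardy_vanishes_at_infinity[OF U d(1)] by blast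
  have "\<forall>\<^sub>F n in sequentially. \<forall>z\<in>qbox (real k). hardy (w n) z \<le> d"
    by (rule hardy_locally_uniformly_0[OF W MW loc d(1)])
  then show ?thesis
  proof eventually_elim
    case (elim n)
    show ?case
    proof
      fix z
      have "hardy u z * hardy (w n) z \<le> d * (20 * M)"
      proof (cases "z \<in> qbox (real k)")
        case True
        then have "hardy u z * hardy (w n) z \<le> (20 * M) * d"
          using elim hardy_bounded[OF U MU, of z] hardy_nonneg M0 by (intro mult_mono) auto
        then show ?thesis by (simp add: mult.commute)
      next
        case False
        then show ?thesis
          using k[rule_format, OF False] hardy_bounded[OF W MW, of n z] hardy_nonneg d(1) by (intro mult_mono) auto
      qed
      then have "sqrt (hardy u z * hardy (w n) z) \<le> sqrt (e^2)" using d(2) by (intro real_sqrt_le_mono) linarith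
      then have "sqrt (hardy u z) * sqrt (hardy (w n) z) \<le> e" using e by (simp add: real_sqrt_mult)
      then show "\<bar>Ab j u (w n) z\<bar> \<le> e" using Ab_bound[OF U W, of j n z] e by linarith
    qed
  qed
qed

lemma sob_uw: "sob (\<lambda>x. u x + w n x) (\<lambda>j x. g j x + h n j x)"
  by (rule sob_add[OF U W])

text \<open>The mixed terms of the cubic expression A(u+w)(u+w), grouped by the field they contain:
  that of \<open>u\<close>, that of \<open>w n\<close>, and the polarised one.\<close>

definition err :: "nat \<Rightarrow> nat \<Rightarrow> cfun" where
  "err j n = (\<lambda>x. (\<i> * of_real (Ab j u u x) * w n x + \<i> * of_real (Ab j (w n) (w n) x) * u x)
     + \<i> * of_real (2 * Ab j u (w n) x) * (u x + w n x))"

lemma dcov_uw: "dcov j (\<lambda>x. u x + w n x) (\<lambda>j x. g j x + h n j x) = (\<lambda>x. (dcov j u g x + dcov j (w n) (h n) x) + err j n x)"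
proof
  fix x
  have "Ab j (\<lambda>x. u x + w n x) (\<lambda>x. u x + w n x) x = Ab j u u x + 2 * Ab j u (w n) x + Ab j (w n) (w n) x"
    by (simp add: Ab_add_left[OF U W sob_uw] Ab_add_right[OF U W U] Ab_add_right[OF U W W] Ab_commute[of j "w n" u])
  then show "dcov j (\<lambda>x. u x + w n x) (\<lambda>j x. g j x + h n j x) x = (dcov j u g x + dcov j (w n) (h n) x) + err j n x"
    unfolding dcov_def err_def by (simp add: algebra_simps)
qed

lemma Auw_bound: "\<bar>2 * Ab j u (w n) z\<bar> \<le> 4 * M"
proof -
  have "sqrt (hardy u z) * sqrt (hardy (w n) z) \<le> sqrt (20 * M) * sqrt (20 * M)"
    using hardy_bounded[OF U MU, of z] hardy_bounded[OF W MW, of n z] hardy_nonneg M0 by (intro mult_mono real_sqrt_le_mono) auto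
  then have "sqrt (hardy u z) * sqrt (hardy (w n) z) \<le> 20 * M" using M0 by simp
  then show ?thesis using Ab_bound[OF U W, of j n z] M0 by (simp add: abs_mult)
qed

lemma err_parts:
  "l2 (\<lambda>x. \<i> * of_real (Ab j u u x) * w n x)" "l2 (\<lambda>x. \<i> * of_real (Ab j (w n) (w n) x) * u x)"
  "l2 (\<lambda>x. \<i> * of_real (2 * Ab j u (w n) x) * (u x + w n x))"
proof -
  note [measurable] = mu mw
  show "l2 (\<lambda>x. \<i> * of_real (Ab j u u x) * w n x)"
    by (rule l2_bounded_phase_mult(1)[OF lw _ Auu_bound]) measurable
  show "l2 (\<lambda>x. \<i> * of_real (Ab j (w n) (w n) x) * u x)"
    by (rule l2_bounded_phase_mult(1)[OF lu _ Aww_bound]) measurable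
  show "l2 (\<lambda>x. \<i> * of_real (2 * Ab j u (w n) x) * (u x + w n x))"
    by (rule l2_bounded_phase_mult(1)[OF l2_add[OF lu lw] _ Auw_bound]) measurable
qed

lemma err_l2: "l2 (err j n)"
  unfolding err_def by (intro l2_add err_parts)

lemma Auw_mult_tendsto: "(\<lambda>n. nsq (\<lambda>x. \<i> * of_real (2 * Ab j u (w n) x) * (u x + w n x))) \<longlonglongrightarrow> 0"
proof (rule tendsto_0_eps)
  fix e :: real assume e: "e > 0"
  note [measurable] = mu mw
  define d where "d = sqrt (e / (16 * M + 16))"
  have d: "d > 0" "(2 * d)^2 * (4 * M) \<le> e"
  proof -
    show "d > 0" using e M0 by (simp add: d_def add_nonneg_pos)
    have "(2 * d)^2 * (4 * M) = e * (16 * M / (16 * M + 16))" using e M0 by (simp add: d_def add_nonneg_pos power_mult_distrib)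
    also have "\<dots> \<le> e * 1" using e M0 by (intro mult_left_mono) (auto simp: divide_le_eq add_nonneg_pos)
    finally show "(2 * d)^2 * (4 * M) \<le> e" by simp
  qed
  show "\<forall>\<^sub>F n in sequentially. \<bar>nsq (\<lambda>x. \<i> * of_real (2 * Ab j u (w n) x) * (u x + w n x))\<bar> \<le> e"
    using Auw_uniform[OF d(1), of j]
  proof eventually_elim
    case (elim n)
    have "nsq (\<lambda>x. \<i> * of_real (2 * Ab j u (w n) x) * (u x + w n x)) \<le> (2 * d)^2 * nsq (\<lambda>x. u x + w n x)"
      by (rule l2_bounded_phase_mult(2)[OF l2_add[OF lu lw]]) (measurable, use elim in \<open>simp add: abs_mult\<close>)
    also have "\<dots> \<le> (2 * d)^2 * (4 * M)"
      using nsq_add_le[OF lu lw, of n] MU(1) MW(1)[of n] by (intro mult_left_mono) auto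
    finally show ?case using d(2) by simp
  qed
qed

lemma err_tendsto: "(\<lambda>n. nsq (err j n)) \<longlonglongrightarrow> 0"
proof (rule Lim_null_comparison)
  show "(\<lambda>n. 2 * (2 * nsq (\<lambda>x. \<i> * of_real (Ab j u u x) * w n x) + 2 * nsq (\<lambda>x. \<i> * of_real (Ab j (w n) (w n) x) * u x))
    + 2 * nsq (\<lambda>x. \<i> * of_real (2 * Ab j u (w n) x) * (u x + w n x))) \<longlonglongrightarrow> 0"
    using tendsto_add[OF tendsto_mult_left[OF tendsto_add[OF tendsto_mult_left[OF Auu_w_tendsto, of 2] tendsto_mult_left[OF Aww_mult_tendsto[OF lu], of 2]], of 2] tendsto_mult_left[OF Auw_mult_tendsto, of 2]]
    by simp
  show "\<forall>\<^sub>F n in sequentially. norm (nsq (err j n)) \<le> 2 * (2 * nsq (\<lambda>x. \<i> * of_real (Ab j u u x) * w n x) + 2 * nsq (\<lambda>x. \<i> * of_real (Ab j (w n) (w n) x) * u x))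
    + 2 * nsq (\<lambda>x. \<i> * of_real (2 * Ab j u (w n) x) * (u x + w n x))"
  proof (rule always_eventually, rule allI)
    fix n
    show "norm (nsq (err j n)) \<le> 2 * (2 * nsq (\<lambda>x. \<i> * of_real (Ab j u u x) * w n x) + 2 * nsq (\<lambda>x. \<i> * of_real (Ab j (w n) (w n) x) * u x))
    + 2 * nsq (\<lambda>x. \<i> * of_real (2 * Ab j u (w n) x) * (u x + w n x))"
      unfolding err_def real_norm_def abs_of_nonneg[OF nsq_nonneg]
      by (rule order_trans[OF nsq_add_le[OF l2_add[OF err_parts(1,2)] err_parts(3)]])
         (intro add_right_mono mult_left_mono nsq_add_le err_parts, simp)
  qed
qed

lemma nsq_dcw_bounded: assumes j: "j \<in> {1,2}" shows "nsq (dcov j (w n) (h n)) \<le> (2 + 16 * M^2) * M"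
proof -
  have "nsq (dcov j (w n) (h n)) \<le> kinetic (w n) (h n)" using j unfolding kinetic_def by auto
  also have "\<dots> \<le> (2 + 16 * (nsq (w n))^2) * dirichlet (h n)" by (rule kinetic_le_dirichlet[OF W])
  also have "\<dots> \<le> (2 + 16 * M^2) * M" using MW[of n] M0 by (intro mult_mono add_left_mono mult_left_mono power_mono) auto
  finally show ?thesis .
qed

lemma cross_tendsto:
  assumes j: "j \<in> {1,2}" shows "(\<lambda>n. ip (dcov j u g) (dcov j (w n) (h n))) \<longlonglongrightarrow> 0"
proof -
  note lP = dcov_l2[OF U j]
  let ?a = "\<lambda>n x. \<i> * of_real (Ab j (w n) (w n) x)"
  have l1: "l2 (\<lambda>x. ?a n x * w n x)" for n by (rule Au_l2(1)[OF W])
  have lP': "l2 (\<lambda>x. ?a n x * dcov j u g x)" for n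
    by (rule l2_bounded_phase_mult(1)[OF lP Ab_measurable[OF mw mw] Aww_bound])
  have eq: "ip (dcov j u g) (dcov j (w n) (h n)) = ip (dcov j u g) (h n j) + ip (dcov j u g) (\<lambda>x. ?a n x * w n x)" for n
    unfolding dcov_def[of j "w n" "h n", abs_def] by (rule ip_add_right[OF sob_l2(4)[OF W j] l1 lP])
  have "(\<lambda>n. ip (dcov j u g) (\<lambda>x. ?a n x * w n x)) \<longlonglongrightarrow> 0"
  proof (rule Lim_null_comparison)
    show "(\<lambda>n. sqrt (nsq (\<lambda>x. ?a n x * dcov j u g x)) * sqrt M) \<longlonglongrightarrow> 0"
      using tendsto_mult_right[OF tendsto_real_sqrt[OF Aww_mult_tendsto[OF lP]], of j "sqrt M"] by simp
    have "\<bar>ip (dcov j u g) (\<lambda>x. ?a n x * w n x)\<bar> \<le> sqrt (nsq (\<lambda>x. ?a n x * dcov j u g x)) * sqrt M" for n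
    proof -
      \<comment> \<open>Multiplication by \<open>\<i>\<close> times a real function is skew for
        \<open>ip\<close>, so the field of \<open>w n\<close> moves onto the fixed function, where
        \<open>Aww_mult_tendsto\<close> applies.\<close>
      have "ip (dcov j u g) (\<lambda>x. ?a n x * w n x) = - ip (\<lambda>x. ?a n x * dcov j u g x) (w n)"
        unfolding ip_def by (subst Bochner_Integration.integral_minus[symmetric]) (intro Bochner_Integration.integral_cong refl, simp add: algebra_simps)
      then have "\<bar>ip (dcov j u g) (\<lambda>x. ?a n x * w n x)\<bar> \<le> sqrt (nsq (\<lambda>x. ?a n x * dcov j u g x)) * sqrt (nsq (w n))"
        using ip_cauchy_schwarz[OF lP' lw] by simp
      also have "\<dots> \<le> sqrt (nsq (\<lambda>x. ?a n x * dcov j u g x)) * sqrt M"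
        using MW(1)[of n] by (intro mult_left_mono real_sqrt_le_mono) auto
      finally show ?thesis .
    qed
    then show "\<forall>\<^sub>F n in sequentially. norm (ip (dcov j u g) (\<lambda>x. ?a n x * w n x)) \<le> sqrt (nsq (\<lambda>x. ?a n x * dcov j u g x)) * sqrt M"
      by simp
  qed
  from tendsto_add[OF weak[OF j lP] this] show ?thesis unfolding eq by simp
qed

lemma dcov_split:
  assumes j: "j \<in> {1,2}"
  shows "(\<lambda>n. nsq (dcov j (\<lambda>x. u x + w n x) (\<lambda>j x. g j x + h n j x)) - nsq (dcov j u g) - nsq (dcov j (w n) (h n))) \<longlonglongrightarrow> 0"
proof -
  note lP = dcov_l2[OF U j] and lQ = dcov_l2[OF W j]
  let ?P = "dcov j u g" and ?Q = "\<lambda>n. dcov j (w n) (h n)"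
  have lPQ: "l2 (\<lambda>x. ?P x + ?Q n x)" for n by (intro l2_add lP lQ)
  have bPQ: "nsq (\<lambda>x. ?P x + ?Q n x) \<le> 2 * nsq ?P + 2 * ((2 + 16 * M^2) * M)" for n
    using nsq_add_le[OF lP lQ, of n] nsq_dcw_bounded[OF j, of n] by linarith
  let ?C = "2 * nsq ?P + 2 * ((2 + 16 * M^2) * M)"
  have eq: "nsq (dcov j (\<lambda>x. u x + w n x) (\<lambda>j x. g j x + h n j x)) - nsq ?P - nsq (?Q n) = 2 * ip ?P (?Q n) + 2 * ip (\<lambda>x. ?P x + ?Q n x) (err j n) + nsq (err j n)" for n
    unfolding dcov_uw nsq_add[OF lPQ err_l2] nsq_add[OF lP lQ] by simp
  have "(\<lambda>n. ip (\<lambda>x. ?P x + ?Q n x) (err j n)) \<longlonglongrightarrow> 0"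
  proof (rule Lim_null_comparison)
    show "(\<lambda>n. sqrt ?C * sqrt (nsq (err j n))) \<longlonglongrightarrow> 0"
      using tendsto_mult_left[OF tendsto_real_sqrt[OF err_tendsto], of "sqrt ?C" j] by simp
    have "\<bar>ip (\<lambda>x. ?P x + ?Q n x) (err j n)\<bar> \<le> sqrt ?C * sqrt (nsq (err j n))" for n
    proof -
      have "\<bar>ip (\<lambda>x. ?P x + ?Q n x) (err j n)\<bar> \<le> sqrt (nsq (\<lambda>x. ?P x + ?Q n x)) * sqrt (nsq (err j n))"
        by (rule ip_cauchy_schwarz[OF lPQ err_l2])
      also have "\<dots> \<le> sqrt ?C * sqrt (nsq (err j n))" by (intro mult_right_mono real_sqrt_le_mono bPQ) simp
      finally show ?thesis .
    qed
    then show "\<forall>\<^sub>F n in sequentially. norm (ip (\<lambda>x. ?P x + ?Q n x) (err j n)) \<le> sqrt ?C * sqrt (nsq (err j n))" by simp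
  qed
  from tendsto_add[OF tendsto_add[OF tendsto_mult_left[OF cross_tendsto[OF j], of 2] tendsto_mult_left[OF this, of 2]] err_tendsto[of j]]
  show ?thesis unfolding eq by simp
qed

lemma kinetic_split:
  "(\<lambda>n. kinetic (\<lambda>x. u x + w n x) (\<lambda>j x. g j x + h n j x) - kinetic u g - kinetic (w n) (h n)) \<longlonglongrightarrow> 0"
  using tendsto_add[OF dcov_split[of 1] dcov_split[of 2]] unfolding kinetic_def by (simp add: algebra_simps)

end

section \<open>Splitting of the nonlinear term\<close>

lemma powr_add_le_aux:
  assumes p: "2 < p" "p < (4::real)" and st: "0 \<le> t" "t \<le> s"
  shows "(s + t) powr p \<le> s powr p + 32 * (s * t + s^3 * t)"
proof (cases "t = 0")
  case False
  then have t: "t > 0" and s: "s > 0" using st by auto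
  have "\<exists>z>s. z < s + t \<and> (s + t) powr p - s powr p = (s + t - s) * (p * z powr (p - 1))"
    by (rule MVT2) (use t s in \<open>auto intro!: has_real_derivative_powr\<close>)
  then obtain z where z: "z > s" "z < s + t" "(s + t) powr p - s powr p = t * (p * z powr (p - 1))" by auto
  have "z powr (p - 1) \<le> (2 * s) powr (p - 1)" using z s st p by (intro powr_mono2) auto
  also have "\<dots> = 2 powr (p - 1) * s powr (p - 1)" using s by (simp add: powr_mult)
  also have "\<dots> \<le> 2 powr 3 * (s + s^3)"
  proof (intro mult_mono)
    show "2 powr (p - 1) \<le> (2::real) powr 3" using p by (intro powr_mono) auto
    show "s powr (p - 1) \<le> s + s^3"
    proof (cases "s \<le> 1")
      case True
      then have "s powr (p - 1) \<le> s powr 1" using s p by (intro powr_mono') auto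
      then show ?thesis using s by (simp add: add_increasing2)
    next
      case False
      then have "s powr (p - 1) \<le> s powr 3" using p by (intro powr_mono) auto
      then show ?thesis using s by simp
    qed
  qed (use s in auto)
  finally have "z powr (p - 1) \<le> 8 * (s + s^3)" by simp
  then have "p * z powr (p - 1) \<le> 4 * (8 * (s + s^3))" using p s by (intro mult_mono) auto
  then have "t * (p * z powr (p - 1)) \<le> t * (4 * (8 * (s + s^3)))" using t by (intro mult_left_mono) auto
  then have "(s + t) powr p - s powr p \<le> t * (4 * (8 * (s + s^3)))" unfolding z(3) .
  moreover have "t * (4 * (8 * (s + s^3))) = 32 * (s * t + s^3 * t)" by (simp add: algebra_simps)
  ultimately show ?thesis by linarith
qed simp

text \<open>The mean value theorem based at the larger summand. An upper bound suffices for the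
  splitting, because \<open>pmass\<close> enters the energy with a minus sign, and each error term
  contains both \<open>s\<close> and \<open>t\<close>.\<close>

lemma powr_add_le:
  assumes p: "2 < p" "p < (4::real)" and st: "0 \<le> t" "0 \<le> s"
  shows "(s + t) powr p \<le> s powr p + t powr p + 32 * (s * t + s^3 * t + s * t^3)"
proof (cases "t \<le> s")
  case True
  have "0 \<le> s * t^3" "0 \<le> t powr p" using st by auto
  then show ?thesis using powr_add_le_aux[OF p st(1) True] by argo
next
  case False
  have "(t + s) powr p \<le> t powr p + 32 * (t * s + t^3 * s)" using False st by (intro powr_add_le_aux[OF p]) auto
  moreover have "0 \<le> s^3 * t" "0 \<le> s powr p" using st by auto
  moreover have "t * s = s * t" "t^3 * s = s * t^3" "t + s = s + t" by simp_all
  ultimately show ?thesis by argo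
qed

context splitting
begin

lemma L4w: "(LINT x|lborel. (cmod (w n x))^4) \<le> 16 * M^2"
proof -
  have "(LINT x|lborel. (cmod (w n x))^4) \<le> 16 * nsq (w n) * dirichlet (h n)" by (rule sob_L4(2)[OF W])
  also have "\<dots> \<le> 16 * (M * M)" using MW[of n] M0 by (simp add: mult.assoc mult_mono)
  finally show ?thesis by (simp add: power2_eq_square)
qed

lemma nsq_sq: "nsq (\<lambda>x. of_real ((cmod (f x))^2)) = (LINT x|lborel. (cmod (f x))^4)"
  unfolding nsq_def by (simp add: norm_power power_mult[symmetric])

lemma uw_l2: "l2 (\<lambda>x. u x * w n x)"
proof -
  note [measurable] = mu mw
  have e: "(cmod (u x * w n x))^2 = cmod (of_real ((cmod (u x))^2)) * cmod (of_real ((cmod (w n x))^2))" for x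
    by (simp add: norm_mult norm_power power_mult_distrib)
  show ?thesis unfolding l2_def e using l2_cmod_mult[OF sq_l2[OF U] sq_l2[OF W[of n]]] by simp
qed

text \<open>On \<open>S k\<close> the function \<open>u\<close> is bounded, so the local vanishing
  of \<open>w n\<close> suffices; off \<open>S k\<close> the L2 norm of |u|^2 is small and is paired
  with the bounded L2 norm of |w|^2.\<close>

lemma nsq_uw_tendsto: "(\<lambda>n. nsq (\<lambda>x. u x * w n x)) \<longlonglongrightarrow> 0"
proof -
  let ?q = "\<lambda>x. complex_of_real ((cmod (u x))^2)"
  define S where "S k = qbox (real k) \<inter> {x. (cmod (u x))^2 \<le> real k}" for k
  note [measurable] = mu mw
  have S[measurable]: "S k \<in> sets borel" for k
  proof -
    have "{x \<in> space borel. (cmod (u x))^2 \<le> real k} \<in> sets borel" by measurable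
    then show ?thesis unfolding S_def by simp
  qed
  have ev: "\<forall>\<^sub>F k in sequentially. x \<in> S k" for x
  proof -
    obtain N :: nat where "(cmod (u x))^2 < real N" using reals_Archimedean2 by blast
    then have "\<forall>\<^sub>F k in sequentially. (cmod (u x))^2 \<le> real k"
      by (auto simp: eventually_sequentially intro!: exI[of _ N])
    with eventually_in_qbox[of x] show ?thesis by eventually_elim (simp add: S_def)
  qed
  have tail: "(\<lambda>k. nsq (cut (- S k) ?q)) \<longlonglongrightarrow> 0" by (rule nsq_cut_exhaust[OF sq_l2[OF U] S ev])
  have t1: "(\<lambda>k. sqrt (nsq (cut (- S k) ?q)) * (4 * M)) \<longlonglongrightarrow> 0"
    using tendsto_mult_right[OF tendsto_real_sqrt[OF tail], of "4 * M"] by simp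
  have t2: "(\<lambda>n. real k * nsq (cut (qbox (real k)) (w n))) \<longlonglongrightarrow> 0" for k
    using tendsto_mult_left[OF loc[rule_format, of k], of "real k"] by simp
  have "nsq (\<lambda>x. u x * w n x) \<le> real k * nsq (cut (qbox (real k)) (w n)) + sqrt (nsq (cut (- S k) ?q)) * (4 * M)" for n k
  proof -
    have lc: "l2 (cut (- S k) ?q)" by (rule l2_cut[OF sq_l2[OF U]]) simp
    note lw2 = sq_l2[OF W[of n]]
    have i1: "integrable lborel (\<lambda>x. real k * (cmod (cut (qbox (real k)) (w n) x))^2)"
      by (intro integrable_mult_right l2_integrable l2_cut lw) simp
    have i2: "integrable lborel (\<lambda>x. cmod (cut (- S k) ?q x) * cmod (complex_of_real ((cmod (w n x))^2)))"
      by (rule l2_cmod_mult[OF lc lw2])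
    have "nsq (\<lambda>x. u x * w n x) = (LINT x|lborel. (cmod (u x * w n x))^2)" by (simp add: nsq_def)
    also have "\<dots> \<le> (LINT x|lborel. real k * (cmod (cut (qbox (real k)) (w n) x))^2 + cmod (cut (- S k) ?q x) * cmod (complex_of_real ((cmod (w n x))^2)))"
    proof (rule integral_mono[OF l2_integrable[OF uw_l2] Bochner_Integration.integrable_add[OF i1 i2]])
      fix x
      show "(cmod (u x * w n x))^2 \<le> real k * (cmod (cut (qbox (real k)) (w n) x))^2 + cmod (cut (- S k) ?q x) * cmod (complex_of_real ((cmod (w n x))^2))"
      proof (cases "x \<in> S k")
        case True
        then have "(cmod (u x))^2 * (cmod (w n x))^2 \<le> real k * (cmod (w n x))^2" by (intro mult_right_mono) (auto simp: S_def)
        then show ?thesis using True by (simp add: cut_def S_def norm_mult power_mult_distrib)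
      next
        case False
        then show ?thesis by (simp add: cut_def norm_mult norm_power power_mult_distrib)
      qed
    qed
    also have "\<dots> = real k * nsq (cut (qbox (real k)) (w n)) + (LINT x|lborel. cmod (cut (- S k) ?q x) * cmod (complex_of_real ((cmod (w n x))^2)))"
      unfolding Bochner_Integration.integral_add[OF i1 i2] nsq_def by simp
    also have "\<dots> \<le> real k * nsq (cut (qbox (real k)) (w n)) + sqrt (nsq (cut (- S k) ?q)) * sqrt (nsq (\<lambda>x. complex_of_real ((cmod (w n x))^2)))"
      by (intro add_left_mono cauchy_schwarz_cmod lc lw2)
    also have "sqrt (nsq (\<lambda>x. complex_of_real ((cmod (w n x))^2))) \<le> 4 * M"
      unfolding nsq_sq using L4w[of n] M0 by (intro real_le_lsqrt) (auto simp: power_mult_distrib)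
    finally show ?thesis by (simp add: mult_left_mono)
  qed
  then have "\<forall>\<^sub>F n in sequentially. \<bar>nsq (\<lambda>x. u x * w n x)\<bar> \<le> real k * nsq (cut (qbox (real k)) (w n)) + sqrt (nsq (cut (- S k) ?q)) * (4 * M)" for k
    by simp
  then show ?thesis by (rule tendsto_0_split[OF _ t2 t1])
qed

lemma pmass_split:
  assumes p: "2 < p" "p < 4"
  shows "\<exists>d. d \<longlonglongrightarrow> 0 \<and> (\<forall>n. pmass p (\<lambda>x. u x + w n x) \<le> pmass p u + pmass p (w n) + d n)"
proof -
  let ?q = "\<lambda>x. complex_of_real ((cmod (u x))^2)" and ?q' = "\<lambda>n x. complex_of_real ((cmod (w n x))^2)"
  note lq = sq_l2[OF U] and lq' = sq_l2[OF W]
  define d where "d n = 32 * ((LINT x|lborel. cmod (u x) * cmod (w n x)) + sqrt (nsq ?q) * sqrt (nsq (\<lambda>x. u x * w n x)) + sqrt (nsq (\<lambda>x. u x * w n x)) * (4 * M))" for n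
  have t1: "(\<lambda>n. LINT x|lborel. cmod (u x) * cmod (w n x)) \<longlonglongrightarrow> 0"
    by (rule tendsto_pairing_loc[OF lu lw MW(1) loc[rule_format]])
  have t2: "(\<lambda>n. sqrt (nsq (\<lambda>x. u x * w n x))) \<longlonglongrightarrow> 0" using tendsto_real_sqrt[OF nsq_uw_tendsto] by simp
  have "(\<lambda>n. 32 * ((LINT x|lborel. cmod (u x) * cmod (w n x)) + sqrt (nsq ?q) * sqrt (nsq (\<lambda>x. u x * w n x)) + sqrt (nsq (\<lambda>x. u x * w n x)) * (4 * M)))
     \<longlonglongrightarrow> 32 * (0 + sqrt (nsq ?q) * 0 + 0 * (4 * M))"
    by (intro tendsto_intros t1 t2)
  then have d0: "d \<longlonglongrightarrow> 0" unfolding d_def by simp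
  have "pmass p (\<lambda>x. u x + w n x) \<le> pmass p u + pmass p (w n) + d n" for n
  proof -
    have i1: "integrable lborel (\<lambda>x. cmod (u x) powr p)" by (rule pmass_integrable[OF U p])
    have i2: "integrable lborel (\<lambda>x. cmod (w n x) powr p)" by (rule pmass_integrable[OF W p])
    have i3: "integrable lborel (\<lambda>x. cmod (u x) * cmod (w n x))" by (rule l2_cmod_mult[OF lu lw])
    have i4: "integrable lborel (\<lambda>x. cmod (?q x) * cmod (u x * w n x))" by (rule l2_cmod_mult[OF lq uw_l2])
    have i5: "integrable lborel (\<lambda>x. cmod (u x * w n x) * cmod (?q' n x))" by (rule l2_cmod_mult[OF uw_l2 lq'])
    have i: "integrable lborel (\<lambda>x. cmod (u x) powr p + cmod (w n x) powr p)"
      "integrable lborel (\<lambda>x. cmod (u x) * cmod (w n x) + cmod (?q x) * cmod (u x * w n x))"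
      "integrable lborel (\<lambda>x. cmod (u x) * cmod (w n x) + cmod (?q x) * cmod (u x * w n x) + cmod (u x * w n x) * cmod (?q' n x))"
      by (intro Bochner_Integration.integrable_add i1 i2 i3 i4 i5)+
    note i6 = integrable_mult_right[OF i(3), of 32]
    have "pmass p (\<lambda>x. u x + w n x) \<le> (LINT x|lborel. (cmod (u x) powr p + cmod (w n x) powr p) +
       32 * (cmod (u x) * cmod (w n x) + cmod (?q x) * cmod (u x * w n x) + cmod (u x * w n x) * cmod (?q' n x)))"
      unfolding pmass_def
    proof (rule integral_mono[OF pmass_integrable[OF sob_uw p] Bochner_Integration.integrable_add[OF i(1) i6]])
      fix x
      have "cmod (u x + w n x) powr p \<le> (cmod (u x) + cmod (w n x)) powr p"
        using p by (intro powr_mono2 norm_triangle_ineq) auto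
      also have "\<dots> \<le> cmod (u x) powr p + cmod (w n x) powr p + 32 * (cmod (u x) * cmod (w n x) + (cmod (u x))^3 * cmod (w n x) + cmod (u x) * (cmod (w n x))^3)"
        by (rule powr_add_le[OF p]) auto
      finally show "cmod (u x + w n x) powr p \<le> (cmod (u x) powr p + cmod (w n x) powr p) +
         32 * (cmod (u x) * cmod (w n x) + cmod (?q x) * cmod (u x * w n x) + cmod (u x * w n x) * cmod (?q' n x))"
        by (simp add: norm_mult norm_power power2_eq_square power3_eq_cube mult_ac)
    qed
    also have "\<dots> = pmass p u + pmass p (w n) + 32 * ((LINT x|lborel. cmod (u x) * cmod (w n x)) + (LINT x|lborel. cmod (?q x) * cmod (u x * w n x)) + (LINT x|lborel. cmod (u x * w n x) * cmod (?q' n x)))"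
      unfolding Bochner_Integration.integral_add[OF i(1) i6] Bochner_Integration.integral_add[OF i1 i2] integral_mult_right_zero
        Bochner_Integration.integral_add[OF i(2) i5] Bochner_Integration.integral_add[OF i3 i4] pmass_def ..
    also have "\<dots> \<le> pmass p u + pmass p (w n) + d n"
    proof -
      have "(LINT x|lborel. cmod (?q x) * cmod (u x * w n x)) \<le> sqrt (nsq ?q) * sqrt (nsq (\<lambda>x. u x * w n x))"
        by (rule cauchy_schwarz_cmod[OF lq uw_l2])
      moreover have "(LINT x|lborel. cmod (u x * w n x) * cmod (?q' n x)) \<le> sqrt (nsq (\<lambda>x. u x * w n x)) * (4 * M)"
      proof -
        have "sqrt (nsq (?q' n)) \<le> 4 * M"
          unfolding nsq_sq using L4w[of n] M0 by (intro real_le_lsqrt) (auto simp: power_mult_distrib)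
        then have "sqrt (nsq (\<lambda>x. u x * w n x)) * sqrt (nsq (?q' n)) \<le> sqrt (nsq (\<lambda>x. u x * w n x)) * (4 * M)" by (intro mult_left_mono) auto
        then show ?thesis using cauchy_schwarz_cmod[OF uw_l2 lq', of n n] by linarith
      qed
      ultimately show ?thesis unfolding d_def by argo
    qed
    finally show ?thesis .
  qed
  then show ?thesis using d0 by blast
qed

lemma en_split:
  assumes p: "2 < p" "p < 4" and lam: "lam > 0"
  shows "\<exists>d. d \<longlonglongrightarrow> 0 \<and> (\<forall>n. en lam p u g + en lam p (w n) (h n) \<le> en lam p (\<lambda>x. u x + w n x) (\<lambda>j x. g j x + h n j x) + d n)"
proof -
  obtain d where d: "d \<longlonglongrightarrow> 0" "\<forall>n. pmass p (\<lambda>x. u x + w n x) \<le> pmass p u + pmass p (w n) + d n" using pmass_split[OF p] by blast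
  define k where "k n = kinetic (\<lambda>x. u x + w n x) (\<lambda>j x. g j x + h n j x) - kinetic u g - kinetic (w n) (h n)" for n
  have "(\<lambda>n. - (1/2) * k n + lam / p * d n) \<longlonglongrightarrow> - (1/2) * 0 + lam / p * 0"
    by (intro tendsto_intros d(1)) (use kinetic_split in \<open>simp add: k_def\<close>)
  moreover have "en lam p u g + en lam p (w n) (h n) \<le> en lam p (\<lambda>x. u x + w n x) (\<lambda>j x. g j x + h n j x) + (- (1/2) * k n + lam / p * d n)" for n
  proof -
    have "lam / p * pmass p (\<lambda>x. u x + w n x) \<le> lam / p * (pmass p u + pmass p (w n) + d n)"
      using d(2) lam p by (intro mult_left_mono) auto
    then have "lam / p * pmass p (\<lambda>x. u x + w n x) \<le> lam / p * pmass p u + lam / p * pmass p (w n) + lam / p * d n"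
      by (simp only: distrib_left)
    then show ?thesis unfolding en_def k_def by argo
  qed
  ultimately show ?thesis by (intro exI[of _ "\<lambda>n. - (1/2) * k n + lam / p * d n"]) simp
qed

end

subsection \<open>Borel representatives\<close>

lemma lebesgue_measurable_AE:
  fixes f f' :: "'a::euclidean_space \<Rightarrow> 'b::topological_space"
  assumes ae: "AE x in lebesgue. f x = f' x" and f'[measurable]: "f' \<in> borel_measurable borel"
  shows "f \<in> borel_measurable lebesgue"
proof (rule measurableI)
  fix S :: "'b set" assume "S \<in> sets borel"
  then have s: "f' -` S \<in> sets lebesgue" using measurable_sets[OF measurable_completion[of f' lborel borel], of S] by simp
  have "AE x in lebesgue. x \<in> f' -` S \<longleftrightarrow> x \<in> f -` S" using ae by eventually_elim auto
  from completion.in_sets_AE[OF this s] show "f -` S \<inter> space lebesgue \<in> sets lebesgue" by simp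
qed simp

lemma l2_rep:
  assumes "L2 f" shows "\<exists>f'. l2 f' \<and> (AE x in lebesgue. f x = f' x)"
proof -
  have m[measurable]: "f \<in> borel_measurable lebesgue" and i: "integrable lebesgue (\<lambda>x. (cmod (f x))\<^sup>2)" using assms by (auto simp: L2_def)
  have "(\<lambda>x. Re (f x)) \<in> borel_measurable lebesgue" "(\<lambda>x. Im (f x)) \<in> borel_measurable lebesgue" by measurable
  then obtain r s where r: "r \<in> borel_measurable lborel" "AE x in lborel. Re (f x) = r x"
    and s: "s \<in> borel_measurable lborel" "AE x in lborel. Im (f x) = s x"
    using completion_ex_borel_measurable_real[of "\<lambda>x. Re (f x)" lborel] completion_ex_borel_measurable_real[of "\<lambda>x. Im (f x)" lborel] by auto
  define f' where "f' x = Complex (r x) (s x)" for x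
  have [measurable]: "f' \<in> borel_measurable borel"
    using r(1) s(1) unfolding f'_def[abs_def] Complex_eq by simp
  have ae: "AE x in lebesgue. f x = f' x"
    using AE_completion[OF r(2)] AE_completion[OF s(2)] by eventually_elim (simp add: f'_def complex_eq_iff)
  have "integrable lebesgue (\<lambda>x. (cmod (f' x))\<^sup>2)"
    by (rule integrable_cong_AE_imp[OF i]) (use ae in \<open>auto intro!: measurable_completion\<close>)
  then have "integrable lborel (\<lambda>x. (cmod (f' x))\<^sup>2)" by (subst (asm) integrable_completion) auto
  then show ?thesis using ae by (intro exI[of _ f']) (simp add: l2_def)
qed

lemma LINT_lebesgue_AE:
  fixes f f' :: "'a::euclidean_space \<Rightarrow> 'b::{banach, second_countable_topology}"
  assumes ae: "AE x in lebesgue. f x = f' x" and f': "f' \<in> borel_measurable borel"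
  shows "(LINT x|lebesgue. f x) = (LINT x|lborel. f' x)"
proof -
  have "(LINT x|lebesgue. f x) = (LINT x|lebesgue. f' x)"
    by (rule integral_cong_AE[OF lebesgue_measurable_AE[OF ae f'] measurable_completion ae]) (use f' in simp)
  also have "\<dots> = (LINT x|lborel. f' x)" by (rule integral_completion) (use f' in simp)
  finally show ?thesis .
qed

lemma L2_iff_l2:
  assumes ae: "AE x in lebesgue. f x = f' x" and f'[measurable]: "f' \<in> borel_measurable borel"
  shows "L2 f \<longleftrightarrow> l2 f'"
proof -
  have m[measurable]: "f \<in> borel_measurable lebesgue" by (rule lebesgue_measurable_AE[OF ae f'])
  have m': "f' \<in> borel_measurable lebesgue" by (rule measurable_completion) simp
  note [measurable] = m'
  have "integrable lebesgue (\<lambda>x. (cmod (f x))\<^sup>2) \<longleftrightarrow> integrable lebesgue (\<lambda>x. (cmod (f' x))\<^sup>2)"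
    by (rule integrable_cong_AE) (measurable, use ae in auto)
  also have "\<dots> \<longleftrightarrow> integrable lborel (\<lambda>x. (cmod (f' x))\<^sup>2)" by (rule integrable_completion) measurable
  finally show ?thesis unfolding L2_def l2_def using m by simp
qed

lemma is_wderiv_iff:
  assumes u: "AE x in lebesgue. u x = u' x" "u' \<in> borel_measurable borel"
    and g: "AE x in lebesgue. g x = g' x" "g' \<in> borel_measurable borel" and j: "j \<in> {1,2}"
  shows "is_wderiv j u g \<longleftrightarrow> wderiv j u' g'"
proof -
  note [measurable] = u(2) g(2)
  have "(LINT x|lebesgue. u x * pd j \<phi> x) = (LINT x|lborel. u' x * pd j \<phi> x)"
    "(LINT x|lebesgue. g x * \<phi> x) = (LINT x|lborel. g' x * \<phi> x)" if t: "test_fun \<phi>" for \<phi>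
  proof -
    have [measurable]: "\<phi> \<in> borel_measurable borel" "pd j \<phi> \<in> borel_measurable borel"
      by (rule test_measurable(1)[OF t], rule test_measurable(2)[OF t j])
    show "(LINT x|lebesgue. u x * pd j \<phi> x) = (LINT x|lborel. u' x * pd j \<phi> x)"
      by (rule LINT_lebesgue_AE) (use u(1) in \<open>eventually_elim, simp\<close>, measurable)
    show "(LINT x|lebesgue. g x * \<phi> x) = (LINT x|lborel. g' x * \<phi> x)"
      by (rule LINT_lebesgue_AE) (use g(1) in \<open>eventually_elim, simp\<close>, measurable)
  qed
  then show ?thesis unfolding is_wderiv_def wderiv_def by auto
qed

lemma H1_rep:
  assumes "u \<in> H1" shows "\<exists>u' g. sob u' g \<and> (AE x in lebesgue. u x = u' x)"
proof -
  obtain u' where u': "l2 u'" "AE x in lebesgue. u x = u' x" using assms l2_rep by (auto simp: H1_def)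
  have "\<exists>g'. l2 g' \<and> wderiv j u' g'" if j: "j \<in> {1,2}" for j
  proof -
    obtain g where g: "L2 g" "is_wderiv j u g" using assms j unfolding H1_def by blast
    obtain g' where g': "l2 g'" "AE x in lebesgue. g x = g' x" using l2_rep[OF g(1)] by blast
    then show ?thesis using g(2) is_wderiv_iff[OF u'(2) l2_measurable[OF u'(1)] g'(2) l2_measurable[OF g'(1)] j] by blast
  qed
  then obtain g1 g2 where g: "l2 g1" "wderiv 1 u' g1" "l2 g2" "wderiv 2 u' g2" by (metis insertI1 insertI2)
  define g where "g j = (if j = (1::nat) then g1 else g2)" for j
  have "sob u' g" unfolding sob_def g_def using g u'(1) by auto
  then show ?thesis using u'(2) by blast
qed

lemma sob_imp_H1:
  assumes S: "sob u' g" and ae: "AE x in lebesgue. u x = u' x"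
  shows "u \<in> H1" "j \<in> {1,2} \<Longrightarrow> AE x in lebesgue. wd j u x = g j x"
proof -
  note mu = l2_measurable[OF sob_l2(1)[OF S]]
  have mg: "g j \<in> borel_measurable borel" if "j \<in> {1,2}" for j by (rule l2_measurable[OF sob_l2(4)[OF S that]])
  have ex: "L2 (g j) \<and> is_wderiv j u (g j)" if j: "j \<in> {1,2}" for j
    using is_wderiv_iff[OF ae mu _ mg[OF j] j, of "g j"] L2_iff_l2[OF _ mg[OF j], of "g j"] sob_l2(4)[OF S j] sob_wderiv[OF S j] by simp
  have "L2 u" using L2_iff_l2[OF ae mu] sob_l2(1)[OF S] by simp
  then show "u \<in> H1" using ex unfolding H1_def by blast
  assume j: "j \<in> {1,2}"
  \<comment> \<open>The choice made by \<open>SOME\<close> is arbitrary; almost everywhere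
    uniqueness of weak derivatives identifies it with \<open>g j\<close>.\<close>
  have "L2 (wd j u) \<and> is_wderiv j u (wd j u)" unfolding wd_def by (rule someI[of _ "g j"]) (rule ex[OF j])
  then have w: "L2 (wd j u)" "is_wderiv j u (wd j u)" by auto
  obtain g' where g': "l2 g'" "AE x in lebesgue. wd j u x = g' x" using l2_rep[OF w(1)] by blast
  have "wderiv j u' g'" using w(2) is_wderiv_iff[OF ae mu g'(2) l2_measurable[OF g'(1)] j] by simp
  then have "AE x in lborel. g' x = g j x" by (rule wderiv_unique[OF g'(1) sob_l2(4)[OF S j] _ sob_wderiv[OF S j]])
  then have "AE x in lebesgue. g' x = g j x" by (rule AE_completion)
  with g'(2) show "AE x in lebesgue. wd j u x = g j x" by eventually_elim simp
qed

text \<open>Equality holds at every point \<open>z\<close>, because changing \<open>u\<close> on a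
  null set leaves the convolution integral unchanged.\<close>

lemma A_cong_AE:
  assumes ae: "AE x in lebesgue. u x = u' x" and [measurable]: "u' \<in> borel_measurable borel"
  shows "A j u z = Ab j u' u' z"
proof -
  have "conv (G k) (\<lambda>y. (cmod (u y))\<^sup>2) z = conv (G k) (\<lambda>y. (cmod (u' y))\<^sup>2) z" for k
  proof -
    have "conv (G k) (\<lambda>y. (cmod (u y))\<^sup>2) z = (LINT y|lborel. G k (z - y) * (cmod (u' y))\<^sup>2)"
      unfolding conv_def by (rule LINT_lebesgue_AE) (use ae in \<open>eventually_elim, simp\<close>, measurable)
    moreover have "conv (G k) (\<lambda>y. (cmod (u' y))\<^sup>2) z = (LINT y|lborel. G k (z - y) * (cmod (u' y))\<^sup>2)"
      unfolding conv_def by (rule integral_completion) measurable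
    ultimately show ?thesis by simp
  qed
  then have "A j u z = A j u' z" unfolding A_def by simp
  then show ?thesis using A_eq_Ab[of u' j z] by simp
qed

lemma Dcov_AE:
  assumes S: "sob u' g" and ae: "AE x in lebesgue. u x = u' x" and j: "j \<in> {1,2}"
  shows "AE x in lebesgue. Dcov j u x = dcov j u' g x"
  using sob_imp_H1(2)[OF S ae j] ae
  by eventually_elim (simp add: Dcov_def dcov_def A_cong_AE[OF ae l2_measurable[OF sob_l2(1)[OF S]]])

lemma mass_AE:
  assumes S: "l2 u'" and ae: "AE x in lebesgue. u x = u' x"
  shows "(LINT x|lebesgue. (cmod (u x))\<^sup>2) = nsq u'"
proof -
  note [measurable] = l2_measurable[OF S]
  show ?thesis unfolding nsq_def by (rule LINT_lebesgue_AE) (use ae in \<open>eventually_elim, simp\<close>, measurable)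
qed

lemma energy_AE:
  assumes S: "sob u' g" and ae: "AE x in lebesgue. u x = u' x"
  shows "energy lam p u = en lam p u' g"
proof -
  note [measurable] = l2_measurable[OF sob_l2(1)[OF S]]
  note l = dcov12_l2[OF S]
  note [measurable] = l[THEN l2_measurable]
  have "(LINT x|lebesgue. (cmod (Dcov 1 u x))\<^sup>2 + (cmod (Dcov 2 u x))\<^sup>2) = (LINT x|lborel. (cmod (dcov 1 u' g x))\<^sup>2 + (cmod (dcov 2 u' g x))\<^sup>2)"
  proof (rule LINT_lebesgue_AE)
    have "AE x in lebesgue. Dcov 1 u x = dcov 1 u' g x" "AE x in lebesgue. Dcov 2 u x = dcov 2 u' g x"
      by (rule Dcov_AE[OF S ae], simp)+
    then show "AE x in lebesgue. (cmod (Dcov 1 u x))\<^sup>2 + (cmod (Dcov 2 u x))\<^sup>2 = (cmod (dcov 1 u' g x))\<^sup>2 + (cmod (dcov 2 u' g x))\<^sup>2"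
      by eventually_elim simp
  qed measurable
  also have "\<dots> = kinetic u' g"
    unfolding kinetic_def nsq_def by (rule Bochner_Integration.integral_add[OF l2_integrable[OF l(1)] l2_integrable[OF l(2)]])
  finally have 1: "(LINT x|lebesgue. (cmod (Dcov 1 u x))\<^sup>2 + (cmod (Dcov 2 u x))\<^sup>2) = kinetic u' g" .
  have 2: "(LINT x|lebesgue. cmod (u x) powr p) = pmass p u'"
    unfolding pmass_def by (rule LINT_lebesgue_AE) (use ae in \<open>eventually_elim, simp\<close>, measurable)
  show ?thesis unfolding energy_def en_def 1 2 by simp
qed

lemma H1_norm_AE:
  assumes S: "sob u' g" and ae: "AE x in lebesgue. u x = u' x"
  shows "H1_norm u = sqrt (nsq u' + dirichlet g)"
proof -
  have "(LINT x|lebesgue. (cmod (wd 1 u x))\<^sup>2) = nsq (g 1)" "(LINT x|lebesgue. (cmod (wd 2 u x))\<^sup>2) = nsq (g 2)"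
    by (rule mass_AE[OF sob_l2(2)[OF S]], rule sob_imp_H1(2)[OF S ae], simp)
       (rule mass_AE[OF sob_l2(3)[OF S]], rule sob_imp_H1(2)[OF S ae], simp)
  then show ?thesis unfolding H1_norm_def dirichlet_def mass_AE[OF sob_l2(1)[OF S] ae] by (simp del: One_nat_def add: add.assoc)
qed

lemma Sc_iff: "u \<in> Sc c \<longleftrightarrow> (\<exists>u' g. sob u' g \<and> (AE x in lebesgue. u x = u' x) \<and> nsq u' = c)"
proof
  assume "u \<in> Sc c"
  then have u: "u \<in> H1" "(LINT x|lebesgue. (cmod (u x))\<^sup>2) = c" by (auto simp: Sc_def)
  obtain u' g where "sob u' g" "AE x in lebesgue. u x = u' x" using H1_rep[OF u(1)] by blast
  then show "\<exists>u' g. sob u' g \<and> (AE x in lebesgue. u x = u' x) \<and> nsq u' = c" using u(2) mass_AE sob_l2(1) by metis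
next
  assume "\<exists>u' g. sob u' g \<and> (AE x in lebesgue. u x = u' x) \<and> nsq u' = c"
  then obtain u' g where *: "sob u' g" "AE x in lebesgue. u x = u' x" "nsq u' = c" by blast
  then show "u \<in> Sc c" unfolding Sc_def using sob_imp_H1(1)[OF *(1,2)] mass_AE[OF sob_l2(1)[OF *(1)] *(2)] by simp
qed

lemma sob_in_Sc: "sob u g \<Longrightarrow> nsq u = c \<Longrightarrow> u \<in> Sc c"
  unfolding Sc_iff by (intro exI[of _ u] exI[of _ g]) simp

lemma energy_sob: "sob u g \<Longrightarrow> energy lam p u = en lam p u g"
  by (rule energy_AE) simp_all

lemma AE_lebesgue_shift:
  fixes P :: "'a::euclidean_space \<Rightarrow> bool"
  assumes "AE x in lebesgue. P x" shows "AE x in lebesgue. P (x + a)"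
  using AE_completion[OF AE_shift[of P a]] assms unfolding AE_completion_iff by blast

subsection \<open>Negativity of the infimum\<close>

lemma Ab_shift:
  assumes [measurable]: "u \<in> borel_measurable borel"
  shows "Ab j (\<lambda>x. u (x + a)) (\<lambda>x. u (x + a)) z = Ab j u u (z + a)"
proof -
  have "Gconv k (\<lambda>x. u (x + a)) (\<lambda>x. u (x + a)) z = Gconv k u u (z + a)" for k
  proof -
    have m: "(\<lambda>y. Re (u y * cnj (u y))) \<in> borel_measurable borel" by measurable
    have "(LINT y|lborel. (\<lambda>y. G k (z + a - y) * Re (u y * cnj (u y))) (y + a)) = Gconv k u u (z + a)"
      unfolding Gconv_def by (rule integral_shift) (use m in measurable)
    then show ?thesis unfolding Gconv_def by simp
  qed
  then show ?thesis unfolding Ab_def by simp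
qed

lemma shift_invariance:
  assumes S: "sob u g"
  shows "nsq (\<lambda>x. u (x + a)) = nsq u" "dirichlet (\<lambda>j x. g j (x + a)) = dirichlet g"
    "en lam p (\<lambda>x. u (x + a)) (\<lambda>j x. g j (x + a)) = en lam p u g"
    "nsq (cut (sqr 0 L) (\<lambda>x. u (x + a))) = nsq (cut (sqr a L) u)"
proof -
  note l = sob_l2(1-3)[OF S]
  note [measurable] = l2_measurable[OF l(1)]
  show "nsq (\<lambda>x. u (x + a)) = nsq u" by (rule nsq_shift[OF l(1)])
  show "dirichlet (\<lambda>j x. g j (x + a)) = dirichlet g" unfolding dirichlet_def by (simp only: nsq_shift[OF l(2)] nsq_shift[OF l(3)])
  have "dcov j (\<lambda>x. u (x + a)) (\<lambda>j x. g j (x + a)) = (\<lambda>x. dcov j u g (x + a))" for j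
    unfolding dcov_def by (simp add: Ab_shift)
  then have K: "kinetic (\<lambda>x. u (x + a)) (\<lambda>j x. g j (x + a)) = kinetic u g"
    unfolding kinetic_def by (simp only: nsq_shift[OF dcov12_l2(1)[OF S]] nsq_shift[OF dcov12_l2(2)[OF S]])
  have N: "pmass p (\<lambda>x. u (x + a)) = pmass p u"
    unfolding pmass_def by (rule integral_shift[of "\<lambda>x. cmod (u x) powr p"]) measurable
  show "en lam p (\<lambda>x. u (x + a)) (\<lambda>j x. g j (x + a)) = en lam p u g" unfolding en_def K N ..
  have "cut (sqr 0 L) (\<lambda>x. u (x + a)) = (\<lambda>x. cut (sqr a L) u (x + a))"
    by (auto simp: cut_def sqr_def fun_eq_iff mem_Times_iff add.commute)
  then show "nsq (cut (sqr 0 L) (\<lambda>x. u (x + a))) = nsq (cut (sqr a L) u)"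
    by (simp only: nsq_shift[OF l2_cut[OF l(1) sqr_sets]])
qed

section \<open>A trial function of negative energy\<close>

lemma test_dilate:
  assumes phi: "test_fun \<phi>" and t: "t > 0"
  shows "test_fun (\<lambda>x. \<phi> (t *\<^sub>R x))" "j \<in> {1,2} \<Longrightarrow> pd j (\<lambda>x. \<phi> (t *\<^sub>R x)) = (\<lambda>x. of_real t * pd j \<phi> (t *\<^sub>R x))"
proof -
  let ?f = "\<lambda>x. \<phi> (t *\<^sub>R x)"
  have step: "((\<lambda>s. of_real (t ^ n) * pds js \<phi> (t *\<^sub>R (x + s *\<^sub>R evec j))) has_vector_derivative of_real (t ^ Suc n) * pds (j # js) \<phi> (t *\<^sub>R x)) (at 0)"
    if js: "set js \<subseteq> {1,2}" and j: "j \<in> {1,2}" for js j n x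
  proof -
    have 1: "((\<lambda>s. pds js \<phi> (t *\<^sub>R x + s *\<^sub>R evec j)) has_vector_derivative pds (j # js) \<phi> (t *\<^sub>R x)) (at (t * 0))"
      unfolding mult_zero_right
      by (rule phi[unfolded test_fun_def, THEN conjunct1, rule_format, OF js, THEN conjunct2, rule_format, OF j])
    have 2: "((\<lambda>s. t * s) has_vector_derivative t) (at 0)"
      by (auto intro!: derivative_eq_intros simp: has_real_derivative_iff_has_vector_derivative[symmetric])
    have "((\<lambda>s. pds js \<phi> (t *\<^sub>R x + (t * s) *\<^sub>R evec j)) has_vector_derivative t *\<^sub>R pds (j # js) \<phi> (t *\<^sub>R x)) (at 0)"
      using vector_diff_chain_at[OF 2 1] by (simp add: o_def)
    from has_vector_derivative_mult_right[OF this, of "of_real (t ^ n)"]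
    show ?thesis by (simp add: scaleR_add_right scaleR_conv_of_real mult_ac)
  qed
  have pds: "pds js ?f = (\<lambda>x. of_real (t ^ length js) * pds js \<phi> (t *\<^sub>R x))" if "set js \<subseteq> {1,2}" for js
    using that
  proof (induct js)
    case (Cons j js)
    have "pd j (\<lambda>x. of_real (t ^ length js) * pds js \<phi> (t *\<^sub>R x)) = (\<lambda>x. of_real (t ^ Suc (length js)) * pds (j # js) \<phi> (t *\<^sub>R x))"
      unfolding pd_def[of j "\<lambda>x. of_real (t ^ length js) * pds js \<phi> (t *\<^sub>R x)"]
      by (rule ext, rule vector_derivative_at, rule step) (use Cons in auto)
    then show ?case using Cons by simp
  qed simp
  show "test_fun ?f"
    unfolding test_fun_def
  proof (intro conjI allI impI ballI)
    fix js :: "nat list" assume js: "set js \<subseteq> {1,2}"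
    have c: "continuous_on UNIV (pds js \<phi>)" using phi js unfolding test_fun_def by blast
    show "continuous_on UNIV (pds js ?f)"
      unfolding pds[OF js] by (intro continuous_intros continuous_on_compose2[OF c]) auto
    fix j x assume j: "j \<in> {1,2::nat}"
    have "set (j # js) \<subseteq> {1,2}" using js j by auto
    from pds[OF this] step[OF js j, of "length js" x]
    show "((\<lambda>s. pds js ?f (x + s *\<^sub>R evec j)) has_vector_derivative pds (j # js) ?f x) (at 0)"
      unfolding pds[OF js] by simp
  next
    have "bounded (closure {x. \<phi> x \<noteq> 0})" using phi by (simp add: test_fun_def compact_imp_bounded)
    then have "bounded {x. \<phi> x \<noteq> 0}" by (rule bounded_subset) (rule closure_subset)
    then have "bounded ((\<lambda>x. (1/t) *\<^sub>R x) ` {x. \<phi> x \<noteq> 0})" by (rule bounded_scaling)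
    moreover have "{x. \<phi> (t *\<^sub>R x) \<noteq> 0} \<subseteq> (\<lambda>x. (1/t) *\<^sub>R x) ` {x. \<phi> x \<noteq> 0}"
    proof
      fix x assume "x \<in> {x. \<phi> (t *\<^sub>R x) \<noteq> 0}"
      then show "x \<in> (\<lambda>x. (1/t) *\<^sub>R x) ` {x. \<phi> x \<noteq> 0}" using t by (intro image_eqI[of _ _ "t *\<^sub>R x"]) auto
    qed
    ultimately have "bounded {x. \<phi> (t *\<^sub>R x) \<noteq> 0}" by (rule bounded_subset)
    then show "compact (closure {x. \<phi> (t *\<^sub>R x) \<noteq> 0})" by simp
  qed
  assume j: "j \<in> {1,2}"
  have "set [j] \<subseteq> {1,2}" using j by auto
  from pds[OF this] show "pd j ?f = (\<lambda>x. of_real t * pd j \<phi> (t *\<^sub>R x))" by simp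
qed

lemma integral_dilate:
  fixes f :: "real \<times> real \<Rightarrow> real"
  assumes [measurable]: "f \<in> borel_measurable borel" and t: "t > 0"
  shows "(LINT x|lborel. f (t *\<^sub>R x)) = (LINT x|lborel. f x) / t^2"
proof -
  have "(LINT x|lborel. f x) = (LINT x|density (distr lborel borel (\<lambda>x. 0 + t *\<^sub>R x)) (\<lambda>_. \<bar>t\<bar>^DIM(real \<times> real)). f x)"
    by (subst lborel_affine[of t 0]) (use t in auto)
  also have "\<dots> = (LINT x|distr lborel borel (\<lambda>x. 0 + t *\<^sub>R x). t^2 *\<^sub>R f x)"
    using t by (subst integral_density) (auto simp: ennreal_power power2_eq_square)
  also have "\<dots> = (LINT x|lborel. t^2 *\<^sub>R f (t *\<^sub>R x))"
    by (subst integral_distr) auto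
  finally show ?thesis using t by simp
qed

lemma nsq_dilate: assumes "l2 f" "t > 0" shows "nsq (\<lambda>x. f (t *\<^sub>R x)) = nsq f / t^2"
proof -
  note [measurable] = l2_measurable[OF assms(1)]
  show ?thesis unfolding nsq_def by (rule integral_dilate[of "\<lambda>x. (cmod (f x))^2"]) (measurable, use assms in simp)
qed

text \<open>An explicit lower bound serving only the positivity of mass and \<open>pmass\<close> of
  the trial bump: four factors exp(-1/s) with s >= 1/4.\<close>

lemma bump_lower: "x \<in> sqr (1/4, 1/4) (1/2) \<Longrightarrow> exp (-16) \<le> cmod (bump2 1 0 1 0 1 x)"
proof -
  assume x: "x \<in> sqr (1/4, 1/4) (1/2)"
  have h: "hexp 0 s \<ge> exp (-4)" if "s \<ge> 1/4" for s
  proof -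
    have "1 / s \<le> 4" using that by (simp add: field_simps)
    then show ?thesis using that by (simp add: hexp_def)
  qed
  have b: "bmp 1 0 1 s \<ge> exp (-8)" if "1/4 \<le> s" "s \<le> 3/4" for s
  proof -
    have "exp (-4) * exp (-4) \<le> hexp 0 s * hexp 0 (1 - s)" using that by (intro mult_mono h) (auto simp: hexp_range)
    then show ?thesis unfolding bmp_def by (simp add: exp_add[symmetric])
  qed
  have "exp (-8) * exp (-8) \<le> bmp 1 0 1 (fst x) * bmp 1 0 1 (snd x)"
    using x by (intro mult_mono b) (auto simp: sqr_def bmp_range)
  then have "exp (-16) \<le> bmp 1 0 1 (fst x) * bmp 1 0 1 (snd x)" by (simp add: exp_add[symmetric])
  then show ?thesis unfolding bump2_def tens_def by (simp del: of_real_mult)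
qed

text \<open>The witness solves t^(2-q) = b/(2a + 1); the summand 1 keeps the denominator positive
  when a = 0. With q = p - 2 < 2 the nonlinear term wins under small dilations.\<close>

lemma powr_tendsto_small:
  assumes "0 < (q::real)" "q < 2" "a \<ge> 0" "b > 0"
  shows "\<exists>t>0. a * t^2 < b * t powr q"
proof -
  define t where "t = (b / (2 * a + 1)) powr (1 / (2 - q))"
  have pos: "b / (2 * a + 1) > 0" using assms by (simp add: add_nonneg_pos)
  have t: "t > 0" unfolding t_def powr_gt_zero using pos by force
  have tq: "t powr (2 - q) = b / (2 * a + 1)" 
  proof -
    have "b \<noteq> 0" "2 * a + 1 \<noteq> 0" "2 - q \<noteq> 0" using assms by auto
    then show ?thesis using pos by (simp add: t_def powr_powr abs_of_pos del: abs_divide)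
  qed
  have "a * (b / (2 * a + 1)) < b" using assms by (simp add: field_simps add_nonneg_pos add_pos_nonneg)
  then have "a * t powr (2 - q) * t powr q < b * t powr q" unfolding tq using t by (intro mult_strict_right_mono) auto
  moreover have "t powr (2 - q) * t powr q = t^2" using t by (simp add: powr_add[symmetric])
  ultimately show ?thesis using t by (intro exI[of _ t]) (simp add: mult.assoc)
qed

text \<open>Under the mass-preserving dilation t * f(t x) the Dirichlet integral scales like t^2 and
  \<open>pmass\<close> like t^(p-2). As p < 4, spreading the bump out makes the energy
  negative.\<close>

lemma trial_function:
  assumes lam: "lam > 0" and p: "2 < p" "p < 4" and c: "0 < c" "c \<le> 1/8"
  shows "\<exists>v g. sob v g \<and> nsq v = c \<and> en lam p v g < 0"
proof -
  let ?\<phi> = "bump2 1 0 1 0 1"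
  have phi: "test_fun ?\<phi>" by (rule test_bump2)
  note lphi = test_l2(1)[OF phi]
  note [measurable] = l2_measurable[OF lphi]
  have S: "sob ?\<phi> (\<lambda>j. pd j ?\<phi>)" by (rule test_sob[OF phi])
  let ?Q = "sqr (1/4, 1/4) (1/2)"
  have em: "emeasure lborel ?Q = ennreal (1/4)" using emeasure_sqr[of "1/2" "(1/4,1/4)"] by (simp add: power2_eq_square)
  have iQ: "integrable lborel (\<lambda>x. C * indicat_real ?Q x)" "(LINT x|lborel. C * indicat_real ?Q x) = C / 4" for C :: real
    using em by (auto simp: measure_def)
  have N: "nsq ?\<phi> > 0"
  proof -
    have "(LINT x|lborel. (exp (-16))^2 * indicat_real ?Q x) \<le> nsq ?\<phi>"
      unfolding nsq_def
    proof (rule integral_mono[OF iQ(1) l2_integrable[OF lphi]])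
      fix x show "(exp (-16))^2 * indicat_real ?Q x \<le> (cmod (?\<phi> x))^2"
        using power_mono[OF bump_lower[of x], of 2] by (cases "x \<in> ?Q") auto
    qed
    moreover have "(exp (-16))^2 / 4 > (0::real)" by simp
    ultimately show ?thesis unfolding iQ(2) by linarith
  qed
  have q: "pmass p ?\<phi> > 0"
  proof -
    have "(LINT x|lborel. (exp (-16)) powr p * indicat_real ?Q x) \<le> pmass p ?\<phi>"
      unfolding pmass_def
    proof (rule integral_mono[OF iQ(1) pmass_integrable[OF S p]])
      fix x show "(exp (-16)) powr p * indicat_real ?Q x \<le> cmod (?\<phi> x) powr p"
        using powr_mono2[OF _ _ bump_lower[of x], of p] p by (cases "x \<in> ?Q") auto
    qed
    moreover have "(exp (-16)) powr p / 4 > (0::real)" by simp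
    ultimately show ?thesis unfolding iQ(2) by linarith
  qed
  define K where "K = dirichlet (\<lambda>j. pd j ?\<phi>)"
  define al where "al = sqrt (c / nsq ?\<phi>)"
  have al: "al > 0" "al^2 * nsq ?\<phi> = c" using c N by (auto simp: al_def)
  have "\<exists>t>0. (3/2 * al^2 * K) * t^2 < (lam / p * (al powr p * pmass p ?\<phi>)) * t powr (p - 2)"
    by (rule powr_tendsto_small) (use p lam al q in \<open>auto simp: K_def\<close>)
  then obtain t where t: "t > 0" "(3/2 * al^2 * K) * t^2 < (lam / p * (al powr p * pmass p ?\<phi>)) * t powr (p - 2)" by blast
  define v where "v x = of_real (al * t) * ?\<phi> (t *\<^sub>R x)" for x
  define g where "g j x = of_real (al * t) * pd j (\<lambda>x. ?\<phi> (t *\<^sub>R x)) x" for j x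
  have Sv: "sob v g" unfolding v_def[abs_def] g_def[abs_def] by (intro sob_cmult test_sob test_dilate(1) phi t)
  have nv: "nsq v = c"
    unfolding v_def[abs_def] nsq_scale nsq_dilate[OF lphi t(1)] norm_of_real power2_abs power_mult_distrib
    using t(1) al(2) by simp
  have "nsq (g j) = al^2 * t^2 * nsq (pd j ?\<phi>)" if j: "j \<in> {1,2}" for j
    unfolding g_def[abs_def] test_dilate(2)[OF phi t(1) j] nsq_scale nsq_dilate[OF test_l2(2)[OF phi j] t(1)]
      norm_of_real power2_abs power_mult_distrib
    using t(1) by (simp add: power2_eq_square)
  from this[of 1] this[of 2] have Gv: "dirichlet g = al^2 * t^2 * K" unfolding dirichlet_def K_def by (simp add: distrib_left)
  \<comment> \<open>Here 16 c^2 <= 1/4, which allows the factor 3; halved by the energy, it is the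
    3/2 in the choice of \<open>t\<close>.\<close>
  have Kv: "kinetic v g \<le> 3 * (al^2 * t^2 * K)"
  proof -
    have "c^2 \<le> (1/8)^2" using c by (intro power_mono) auto
    then have "2 + 16 * c^2 \<le> 3" by (simp add: power2_eq_square)
    then have "(2 + 16 * c^2) * dirichlet g \<le> 3 * dirichlet g" by (intro mult_right_mono) auto
    then show ?thesis using kinetic_le_dirichlet[OF Sv] unfolding nv Gv by linarith
  qed
  have Nv: "pmass p v = al powr p * t powr (p - 2) * pmass p ?\<phi>"
  proof -
    have "pmass p v = (LINT x|lborel. (al * t) powr p * (cmod (?\<phi> (t *\<^sub>R x)) powr p))"
      unfolding pmass_def v_def using al t by (intro Bochner_Integration.integral_cong refl) (simp add: norm_mult powr_mult)
    also have "\<dots> = (al * t) powr p * (pmass p ?\<phi> / t^2)"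
      unfolding integral_mult_right_zero pmass_def by (subst integral_dilate[of "\<lambda>x. cmod (?\<phi> x) powr p"]) (use t in auto)
    also have "(al * t) powr p = al powr p * t powr (p - 2) * t^2"
      using al t powr_add[of t "p - 2" 2] by (simp add: powr_mult)
    finally show ?thesis using t by simp
  qed
  have "en lam p v g \<le> 1/2 * (3 * (al^2 * t^2 * K)) - lam / p * (al powr p * t powr (p - 2) * pmass p ?\<phi>)"
    unfolding en_def Nv by (intro diff_right_mono mult_left_mono[OF Kv]) simp
  also have "\<dots> < 0" using t(2) by (simp add: mult_ac)
  finally show ?thesis using Sv nv by blast
qed

section \<open>The infimum on the sphere\<close>

lemma Sc_energy_bdd_below:
  assumes lam: "lam > 0" and p: "2 < p" "p < 4" and c: "c \<le> 1/8"
  shows "bdd_below (energy lam p ` Sc c)"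
proof -
  obtain C where C: "C \<ge> 0" "\<forall>u g. sob u g \<longrightarrow> nsq u \<le> 1/8 \<longrightarrow> dirichlet g \<le> 16 * en lam p u g + C"
    using en_coercive[OF lam p] by blast
  have "- C / 16 \<le> energy lam p u" if u: "u \<in> Sc c" for u
  proof -
    obtain u' g where *: "sob u' g" "AE x in lebesgue. u x = u' x" "nsq u' = c" using u Sc_iff by blast
    have "0 \<le> 16 * en lam p u' g + C" using C(2) *(1,3) c dirichlet_nonneg[of g] order_trans by blast
    then show ?thesis unfolding energy_AE[OF *(1,2)] by argo
  qed
  then show ?thesis by (intro bdd_belowI2) auto
qed

lemma mc_le:
  assumes lam: "lam > 0" and p: "2 < p" "p < 4" and c: "c \<le> 1/8" and S: "sob u g" "nsq u = c"
  shows "mc lam p c \<le> en lam p u g"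
  unfolding mc_def energy_sob[OF S(1), symmetric]
  by (rule cINF_lower[OF Sc_energy_bdd_below[OF lam p c] sob_in_Sc[OF S]])

lemma mc_neg:
  assumes lam: "lam > 0" and p: "2 < p" "p < 4" and c: "0 < c" "c \<le> 1/8"
  shows "mc lam p c < 0"
proof -
  obtain v g where v: "sob v g" "nsq v = c" "en lam p v g < 0" using trial_function[OF lam p c] by blast
  show ?thesis using mc_le[OF lam p c(2) v(1,2)] v(3) by linarith
qed

lemma minimizing_sequence:
  assumes lam: "lam > 0" and p: "2 < p" "p < 4" and c: "0 < c" "c \<le> 1/8"
  shows "\<exists>un :: nat \<Rightarrow> cfun. (\<forall>n. un n \<in> Sc c) \<and> (\<lambda>n. energy lam p (un n)) \<longlonglongrightarrow> mc lam p c"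
proof -
  have ne: "Sc c \<noteq> {}" using trial_function[OF lam p c] sob_in_Sc by blast
  have "\<exists>v. v \<in> Sc c \<and> energy lam p v < mc lam p c + 1 / real (Suc n)" for n
  proof -
    have lt: "Inf (energy lam p ` Sc c) < mc lam p c + 1 / real (Suc n)"
      unfolding mc_def by (rule less_add_same_cancel1[THEN iffD2]) simp
    have "energy lam p ` Sc c \<noteq> {}" unfolding image_is_empty by (rule ne)
    from cInf_lessD[OF this lt] show ?thesis by blast
  qed
  then obtain un where un: "\<forall>n. un n \<in> Sc c \<and> energy lam p (un n) < mc lam p c + 1 / real (Suc n)" by metis
  have "(\<lambda>n. energy lam p (un n)) \<longlonglongrightarrow> mc lam p c"
  proof (rule tendsto_sandwich)
    show "\<forall>\<^sub>F n in sequentially. mc lam p c \<le> energy lam p (un n)"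
      unfolding mc_def by (intro always_eventually allI cINF_lower[OF Sc_energy_bdd_below[OF lam p c(2)]]) (use un in auto)
    show "\<forall>\<^sub>F n in sequentially. energy lam p (un n) \<le> mc lam p c + 1 / real (Suc n)" using un by (simp add: less_imp_le)
    show "(\<lambda>n. mc lam p c + 1 / real (Suc n)) \<longlonglongrightarrow> mc lam p c"
      using tendsto_add[OF tendsto_const LIMSEQ_Suc[OF lim_1_over_n], of "mc lam p c"] by simp
  qed simp
  then show ?thesis using un by blast
qed

text \<open>Scaling \<open>v\<close> up to mass \<open>c\<close> compares it with m(c). As m(c) < 0,
  the divisor strictly improves on the proportional share of m(c) when \<open>nsq v\<close> < c.
  This is the form in which strict subadditivity is used; the infimum at other masses never
  appears.\<close>

lemma en_lower_scaled:
  assumes lam: "lam > 0" and p: "2 < p" "p < 4" and c: "0 < c" "c \<le> (p - 2) / 260"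
    and S: "sob v g" and b: "0 < nsq v" "nsq v \<le> c"
  shows "nsq v / c * mc lam p c / (1 + (p - 2) / 4 * (1 - nsq v / c)) \<le> en lam p v g"
    "nsq v / c * mc lam p c \<le> en lam p v g"
proof -
  define \<theta> where "\<theta> = c / nsq v"
  have th: "\<theta> \<ge> 1" "\<theta> * nsq v = c" "1/\<theta> = nsq v / c" using b c by (auto simp: \<theta>_def)
  have "(p - 2) / 260 \<le> 1/8" using p by simp
  then have c8: "c \<le> 1/8" using c by linarith
  define d where "d = 1 + (p - 2) / 4 * (1 - nsq v / c)"
  have d: "d \<ge> 1" using b c p by (simp add: d_def)
  have "mc lam p c \<le> en lam p (\<lambda>x. of_real (sqrt \<theta>) * v x) (\<lambda>j x. of_real (sqrt \<theta>) * g j x)"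
    by (rule mc_le[OF lam p c8 sob_cmult[OF S]]) (use th in \<open>simp add: nsq_scale\<close>)
  also have "\<dots> \<le> \<theta> * (1 + (p - 2) / 4 * (1 - 1/\<theta>)) * en lam p v g"
    by (rule en_scale[OF S p lam b(1) th(1)]) (use th c in simp)
  also have "\<dots> = \<theta> * d * en lam p v g" unfolding th(3) d_def ..
  finally have 1: "mc lam p c \<le> \<theta> * d * en lam p v g" .
  have "nsq v / c * mc lam p c / d \<le> nsq v / c * (\<theta> * d * en lam p v g) / d"
    using 1 b c d by (intro divide_right_mono mult_left_mono) auto
  also have "\<dots> = en lam p v g" using b c d by (simp add: \<theta>_def)
  finally have 2: "nsq v / c * mc lam p c / d \<le> en lam p v g" .
  then show "nsq v / c * mc lam p c / (1 + (p - 2) / 4 * (1 - nsq v / c)) \<le> en lam p v g" unfolding d_def .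
  \<comment> \<open>The infimum is negative, so dropping the divisor d >= 1 only lowers the
    bound.\<close>
  have "nsq v / c * (- mc lam p c) / d \<le> nsq v / c * (- mc lam p c) / 1"
    using b c d mc_neg[OF lam p c(1) c8] by (intro divide_left_mono mult_nonneg_nonneg) auto
  then show "nsq v / c * mc lam p c \<le> en lam p v g" using 2 by simp
qed

subsection \<open>Compactness of minimizing sequences\<close>

text \<open>If every unit square carried mass at most s^2, \<open>powr_interp2\<close> and
  \<open>sob_L3\<close> would push \<open>pmass\<close> down to 3/4 of \<open>\<kappa>\<close>. The
  threshold depends on \<open>\<kappa>\<close>, \<open>p\<close> and the bound \<open>M\<close>
  only, so one \<open>d\<close> serves a whole sequence.\<close>

lemma nonvanishing:
  assumes p: "2 < p" "p < 4" and k: "\<kappa> > 0"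
  shows "\<exists>d>0. \<forall>u g. sob u g \<longrightarrow> nsq u \<le> M \<longrightarrow> dirichlet g \<le> M \<longrightarrow> \<kappa> \<le> pmass p u \<longrightarrow> (\<exists>y. d < nsq (cut (sqr y 1) u))"
proof (cases "M \<ge> 0")
  case True
  define D where "D = M + 16 * M^2 + 1"
  define e where "e = \<kappa> / (4 * D)"
  have D: "D > 0" using True by (simp add: D_def add_nonneg_pos)
  have e: "e > 0" "e * D = \<kappa> / 4" using k D by (simp_all add: e_def)
  have e1: "e * (M + 16 * M^2) \<le> \<kappa> / 4"
  proof -
    have "e * (M + 16 * M^2) \<le> e * D" using e unfolding D_def by (intro mult_left_mono) auto
    also have "\<dots> = \<kappa> / 4" by (rule e(2))
    finally show ?thesis .
  qed
  obtain C where C: "C \<ge> 0" "\<forall>t\<ge>0. t powr p \<le> e * t^2 + C * t^3 + e * t^4" using powr_interp2[OF p e(1)] by blast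
  define D' where "D' = C * (4 * M) + 1"
  define s where "s = \<kappa> / (2 * D')"
  have D': "D' > 0" using True C by (simp add: D'_def add_nonneg_pos)
  have s: "s > 0" using k D' by (simp add: s_def)
  have s1: "C * (s * (4 * M)) \<le> \<kappa> / 2"
  proof -
    have "C * (s * (4 * M)) \<le> s * D'" using s by (simp add: D'_def algebra_simps)
    also have "\<dots> = \<kappa> / 2" using D' by (simp add: s_def)
    finally show ?thesis .
  qed
  have "\<exists>y. s^2 < nsq (cut (sqr y 1) u)" if S: "sob u g" and m: "nsq u \<le> M" "dirichlet g \<le> M" and K: "\<kappa> \<le> pmass p u" for u g
  proof (rule ccontr)
    assume "\<not> (\<exists>y. s^2 < nsq (cut (sqr y 1) u))"
    then have small: "nsq (cut (sqr z 1) u) \<le> s^2" for z by (simp add: not_less)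
    note l3 = sob_L3[OF S small] and l4 = sob_L4[OF S]
    note l = sob_l2(1)[OF S]
    have i: "integrable lborel (\<lambda>x. e * (cmod (u x))^2)" "integrable lborel (\<lambda>x. C * (cmod (u x))^3)" "integrable lborel (\<lambda>x. e * (cmod (u x))^4)"
      by (intro integrable_mult_right l3(1) l4(1) l2_integrable[OF l])+
    have "pmass p u \<le> (LINT x|lborel. e * (cmod (u x))^2 + C * (cmod (u x))^3 + e * (cmod (u x))^4)"
      unfolding pmass_def by (intro integral_mono pmass_integrable[OF S p] Bochner_Integration.integrable_add i) (use C in auto)
    also have "\<dots> = e * nsq u + C * (LINT x|lborel. (cmod (u x))^3) + e * (LINT x|lborel. (cmod (u x))^4)"
      by (simp add: Bochner_Integration.integral_add[OF Bochner_Integration.integrable_add[OF i(1,2)] i(3)]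
          Bochner_Integration.integral_add[OF i(1,2)] nsq_def)
    also have "\<dots> \<le> e * M + C * (s * (4 * M)) + e * (16 * M^2)"
    proof (intro add_mono mult_left_mono)
      have "sqrt (s^2) * h1_scaled 1 u g \<le> s * (4 * M)" using s m by (auto simp: h1_scaled_def intro!: mult_left_mono)
      then show "(LINT x|lborel. (cmod (u x))^3) \<le> s * (4 * M)" using l3(2) by linarith
      have "nsq u * dirichlet g \<le> M * M" using m True by (intro mult_mono) auto
      then show "(LINT x|lborel. (cmod (u x))^4) \<le> 16 * M^2" using l4(2) by (simp add: power2_eq_square)
    qed (use e C m in auto)
    also have "\<dots> \<le> \<kappa> / 4 + \<kappa> / 2" using e1 s1 by (simp add: distrib_left)
    finally show False using K k by linarith
  qed
  then show ?thesis using s by (intro exI[of _ "s^2"]) auto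
next
  case False
  then have "\<not> nsq u \<le> M" for u using nsq_nonneg[of u] by linarith
  then show ?thesis by (intro exI[of _ 1]) auto
qed

lemma en_bounded_imp_bounded:
  assumes lam: "lam > 0" and p: "2 < p" "p < 4" and c: "c \<le> 1/8"
    and S: "\<And>n. sob (vn n) (hn n)" and nc: "\<And>n. nsq (vn n) = c" and E: "(\<lambda>n. en lam p (vn n) (hn n)) \<longlonglongrightarrow> m"
  shows "\<exists>M. \<forall>n. nsq (vn n) \<le> M \<and> dirichlet (hn n) \<le> M"
proof -
  obtain C where C: "C \<ge> 0" "\<forall>u g. sob u g \<longrightarrow> nsq u \<le> 1/8 \<longrightarrow> dirichlet g \<le> 16 * en lam p u g + C"
    using en_coercive[OF lam p] by blast
  obtain B where B: "\<forall>n. \<bar>en lam p (vn n) (hn n)\<bar> \<le> B"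
    using convergent_imp_Bseq[OF convergentI[OF E]] unfolding Bseq_def real_norm_def by blast
  have "dirichlet (hn n) \<le> 16 * B + C" for n
  proof -
    have "dirichlet (hn n) \<le> 16 * en lam p (vn n) (hn n) + C" using C(2) S nc c by auto
    then show ?thesis using B[rule_format, of n] by linarith
  qed
  then show ?thesis using nc by (intro exI[of _ "max c (16 * B + C)"]) (auto simp: le_max_iff_disj)
qed

lemma compact_minimizing_sequence:
  assumes lam: "lam > 0" and p: "2 < p" "p < 4" and c: "0 < c" "c < (p - 2) / 260"
    and S: "\<And>n. sob (vn n) (hn n)" and nc: "\<And>n. nsq (vn n) = c"
    and E: "(\<lambda>n. en lam p (vn n) (hn n)) \<longlonglongrightarrow> mc lam p c"
    and d: "d > 0" "\<forall>\<^sub>F n in sequentially. d < nsq (cut (sqr 0 1) (vn n))"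
  shows "\<exists>(r :: nat \<Rightarrow> nat) u g. strict_mono r \<and> sob u g \<and> nsq u = c \<and> en lam p u g = mc lam p c \<and>
     (\<lambda>n. nsq (\<lambda>x. vn (r n) x - u x) + dirichlet (\<lambda>j x. hn (r n) j x - g j x)) \<longlonglongrightarrow> 0"
proof -
  have c8: "c \<le> 1/8" using c p by argo
  have neg: "mc lam p c < 0" by (rule mc_neg[OF lam p c(1) c8])
  obtain M where M: "\<forall>n. nsq (vn n) \<le> M \<and> dirichlet (hn n) \<le> M"
    using en_bounded_imp_bounded[where vn=vn and hn=hn, OF lam p c8 S nc E] by blast
  obtain r :: "nat \<Rightarrow> nat" and u g where r: "strict_mono r" and U: "sob u g"
    and ae: "AE x in lborel. (\<lambda>n. vn (r n) x) \<longlonglongrightarrow> u x"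
    and loc: "\<forall>k. (\<lambda>n. nsq (cut (qbox (real k)) (\<lambda>x. vn (r n) x - u x))) \<longlonglongrightarrow> 0"
    using sobolev_compactness[where un=vn and gn=hn and M=M, OF S] M by blast
  define w where "w n x = vn (r n) x - u x" for n x
  define h where "h n j x = hn (r n) j x - g j x" for n j x
  have W: "sob (w n) (h n)" for n unfolding w_def[abs_def] h_def[abs_def] by (rule sob_diff[OF S U])
  note lu = sob_l2(1)[OF U] and lw = sob_l2(1)[OF W] and lv = sob_l2(1)[OF S]
  have uw: "(\<lambda>x. u x + w n x) = vn (r n)" "(\<lambda>j x. g j x + h n j x) = hn (r n)" for n
    by (simp_all add: w_def h_def)
  have loc: "\<forall>k. (\<lambda>n. nsq (cut (qbox (real k)) (w n))) \<longlonglongrightarrow> 0" using loc by (simp add: w_def[abs_def])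
  have ac: "nsq u \<le> c"
    by (rule l2_fatou(2)[OF lv _ l2_measurable[OF lu] ae]) (simp add: nc)
  \<comment> \<open>Mass \<open>d\<close> stays in the unit square, where \<open>w n\<close> tends
    to 0 in L2; hence \<open>u\<close> carries at least d/2.\<close>
  have a0: "nsq u > 0"
  proof -
    have "\<forall>\<^sub>F n in sequentially. d < nsq (cut (sqr 0 1) (vn (r n)))"
      using r d(2) by (rule eventually_subseq)
    then have "\<forall>\<^sub>F n in sequentially. d \<le> 2 * nsq (cut (qbox (real 1)) (w n)) + 2 * nsq u"
    proof eventually_elim
      case (elim n)
      have sub: "sqr 0 1 \<subseteq> qbox (real 1)" unfolding qbox_eq_sqr by (auto simp: sqr_def)
      have "nsq (cut (sqr 0 1) (vn (r n))) \<le> nsq (cut (qbox (real 1)) (vn (r n)))"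
        by (rule nsq_cut_mono[OF lv _ _ sub]) simp_all
      also have "cut (qbox (real 1)) (vn (r n)) = (\<lambda>x. cut (qbox (real 1)) (w n) x + cut (qbox (real 1)) u x)"
        by (auto simp: cut_def w_def)
      also have "nsq \<dots> \<le> 2 * nsq (cut (qbox (real 1)) (w n)) + 2 * nsq (cut (qbox (real 1)) u)"
        by (intro nsq_add_le l2_cut lw lu) simp_all
      also have "\<dots> \<le> 2 * nsq (cut (qbox (real 1)) (w n)) + 2 * nsq u"
        using nsq_cut_le[OF lu, of "qbox (real 1)"] by simp
      finally show ?case using elim by linarith
    qed
    moreover have "(\<lambda>n. 2 * nsq (cut (qbox (real 1)) (w n)) + 2 * nsq u) \<longlonglongrightarrow> 2 * 0 + 2 * nsq u"
      by (intro tendsto_intros loc[rule_format])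
    ultimately have "d \<le> 2 * 0 + 2 * nsq u" by (intro tendsto_lowerbound[of _ _ sequentially]) auto
    then show ?thesis using d(1) by simp
  qed
  define M' where "M' = 2 * M + 2 * nsq u + 2 * dirichlet g"
  have M0: "M \<ge> 0" using M nsq_nonneg order_trans by blast
  have MU: "nsq u \<le> M'" "dirichlet g \<le> M'" using M0 nsq_nonneg[of u] dirichlet_nonneg[of g] by (simp_all add: M'_def del: nsq_nonneg dirichlet_nonneg)
  have MW: "nsq (w n) \<le> M'" "dirichlet (h n) \<le> M'" for n
  proof -
    have "nsq (w n) \<le> 2 * nsq (vn (r n)) + 2 * nsq u" unfolding w_def[abs_def] by (rule nsq_diff_le[OF lv lu])
    then show "nsq (w n) \<le> M'" using M[rule_format, of "r n"] dirichlet_nonneg[of g] unfolding M'_def by linarith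
    have "nsq (h n j) \<le> 2 * nsq (hn (r n) j) + 2 * nsq (g j)" if j: "j \<in> {1,2}" for j
      unfolding h_def[abs_def] by (rule nsq_diff_le[OF sob_l2(4)[OF S j] sob_l2(4)[OF U j]])
    from this[of 1] this[of 2] have "dirichlet (h n) \<le> 2 * dirichlet (hn (r n)) + 2 * dirichlet g" by (simp add: dirichlet_def)
    then show "dirichlet (h n) \<le> M'" using M[rule_format, of "r n"] nsq_nonneg[of u] unfolding M'_def by linarith
  qed
  have weak: "(\<lambda>n. ip \<psi> (h n j)) \<longlonglongrightarrow> 0" if j: "j \<in> {1,2}" and psi: "l2 \<psi>" for j \<psi>
  proof -
    have "(\<lambda>n. ip \<psi> (hn (r n) j)) \<longlonglongrightarrow> ip \<psi> (g j)"
    proof (rule weak_convergence[where f="\<lambda>n. vn (r n)" and M=M])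
      show "sob (vn (r n)) (hn (r n))" "nsq (vn (r n)) \<le> M" "dirichlet (hn (r n)) \<le> M" for n using S M by auto
    qed (use loc psi j U in \<open>simp_all add: w_def[abs_def]\<close>)
    then have "(\<lambda>n. ip \<psi> (hn (r n) j) - ip \<psi> (g j)) \<longlonglongrightarrow> 0" by (rule LIM_zero)
    moreover have "ip \<psi> (h n j) = ip \<psi> (hn (r n) j) - ip \<psi> (g j)" for n
      unfolding h_def[abs_def] by (rule ip_diff_right[OF sob_l2(4)[OF S j] sob_l2(4)[OF U j] psi])
    ultimately show ?thesis by simp
  qed
  interpret splitting u g w h M'
    by unfold_locales (rule U W MU MW loc weak, assumption?)+
  obtain e where e: "e \<longlonglongrightarrow> 0" "\<forall>n. en lam p u g + en lam p (w n) (h n) \<le> en lam p (vn (r n)) (hn (r n)) + e n"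
    using en_split[OF p lam] unfolding uw by blast
  have Er: "(\<lambda>n. en lam p (vn (r n)) (hn (r n))) \<longlonglongrightarrow> mc lam p c"
    using LIMSEQ_subseq_LIMSEQ[OF E r] by (simp add: o_def)
  have R: "(\<lambda>n. en lam p (vn (r n)) (hn (r n)) + e n) \<longlonglongrightarrow> mc lam p c + 0" by (rule tendsto_add[OF Er e(1)])
  \<comment> \<open>The remainder is weakly null, so the masses of \<open>u\<close> and
    \<open>w n\<close> add up in the limit.\<close>
  have nw: "(\<lambda>n. nsq (w n)) \<longlonglongrightarrow> c - nsq u"
  proof -
    have "(\<lambda>n. LINT x|lborel. cmod (u x) * cmod (w n x)) \<longlonglongrightarrow> 0"
      by (rule tendsto_pairing_loc[OF lu lw MW(1)]) (use loc in blast)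
    then have "(\<lambda>n. ip u (w n)) \<longlonglongrightarrow> 0"
    proof (rule Lim_null_comparison[rotated], intro always_eventually allI)
      fix n
      have "norm (ip u (w n)) \<le> (LINT x|lborel. norm (Re (u x * cnj (w n x))))"
        unfolding ip_def by (rule integral_norm_bound)
      also have "\<dots> \<le> (LINT x|lborel. cmod (u x) * cmod (w n x))"
        by (intro integral_mono integrable_norm ip_integrable l2_cmod_mult lu lw) (simp only: real_norm_def abs_Re_mult_cnj_le)
      finally show "norm (ip u (w n)) \<le> (LINT x|lborel. cmod (u x) * cmod (w n x))" .
    qed
    then have "(\<lambda>n. c - nsq u - 2 * ip u (w n)) \<longlonglongrightarrow> c - nsq u - 2 * 0" by (intro tendsto_intros)
    moreover have "nsq (w n) = c - nsq u - 2 * ip u (w n)" for n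
      using nsq_add[OF lu lw[of n]] nc[of "r n"] unfolding uw by simp
    ultimately show ?thesis by simp
  qed
  \<comment> \<open>If mass were lost, \<open>u\<close> would have energy above its proportional
    share of m(c), by the divisor D > 1, and \<open>w n\<close> at least its own share; the limit
    energy would exceed m(c).\<close>
  have full: "nsq u = c"
  proof (rule ccontr)
    assume "nsq u \<noteq> c"
    then have lt: "nsq u < c" using ac by simp
    define D where "D = 1 + (p - 2) / 4 * (1 - nsq u / c)"
    have "0 < (p - 2) / 4 * (1 - nsq u / c)" using lt c p by (intro mult_pos_pos) auto
    then have D: "D > 1" unfolding D_def by linarith
    have eu: "nsq u / c * mc lam p c / D \<le> en lam p u g"
      unfolding D_def by (rule en_lower_scaled(1)[OF lam p c(1) less_imp_le[OF c(2)] U a0 ac])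
    have "\<forall>\<^sub>F n in sequentially. 0 < nsq (w n)" "\<forall>\<^sub>F n in sequentially. nsq (w n) < c"
      using nw lt a0 by (auto intro: order_tendstoD)
    then have "\<forall>\<^sub>F n in sequentially. nsq u / c * mc lam p c / D + nsq (w n) / c * mc lam p c \<le> en lam p (vn (r n)) (hn (r n)) + e n"
    proof eventually_elim
      case (elim n)
      have "nsq (w n) / c * mc lam p c \<le> en lam p (w n) (h n)"
        by (rule en_lower_scaled(2)[OF lam p c(1) less_imp_le[OF c(2)] W elim(1) less_imp_le[OF elim(2)]])
      then show ?case using eu e(2)[rule_format, of n] by linarith
    qed
    moreover have "(\<lambda>n. nsq u / c * mc lam p c / D + nsq (w n) / c * mc lam p c) \<longlonglongrightarrow> nsq u / c * mc lam p c / D + (c - nsq u) / c * mc lam p c"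
      using c(1) by (intro tendsto_intros nw) auto
    ultimately have "nsq u / c * mc lam p c / D + (c - nsq u) / c * mc lam p c \<le> mc lam p c + 0"
      by (intro tendsto_le[OF _ R]) auto
    then have 1: "nsq u / c * mc lam p c / D \<le> nsq u / c * mc lam p c"
      using c(1) by (simp add: diff_divide_distrib left_diff_distrib)
    have "nsq u / c * mc lam p c < 0" using a0 c(1) neg by (intro mult_pos_neg) auto
    moreover have "nsq u / c * mc lam p c \<le> nsq u / c * mc lam p c * D" using 1 D by (simp only: divide_le_eq)
    ultimately have "nsq u / c * mc lam p c * (D - 1) \<ge> 0 \<and> nsq u / c * mc lam p c < 0" by (simp only: right_diff_distrib) simp
    with D show False using mult_neg_pos[of "nsq u / c * mc lam p c" "D - 1"] by linarith
  qed
  have nw0: "(\<lambda>n. nsq (w n)) \<longlonglongrightarrow> 0" using nw full by simp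
  obtain C where C: "C \<ge> 0" "\<forall>u g. sob u g \<longrightarrow> pmass p u \<le> 16 * 1 * nsq u * dirichlet g + C * nsq u"
    using pmass_le1[OF p, of 1] by auto
  \<comment> \<open>With mass tending to 0 and Dirichlet integrals bounded, interpolation removes
    the nonlinear term of \<open>w n\<close>. The energy splitting then leaves only its kinetic
    term, whose vanishing gives strong convergence.\<close>
  have Nw: "(\<lambda>n. pmass p (w n)) \<longlonglongrightarrow> 0"
  proof (rule tendsto_sandwich[where f="\<lambda>_. 0"])
    have "(\<lambda>n. 16 * M' * nsq (w n) + C * nsq (w n)) \<longlonglongrightarrow> 16 * M' * 0 + C * 0" by (intro tendsto_intros nw0)
    then show "(\<lambda>n. 16 * M' * nsq (w n) + C * nsq (w n)) \<longlonglongrightarrow> 0" by simp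
    have "pmass p (w n) \<le> 16 * M' * nsq (w n) + C * nsq (w n)" for n
    proof -
      have "nsq (w n) * dirichlet (h n) \<le> nsq (w n) * M'" by (intro mult_left_mono MW) simp
      then show ?thesis using C(2)[rule_format, OF W[of n]] by (simp add: mult_ac)
    qed
    then show "\<forall>\<^sub>F n in sequentially. pmass p (w n) \<le> 16 * M' * nsq (w n) + C * nsq (w n)" by simp
  qed (simp_all add: pmass_nonneg)
  have mce: "mc lam p c \<le> en lam p u g" by (rule mc_le[OF lam p c8 U full])
  have "en lam p u g \<le> mc lam p c + 0 + lam / p * 0"
  proof (rule tendsto_lowerbound)
    show "(\<lambda>n. en lam p (vn (r n)) (hn (r n)) + e n + lam / p * pmass p (w n)) \<longlonglongrightarrow> mc lam p c + 0 + lam / p * 0"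
      by (intro tendsto_intros R Nw)
    show "\<forall>\<^sub>F n in sequentially. en lam p u g \<le> en lam p (vn (r n)) (hn (r n)) + e n + lam / p * pmass p (w n)"
    proof (intro always_eventually allI)
      fix n show "en lam p u g \<le> en lam p (vn (r n)) (hn (r n)) + e n + lam / p * pmass p (w n)"
        using e(2)[rule_format, of n] kinetic_nonneg[of "w n" "h n"] unfolding en_def[of lam p "w n"] by linarith
    qed
  qed simp
  with mce have min: "en lam p u g = mc lam p c" by simp
  from mce have "1/2 * kinetic (w n) (h n) \<le> en lam p (vn (r n)) (hn (r n)) + e n - mc lam p c + lam / p * pmass p (w n)" for n
    using e(2)[rule_format, of n] unfolding en_def[of lam p "w n"] by linarith
  then have K: "kinetic (w n) (h n) \<le> 2 * (en lam p (vn (r n)) (hn (r n)) + e n - mc lam p c + lam / p * pmass p (w n))" for n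
    by (simp add: field_simps)
  have K0: "(\<lambda>n. kinetic (w n) (h n)) \<longlonglongrightarrow> 0"
  proof (rule tendsto_sandwich[where f="\<lambda>_. 0"])
    have "(\<lambda>n. 2 * (en lam p (vn (r n)) (hn (r n)) + e n - mc lam p c + lam / p * pmass p (w n))) \<longlonglongrightarrow> 2 * (mc lam p c + 0 - mc lam p c + lam / p * 0)"
      by (intro tendsto_intros R Nw)
    then show "(\<lambda>n. 2 * (en lam p (vn (r n)) (hn (r n)) + e n - mc lam p c + lam / p * pmass p (w n))) \<longlonglongrightarrow> 0" by simp
    show "\<forall>\<^sub>F n in sequentially. kinetic (w n) (h n) \<le> 2 * (en lam p (vn (r n)) (hn (r n)) + e n - mc lam p c + lam / p * pmass p (w n))"
      using K by simp
  qed simp_all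
  have "(\<lambda>n. nsq (w n) + dirichlet (h n)) \<longlonglongrightarrow> 0"
  proof (rule tendsto_sandwich[where f="\<lambda>_. 0"])
    have "\<forall>\<^sub>F n in sequentially. nsq (w n) < 1/8" using nw0 by (rule order_tendstoD) simp
    then show "\<forall>\<^sub>F n in sequentially. nsq (w n) + dirichlet (h n) \<le> nsq (w n) + 4 * kinetic (w n) (h n)"
      by eventually_elim (simp add: dirichlet_le_kinetic[OF W])
    have "(\<lambda>n. nsq (w n) + 4 * kinetic (w n) (h n)) \<longlonglongrightarrow> 0 + 4 * 0" by (intro tendsto_intros nw0 K0)
    then show "(\<lambda>n. nsq (w n) + 4 * kinetic (w n) (h n)) \<longlonglongrightarrow> 0" by simp
  qed simp_all
  then show ?thesis using r U full min unfolding w_def[abs_def] h_def[abs_def] by blast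
qed

lemma minimizing_sequence_compact:
  assumes lam: "lam > 0" and p: "2 < p" "p < 4" and c: "0 < c" "c < (p - 2) / 260"
    and un: "\<forall>n. un n \<in> Sc c" and E: "(\<lambda>n. energy lam p (un n)) \<longlonglongrightarrow> mc lam p c"
  shows "\<exists>(y :: nat \<Rightarrow> real \<times> real) u (r :: nat \<Rightarrow> nat). u \<in> Sc c \<and> energy lam p u = mc lam p c \<and> strict_mono r \<and>
     (\<lambda>n. H1_norm (\<lambda>x. un (r n) (x + y (r n)) - u x)) \<longlonglongrightarrow> 0"
proof -
  have c8: "c \<le> 1/8" using c p by argo
  have neg: "mc lam p c < 0" by (rule mc_neg[OF lam p c(1) c8])
  obtain fn gn where f: "\<forall>n. sob (fn n) (gn n) \<and> (AE x in lebesgue. un n x = fn n x) \<and> nsq (fn n) = c"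
    using un[unfolded Sc_iff] by metis
  then have S: "sob (fn n) (gn n)" and ae: "AE x in lebesgue. un n x = fn n x" and nc: "nsq (fn n) = c" for n by auto
  have E': "(\<lambda>n. en lam p (fn n) (gn n)) \<longlonglongrightarrow> mc lam p c"
    using E by (simp only: energy_AE[OF S ae])
  obtain M where M: "\<forall>n. nsq (fn n) \<le> M \<and> dirichlet (gn n) \<le> M"
    using en_bounded_imp_bounded[where vn=fn and hn=gn, OF lam p c8 S nc E'] by blast
  \<comment> \<open>An energy below m(c)/2 < 0 forces this much \<open>pmass\<close>, since the
    kinetic part is nonnegative.\<close>
  define \<kappa> where "\<kappa> = p / lam * (- mc lam p c / 2)"
  have k: "\<kappa> > 0" unfolding \<kappa>_def by (intro mult_pos_pos divide_pos_pos) (use neg lam p in auto)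
  obtain d where d: "d > 0" "\<forall>u g. sob u g \<longrightarrow> nsq u \<le> M \<longrightarrow> dirichlet g \<le> M \<longrightarrow> \<kappa> \<le> pmass p u \<longrightarrow> (\<exists>y. d < nsq (cut (sqr y 1) u))"
    using nonvanishing[OF p k] by blast
  have "\<forall>\<^sub>F n in sequentially. en lam p (fn n) (gn n) < mc lam p c / 2"
    using E' neg by (intro order_tendstoD) auto
  then have ev: "\<forall>\<^sub>F n in sequentially. \<exists>y. d < nsq (cut (sqr y 1) (fn n))"
  proof eventually_elim
    case (elim n)
    have "- mc lam p c / 2 \<le> lam / p * pmass p (fn n)"
      using elim kinetic_nonneg[of "fn n" "gn n"] unfolding en_def by linarith
    then have "p / lam * (- mc lam p c / 2) \<le> p / lam * (lam / p * pmass p (fn n))"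
      using lam p by (intro mult_left_mono) auto
    then have "\<kappa> \<le> pmass p (fn n)" using lam p unfolding \<kappa>_def by simp
    then show ?case using d(2) S M by blast
  qed
  \<comment> \<open>For the finitely many early \<open>n\<close> at which no such square may exist,
    \<open>SOME\<close> gives an arbitrary translation.\<close>
  define y where "y n = (SOME y. d < nsq (cut (sqr y 1) (fn n)))" for n
  have y: "\<forall>\<^sub>F n in sequentially. d < nsq (cut (sqr (y n) 1) (fn n))"
    using ev unfolding y_def by (rule eventually_mono) (rule someI_ex)
  note sh = shift_invariance[OF S]
  have "\<exists>(r :: nat \<Rightarrow> nat) u g. strict_mono r \<and> sob u g \<and> nsq u = c \<and> en lam p u g = mc lam p c \<and>
     (\<lambda>n. nsq (\<lambda>x. fn (r n) (x + y (r n)) - u x) + dirichlet (\<lambda>j x. gn (r n) j (x + y (r n)) - g j x)) \<longlonglongrightarrow> 0"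
    by (rule compact_minimizing_sequence[where vn="\<lambda>n x. fn n (x + y n)" and hn="\<lambda>n j x. gn n j (x + y n)", OF lam p c sob_shift[OF S] _ _ d(1)])
       (unfold sh(1,3,4), rule nc, rule E', rule y)
  then obtain r u g where r: "strict_mono r" and U: "sob u g" "nsq u = c" "en lam p u g = mc lam p c"
    and lim: "(\<lambda>n. nsq (\<lambda>x. fn (r n) (x + y (r n)) - u x) + dirichlet (\<lambda>j x. gn (r n) j (x + y (r n)) - g j x)) \<longlonglongrightarrow> 0" by blast
  have "H1_norm (\<lambda>x. un (r n) (x + y (r n)) - u x) = sqrt (nsq (\<lambda>x. fn (r n) (x + y (r n)) - u x) + dirichlet (\<lambda>j x. gn (r n) j (x + y (r n)) - g j x))" for n
  proof (rule H1_norm_AE)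
    show "sob (\<lambda>x. fn (r n) (x + y (r n)) - u x) (\<lambda>j x. gn (r n) j (x + y (r n)) - g j x)"
      by (rule sob_diff[OF sob_shift[OF S] U(1)])
    show "AE x in lebesgue. un (r n) (x + y (r n)) - u x = fn (r n) (x + y (r n)) - u x"
      using AE_lebesgue_shift[OF ae[of "r n"], of "y (r n)"] by eventually_elim simp
  qed
  then have "(\<lambda>n. H1_norm (\<lambda>x. un (r n) (x + y (r n)) - u x)) \<longlonglongrightarrow> 0"
    using tendsto_real_sqrt[OF lim] by simp
  then show ?thesis 
    using sob_in_Sc[OF U(1,2)] energy_sob[OF U(1), of lam p] U(3) r
    by (intro exI[of _ y] exI[of _ u] exI[of _ r]) simp
qed

subsection \<open>The Euler--Lagrange equation\<close>

lemma l2_sum: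
  fixes n :: nat
  assumes "\<And>k. k < n \<Longrightarrow> l2 (f k)" shows "l2 (\<lambda>x. \<Sum>k<n. of_real (a k) * f k x)"
  using assms
proof (induct n)
  case (Suc n)
  then show ?case using l2_add[OF Suc(1) l2_cmult[of "f n" "of_real (a n)"]] by simp
qed simp

lemma ip_sum_right:
  fixes n :: nat
  assumes "\<And>k. k < n \<Longrightarrow> l2 (f k)" "l2 h" shows "ip h (\<lambda>x. \<Sum>k<n. of_real (a k) * f k x) = (\<Sum>k<n. a k * ip h (f k))"
  using assms(1)
proof (induct n)
  case 0
  then show ?case by (simp add: ip_def)
next
  case (Suc n)
  have "ip h (\<lambda>x. (\<Sum>k<n. of_real (a k) * f k x) + of_real (a n) * f n x) = ip h (\<lambda>x. \<Sum>k<n. of_real (a k) * f k x) + a n * ip h (f n)"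
    by (subst ip_add_right[OF l2_sum l2_cmult assms(2)]) (use Suc in \<open>simp_all add: ip_scale_right\<close>)
  then show ?case using Suc by simp
qed

text \<open>With fixed functions and moving coefficients the squared norm is a quadratic form in the
  coefficients, so its derivative is a matter of algebra.\<close>

lemma nsq_sum_has_derivative:
  fixes n :: nat
  assumes f: "\<And>k. k < n \<Longrightarrow> l2 (f k)" and a: "\<And>k. k < n \<Longrightarrow> (a k has_real_derivative a' k) (at t)"
  shows "((\<lambda>t. nsq (\<lambda>x. \<Sum>k<n. of_real (a k t) * f k x)) has_real_derivative
     2 * (\<Sum>l<n. a' l * ip (\<lambda>x. \<Sum>k<n. of_real (a k t) * f k x) (f l))) (at t)"
proof -
  have F: "ip (\<lambda>x. \<Sum>k<n. of_real (b k) * f k x) (f l) = (\<Sum>k<n. b k * ip (f k) (f l))" if "l < n" for b :: "nat \<Rightarrow> real" and l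
    by (subst ip_commute, subst ip_sum_right[OF f f[OF that]]) (simp_all add: ip_commute)
  have e: "nsq (\<lambda>x. \<Sum>k<n. of_real (b k) * f k x) = (\<Sum>l<n. \<Sum>k<n. b l * b k * ip (f k) (f l))" for b :: "nat \<Rightarrow> real"
  proof -
    have "nsq (\<lambda>x. \<Sum>k<n. of_real (b k) * f k x) = (\<Sum>l<n. b l * ip (\<lambda>x. \<Sum>k<n. of_real (b k) * f k x) (f l))"
      unfolding ip_self[symmetric] by (rule ip_sum_right[OF f l2_sum[OF f]])
    also have "\<dots> = (\<Sum>l<n. \<Sum>k<n. b l * b k * ip (f k) (f l))"
      by (intro sum.cong refl) (simp add: F sum_distrib_left mult.assoc)
    finally show ?thesis .
  qed
  have "((\<lambda>t. \<Sum>l<n. \<Sum>k<n. a l t * a k t * ip (f k) (f l)) has_real_derivative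
      (\<Sum>l<n. \<Sum>k<n. (a' l * a k t + a' k * a l t) * ip (f k) (f l))) (at t)"
    by (intro DERIV_sum DERIV_cmult_right DERIV_mult a) auto
  moreover have "(\<Sum>l<n. \<Sum>k<n. (a' l * a k t + a' k * a l t) * ip (f k) (f l)) = 2 * (\<Sum>l<n. a' l * (\<Sum>k<n. a k t * ip (f k) (f l)))"
  proof -
    have "(\<Sum>l<n. \<Sum>k<n. a' k * a l t * ip (f k) (f l)) = (\<Sum>l<n. \<Sum>k<n. a' l * a k t * ip (f k) (f l))"
      by (subst sum.swap) (simp add: ip_commute)
    then show ?thesis by (simp add: distrib_right sum.distrib sum_distrib_left mult.assoc)
  qed
  moreover have "(\<Sum>l<n. a' l * (\<Sum>k<n. a k t * ip (f k) (f l))) = (\<Sum>l<n. a' l * ip (\<lambda>x. \<Sum>k<n. of_real (a k t) * f k x) (f l))"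
    by (intro sum.cong refl) (simp add: F)
  ultimately show ?thesis unfolding e by simp
qed

text \<open>Young's inequality with exponents p/(p-1) and p, applied to x^(p-1) and y, is the
  tangent line inequality at x.\<close>

lemma powr_tangent:
  assumes p: "p > 1" and "x \<ge> 0" "y \<ge> (0::real)"
  shows "x powr p + p * x powr (p - 1) * (y - x) \<le> y powr p"
proof (cases "x = 0")
  case False
  then have x: "x > 0" using assms by simp
  have "1 / (p / (p - 1)) + 1 / p = 1" using p by (simp add: field_simps)
  then have "x powr (p - 1) * y \<le> (x powr (p - 1)) powr (p / (p - 1)) / (p / (p - 1)) + y powr p / p"
    using p x assms by (intro Youngs_inequality) (auto simp: field_simps)
  also have "(x powr (p - 1)) powr (p / (p - 1)) = x powr p" using p by (simp add: powr_powr)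
  finally have "p * (x powr (p - 1) * y) \<le> p * (x powr p / (p / (p - 1)) + y powr p / p)"
    using p by (intro mult_left_mono) auto
  also have "\<dots> = (p - 1) * x powr p + y powr p" using p by (simp add: field_simps)
  finally have 1: "p * (x powr (p - 1) * y) \<le> (p - 1) * x powr p + y powr p" .
  have "x powr p = x powr (p - 1) * x" using x powr_add[of x "p - 1" 1] by simp
  then have "p * x powr (p - 1) * (y - x) = p * (x powr (p - 1) * y) - p * x powr p" by (simp add: algebra_simps)
  moreover have "(p - 1) * x powr p = p * x powr p - x powr p" by (simp add: left_diff_distrib)
  ultimately show ?thesis using 1 by linarith
qed simp

text \<open>The modulus of a complex number dominates its component in the direction of
  \<open>a\<close>; this reduces the claim to the real tangent inequality.\<close>

lemma cmod_powr_tangent: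
  assumes p: "p > 2"
  shows "cmod a powr p + t * p * (cmod a powr (p - 2) * Re (a * cnj b)) \<le> cmod (a + of_real t * b) powr p"
proof (cases "a = 0")
  case False
  let ?z = "a + of_real t * b"
  have "Re (?z * cnj a) \<le> cmod ?z * cmod a" using complex_Re_le_cmod[of "?z * cnj a"] by (simp add: norm_mult)
  moreover have "Re (?z * cnj a) = (cmod a)^2 + t * Re (a * cnj b)"
    unfolding cmod_power2 by (simp add: algebra_simps power2_eq_square)
  ultimately have "t * Re (a * cnj b) \<le> cmod a * (cmod ?z - cmod a)" by (simp add: algebra_simps power2_eq_square)
  then have "p * cmod a powr (p - 2) * (t * Re (a * cnj b)) \<le> p * cmod a powr (p - 2) * (cmod a * (cmod ?z - cmod a))"
    using p by (intro mult_left_mono) auto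
  also have "\<dots> = p * (cmod a powr (p - 2) * cmod a) * (cmod ?z - cmod a)" by simp
  also have "cmod a powr (p - 2) * cmod a = cmod a powr (p - 1)" using False powr_add[of "cmod a" "p - 2" 1] by simp
  finally have "p * cmod a powr (p - 2) * (t * Re (a * cnj b)) \<le> p * cmod a powr (p - 1) * (cmod ?z - cmod a)" .
  moreover have "t * p * (cmod a powr (p - 2) * Re (a * cnj b)) = p * cmod a powr (p - 2) * (t * Re (a * cnj b))" by (simp only: mult_ac)
  moreover have "cmod a powr p + p * cmod a powr (p - 1) * (cmod ?z - cmod a) \<le> cmod ?z powr p"
    by (rule powr_tangent) (use p in auto)
  ultimately show ?thesis by linarith
qed simp

lemma test_cmult:
  assumes phi: "test_fun \<phi>"
  shows "test_fun (\<lambda>x. c * \<phi> x)" "j \<in> {1,2} \<Longrightarrow> pd j (\<lambda>x. c * \<phi> x) = (\<lambda>x. c * pd j \<phi> x)"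
proof -
  let ?f = "\<lambda>x. c * \<phi> x"
  have d: "((\<lambda>s. pds js \<phi> (x + s *\<^sub>R evec j)) has_vector_derivative pds (j # js) \<phi> x) (at 0)"
    if "set js \<subseteq> {1,2}" "j \<in> {1,2}" for js j x
    by (rule phi[unfolded test_fun_def, THEN conjunct1, rule_format, OF that(1), THEN conjunct2, rule_format, OF that(2)])
  have pds: "pds js ?f = (\<lambda>x. c * pds js \<phi> x)" if "set js \<subseteq> {1,2}" for js
    using that
  proof (induct js)
    case (Cons j js)
    have "pd j (\<lambda>x. c * pds js \<phi> x) = (\<lambda>x. c * pds (j # js) \<phi> x)"
      unfolding pd_def[of j "\<lambda>x. c * pds js \<phi> x"]
      by (rule ext, rule vector_derivative_at, rule has_vector_derivative_mult_right, rule d) (use Cons in auto)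
    then show ?case using Cons by simp
  qed simp
  show "test_fun ?f"
    unfolding test_fun_def
  proof (intro conjI allI impI ballI)
    fix js :: "nat list" assume js: "set js \<subseteq> {1,2}"
    have c: "continuous_on UNIV (pds js \<phi>)" using phi js unfolding test_fun_def by blast
    show "continuous_on UNIV (pds js ?f)"
      unfolding pds[OF js] by (intro continuous_intros c)
    fix j x assume j: "j \<in> {1,2::nat}"
    have "set (j # js) \<subseteq> {1,2}" using js j by auto
    from pds[OF this] show "((\<lambda>s. pds js ?f (x + s *\<^sub>R evec j)) has_vector_derivative pds (j # js) ?f x) (at 0)"
      unfolding pds[OF js] by (simp only: has_vector_derivative_mult_right[OF d[OF js j]])
  next
    have "bounded (closure {x. \<phi> x \<noteq> 0})" using phi by (simp add: test_fun_def compact_imp_bounded)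
    then have "bounded {x. \<phi> x \<noteq> 0}" by (rule bounded_subset) (rule closure_subset)
    then have "bounded {x. c * \<phi> x \<noteq> 0}" by (rule bounded_subset) auto
    then show "compact (closure {x. c * \<phi> x \<noteq> 0})" by simp
  qed
  assume j: "j \<in> {1,2}"
  have "set [j] \<subseteq> {1,2}" using j by auto
  from pds[OF this] show "pd j ?f = (\<lambda>x. c * pd j \<phi> x)" by simp
qed

text \<open>When \<open>f\<close> is not integrable and \<open>s\<close> is nonzero, both integrals
  take the default value 0.\<close>

lemma integral_scaleR_const:
  fixes s :: "'b::{banach, second_countable_topology}"
  assumes f[measurable]: "f \<in> borel_measurable M" shows "(LINT z|M. f z *\<^sub>R s) = (LINT z|M. f z) *\<^sub>R s"
proof (cases "s = 0 \<or> integrable M f")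
  case False
  have "\<not> integrable M (\<lambda>z. f z *\<^sub>R s)"
  proof
    assume "integrable M (\<lambda>z. f z *\<^sub>R s)"
    then have "integrable M (\<lambda>z. norm (f z) * norm s)" using integrable_norm[of M "\<lambda>z. f z *\<^sub>R s"] by simp
    then have "integrable M (\<lambda>z. norm (f z))" using False by simp
    then show False using False integrable_norm_iff[OF f] by simp
  qed
  then show ?thesis using False by (simp add: not_integrable_integral_eq)
qed auto

text \<open>The kernel is odd, hence the minus sign when the convolution moves to the other factor.
  Fubini is justified by the decay of the kernel, the uniform bound \<open>C\<close> and the
  integrability of \<open>J\<close>.\<close>

lemma conv_swap:
  fixes S :: "real \<times> real \<Rightarrow> 'b::{banach, second_countable_topology}"
  assumes S[measurable]: "S \<in> borel_measurable borel" and J: "integrable lborel J" and Jm[measurable]: "J \<in> borel_measurable borel"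
    and i: "\<And>z. integrable lborel (\<lambda>y. norm (S y) / norm (z - y))"
    and C: "\<And>z. (LINT y|lborel. norm (S y) / norm (z - y)) \<le> C"
  shows "integrable lborel (\<lambda>y. (LINT z|lborel. G k (y - z) * J z) *\<^sub>R S y)"
    "(LINT y|lborel. (LINT z|lborel. G k (y - z) * J z) *\<^sub>R S y) = - (LINT z|lborel. J z *\<^sub>R (LINT y|lborel. G k (z - y) *\<^sub>R S y))"
proof -
  define F where "F = (\<lambda>(z, y). (J z * G k (z - y)) *\<^sub>R S y)"
  have neg: "G k (- w) = - G k w" for w by (simp add: G_def)
  have odd: "G k (z - y) = - G k (y - z)" for z y using neg[of "y - z"] by (simp only: minus_diff_eq)
  have Gm: "(\<lambda>p :: (real\<times>real) \<times> (real\<times>real). G k (fst p - snd p)) \<in> borel_measurable borel"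
    by (rule measurable_compose[OF borel_measurable_continuous_onI measurable_G]) (intro continuous_intros)
  have Jm': "(\<lambda>p :: (real\<times>real) \<times> (real\<times>real). J (fst p)) \<in> borel_measurable borel"
    by (rule measurable_compose[OF borel_measurable_continuous_onI Jm]) (intro continuous_intros)
  have Sm': "(\<lambda>p :: (real\<times>real) \<times> (real\<times>real). S (snd p)) \<in> borel_measurable borel"
    by (rule measurable_compose[OF borel_measurable_continuous_onI S]) (intro continuous_intros)
  have Fm[measurable]: "F \<in> borel_measurable (lborel \<Otimes>\<^sub>M lborel)"
    unfolding lborel_prod F_def case_prod_beta using Gm Jm' Sm' by (simp add: borel_measurable_scaleR borel_measurable_times)
  have nF: "norm (F (z, y)) \<le> \<bar>J z\<bar> * (norm (S y) / norm (z - y))" for z y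
  proof -
    have "norm (F (z, y)) = \<bar>J z\<bar> * (\<bar>G k (z - y)\<bar> * norm (S y))" by (simp add: F_def abs_mult)
    also have "\<dots> \<le> \<bar>J z\<bar> * (1 / (6 * norm (z - y)) * norm (S y))" by (intro mult_left_mono mult_right_mono G_bound) auto
    also have "\<dots> \<le> \<bar>J z\<bar> * (norm (S y) / norm (z - y))"
    proof (rule mult_left_mono)
      have q: "X / 6 \<le> X" if "X \<ge> 0" for X :: real using that by simp
      show "1 / (6 * norm (z - y)) * norm (S y) \<le> norm (S y) / norm (z - y)"
        by (rule ord_eq_le_trans[OF _ q]) simp_all
    qed simp
    finally show ?thesis .
  qed
  have Gmz[measurable]: "(\<lambda>y. G k (z - y)) \<in> borel_measurable borel" for z by measurable
  have iF: "integrable lborel (\<lambda>y. F (z, y))" for z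
  proof (rule Bochner_Integration.integrable_bound[OF integrable_mult_right[OF i, of "\<bar>J z\<bar>" z]])
    show "(\<lambda>y. F (z, y)) \<in> borel_measurable lborel" unfolding F_def by simp
    show "AE y in lborel. norm (F (z, y)) \<le> norm (\<bar>J z\<bar> * (norm (S y) / norm (z - y)))"
      by (intro AE_I2 order_trans[OF nF]) simp
  qed
  have nnF: "integrable lborel (\<lambda>z. LINT y|lborel. norm (F (z, y)))"
  proof (rule Bochner_Integration.integrable_bound[OF integrable_mult_right[OF integrable_abs[OF J], of C]])
    show "(\<lambda>z. LINT y|lborel. norm (F (z, y))) \<in> borel_measurable lborel" by measurable
    show "AE z in lborel. norm (LINT y|lborel. norm (F (z, y))) \<le> norm (C * \<bar>J z\<bar>)"
    proof (intro AE_I2)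
      fix z
      have "(LINT y|lborel. norm (F (z, y))) \<le> (LINT y|lborel. \<bar>J z\<bar> * (norm (S y) / norm (z - y)))"
        by (intro integral_mono integrable_norm iF integrable_mult_right i nF)
      also have "\<dots> \<le> \<bar>J z\<bar> * C" unfolding integral_mult_right_zero by (intro mult_left_mono C) simp
      finally show "norm (LINT y|lborel. norm (F (z, y))) \<le> norm (C * \<bar>J z\<bar>)"
        by (simp add: abs_of_nonneg mult.commute)
    qed
  qed
  have int: "integrable (lborel \<Otimes>\<^sub>M lborel) F"
    by (rule lborel_pair.Fubini_integrable[OF Fm nnF]) (use iF in simp)
  have e: "(LINT z|lborel. F (z, y)) = - ((LINT z|lborel. G k (y - z) * J z) *\<^sub>R S y)" for y
  proof -
    have "(LINT z|lborel. F (z, y)) = (LINT z|lborel. (- (G k (y - z) * J z)) *\<^sub>R S y)"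
      unfolding F_def by (simp add: odd[of _ y] mult.commute)
    also have "\<dots> = (LINT z|lborel. - (G k (y - z) * J z)) *\<^sub>R S y" by (rule integral_scaleR_const) simp
    finally show ?thesis by simp
  qed
  have "integrable lborel (\<lambda>y. LINT z|lborel. F (z, y))"
    using lborel_pair.integrable_snd[of "\<lambda>z y. F (z, y)"] int by simp
  then show "integrable lborel (\<lambda>y. (LINT z|lborel. G k (y - z) * J z) *\<^sub>R S y)" unfolding e by simp
  have "(LINT y|lborel. LINT z|lborel. F (z, y)) = (LINT z|lborel. LINT y|lborel. F (z, y))"
    using lborel_pair.Fubini_integral[of "\<lambda>z y. F (z, y)"] int by simp
  moreover have "(LINT y|lborel. F (z, y)) = J z *\<^sub>R (LINT y|lborel. G k (z - y) *\<^sub>R S y)" for z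
    unfolding F_def by (simp add: scaleR_scaleR[symmetric] del: scaleR_scaleR)
  ultimately show "(LINT y|lborel. (LINT z|lborel. G k (y - z) * J z) *\<^sub>R S y) = - (LINT z|lborel. J z *\<^sub>R (LINT y|lborel. G k (z - y) *\<^sub>R S y))"
    unfolding e by (simp add: eq_neg_iff_add_eq_0 neg_eq_iff_add_eq_0)
qed

lemma Ab_phase_l2:
  assumes A: "sob a g" and B: "sob b h" and f: "l2 f"
  shows "l2 (\<lambda>x. \<i> * of_real (Ab j a b x) * f x)"
proof (rule l2_bounded_phase_mult(1)[OF f])
  note [measurable] = l2_measurable[OF sob_l2(1)[OF A]] l2_measurable[OF sob_l2(1)[OF B]]
  show "Ab j a b \<in> borel_measurable borel" by measurable
  let ?C = "sqrt (20 * sqrt (nsq a * dirichlet g)) * sqrt (20 * sqrt (nsq b * dirichlet h)) / 12"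
  fix x
  have "sqrt (hardy a x) * sqrt (hardy b x) \<le> sqrt (20 * sqrt (nsq a * dirichlet g)) * sqrt (20 * sqrt (nsq b * dirichlet h))"
    by (intro mult_mono real_sqrt_le_mono hardy_le[OF A] hardy_le[OF B] real_sqrt_ge_zero hardy_nonneg) simp
  then show "\<bar>Ab j a b x\<bar> \<le> ?C" using Ab_bound[OF A B, of j x] by linarith
qed

lemma powr_mult_integrable:
  assumes A: "sob a g" and B: "sob b h" and p: "2 < p" "p < 4"
  shows "integrable lborel (\<lambda>x. cmod (a x) powr (p - 2) * (cmod (a x) * cmod (b x)))"
proof (rule Bochner_Integration.integrable_bound[OF Bochner_Integration.integrable_add[OF pmass_integrable[OF A p] pmass_integrable[OF B p]]])
  note [measurable] = l2_measurable[OF sob_l2(1)[OF A]] l2_measurable[OF sob_l2(1)[OF B]]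
  show "(\<lambda>x. cmod (a x) powr (p - 2) * (cmod (a x) * cmod (b x))) \<in> borel_measurable lborel" by measurable
  have le: "s powr (p - 2) * (s * t) \<le> s powr p + t powr p" if st: "s \<ge> 0" "t \<ge> 0" for s t :: real
  proof -
    define m where "m = max s t"
    have "s powr (p - 2) * (s * t) \<le> m powr (p - 2) * (m * m)"
      using st p by (intro mult_mono powr_mono2) (auto simp: m_def)
    also have "\<dots> = m powr p" using st powr_add[of m "p - 2" 2] by (cases "m = 0") (auto simp: m_def power2_eq_square)
    also have "\<dots> \<le> s powr p + t powr p" by (auto simp: m_def max_def)
    finally show ?thesis .
  qed
  show "AE x in lborel. norm (cmod (a x) powr (p - 2) * (cmod (a x) * cmod (b x))) \<le> norm (cmod (a x) powr p + cmod (b x) powr p)"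
    using le by (intro AE_I2) (simp add: abs_mult)
qed

text \<open>The expansion of \<open>D\<^sub>j(\<sigma>(u + t v))\<close> into monomials in \<open>\<sigma>\<close> and \<open>t\<close>.\<close>

definition curve_term :: "nat \<Rightarrow> cfun \<Rightarrow> (nat \<Rightarrow> cfun) \<Rightarrow> cfun \<Rightarrow> (nat \<Rightarrow> cfun) \<Rightarrow> nat \<Rightarrow> cfun" where
  "curve_term j u g v h k = [g j, h j, \<lambda>x. \<i> * of_real (Ab j u u x) * u x,
     \<lambda>x. \<i> * of_real (Ab j u u x) * v x, \<lambda>x. \<i> * of_real (2 * Ab j u v x) * u x,
     \<lambda>x. \<i> * of_real (Ab j v v x) * u x, \<lambda>x. \<i> * of_real (2 * Ab j u v x) * v x,
     \<lambda>x. \<i> * of_real (Ab j v v x) * v x] ! k"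

definition curve_coeff :: "(real \<Rightarrow> real) \<Rightarrow> nat \<Rightarrow> real \<Rightarrow> real" where
  "curve_coeff \<sigma> k t = [\<sigma> t, \<sigma> t * t, \<sigma> t ^ 3, \<sigma> t ^ 3 * t, \<sigma> t ^ 3 * t, \<sigma> t ^ 3 * t^2, \<sigma> t ^ 3 * t^2, \<sigma> t ^ 3 * t^3] ! k"

lemma sum_lessThan_8: "(\<Sum>k<8. f k) = f 0 + f 1 + f 2 + f 3 + f 4 + f 5 + f 6 + f (7::nat)"
  for f :: "nat \<Rightarrow> 'a::comm_monoid_add"
  by (simp add: eval_nat_numeral add.assoc)

lemma less_8E: "k < (8::nat) \<Longrightarrow> k = 0 \<or> k = 1 \<or> k = 2 \<or> k = 3 \<or> k = 4 \<or> k = 5 \<or> k = 6 \<or> k = 7"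
  by auto

lemma dcov_curve:
  assumes U: "sob u g" and V: "sob v h"
  shows "dcov j (\<lambda>x. of_real (\<sigma> t) * (u x + of_real t * v x)) (\<lambda>j x. of_real (\<sigma> t) * (g j x + of_real t * h j x)) =
     (\<lambda>x. \<Sum>k<8. of_real (curve_coeff \<sigma> k t) * curve_term j u g v h k x)"
proof
  fix x
  note tV = sob_cmult[OF V, of "of_real t"]
  note uV = sob_add[OF U tV]
  have "Ab j (\<lambda>x. of_real (\<sigma> t) * (u x + of_real t * v x)) (\<lambda>x. of_real (\<sigma> t) * (u x + of_real t * v x)) x
      = \<sigma> t * (\<sigma> t * (Ab j u u x + 2 * t * Ab j u v x + t * t * Ab j v v x))"
    unfolding Ab_scale_left Ab_scale_right Ab_add_left[OF U tV uV] Ab_add_right[OF U tV U] Ab_add_right[OF U tV V]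
    by (simp add: Ab_commute[of j v u] algebra_simps)
  then show "dcov j (\<lambda>x. of_real (\<sigma> t) * (u x + of_real t * v x)) (\<lambda>j x. of_real (\<sigma> t) * (g j x + of_real t * h j x)) x =
     (\<Sum>k<8. of_real (curve_coeff \<sigma> k t) * curve_term j u g v h k x)"
    unfolding dcov_def sum_lessThan_8 by (simp add: curve_coeff_def curve_term_def eval_nat_numeral algebra_simps)
qed

lemma curve_term_l2:
  assumes U: "sob u g" and V: "sob v h" and j: "j \<in> {1,2}" and k: "k < 8"
  shows "l2 (curve_term j u g v h k)"
proof -
  note lu = sob_l2(1)[OF U] and lv = sob_l2(1)[OF V]
  have two: "l2 (\<lambda>x. \<i> * of_real (2 * Ab j u v x) * f x)" if "l2 f" for f
    using l2_cmult[OF Ab_phase_l2[OF U V that], of 2 j] by (simp add: mult_ac)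
  note all = sob_l2(4)[OF U j] sob_l2(4)[OF V j] Ab_phase_l2[OF U U lu] Ab_phase_l2[OF U U lv] two[OF lu] Ab_phase_l2[OF V V lu] two[OF lv] Ab_phase_l2[OF V V lv]
  show ?thesis
    unfolding curve_term_def
    by (rule bspec[where P=l2, OF _ nth_mem], simp only: list.set ball_simps all simp_thms) (use k in simp)
qed

lemma kinetic_curve_derivative:
  assumes U: "sob u g" and V: "sob v h" and s: "(\<sigma> has_real_derivative a) (at 0)" "\<sigma> 0 = 1" and j: "j \<in> {1,2}"
  shows "((\<lambda>t. nsq (dcov j (\<lambda>x. of_real (\<sigma> t) * (u x + of_real t * v x)) (\<lambda>j x. of_real (\<sigma> t) * (g j x + of_real t * h j x)))) has_real_derivative
     2 * (a * (ip (dcov j u g) (g j) + 3 * ip (dcov j u g) (\<lambda>x. \<i> * of_real (Ab j u u x) * u x))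
       + ip (dcov j u g) (\<lambda>x. h j x + \<i> * of_real (Ab j u u x) * v x)
       + ip (dcov j u g) (\<lambda>x. \<i> * of_real (2 * Ab j u v x) * u x))) (at 0)"
proof -
  \<comment> \<open>The derivatives of the eight coefficients at 0, where \<sigma> = 1 and \<sigma>'
    = a; the terms of order at least two in \<open>t\<close> drop out.\<close>
  let ?d = "\<lambda>k. [a, 1, 3 * a, 1, 1, 0, 0, 0::real] ! k"
  have der: "(curve_coeff \<sigma> k has_real_derivative ?d k) (at 0)" if k: "k < 8" for k
  proof -
    have 1: "((\<lambda>t. \<sigma> t ^ 3) has_real_derivative 3 * a) (at 0)"
      using DERIV_power[OF s(1), of 3] s(2) by simp
    have 2: "((\<lambda>t. \<sigma> t * t) has_real_derivative 1) (at 0)" "((\<lambda>t. \<sigma> t ^ 3 * t) has_real_derivative 1) (at 0)"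
      using DERIV_mult[OF s(1) DERIV_ident] DERIV_mult[OF 1 DERIV_ident] s(2) by simp_all
    have 3: "((\<lambda>t. \<sigma> t ^ 3 * t^2) has_real_derivative 0) (at 0)" "((\<lambda>t. \<sigma> t ^ 3 * t^3) has_real_derivative 0) (at 0)"
      using DERIV_mult[OF 1 DERIV_pow[of 2 0]] DERIV_mult[OF 1 DERIV_pow[of 3 0]] by simp_all
    from less_8E[OF k] show ?thesis
      unfolding curve_coeff_def[abs_def] by (elim disjE) (simp_all add: s 1 2 3)
  qed
  have F0: "(\<lambda>x. \<Sum>k<8. of_real (curve_coeff \<sigma> k 0) * curve_term j u g v h k x) = dcov j u g"
    unfolding dcov_curve[OF U V, symmetric] using s(2) by simp
  have "((\<lambda>t. nsq (\<lambda>x. \<Sum>k<8. of_real (curve_coeff \<sigma> k t) * curve_term j u g v h k x)) has_real_derivative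
     2 * (\<Sum>l<8. ?d l * ip (dcov j u g) (curve_term j u g v h l))) (at 0)"
    using nsq_sum_has_derivative[of 8 "curve_term j u g v h" "curve_coeff \<sigma>" ?d 0, OF curve_term_l2[OF U V j] der] unfolding F0 .
  moreover have "(\<Sum>l<8. ?d l * ip (dcov j u g) (curve_term j u g v h l)) =
     a * (ip (dcov j u g) (g j) + 3 * ip (dcov j u g) (\<lambda>x. \<i> * of_real (Ab j u u x) * u x))
       + ip (dcov j u g) (\<lambda>x. h j x + \<i> * of_real (Ab j u u x) * v x)
       + ip (dcov j u g) (\<lambda>x. \<i> * of_real (2 * Ab j u v x) * u x)"
    unfolding sum_lessThan_8 ip_add_right[OF sob_l2(4)[OF V j] Ab_phase_l2[OF U U sob_l2(1)[OF V]] dcov_l2[OF U j]]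
    by (simp add: curve_term_def eval_nat_numeral distrib_left)
  ultimately show ?thesis unfolding dcov_curve[OF U V] by simp
qed

lemma pmass_curve_le:
  assumes U: "sob u g" and V: "sob v h" and p: "2 < p" "p < 4"
  shows "integrable lborel (\<lambda>x. cmod (u x) powr (p - 2) * Re (u x * cnj (v x)))"
    "pmass p u + t * p * (LINT x|lborel. cmod (u x) powr (p - 2) * Re (u x * cnj (v x))) \<le> pmass p (\<lambda>x. u x + of_real t * v x)"
proof -
  note [measurable] = l2_measurable[OF sob_l2(1)[OF U]] l2_measurable[OF sob_l2(1)[OF V]]
  have m: "(\<lambda>x. Re (u x * cnj (v x))) \<in> borel_measurable borel" by measurable
  show i: "integrable lborel (\<lambda>x. cmod (u x) powr (p - 2) * Re (u x * cnj (v x)))"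
  proof (rule Bochner_Integration.integrable_bound[OF powr_mult_integrable[OF U V p]])
    show "(\<lambda>x. cmod (u x) powr (p - 2) * Re (u x * cnj (v x))) \<in> borel_measurable lborel" using m by measurable
    show "AE x in lborel. norm (cmod (u x) powr (p - 2) * Re (u x * cnj (v x))) \<le> norm (cmod (u x) powr (p - 2) * (cmod (u x) * cmod (v x)))"
      unfolding real_norm_def abs_mult abs_norm_cancel by (rule AE_I2, rule mult_left_mono[OF abs_Re_mult_cnj_le]) simp
  qed
  have it: "integrable lborel (\<lambda>x. t * p * (cmod (u x) powr (p - 2) * Re (u x * cnj (v x))))" by (rule integrable_mult_right[OF i])
  have "pmass p u + t * p * (LINT x|lborel. cmod (u x) powr (p - 2) * Re (u x * cnj (v x)))
      = (LINT x|lborel. cmod (u x) powr p + t * p * (cmod (u x) powr (p - 2) * Re (u x * cnj (v x))))"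
    unfolding pmass_def integral_mult_right_zero[symmetric] by (rule Bochner_Integration.integral_add[OF pmass_integrable[OF U p] it, symmetric])
  also have "\<dots> \<le> pmass p (\<lambda>x. u x + of_real t * v x)"
    unfolding pmass_def
    by (rule integral_mono[OF Bochner_Integration.integrable_add[OF pmass_integrable[OF U p] it] pmass_integrable[OF sob_add[OF U sob_cmult[OF V]] p]])
       (rule cmod_powr_tangent[OF p(1)])
  finally show "pmass p u + t * p * (LINT x|lborel. cmod (u x) powr (p - 2) * Re (u x * cnj (v x))) \<le> pmass p (\<lambda>x. u x + of_real t * v x)" .
qed

lemma pmass_cmult: "\<sigma> \<ge> 0 \<Longrightarrow> pmass p (\<lambda>x. of_real \<sigma> * f x) = \<sigma> powr p * pmass p f"
  unfolding pmass_def integral_mult_right_zero[symmetric]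
  by (intro Bochner_Integration.integral_cong refl) (simp add: norm_mult powr_mult)

text \<open>The value forced by testing the equation with \<open>u\<close> itself. The field is
  quadratic, so its variation in the direction \<open>u\<close> contributes twice the magnetic term,
  whence 3 = 1 + 2.\<close>

definition multiplier :: "real \<Rightarrow> real \<Rightarrow> cfun \<Rightarrow> (nat \<Rightarrow> cfun) \<Rightarrow> real" where
  "multiplier lam p u g = (lam * pmass p u - (\<Sum>j\<in>{1,2}. ip (dcov j u g) (g j) + 3 * ip (dcov j u g) (\<lambda>x. \<i> * of_real (Ab j u u x) * u x))) / nsq u"

text \<open>By convexity \<open>|u + t v|\<^sup>p\<close> lies above its tangent in \<open>t\<close>, so the energy along the curve on the sphere is bounded
  above by a differentiable function touching it at \<open>t = 0\<close>; no differentiation under the integral is needed.\<close>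

lemma minimizer_variation:
  assumes lam: "lam > 0" and p: "2 < p" "p < 4" and c: "0 < c" "c \<le> 1/8"
    and U: "sob u g" and nu: "nsq u = c" and min: "en lam p u g = mc lam p c" and V: "sob v h"
  shows "(\<Sum>j\<in>{1,2}. ip (dcov j u g) (\<lambda>x. h j x + \<i> * of_real (Ab j u u x) * v x)
       + ip (dcov j u g) (\<lambda>x. \<i> * of_real (2 * Ab j u v x) * u x)) + multiplier lam p u g * ip u v
     = lam * (LINT x|lborel. cmod (u x) powr (p - 2) * Re (u x * cnj (v x)))"
proof -
  note lu = sob_l2(1)[OF U] and lv = sob_l2(1)[OF V]
  define N1 where "N1 = (LINT x|lborel. cmod (u x) powr (p - 2) * Re (u x * cnj (v x)))"
  define m where "m t = c + 2 * t * ip u v + t^2 * nsq v" for t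
  \<comment> \<open>Rescales u + t v back to mass \<open>c\<close>; the \<open>a\<close> below is
    its derivative at 0.\<close>
  define \<sigma> where "\<sigma> t = sqrt (c / m t)" for t
  have nm: "nsq (\<lambda>x. u x + of_real t * v x) = m t" for t
    using nsq_add[OF lu l2_cmult[OF lv, of "of_real t"]] by (simp add: nu m_def nsq_scale ip_scale_right)
  have m0: "m 0 = c" by (simp add: m_def)
  have dm: "(m has_real_derivative 2 * ip u v) (at 0)"
    unfolding m_def[abs_def] by (auto intro!: derivative_eq_intros)
  define a where "a = - ip u v / c"
  have s0: "\<sigma> 0 = 1" using c by (simp add: \<sigma>_def m0)
  have ds: "(\<sigma> has_real_derivative a) (at 0)"
  proof -
    have "((\<lambda>t. c / m t) has_real_derivative - 2 * ip u v / c) (at 0)"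
      by (rule DERIV_cong[OF DERIV_divide[OF DERIV_const dm]]) (use c in \<open>simp_all add: m0\<close>)
    from DERIV_chain2[OF DERIV_real_sqrt this] show ?thesis
      unfolding \<sigma>_def[abs_def] using c by (simp add: m0 a_def inverse_eq_divide)
  qed
  define v' where "v' t = (\<lambda>x. of_real (\<sigma> t) * (u x + of_real t * v x))" for t
  define g' where "g' t = (\<lambda>j x. of_real (\<sigma> t) * (g j x + of_real t * h j x))" for t
  define D where "D t = 1/2 * (nsq (dcov 1 (v' t) (g' t)) + nsq (dcov 2 (v' t) (g' t))) - lam / p * (\<sigma> t powr p * (pmass p u + t * p * N1))" for t
  define E where "E j = a * (ip (dcov j u g) (g j) + 3 * ip (dcov j u g) (\<lambda>x. \<i> * of_real (Ab j u u x) * u x))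
       + ip (dcov j u g) (\<lambda>x. h j x + \<i> * of_real (Ab j u u x) * v x)
       + ip (dcov j u g) (\<lambda>x. \<i> * of_real (2 * Ab j u v x) * u x)" for j
  have dK: "((\<lambda>t. nsq (dcov j (v' t) (g' t))) has_real_derivative 2 * E j) (at 0)" if "j \<in> {1,2}" for j
    using kinetic_curve_derivative[OF U V ds s0 that] unfolding v'_def g'_def E_def .
  have dsp: "((\<lambda>t. \<sigma> t powr p) has_real_derivative p * a) (at 0)"
    using DERIV_powr[OF ds, of "\<lambda>_. p" 0] s0 by (simp add: mult.commute)
  have dN: "((\<lambda>t. \<sigma> t powr p * (pmass p u + t * p * N1)) has_real_derivative p * a * pmass p u + p * N1) (at 0)"
    by (rule DERIV_cong[OF DERIV_mult[OF dsp, of "\<lambda>t. pmass p u + t * p * N1" "p * N1"]])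
       (auto intro!: derivative_eq_intros simp: s0)
  have dD: "(D has_real_derivative 1/2 * (2 * E 1 + 2 * E 2) - lam / p * (p * a * pmass p u + p * N1)) (at 0)"
    unfolding D_def[abs_def] by (intro DERIV_diff DERIV_cmult DERIV_add dK dN) simp_all
  have v0: "v' 0 = u" "g' 0 = g" by (simp_all add: v'_def g'_def s0)
  have D0: "D 0 = mc lam p c" unfolding min[symmetric] D_def v0 en_def kinetic_def s0 by simp
  have cont: "isCont m 0" by (rule DERIV_isCont[OF dm])
  then have "\<forall>\<^sub>F t in at 0. m t > 0" using m0 c(1) by (intro order_tendstoD(1)[of m c]) (simp_all add: isCont_def)
  then obtain d where d: "d > 0" "\<forall>t. t \<noteq> 0 \<and> dist t 0 < d \<longrightarrow> m t > 0" unfolding eventually_at by auto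
  have "1/2 * (2 * E 1 + 2 * E 2) - lam / p * (p * a * pmass p u + p * N1) = 0"
  proof (rule DERIV_local_min[OF dD d(1)], intro allI impI)
    fix t :: real assume t: "\<bar>0 - t\<bar> < d"
    have mt: "m t > 0" using d(2) t m0 c by (cases "t = 0") (auto simp: dist_real_def)
    then have st: "\<sigma> t \<ge> 0" "\<sigma> t ^ 2 * m t = c" using c by (simp_all add: \<sigma>_def)
    have S: "sob (v' t) (g' t)" unfolding v'_def g'_def by (intro sob_cmult sob_add U V)
    have "nsq (v' t) = c" unfolding v'_def nsq_scale nm using st by simp
    then have "D 0 \<le> en lam p (v' t) (g' t)" unfolding D0 by (rule mc_le[OF lam p c(2) S])
    also have "\<dots> \<le> D t"
    proof -
      have "\<sigma> t powr p * (pmass p u + t * p * N1) \<le> pmass p (v' t)"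
        unfolding v'_def pmass_cmult[OF st(1)] N1_def by (intro mult_left_mono pmass_curve_le(2)[OF U V p]) simp
      then have "lam / p * (\<sigma> t powr p * (pmass p u + t * p * N1)) \<le> lam / p * pmass p (v' t)" using lam p by (intro mult_left_mono) auto
      then show ?thesis unfolding en_def kinetic_def D_def by linarith
    qed
    finally show "D 0 \<le> D t" .
  qed
  moreover have "lam / p * (p * a * pmass p u + p * N1) = lam * a * pmass p u + lam * N1" using p by (simp add: field_simps)
  moreover have "1/2 * (2 * E 1 + 2 * E 2) = E 1 + E 2" by simp
  ultimately have "E 1 + E 2 = lam * a * pmass p u + lam * N1" by (simp only: right_minus_eq)
  \<comment> \<open>The terms with factor \<open>a\<close> come from the rescaling; together they
    form the multiplier times \<open>ip u v\<close>.\<close>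
  moreover have "multiplier lam p u g * ip u v = a * (\<Sum>j\<in>{1,2}. ip (dcov j u g) (g j) + 3 * ip (dcov j u g) (\<lambda>x. \<i> * of_real (Ab j u u x) * u x)) - lam * a * pmass p u"
    unfolding multiplier_def nu a_def using c(1) by (simp add: field_simps)
  ultimately show ?thesis unfolding N1_def[symmetric] E_def by (simp add: algebra_simps)
qed

section \<open>The potential A0 and the weak equation\<close>

definition current :: "nat \<Rightarrow> cfun \<Rightarrow> (nat \<Rightarrow> cfun) \<Rightarrow> real \<times> real \<Rightarrow> real" where
  "current j u g x = Im (cnj (u x) * dcov j u g x)"

definition A0_rep :: "cfun \<Rightarrow> (nat \<Rightarrow> cfun) \<Rightarrow> real \<times> real \<Rightarrow> real" where
  "A0_rep u g y = - (LINT z|lborel. G 1 (y - z) * current 2 u g z) + (LINT z|lborel. G 2 (y - z) * current 1 u g z)"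

lemma measurable_current[measurable]:
  assumes U: "sob u g" and j: "j \<in> {1,2}" shows "current j u g \<in> borel_measurable borel"
proof -
  note [measurable] = l2_measurable[OF sob_l2(1)[OF U]] l2_measurable[OF dcov_l2[OF U j]]
  show ?thesis unfolding current_def[abs_def] by measurable
qed

lemma current_integrable: assumes U: "sob u g" and j: "j \<in> {1,2}" shows "integrable lborel (current j u g)"
proof (rule l2_mult_integrable[OF sob_l2(1)[OF U] dcov_l2[OF U j] measurable_current[OF U j]])
  fix x show "norm (current j u g x) \<le> cmod (u x) * cmod (dcov j u g x)"
    using abs_Im_le_cmod[of "cnj (u x) * dcov j u g x"] unfolding current_def norm_mult complex_mod_cnj real_norm_def .
qed

lemma A0_eq: assumes U: "sob u g" shows "A0 u y = A0_rep u g y"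
proof -
  have "conv (G k) (\<lambda>y. Im (cnj (u y) * Dcov j u y)) y = (LINT z|lborel. G k (y - z) * current j u g z)" if j: "j \<in> {1,2}" for j k
    unfolding conv_def
  proof (rule LINT_lebesgue_AE)
    note [measurable] = measurable_current[OF U j]
    show "(\<lambda>z. G k (y - z) * current j u g z) \<in> borel_measurable borel" by measurable
    have "AE z in lebesgue. Dcov j u z = dcov j u g z" by (rule Dcov_AE[OF U _ j]) simp
    then show "AE z in lebesgue. G k (y - z) * Im (cnj (u z) * Dcov j u z) = G k (y - z) * current j u g z"
      by eventually_elim (simp only: current_def)
  qed
  from this[of 1] this[of 2] show ?thesis unfolding A0_def A0_rep_def by (simp del: One_nat_def)
qed

text \<open>The variation of the gauge field pairs the current with a convolution of Re (u cnj v).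
  Exchanging the integrals moves the convolution onto the current, and the oddness of the kernel
  produces exactly the signs of A0.\<close>

lemma A0_rep_pairing:
  assumes U: "sob u g" and V: "sob v h"
  shows "integrable lborel (\<lambda>y. of_real (A0_rep u g y) * u y * cnj (v y))"
    "(LINT y|lborel. A0_rep u g y * Re (u y * cnj (v y))) = (\<Sum>j\<in>{1,2}. ip (dcov j u g) (\<lambda>x. \<i> * of_real (2 * Ab j u v x) * u x))"
proof -
  note [measurable] = l2_measurable[OF sob_l2(1)[OF U]] l2_measurable[OF sob_l2(1)[OF V]]
  define S where "S y = u y * cnj (v y)" for y
  have Sm[measurable]: "S \<in> borel_measurable borel" unfolding S_def[abs_def] by measurable
  have nS: "norm (S y) = cmod (u y) * cmod (v y)" for y by (simp add: S_def norm_mult)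
  have Rm[measurable]: "(\<lambda>y. Re (S y)) \<in> borel_measurable borel" by measurable
  obtain C where C: "(LINT y|lborel. cmod (u y) * cmod (v y) / norm (z - y)) \<le> C" for z
  proof
    fix z
    have "sqrt (hardy u z) * sqrt (hardy v z) \<le> sqrt (20 * sqrt (nsq u * dirichlet g)) * sqrt (20 * sqrt (nsq v * dirichlet h))"
      by (intro mult_mono real_sqrt_le_mono hardy_le[OF U] hardy_le[OF V] real_sqrt_ge_zero hardy_nonneg) simp
    then show "(LINT y|lborel. cmod (u y) * cmod (v y) / norm (z - y)) \<le> sqrt (20 * sqrt (nsq u * dirichlet g)) * sqrt (20 * sqrt (nsq v * dirichlet h))"
      using hardy_pair_integrable(2)[OF U V, of z] by linarith
  qed
  have iS: "integrable lborel (\<lambda>y. norm (S y) / norm (z - y))" for z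
    unfolding nS by (rule hardy_pair_integrable(1)[OF U V])
  have iR: "integrable lborel (\<lambda>y. norm (Re (S y)) / norm (z - y))" for z
    by (rule Bochner_Integration.integrable_bound[OF iS[of z]])
       (measurable, auto intro!: AE_I2 divide_right_mono abs_Re_le_cmod)
  have CR: "(LINT y|lborel. norm (Re (S y)) / norm (z - y)) \<le> C" for z
  proof -
    have "(LINT y|lborel. norm (Re (S y)) / norm (z - y)) \<le> (LINT y|lborel. norm (S y) / norm (z - y))"
      by (intro integral_mono iR iS divide_right_mono) (auto simp: abs_Re_le_cmod)
    then show ?thesis using C[of z] unfolding nS by linarith
  qed
  have c12: "1 \<in> {1,2::nat}" "2 \<in> {1,2::nat}" by auto
  note swC = conv_swap[OF Sm current_integrable[OF U] measurable_current[OF U] iS C[unfolded nS[symmetric]]]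
  note swR = conv_swap[OF Rm current_integrable[OF U] measurable_current[OF U] iR CR]
  \<comment> \<open>Stated in a general real vector space, so that it serves both the complex
    integrand, for integrability, and its real part, for the identity.\<close>
  have e: "A0_rep u g y *\<^sub>R s = (LINT z|lborel. G 2 (y - z) * current 1 u g z) *\<^sub>R s - (LINT z|lborel. G 1 (y - z) * current 2 u g z) *\<^sub>R s" for y and s :: "'c::real_vector"
    unfolding A0_rep_def by (simp add: scaleR_left_diff_distrib del: One_nat_def)
  have "integrable lborel (\<lambda>y. A0_rep u g y *\<^sub>R S y)"
    unfolding e by (rule Bochner_Integration.integrable_diff[OF swC(1)[OF c12(1) c12(1)] swC(1)[OF c12(2) c12(2)]])
  then show "integrable lborel (\<lambda>y. of_real (A0_rep u g y) * u y * cnj (v y))"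
    by (simp add: S_def scaleR_conv_of_real mult.assoc)
  have Gconv: "(LINT y|lborel. G k (z - y) *\<^sub>R Re (S y)) = Gconv k u v z" for k z unfolding Gconv_def S_def by simp
  have ipe: "ip (dcov j u g) (\<lambda>x. \<i> * of_real (2 * Ab j u v x) * u x) = (LINT z|lborel. 2 * Ab j u v z * current j u g z)" for j
    unfolding ip_def current_def by (intro Bochner_Integration.integral_cong refl) (simp add: algebra_simps)
  have "(LINT y|lborel. A0_rep u g y * Re (u y * cnj (v y))) = (LINT y|lborel. A0_rep u g y *\<^sub>R Re (S y))" by (simp only: S_def real_scaleR_def)
  also have "\<dots> = - (LINT z|lborel. current 1 u g z *\<^sub>R Gconv 2 u v z) + (LINT z|lborel. current 2 u g z *\<^sub>R Gconv 1 u v z)"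
    unfolding e Bochner_Integration.integral_diff[OF swR(1)[OF c12(1) c12(1)] swR(1)[OF c12(2) c12(2)]] swR(2)[OF c12(1) c12(1)] swR(2)[OF c12(2) c12(2)] Gconv
    by simp
  also have "\<dots> = (LINT z|lborel. 2 * Ab 1 u v z * current 1 u g z) + (LINT z|lborel. 2 * Ab 2 u v z * current 2 u g z)"
    by (simp add: Ab_def mult.commute del: One_nat_def)
  also have "\<dots> = (\<Sum>j\<in>{1,2}. ip (dcov j u g) (\<lambda>x. \<i> * of_real (2 * Ab j u v x) * u x))"
    unfolding ipe by (simp del: One_nat_def)
  finally show "(LINT y|lborel. A0_rep u g y * Re (u y * cnj (v y))) = (\<Sum>j\<in>{1,2}. ip (dcov j u g) (\<lambda>x. \<i> * of_real (2 * Ab j u v x) * u x))" .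
qed

text \<open>Left side minus right side of the weak equation, over Borel representatives, so that
  solving the equation means vanishing of one conjugate linear functional.\<close>

definition EL_form :: "real \<Rightarrow> real \<Rightarrow> real \<Rightarrow> cfun \<Rightarrow> (nat \<Rightarrow> cfun) \<Rightarrow> cfun \<Rightarrow> complex" where
  "EL_form lam p \<alpha> u g \<phi> =
      (LINT x|lborel. dcov 1 u g x * cnj (pd 1 \<phi> x + \<i> * of_real (Ab 1 u u x) * \<phi> x))
    + (LINT x|lborel. dcov 2 u g x * cnj (pd 2 \<phi> x + \<i> * of_real (Ab 2 u u x) * \<phi> x))
    + (LINT x|lborel. complex_of_real (A0_rep u g x) * u x * cnj (\<phi> x))
    + complex_of_real \<alpha> * (LINT x|lborel. u x * cnj (\<phi> x))
    - complex_of_real lam * (LINT x|lborel. complex_of_real (cmod (u x) powr (p - 2)) * u x * cnj (\<phi> x))"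

lemma EL_form_integrable:
  assumes U: "sob u g" and phi: "test_fun \<phi>" and p: "2 < p" "p < 4"
  shows "j \<in> {1,2} \<Longrightarrow> integrable lborel (\<lambda>x. dcov j u g x * cnj (pd j \<phi> x + \<i> * of_real (Ab j u u x) * \<phi> x))"
    "integrable lborel (\<lambda>x. complex_of_real (A0_rep u g x) * u x * cnj (\<phi> x))"
    "integrable lborel (\<lambda>x. u x * cnj (\<phi> x))"
    "integrable lborel (\<lambda>x. complex_of_real (cmod (u x) powr (p - 2)) * u x * cnj (\<phi> x))"
proof -
  note V = test_sob[OF phi]
  note lu = sob_l2(1)[OF U] and lv = sob_l2(1)[OF V]
  note [measurable] = lu[THEN l2_measurable] lv[THEN l2_measurable]
  have pr: "integrable lborel (\<lambda>x. a x * cnj (b x))" if "l2 a" "l2 b" for a b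
    by (rule l2_mult_integrable[OF that]) (use that in \<open>measurable, simp add: norm_mult\<close>)
  show "integrable lborel (\<lambda>x. dcov j u g x * cnj (pd j \<phi> x + \<i> * of_real (Ab j u u x) * \<phi> x))" if j: "j \<in> {1,2}"
    by (rule pr[OF dcov_l2[OF U j] l2_add[OF sob_l2(4)[OF V j] Ab_phase_l2[OF U U lv]]])
  show "integrable lborel (\<lambda>x. complex_of_real (A0_rep u g x) * u x * cnj (\<phi> x))" by (rule A0_rep_pairing(1)[OF U V])
  show "integrable lborel (\<lambda>x. u x * cnj (\<phi> x))" by (rule pr[OF lu lv])
  show "integrable lborel (\<lambda>x. complex_of_real (cmod (u x) powr (p - 2)) * u x * cnj (\<phi> x))"
    by (rule Bochner_Integration.integrable_bound[OF powr_mult_integrable[OF U V p]])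
       (measurable, auto intro!: AE_I2 simp: norm_mult)
qed

text \<open>Real variations of the energy see only the real part of the weak form.\<close>

lemma EL_form_Re:
  assumes lam: "lam > 0" and p: "2 < p" "p < 4" and c: "0 < c" "c \<le> 1/8"
    and U: "sob u g" and nu: "nsq u = c" and min: "en lam p u g = mc lam p c" and phi: "test_fun \<phi>"
  shows "Re (EL_form lam p (multiplier lam p u g) u g \<phi>) = 0"
proof -
  note V = test_sob[OF phi]
  note i = EL_form_integrable[OF U phi p]
  have c12: "1 \<in> {1,2::nat}" "2 \<in> {1,2::nat}" by auto
  have r: "Re (complex_of_real a * z) = a * Re z" for a z by simp
  have "Re (EL_form lam p (multiplier lam p u g) u g \<phi>) =
     ip (dcov 1 u g) (\<lambda>x. pd 1 \<phi> x + \<i> * of_real (Ab 1 u u x) * \<phi> x)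
     + ip (dcov 2 u g) (\<lambda>x. pd 2 \<phi> x + \<i> * of_real (Ab 2 u u x) * \<phi> x)
     + (LINT x|lborel. A0_rep u g x * Re (u x * cnj (\<phi> x))) + multiplier lam p u g * ip u \<phi>
     - lam * (LINT x|lborel. cmod (u x) powr (p - 2) * Re (u x * cnj (\<phi> x)))"
    unfolding EL_form_def ip_def plus_complex.sel minus_complex.sel r integral_Re[OF i(1)[OF c12(1)], symmetric]
      integral_Re[OF i(1)[OF c12(2)], symmetric] integral_Re[OF i(2), symmetric] integral_Re[OF i(3), symmetric] integral_Re[OF i(4), symmetric]
    by (simp only: mult.assoc r)
  also have "\<dots> = 0"
    using minimizer_variation[OF lam p c U nu min V] A0_rep_pairing(2)[OF U V] by (simp del: One_nat_def add: sum.distrib)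
  finally show ?thesis .
qed

text \<open>Conjugate linearity in the test function: testing with \<open>\<i> * \<phi>\<close>
  turns the imaginary part into a real part.\<close>

lemma EL_form_imag:
  assumes phi: "test_fun \<phi>" shows "EL_form lam p \<alpha> u g (\<lambda>x. \<i> * \<phi> x) = - \<i> * EL_form lam p \<alpha> u g \<phi>"
proof -
  have c12: "1 \<in> {1,2::nat}" "2 \<in> {1,2::nat}" by auto
  have e: "(LINT x|lborel. a x * cnj (\<i> * b x)) = - \<i> * (LINT x|lborel. a x * cnj (b x))" for a b :: cfun
    unfolding integral_mult_right_zero[symmetric] by (simp add: mult_ac)
  have f: "\<i> * pd j \<phi> x + \<i> * of_real (Ab j u u x) * (\<i> * \<phi> x) = \<i> * (pd j \<phi> x + \<i> * of_real (Ab j u u x) * \<phi> x)" for j x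
    by (simp only: distrib_left mult_ac)
  show ?thesis
    unfolding EL_form_def test_cmult(2)[OF phi c12(1)] test_cmult(2)[OF phi c12(2)] f e
    by (simp only: algebra_simps)
qed

lemma weak_CSS_iff_EL_form:
  assumes U: "sob u g" and p: "2 < p" "p < 4"
  shows "weak_CSS lam p \<alpha> u \<longleftrightarrow> (\<forall>\<phi>. test_fun \<phi> \<longrightarrow> EL_form lam p \<alpha> u g \<phi> = 0)"
proof -
  note mu = l2_measurable[OF sob_l2(1)[OF U]]
  have "((LINT x|lebesgue. Dcov 1 u x * cnj (pd 1 \<phi> x + \<i> * of_real (A 1 u x) * \<phi> x))
    + (LINT x|lebesgue. Dcov 2 u x * cnj (pd 2 \<phi> x + \<i> * of_real (A 2 u x) * \<phi> x))
    + (LINT x|lebesgue. complex_of_real (A0 u x) * u x * cnj (\<phi> x))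
    + complex_of_real \<alpha> * (LINT x|lebesgue. u x * cnj (\<phi> x))
    = complex_of_real lam * (LINT x|lebesgue. complex_of_real (cmod (u x) powr (p - 2)) * u x * cnj (\<phi> x)))
    \<longleftrightarrow> EL_form lam p \<alpha> u g \<phi> = 0" if phi: "test_fun \<phi>" for \<phi>
  proof -
    note i = EL_form_integrable[OF U phi p, THEN borel_measurable_integrable, unfolded measurable_lborel2]
    have D: "(LINT x|lebesgue. Dcov j u x * cnj (pd j \<phi> x + \<i> * of_real (A j u x) * \<phi> x))
        = (LINT x|lborel. dcov j u g x * cnj (pd j \<phi> x + \<i> * of_real (Ab j u u x) * \<phi> x))" if j: "j \<in> {1,2}" for j
    proof (rule LINT_lebesgue_AE[OF _ i(1)[OF j]])
      have "AE z in lebesgue. Dcov j u z = dcov j u g z" by (rule Dcov_AE[OF U _ j]) simp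
      then show "AE x in lebesgue. Dcov j u x * cnj (pd j \<phi> x + \<i> * of_real (A j u x) * \<phi> x)
         = dcov j u g x * cnj (pd j \<phi> x + \<i> * of_real (Ab j u u x) * \<phi> x)"
        by eventually_elim (simp only: A_eq_Ab[OF mu])
    qed
    have 2: "(LINT x|lebesgue. complex_of_real (A0 u x) * u x * cnj (\<phi> x)) = (LINT x|lborel. complex_of_real (A0_rep u g x) * u x * cnj (\<phi> x))"
      by (rule LINT_lebesgue_AE[OF _ i(2)]) (simp add: A0_eq[OF U])
    have 3: "(LINT x|lebesgue. u x * cnj (\<phi> x)) = (LINT x|lborel. u x * cnj (\<phi> x))"
      by (rule LINT_lebesgue_AE[OF _ i(3)]) simp
    have 4: "(LINT x|lebesgue. complex_of_real (cmod (u x) powr (p - 2)) * u x * cnj (\<phi> x)) = (LINT x|lborel. complex_of_real (cmod (u x) powr (p - 2)) * u x * cnj (\<phi> x))"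
      by (rule LINT_lebesgue_AE[OF _ i(4)]) simp
    have c12: "1 \<in> {1,2::nat}" "2 \<in> {1,2::nat}" by auto
    show ?thesis unfolding EL_form_def D[OF c12(1)] D[OF c12(2)] 2 3 4 right_minus_eq ..
  qed
  then show ?thesis unfolding weak_CSS_def by simp
qed

lemma minimizer_weak_CSS:
  assumes lam: "lam > 0" and p: "2 < p" "p < 4" and c: "0 < c" "c \<le> 1/8"
    and U: "sob u g" and nu: "nsq u = c" and min: "en lam p u g = mc lam p c"
  shows "weak_CSS lam p (multiplier lam p u g) u"
  unfolding weak_CSS_iff_EL_form[OF U p]
proof (intro allI impI)
  fix \<phi> assume phi: "test_fun \<phi>"
  note R = EL_form_Re[OF lam p c U nu min]
  have "Re (- \<i> * EL_form lam p (multiplier lam p u g) u g \<phi>) = 0"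
    using R[OF test_cmult(1)[OF phi]] unfolding EL_form_imag[OF phi, symmetric] .
  then show "EL_form lam p (multiplier lam p u g) u g \<phi> = 0" using R[OF phi] by (simp add: complex_eq_iff)
qed

theorem theorem1p1:
  fixes lam p :: real
  assumes "lam > 0" and "2 < p" and "p < 4"
  shows "\<exists>c0>0. \<forall>c. 0 < c \<and> c < c0 \<longrightarrow>
     (\<forall>un :: nat \<Rightarrow> cfun. (\<forall>n. un n \<in> Sc c) \<and> (\<lambda>n. energy lam p (un n)) \<longlonglongrightarrow> mc lam p c \<longrightarrow>
        (\<exists>(y :: nat \<Rightarrow> real \<times> real) u (r :: nat \<Rightarrow> nat). u \<in> Sc c \<and> strict_mono r \<and>
           (\<lambda>n. H1_norm (\<lambda>x. un (r n) (x + y (r n)) - u x)) \<longlonglongrightarrow> 0))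
     \<and> (\<exists>u\<in>Sc c. energy lam p u = mc lam p c)
     \<and> (\<exists>u\<in>Sc c. \<exists>\<alpha>::real. weak_CSS lam p \<alpha> u)"
proof (intro exI[of _ "(p - 2) / 260"] conjI allI impI)
  note lam = assms(1) and p = assms(2,3)
  show "(p - 2) / 260 > 0" using p by simp
  fix c assume c': "0 < c \<and> c < (p - 2) / 260"
  then have c: "0 < c" "c < (p - 2) / 260" by auto
  \<comment> \<open>As p < 4, (p - 2)/260 is below 1/8, so the coercivity threshold holds as
    well.\<close>
  have c8: "c \<le> 1/8" using c p by argo
  note cpt = minimizing_sequence_compact[OF lam p c]
  show "\<exists>(y :: nat \<Rightarrow> real \<times> real) u (r :: nat \<Rightarrow> nat). u \<in> Sc c \<and> strict_mono r \<and>
      (\<lambda>n. H1_norm (\<lambda>x. un (r n) (x + y (r n)) - u x)) \<longlonglongrightarrow> 0"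
    if "(\<forall>n. un n \<in> Sc c) \<and> (\<lambda>n. energy lam p (un n)) \<longlonglongrightarrow> mc lam p c" for un
    using cpt[OF that[THEN conjunct1] that[THEN conjunct2]] by blast
  obtain un :: "nat \<Rightarrow> cfun" where "\<forall>n. un n \<in> Sc c" "(\<lambda>n. energy lam p (un n)) \<longlonglongrightarrow> mc lam p c"
    using minimizing_sequence[OF lam p c(1) c8] by blast
  then obtain v where v: "v \<in> Sc c" "energy lam p v = mc lam p c" using cpt by blast
  then show "\<exists>u\<in>Sc c. energy lam p u = mc lam p c" by blast
  \<comment> \<open>The weak equation is proved for a Borel representative of the minimizer, which
    lies on the same sphere and has the same energy.\<close>
  obtain u g where U: "sob u g" "AE x in lebesgue. v x = u x" "nsq u = c" using v(1) Sc_iff by blast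
  have "en lam p u g = mc lam p c" using energy_AE[OF U(1,2), of lam p] v(2) by simp
  from minimizer_weak_CSS[OF lam p c(1) c8 U(1,3) this] sob_in_Sc[OF U(1,3)]
  show "\<exists>u\<in>Sc c. \<exists>\<alpha>::real. weak_CSS lam p \<alpha> u" by blast
qed

end
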